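(* For each cubcat $C$ and vertex $v\in C_0$, the unit $C\to\mathbf{S}C$ of the adjunction $\|-\|\dashv\mathrm{sing}$ induces a bijection $$\tau_n(C,v)\cong\tau_n(\mathbf{S}C,v),\quad n=0,1,2,\ldots$$ where $v$ also denotes the image of $v$ in $(\mathbf{S}C)_0$.
   Context: Cubical sets. For a natural number $k$, $[k]$ is the ordinal $\{0<1<\cdots<k\}$; posets are regarded as categories and $[k]^n$ is the product poset. $\square$ is the subcategory of the category of small categories with objects $[1]^n$ ($n\geq 0$) and morphisms all composites of cofaces $[1]^{n-1}\to[1]^n$ (inserting a constant $0$ or $1$ in one coordinate), codegeneracies $[1]^{n+1}\to[1]^n$ (projections omitting one coordinate) and coordinate permutations. Cubical sets are presheaves of sets on $\square$, forming the category $\hat\square$; $\square[1]^n$ is the presheaf represented by $[1]^n$; $\otimes$ is the closed symmetric monoidal Day convolution product with $\square[1]^m\otimes\square[1]^n=\square[1]^{m+n}$, and $C^B$ is the cubical set with $(C^B)_n=\hat\square(B\otimes\square[1]^n,C)$. $\partial\square[1]^n$ is the maximal proper subpresheaf (boundary) of $\square[1]^n$. $\pi_0C$ is the quotient of $C_0$ by the equivalence relation generated by identifying the two endpoints of each element of $C_1$. For a cubical set $C$ and $v\in C_0$, let $\langle v\rangle\subset C$ be the minimal subpresheaf containing $v$ and let $\Omega^n(C,v)$ be the pullback of $C^{\square[1]^n}\to C^{\partial\square[1]^n}\leftarrow\langle v\rangle^{\partial\square[1]^n}$. Then $\tau_n(C,v)=\pi_0\Omega^n(C,v)$. Streams. A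 circulation on a space $X$ assigns to each open $U\subset X$ a preorder $\leqslant_U$ on $U$ such that, for each collection $\mathcal{O}$ of open subsets, the preorder on $\bigcup\mathcal{O}$ is the one with smallest graph containing the graphs of all $\leqslant_U$, $U\in\mathcal{O}$. A stream is a space with a circulation; a stream map $f:X\to Y$ is a continuous function with $f(x)\leqslant_U f(y)$ whenever $U\subset Y$ is open and $x\leqslant_{f^{-1}U}y$. $\mathbf{DiTop}$ is the category of weak Hausdorff k-streams (k-stream: colimit of compact Hausdorff streams in all streams; weak Hausdorff: the underlying space is). $\vec{\mathbb{I}}^n$ is $[0,1]^n$ with the unique circulation whose value on the whole cube is the coordinatewise order. Directed realization $\|-\|:\hat\square\to\mathbf{DiTop}$ is the cocontinuous functor with $\|\square[1]^n\|=\vec{\mathbb{I}}^n$ (with the evident action on cofaces, codegeneracies, permutations); its right adjoint is $\mathrm{sing}$, $(\mathrm{sing}\,X)_n=\mathbf{DiTop}(\|\square[1]^n\|,X)$; $\mathbf{S}=\mathrm{sing}\,\|-\|$ is the resulting monad. Subdivision. A Boolean interval in a finite lattice is an interval (order-convex subset with a minimum and a maximum) isomorphic to some $[1]^m$. For a finite distributive lattice $L$, $\square[L]$ is the cubical set with $\square[L]_m$ the set of lattice homomorphisms $[1]^m\to L$ mapping Boolean intervals onto Boolean intervals. $\mathrm{sd}_2:\hat\square\to\hat\square$ is the cocontinuous functor with $\mathrm{sd}_2\square[1]^n=\square[[2]^n]$, where $[2]^n$ is identified with the poset $([1]^n)^{[1]}$ of monotone functions $[1]\to[1]^n$ (for $n=1$,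 $\zeta\mapsto\zeta(0)+\zeta(1)$) and $\square$-morphisms act by postcomposition. Its right adjoint is $\mathrm{ex}_2$, $(\mathrm{ex}_2C)_n=\hat\square(\mathrm{sd}_2\square[1]^n,C)$. There is a natural isomorphism $\varphi_{C;2}:\|\mathrm{sd}_2C\|\cong\|C\|$ that for $C=\square[1]^n$ is linear on cells and sends the vertex $v\in[2]^n$ to $v/2\in[0,1]^n$. Cubcats. $(-)^\sharp:\hat\square\to\hat\square$ is the cocontinuous functor with $(\square[1]^n)^\sharp=\mathbf{S}\square[1]^n$, and $\eta_C:C\to C^\sharp$ is the natural map given on representables by the unit of $\mathbf{S}$. $\varphi^\sharp_{C;2}:C^\sharp\to\mathrm{ex}_2C^\sharp$ is the natural map given for $C=\square[1]^n$ by sending an $m$-cube $\theta:\|\square[1]^m\|\to\|\square[1]^n\|$ to the $m$-cube of $\mathrm{ex}_2\mathbf{S}\square[1]^n$ adjoint to $\theta\varphi_{\square[1]^m;2}:\|\mathrm{sd}_2\square[1]^m\|\to\|\square[1]^n\|$. A cubcat is a cubical set $C$ for which there exist cubical functions $\rho:C^\sharp\to C$ and $\mu:\mathrm{ex}_2C\to C$ with $\rho\eta_C=\mathrm{id}_C$ and $\rho=\mu\circ(\mathrm{ex}_2\rho)\circ\varphi^\sharp_{C;2}$. *)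

theory Defs
  imports "HOL-Analysis.Analysis"
begin

section \<open>Generated relations\<close>

definition gen_preorder :: "'a set \<Rightarrow> 'a rel \<Rightarrow> 'a rel" where
  "gen_preorder A r = \<Inter> {R. preorder_on A R \<and> r \<subseteq> R}"

definition gen_equiv :: "'a set \<Rightarrow> 'a rel \<Rightarrow> 'a rel" where
  "gen_equiv A r = \<Inter> {R. equiv A R \<and> r \<subseteq> R}"


section \<open>The category of cubes\<close>

text \<open>The points of \<open>[k]\<^sup>n\<close> are the extensional functions from \<open>{..<n}\<close> to \<open>{0..k}\<close>.  Its order
  and its lattice operations are those of the type \<^typ>\<open>nat \<Rightarrow> nat\<close>: all points agree outside
  \<open>{..<n}\<close>.\<close>

definition grid :: "nat \<Rightarrow> nat \<Rightarrow> (nat \<Rightarrow> nat) set" where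
  "grid k n = {..<n} \<rightarrow>\<^sub>E {0..k}"

type_synonym mor = "(nat \<Rightarrow> nat) \<Rightarrow> nat \<Rightarrow> nat"

definition coface :: "nat \<Rightarrow> nat \<Rightarrow> nat \<Rightarrow> mor" where
  "coface n i e = (\<lambda>x\<in>grid 1 n. \<lambda>j\<in>{..<Suc n}. if j < i then x j else if j = i then e else x (j - 1))"

definition codegen :: "nat \<Rightarrow> nat \<Rightarrow> mor" where
  "codegen n i = (\<lambda>x\<in>grid 1 (Suc n). \<lambda>j\<in>{..<n}. if j < i then x j else x (Suc j))"

definition coperm :: "nat \<Rightarrow> (nat \<Rightarrow> nat) \<Rightarrow> mor" where
  "coperm n p = (\<lambda>x\<in>grid 1 n. \<lambda>j\<in>{..<n}. x (p j))"

definition box_id :: "nat \<Rightarrow> mor" where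
  "box_id n = (\<lambda>x\<in>grid 1 n. x)"

text \<open>\<open>box_hom m n f\<close>: the function \<open>f\<close> is a morphism \<open>[1]\<^sup>m \<rightarrow> [1]\<^sup>n\<close>.\<close>

inductive box_hom :: "nat \<Rightarrow> nat \<Rightarrow> mor \<Rightarrow> bool" where
  box_id: "box_hom n n (box_id n)"
| box_coface: "i \<le> n \<Longrightarrow> e \<le> 1 \<Longrightarrow> box_hom n (Suc n) (coface n i e)"
| box_codegen: "i \<le> n \<Longrightarrow> box_hom (Suc n) n (codegen n i)"
| box_coperm: "p permutes {..<n} \<Longrightarrow> box_hom n n (coperm n p)"
| box_compose: "box_hom l m f \<Longrightarrow> box_hom m n g \<Longrightarrow> box_hom l n (compose (grid 1 l) g f)"

definition box_tensor :: "nat \<Rightarrow> nat \<Rightarrow> mor \<Rightarrow> nat \<Rightarrow> nat \<Rightarrow> mor \<Rightarrow> mor" where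
  "box_tensor p p' f q q' g = (\<lambda>x\<in>grid 1 (p + q). \<lambda>j\<in>{..<p' + q'}.
     if j < p' then f (\<lambda>i\<in>{..<p}. x i) j else g (\<lambda>i\<in>{..<q}. x (p + i)) (j - p'))"


section \<open>Cubical sets\<close>

text \<open>\<open>act C m n f\<close> is the function \<open>C\<^sub>n \<rightarrow> C\<^sub>m\<close> induced by \<open>f : [1]\<^sup>m \<rightarrow> [1]\<^sup>n\<close>.\<close>

record 'a cset =
  cells :: "nat \<Rightarrow> 'a set"
  act :: "nat \<Rightarrow> nat \<Rightarrow> mor \<Rightarrow> 'a \<Rightarrow> 'a"

definition cubical_set :: "'a cset \<Rightarrow> bool" where
  "cubical_set C \<longleftrightarrow>
     (\<forall>m n f. \<forall>c\<in>cells C n. box_hom m n f \<longrightarrow> act C m n f c \<in> cells C m) \<and>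
     (\<forall>n. \<forall>c\<in>cells C n. act C n n (box_id n) c = c) \<and>
     (\<forall>l m n f g. \<forall>c\<in>cells C n. box_hom l m f \<longrightarrow> box_hom m n g \<longrightarrow>
        act C l n (compose (grid 1 l) g f) c = act C l m f (act C m n g c))"

definition chom :: "'a cset \<Rightarrow> 'b cset \<Rightarrow> (nat \<Rightarrow> 'a \<Rightarrow> 'b) set" where
  "chom C D = {h. (\<forall>n. h n \<in> cells C n \<rightarrow>\<^sub>E cells D n) \<and>
     (\<forall>m n f. \<forall>c\<in>cells C n. box_hom m n f \<longrightarrow> h m (act C m n f c) = act D m n f (h n c))}"

definition ccomp :: "'a cset \<Rightarrow> (nat \<Rightarrow> 'b \<Rightarrow> 'c) \<Rightarrow> (nat \<Rightarrow> 'a \<Rightarrow> 'b) \<Rightarrow> nat \<Rightarrow> 'a \<Rightarrow> 'c" where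
  "ccomp A h g = (\<lambda>n. compose (cells A n) (h n) (g n))"

definition representable :: "nat \<Rightarrow> mor cset" where
  "representable n = \<lparr>cells = (\<lambda>m. {f. box_hom m n f}), act = (\<lambda>k m f g. compose (grid 1 k) g f)\<rparr>"

definition subpresheaf :: "'a cset \<Rightarrow> (nat \<Rightarrow> 'a set) \<Rightarrow> bool" where
  "subpresheaf C D \<longleftrightarrow> (\<forall>n. D n \<subseteq> cells C n) \<and>
     (\<forall>m n f. \<forall>c\<in>D n. box_hom m n f \<longrightarrow> act C m n f c \<in> D m)"

text \<open>The maximal proper subpresheaf is the union of all the proper ones
  (see \<open>boundary_maximal\<close> below).\<close>

definition boundary :: "nat \<Rightarrow> mor cset" where
  "boundary n = representable n
     \<lparr>cells := \<lambda>m. \<Union> {D m | D. subpresheaf (representable n) D \<and> D \<noteq> cells (representable n)}\<rparr>"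

definition generated :: "'a cset \<Rightarrow> 'a \<Rightarrow> 'a cset" where
  "generated C v = C\<lparr>cells := \<lambda>m. \<Inter> {D m | D. subpresheaf C D \<and> v \<in> D 0}\<rparr>"

definition pullback :: "'a cset \<Rightarrow> 'b cset \<Rightarrow> (nat \<Rightarrow> 'a \<Rightarrow> 'c) \<Rightarrow> (nat \<Rightarrow> 'b \<Rightarrow> 'c) \<Rightarrow> ('a \<times> 'b) cset" where
  "pullback A B f g = \<lparr>cells = (\<lambda>n. {(a, b). a \<in> cells A n \<and> b \<in> cells B n \<and> f n a = g n b}),
     act = (\<lambda>m n h (a, b). (act A m n h a, act B m n h b))\<rparr>"


subsection \<open>Day convolution and its closed structure\<close>

text \<open>\<open>(A \<otimes> B)\<^sub>n\<close> is the coend over \<open>p, q\<close> of \<open>A\<^sub>p \<times> B\<^sub>q \<times> \<box>([1]\<^sup>n, [1]\<^sup>p\<^sup>+\<^sup>q)\<close>.\<close>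

type_synonym ('a, 'b) day = "nat \<times> nat \<times> 'a \<times> 'b \<times> mor"

definition day_rel :: "'a cset \<Rightarrow> 'b cset \<Rightarrow> nat \<Rightarrow> ('a, 'b) day rel" where
  "day_rel A B n = gen_equiv
     {(p, q, a, b, h). a \<in> cells A p \<and> b \<in> cells B q \<and> box_hom n (p + q) h}
     {((p, q, act A p p' f a, act B q q' g b, h),
       (p', q', a, b, compose (grid 1 n) (box_tensor p p' f q q' g) h)) | p p' q q' f g a b h.
        box_hom p p' f \<and> box_hom q q' g \<and> a \<in> cells A p' \<and> b \<in> cells B q' \<and> box_hom n (p + q) h}"

definition day :: "'a cset \<Rightarrow> 'b cset \<Rightarrow> ('a, 'b) day set cset" where
  "day A B = \<lparr>cells = (\<lambda>n.
       {(p, q, a, b, h). a \<in> cells A p \<and> b \<in> cells B q \<and> box_hom n (p + q) h} // day_rel A B n),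
     act = (\<lambda>m n f X. day_rel A B m `` ((\<lambda>(p, q, a, b, h). (p, q, a, b, compose (grid 1 m) h f)) ` X))\<rparr>"

text \<open>The map \<open>f \<otimes> g : A \<otimes> B \<rightarrow> A' \<otimes> B'\<close>.\<close>

definition day_map :: "'c cset \<Rightarrow> 'd cset \<Rightarrow> (nat \<Rightarrow> 'a \<Rightarrow> 'c) \<Rightarrow> (nat \<Rightarrow> 'b \<Rightarrow> 'd) \<Rightarrow>
    nat \<Rightarrow> ('a, 'b) day set \<Rightarrow> ('c, 'd) day set" where
  "day_map A' B' f g = (\<lambda>n X. day_rel A' B' n `` ((\<lambda>(p, q, a, b, h). (p, q, f p a, g q b, h)) ` X))"

text \<open>\<open>exponent B C\<close> is the cubical set \<open>C\<^sup>B\<close>; a morphism \<open>f : [1]\<^sup>m \<rightarrow> [1]\<^sup>n\<close> acts on it by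
  precomposition with \<open>B \<otimes> \<box>[1]\<^sup>m \<rightarrow> B \<otimes> \<box>[1]\<^sup>n\<close>.\<close>

type_synonym ('b, 'c) expo = "nat \<Rightarrow> ('b, mor) day set \<Rightarrow> 'c"

definition exponent :: "'b cset \<Rightarrow> 'c cset \<Rightarrow> ('b, 'c) expo cset" where
  "exponent B C = \<lparr>cells = (\<lambda>n. chom (day B (representable n)) C),
     act = (\<lambda>m n f h. ccomp (day B (representable m)) h
              (day_map B (representable n) (\<lambda>_ b. b) (\<lambda>k g. compose (grid 1 k) f g)))\<rparr>"

text \<open>The maps \<open>C\<^sup>B \<rightarrow> C\<^sup>A\<close> induced by \<open>i : A \<rightarrow> B\<close> and \<open>C\<^sup>B \<rightarrow> D\<^sup>B\<close> induced by \<open>g : C \<rightarrow> D\<close>.\<close>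

definition exponent_pre :: "'a cset \<Rightarrow> 'b cset \<Rightarrow> (nat \<Rightarrow> 'a \<Rightarrow> 'b) \<Rightarrow> nat \<Rightarrow> ('b, 'c) expo \<Rightarrow> ('a, 'c) expo" where
  "exponent_pre A B i = (\<lambda>n h. ccomp (day A (representable n)) h
     (day_map B (representable n) i (\<lambda>_ g. g)))"

definition exponent_post :: "'b cset \<Rightarrow> (nat \<Rightarrow> 'c \<Rightarrow> 'd) \<Rightarrow> nat \<Rightarrow> ('b, 'c) expo \<Rightarrow> ('b, 'd) expo" where
  "exponent_post B g = (\<lambda>n h. ccomp (day B (representable n)) g h)"


subsection \<open>Connected components and the sets \<open>\<tau>\<^sub>n\<close>\<close>

definition pi0_rel :: "'a cset \<Rightarrow> 'a rel" where
  "pi0_rel C = gen_equiv (cells C 0)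
     {(act C 0 1 (coface 0 0 0) e, act C 0 1 (coface 0 0 1) e) | e. e \<in> cells C 1}"

definition pi0 :: "'a cset \<Rightarrow> 'a set set" where
  "pi0 C = cells C 0 // pi0_rel C"

definition pi0_map :: "'b cset \<Rightarrow> (nat \<Rightarrow> 'a \<Rightarrow> 'b) \<Rightarrow> 'a set \<Rightarrow> 'b set" where
  "pi0_map D f = (\<lambda>X. pi0_rel D `` (f 0 ` X))"

type_synonym 'a loops = "(mor, 'a) expo \<times> (mor, 'a) expo"

definition Omega :: "nat \<Rightarrow> 'a cset \<Rightarrow> 'a \<Rightarrow> 'a loops cset" where
  "Omega n C v = pullback (exponent (representable n) C) (exponent (boundary n) (generated C v))
     (exponent_pre (boundary n) (representable n) (\<lambda>_ f. f))
     (exponent_post (boundary n) (\<lambda>_ c. c))"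

definition Omega_map :: "nat \<Rightarrow> (nat \<Rightarrow> 'a \<Rightarrow> 'b) \<Rightarrow> nat \<Rightarrow> 'a loops \<Rightarrow> 'b loops" where
  "Omega_map n g = (\<lambda>k (h, h').
     (exponent_post (representable n) g k h, exponent_post (boundary n) g k h'))"

definition tau :: "nat \<Rightarrow> 'a cset \<Rightarrow> 'a \<Rightarrow> 'a loops set set" where
  "tau n C v = pi0 (Omega n C v)"

text \<open>The map \<open>\<tau>\<^sub>n(C, v) \<rightarrow> \<tau>\<^sub>n(D, g v)\<close> induced by \<open>g : C \<rightarrow> D\<close>.\<close>

definition tau_map :: "nat \<Rightarrow> 'b cset \<Rightarrow> 'a \<Rightarrow> (nat \<Rightarrow> 'a \<Rightarrow> 'b) \<Rightarrow> 'a loops set \<Rightarrow> 'b loops set" where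
  "tau_map n D v g = pi0_map (Omega n D (g 0 v)) (Omega_map n g)"


section \<open>Streams\<close>

text \<open>Circulations are extended by \<open>{}\<close> to the subsets that are not open.\<close>

definition circulation :: "'a topology \<Rightarrow> ('a set \<Rightarrow> 'a rel) \<Rightarrow> bool" where
  "circulation T c \<longleftrightarrow>
     (\<forall>U. openin T U \<longrightarrow> preorder_on U (c U)) \<and>
     (\<forall>\<O>. (\<forall>U\<in>\<O>. openin T U) \<longrightarrow> c (\<Union>\<O>) = gen_preorder (\<Union>\<O>) (\<Union>U\<in>\<O>. c U)) \<and>
     (\<forall>U. \<not> openin T U \<longrightarrow> c U = {})"

record 'a dstream =
  topo :: "'a topology"
  circ :: "'a set \<Rightarrow> 'a rel"

definition is_stream :: "'a dstream \<Rightarrow> bool" where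
  "is_stream X \<longleftrightarrow> circulation (topo X) (circ X)"

definition stream_map :: "'a dstream \<Rightarrow> 'b dstream \<Rightarrow> ('a \<Rightarrow> 'b) \<Rightarrow> bool" where
  "stream_map X Y f \<longleftrightarrow> continuous_map (topo X) (topo Y) f \<and>
     (\<forall>U x y. openin (topo Y) U \<longrightarrow> (x, y) \<in> circ X {z \<in> topspace (topo X). f z \<in> U} \<longrightarrow>
        (f x, f y) \<in> circ Y U)"

text \<open>The final stream on the set \<open>P\<close> with respect to a family of functions \<open>f i : Y i \<rightarrow> P\<close>:
  final topology, and smallest circulation for which all the \<open>f i\<close> are stream maps.  Colimits of
  streams are final streams on colimits of sets.\<close>

definition final_topology :: "'x set \<Rightarrow> 'i set \<Rightarrow> ('i \<Rightarrow> 'y topology) \<Rightarrow> ('i \<Rightarrow> 'y \<Rightarrow> 'x) \<Rightarrow> 'x topology" where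
  "final_topology P I T f = topology (\<lambda>U. U \<subseteq> P \<and> (\<forall>i\<in>I. openin (T i) {y \<in> topspace (T i). f i y \<in> U}))"

definition final_stream :: "'x set \<Rightarrow> 'i set \<Rightarrow> ('i \<Rightarrow> 'y dstream) \<Rightarrow> ('i \<Rightarrow> 'y \<Rightarrow> 'x) \<Rightarrow> 'x dstream" where
  "final_stream P I Y f = (let T = final_topology P I (\<lambda>i. topo (Y i)) f in
     \<lparr>topo = T,
      circ = (\<lambda>U. if openin T U then gen_preorder U
        (\<Union>i\<in>I. (\<lambda>(x, y). (f i x, f i y)) ` circ (Y i) {y \<in> topspace (topo (Y i)). f i y \<in> U})
        else {})\<rparr>)"

lemma istopology_final:
  "istopology (\<lambda>U. U \<subseteq> P \<and> (\<forall>i\<in>I. openin (T i) {y \<in> topspace (T i). f i y \<in> U}))"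
proof -
  have 1: "{y \<in> topspace (T i). f i y \<in> S \<inter> U} =
      {y \<in> topspace (T i). f i y \<in> S} \<inter> {y \<in> topspace (T i). f i y \<in> U}" for i S U by auto
  have 2: "{y \<in> topspace (T i). f i y \<in> \<Union>\<K>} = (\<Union>U\<in>\<K>. {y \<in> topspace (T i). f i y \<in> U})" for i \<K> by auto
  show ?thesis
    unfolding istopology_def 1 2 by (intro conjI allI impI ballI openin_Union) auto
qed

lemma openin_final:
  "openin (final_topology P I T f) U \<longleftrightarrow>
     U \<subseteq> P \<and> (\<forall>i\<in>I. openin (T i) {y \<in> topspace (T i). f i y \<in> U})"
  unfolding final_topology_def by (subst topology_inverse'[OF istopology_final]) (rule refl)

lemma gen_preorder:
  assumes "r \<subseteq> A \<times> A"
  shows "preorder_on A (gen_preorder A r)" "r \<subseteq> gen_preorder A r"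
    "preorder_on A R \<Longrightarrow> r \<subseteq> R \<Longrightarrow> gen_preorder A r \<subseteq> R"
proof -
  have A: "A \<times> A \<in> {R. preorder_on A R \<and> r \<subseteq> R}"
    using assms by (auto simp: preorder_on_def refl_on_def trans_def)
  show "preorder_on A (gen_preorder A r)"
    unfolding preorder_on_def
  proof (intro conjI)
    show "gen_preorder A r \<subseteq> A \<times> A" unfolding gen_preorder_def using A by (rule Inter_lower)
    show "refl_on A (gen_preorder A r)"
      by (auto simp: gen_preorder_def preorder_on_def refl_on_def)
    show "trans (gen_preorder A r)"
      unfolding gen_preorder_def by (rule trans_INTER[of _ id, simplified]) (auto simp: preorder_on_def)
  qed
  show "r \<subseteq> gen_preorder A r" unfolding gen_preorder_def by (rule Inter_greatest) simp
  show "gen_preorder A r \<subseteq> R" if "preorder_on A R" "r \<subseteq> R"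
    unfolding gen_preorder_def by (rule Inter_lower) (simp add: that)
qed

lemma circ_subset:
  assumes "is_stream X"
  shows "circ X U \<subseteq> U \<times> U"
  using assms unfolding is_stream_def circulation_def preorder_on_def by (metis empty_subsetI)

lemma circulation_Union:
  "circulation T c \<Longrightarrow> (\<And>U. U \<in> \<O> \<Longrightarrow> openin T U) \<Longrightarrow> c (\<Union>\<O>) = gen_preorder (\<Union>\<O>) (\<Union>U\<in>\<O>. c U)"
  by (simp add: circulation_def)

lemma gen_preorder_map:
  assumes xy: "(x, y) \<in> gen_preorder A r" and r: "r \<subseteq> A \<times> A"
    and R: "preorder_on B R" and g: "\<And>a. a \<in> A \<Longrightarrow> g a \<in> B"
    and rR: "\<And>a b. (a, b) \<in> r \<Longrightarrow> (g a, g b) \<in> R"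
  shows "(g x, g y) \<in> R"
proof -
  define Q where "Q = {(a, b). a \<in> A \<and> b \<in> A \<and> (g a, g b) \<in> R}"
  have "preorder_on A Q"
    using R g unfolding Q_def preorder_on_def refl_on_def trans_def by blast
  moreover have "r \<subseteq> Q" using r rR unfolding Q_def by blast
  ultimately have "gen_preorder A r \<subseteq> Q" by (rule gen_preorder(3)[OF r])
  then show ?thesis using xy unfolding Q_def by blast
qed

lemma circ_mono:
  assumes "is_stream X" "openin (topo X) U" "openin (topo X) V" "U \<subseteq> V"
  shows "circ X U \<subseteq> circ X V"
proof -
  have "circ X (\<Union>{U, V}) = gen_preorder (\<Union>{U, V}) (\<Union>W\<in>{U, V}. circ X W)"
    by (rule circulation_Union[of "topo X" "circ X" "{U, V}"])
      (use assms(1-3) in \<open>auto simp: is_stream_def\<close>)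
  moreover have "\<Union>{U, V} = V" using assms(4) by auto
  moreover have "(\<Union>W\<in>{U, V}. circ X W) = circ X U \<union> circ X V" by simp
  ultimately have eq: "circ X V = gen_preorder V (circ X U \<union> circ X V)" by metis
  have "circ X U \<union> circ X V \<subseteq> V \<times> V"
    using circ_subset[OF assms(1), of U] circ_subset[OF assms(1), of V] assms(4) by blast
  from gen_preorder(2)[OF this] show ?thesis unfolding eq[symmetric] by blast
qed

lemma is_stream_final_stream:
  assumes Y: "\<And>i. i \<in> I \<Longrightarrow> is_stream (Y i)"
  shows "is_stream (final_stream P I Y f)"
proof -
  define X where "X = final_stream P I Y f"
  define T where "T = final_topology P I (\<lambda>i. topo (Y i)) f"
  define v where "v = (\<lambda>U i. {y \<in> topspace (topo (Y i)). f i y \<in> U})"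
  define r where "r = (\<lambda>U. \<Union>i\<in>I. (\<lambda>(x, y). (f i x, f i y)) ` circ (Y i) (v U i))"
  have topo: "topo X = T" and circ: "openin T U \<Longrightarrow> circ X U = gen_preorder U (r U)"
    and circ': "\<not> openin T U \<Longrightarrow> circ X U = {}" for U
    by (auto simp: X_def T_def r_def v_def final_stream_def Let_def)
  have rI: "(f i x, f i y) \<in> r U" if "i \<in> I" "(x, y) \<in> circ (Y i) (v U i)" for i x y U
    unfolding r_def by (rule UN_I[OF that(1)], rule image_eqI[OF _ that(2)]) simp
  have rE: "\<exists>i x y. i \<in> I \<and> p = (f i x, f i y) \<and> (x, y) \<in> circ (Y i) (v U i)" if "p \<in> r U" for p U
    using that unfolding r_def by auto
  have fv: "f i x \<in> U" if "x \<in> v U i" for i x U using that by (simp add: v_def)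
  have r: "r U \<subseteq> U \<times> U" for U
  proof
    fix p assume "p \<in> r U"
    then obtain i x y where i: "i \<in> I" and p: "p = (f i x, f i y)" and xy: "(x, y) \<in> circ (Y i) (v U i)"
      using rE by blast
    have "(x, y) \<in> v U i \<times> v U i" using circ_subset[OF Y[OF i]] xy by (rule subsetD)
    then show "p \<in> U \<times> U" using p fv by simp
  qed
  have pre: "preorder_on U (circ X U)" and rc: "r U \<subseteq> circ X U" if "openin T U" for U
    using gen_preorder(1,2)[OF r[of U]] circ[OF that] by simp_all
  have v: "openin (topo (Y i)) (v U i)" if "openin T U" "i \<in> I" for U i
    using that by (simp add: T_def v_def openin_final)
  have Un: "circ X (\<Union>\<O>) = gen_preorder (\<Union>\<O>) (\<Union>U\<in>\<O>. circ X U)" if "\<forall>U\<in>\<O>. openin T U" for \<O>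
  proof (rule subset_antisym; rule subrelI)
    define W where "W = \<Union>\<O>"
    define s where "s = (\<Union>U\<in>\<O>. circ X U)"
    have O: "openin T U" if "U \<in> \<O>" for U using \<open>\<forall>U\<in>\<O>. openin T U\<close> that by blast
    have W: "openin T W" unfolding W_def using O by (rule openin_Union)
    have UW: "U \<subseteq> W" if "U \<in> \<O>" for U using that by (auto simp: W_def)
    have "circ X U \<subseteq> W \<times> W" if "U \<in> \<O>" for U
      using pre[OF O[OF that]] UW[OF that] by (auto simp: preorder_on_def)
    then have s: "s \<subseteq> W \<times> W" unfolding s_def by (rule UN_least)
    have cs: "p \<in> s" if "U \<in> \<O>" "p \<in> circ X U" for p U unfolding s_def using that by (rule UN_I)
    note G = gen_preorder(1,2)[OF s]
    {
      fix a b assume "(a, b) \<in> circ X (\<Union>\<O>)"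
      then have ab: "(a, b) \<in> gen_preorder W (r W)" using circ[OF W] by (simp add: W_def)
      have "(a', b') \<in> gen_preorder W s" if ab2: "(a', b') \<in> r W" for a' b'
      proof -
        obtain i x y where i: "i \<in> I" and p: "a' = f i x" "b' = f i y" and xy: "(x, y) \<in> circ (Y i) (v W i)"
          using rE[OF ab2] by blast
        have vW: "v W i = \<Union> ((\<lambda>U. v U i) ` \<O>)" by (auto simp: v_def W_def)
        have "circ (Y i) (v W i) = gen_preorder (v W i) (\<Union>A\<in>(\<lambda>U. v U i) ` \<O>. circ (Y i) A)"
          unfolding vW by (rule circulation_Union[of "topo (Y i)" "circ (Y i)"])
            (use Y[OF i] v[OF O i] in \<open>auto simp: is_stream_def\<close>)
        then have xy': "(x, y) \<in> gen_preorder (v W i) (\<Union>U\<in>\<O>. circ (Y i) (v U i))"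
          using xy by simp
        have "(f i x, f i y) \<in> gen_preorder W s"
        proof (rule gen_preorder_map[OF xy' _ G(1)])
          have "circ (Y i) (v U i) \<subseteq> v W i \<times> v W i" if "U \<in> \<O>" for U
          proof -
            have "v U i \<subseteq> v W i" using UW[OF that] by (auto simp: v_def)
            then show ?thesis using circ_subset[OF Y[OF i], of "v U i"] by blast
          qed
          then show "(\<Union>U\<in>\<O>. circ (Y i) (v U i)) \<subseteq> v W i \<times> v W i" by (rule UN_least)
        next
          fix c d assume "(c, d) \<in> (\<Union>U\<in>\<O>. circ (Y i) (v U i))"
          then obtain U where U: "U \<in> \<O>" "(c, d) \<in> circ (Y i) (v U i)" by (rule UN_E)
          have "(f i c, f i d) \<in> circ X U" using rc[OF O[OF U(1)]] rI[OF i U(2)] by (rule subsetD)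
          then show "(f i c, f i d) \<in> gen_preorder W s" using G(2) cs[OF U(1)] by blast
        qed (rule fv)
        then show ?thesis using p by simp
      qed
      then have "(id a, id b) \<in> gen_preorder W s"
        by (intro gen_preorder_map[OF ab r G(1)]) simp_all
      then show "(a, b) \<in> gen_preorder (\<Union>\<O>) (\<Union>U\<in>\<O>. circ X U)" by (simp add: W_def s_def)
    next
      fix a b assume "(a, b) \<in> gen_preorder (\<Union>\<O>) (\<Union>U\<in>\<O>. circ X U)"
      then have ab: "(a, b) \<in> gen_preorder W s" by (simp add: W_def s_def)
      have "(a', b') \<in> circ X W" if ab2: "(a', b') \<in> s" for a' b'
      proof -
        obtain U where U: "U \<in> \<O>" "(a', b') \<in> circ X U" using ab2 unfolding s_def by (rule UN_E)
        then have ab': "(a', b') \<in> gen_preorder U (r U)" using circ[OF O] by simp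
        have "(c, d) \<in> circ X W" if cd: "(c, d) \<in> r U" for c d
        proof -
          obtain i x y where i: "i \<in> I" and p: "c = f i x" "d = f i y" and xy: "(x, y) \<in> circ (Y i) (v U i)"
            using rE[OF cd] by blast
          have "v U i \<subseteq> v W i" using UW[OF U(1)] by (auto simp: v_def)
          then have "(x, y) \<in> circ (Y i) (v W i)"
            using circ_mono[OF Y[OF i] v[OF O[OF U(1)] i] v[OF W i]] xy by blast
          then show ?thesis using rI[OF i] rc[OF W] p by blast
        qed
        then have "(id a', id b') \<in> circ X W"
          using UW[OF U(1)] by (intro gen_preorder_map[OF ab' r pre[OF W]]) auto
        then show ?thesis by simp
      qed
      then have "(id a, id b) \<in> circ X W"
        by (intro gen_preorder_map[OF ab s pre[OF W]]) simp_all
      then show "(a, b) \<in> circ X (\<Union>\<O>)" by (simp add: W_def)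
    }
  qed
  have "is_stream X"
    unfolding is_stream_def circulation_def topo using pre Un circ' by simp
  then show ?thesis by (simp add: X_def)
qed

text \<open>The universal property of final streams.\<close>

lemma final_stream_universal:
  assumes Y: "\<And>i. i \<in> I \<Longrightarrow> is_stream (Y i)" and Z: "is_stream Z"
    and P: "P = (\<Union>i\<in>I. f i ` topspace (topo (Y i)))"
  shows "stream_map (final_stream P I Y f) Z g \<longleftrightarrow> (\<forall>i\<in>I. stream_map (Y i) Z (g \<circ> f i))"
proof -
  have f: "f i ` topspace (topo (Y i)) \<subseteq> P" if "i \<in> I" for i using that P by blast
  let ?X = "final_stream P I Y f"
  let ?T = "final_topology P I (\<lambda>i. topo (Y i)) f"
  let ?r = "\<lambda>U. \<Union>i\<in>I. (\<lambda>(x, y). (f i x, f i y)) ` circ (Y i) {y \<in> topspace (topo (Y i)). f i y \<in> U}"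
  have topo: "topo ?X = ?T" and circ: "openin ?T U \<Longrightarrow> circ ?X U = gen_preorder U (?r U)" for U
    by (auto simp: final_stream_def Let_def)
  have r: "?r U \<subseteq> U \<times> U" for U using circ_subset[OF Y] by fast
  have "{y \<in> topspace (topo (Y i)). f i y \<in> P} = topspace (topo (Y i))" if "i \<in> I" for i
    using f[OF that] by auto
  then have oP: "openin ?T P" by (simp add: openin_final)
  then have tP: "topspace ?T = P"
    by (metis openin_final openin_subset openin_topspace subset_antisym)
  have vim: "{y \<in> topspace (topo (Y i)). f i y \<in> {z \<in> P. g z \<in> V}} =
      {y \<in> topspace (topo (Y i)). (g \<circ> f i) y \<in> V}" if "i \<in> I" for i V
    using f[OF that] by auto
  have cont: "continuous_map ?T (topo Z) g \<longleftrightarrow> (\<forall>i\<in>I. continuous_map (topo (Y i)) (topo Z) (g \<circ> f i))"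
    unfolding continuous_map_def tP openin_final using vim f P by (auto simp: Pi_iff)
  have "(\<forall>x y. (x, y) \<in> circ ?X {z \<in> P. g z \<in> V} \<longrightarrow> (g x, g y) \<in> circ Z V) \<longleftrightarrow>
      (\<forall>i\<in>I. \<forall>x y. (x, y) \<in> circ (Y i) {y \<in> topspace (topo (Y i)). (g \<circ> f i) y \<in> V} \<longrightarrow>
        ((g \<circ> f i) x, (g \<circ> f i) y) \<in> circ Z V)" (is "?L \<longleftrightarrow> ?R")
    if c: "continuous_map ?T (topo Z) g" and V: "openin (topo Z) V" for V
  proof -
    let ?U = "{z \<in> P. g z \<in> V}"
    have U: "openin ?T ?U" using c V tP by (auto simp: continuous_map_def)
    note G = gen_preorder[OF r, of ?U]
    show ?thesis
    proof
      assume L: ?L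
      show ?R
      proof (intro ballI allI impI)
        fix i x y
        assume i: "i \<in> I" and xy: "(x, y) \<in> circ (Y i) {y \<in> topspace (topo (Y i)). (g \<circ> f i) y \<in> V}"
        then have "(f i x, f i y) \<in> ?r ?U" unfolding vim[OF i, symmetric] by force
        then have "(f i x, f i y) \<in> circ ?X ?U" using G(2) circ[OF U] by blast
        then show "((g \<circ> f i) x, (g \<circ> f i) y) \<in> circ Z V" using L by simp
      qed
    next
      assume R: ?R
      let ?Q = "{(x, y). x \<in> ?U \<and> y \<in> ?U \<and> (g x, g y) \<in> circ Z V}"
      have pre: "preorder_on V (circ Z V)" using Z V by (auto simp: is_stream_def circulation_def)
      have "preorder_on ?U ?Q"
        using pre unfolding preorder_on_def refl_on_def trans_def by blast
      moreover have "?r ?U \<subseteq> ?Q"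
      proof
        fix p assume p: "p \<in> ?r ?U"
        then obtain i x y where i: "i \<in> I" and "p = (f i x, f i y)"
          and "(x, y) \<in> circ (Y i) {y \<in> topspace (topo (Y i)). f i y \<in> ?U}" by auto
        then have "p = (f i x, f i y)" "(g (f i x), g (f i y)) \<in> circ Z V"
          using R unfolding vim[OF i] by auto
        moreover have "p \<in> ?U \<times> ?U" using r[of ?U] p by blast
        ultimately show "p \<in> ?Q" by blast
      qed
      ultimately have "circ ?X ?U \<subseteq> ?Q" using G(3) circ[OF U] by simp
      then show ?L by blast
    qed
  qed
  then show ?thesis
    unfolding stream_map_def topo tP cont[symmetric] using cont by (auto 0 4 simp: tP)
qed

definition cube :: "nat \<Rightarrow> (nat \<Rightarrow> real) set" where
  "cube n = {..<n} \<rightarrow>\<^sub>E {0..1}"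

definition cube_topology :: "nat \<Rightarrow> (nat \<Rightarrow> real) topology" where
  "cube_topology n = product_topology (\<lambda>_. top_of_set {0..1}) {..<n}"

definition dcube :: "nat \<Rightarrow> (nat \<Rightarrow> real) dstream" where
  "dcube n = \<lparr>topo = cube_topology n,
     circ = (THE c. circulation (cube_topology n) c \<and>
                    c (cube n) = {(x, y). x \<in> cube n \<and> y \<in> cube n \<and> (\<forall>i<n. x i \<le> y i)})\<rparr>"


section \<open>Directed realization\<close>

text \<open>The multilinear extension of a function \<open>[1]\<^sup>m \<rightarrow> \<nat>\<^sup>n\<close> to a function \<open>[0,1]\<^sup>m \<rightarrow> \<real>\<^sup>n\<close>.  For cofaces,
  codegeneracies, coordinate permutations and their composites this is the evident action
  (see \<open>linear_ext_coface\<close>, \<open>linear_ext_codegen\<close>, \<open>linear_ext_coperm\<close>, \<open>linear_ext_compose\<close> below).\<close>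

definition linear_ext :: "nat \<Rightarrow> nat \<Rightarrow> mor \<Rightarrow> (nat \<Rightarrow> real) \<Rightarrow> nat \<Rightarrow> real" where
  "linear_ext m n f = (\<lambda>x\<in>cube m. \<lambda>j\<in>{..<n}.
     \<Sum>v\<in>grid 1 m. (\<Prod>i<m. if v i = 0 then 1 - x i else x i) * real (f v j))"

lemma sum_grid_weights:
  "(\<Sum>v\<in>grid 1 m. \<Prod>i<m. w i (v i)) = (\<Prod>i<m. w i 0 + w i (1::nat))" for w :: "nat \<Rightarrow> nat \<Rightarrow> real"
proof -
  have "(\<Prod>i<m. \<Sum>t\<in>{0..1}. w i t) = (\<Sum>v\<in>grid 1 m. \<Prod>i<m. w i (v i))"
    unfolding grid_def by (rule prod_sum_PiE) auto
  moreover have "(\<Sum>t\<in>{0..1}. w i t) = w i 0 + w i 1" for i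
    by (simp add: atLeast0_atMost_Suc)
  ultimately show ?thesis by simp
qed

lemma linear_ext_const:
  assumes "x \<in> cube m" "j < n" "\<And>v. v \<in> grid 1 m \<Longrightarrow> f v j = e"
  shows "linear_ext m n f x j = real e"
proof -
  have "linear_ext m n f x j = (\<Sum>v\<in>grid 1 m. (\<Prod>i<m. if v i = 0 then 1 - x i else x i) * real e)"
    using assms by (simp add: linear_ext_def)
  also have "\<dots> = (\<Sum>v\<in>grid 1 m. \<Prod>i<m. if v i = 0 then 1 - x i else x i) * real e"
    by (simp add: sum_distrib_right)
  also have "\<dots> = real e"
    by (subst sum_grid_weights[where w = "\<lambda>i t. if t = 0 then 1 - x i else x i"]) simp
  finally show ?thesis .
qed

lemma linear_ext_var:
  assumes "x \<in> cube m" "j < n" "i < m" "\<And>v. v \<in> grid 1 m \<Longrightarrow> f v j = v i"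
  shows "linear_ext m n f x j = x i"
proof -
  define w where "w = (\<lambda>l t. (if t = 0 then 1 - x l else x l) * (if l = i then real t else 1))"
  have *: "(\<Prod>l<m. if v l = 0 then 1 - x l else x l) * real (v i) = (\<Prod>l<m. w l (v l))" for v :: "nat \<Rightarrow> nat"
  proof -
    have "(\<Prod>l<m. if l = i then real (v l) else 1) = real (v i)"
      using assms(3) by simp
    then show ?thesis by (simp add: w_def prod.distrib)
  qed
  have "linear_ext m n f x j = (\<Sum>v\<in>grid 1 m. \<Prod>l<m. w l (v l))"
    using assms by (simp add: linear_ext_def *)
  also have "\<dots> = (\<Prod>l<m. w l 0 + w l 1)" by (rule sum_grid_weights)
  also have "\<dots> = (\<Prod>l<m. if l = i then x l else 1)"
    by (rule prod.cong) (auto simp: w_def)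
  also have "\<dots> = x i" using assms(3) by simp
  finally show ?thesis .
qed

lemma linear_ext_coface:
  assumes "i \<le> n"
  shows "linear_ext n (Suc n) (coface n i e) =
    (\<lambda>x\<in>cube n. \<lambda>j\<in>{..<Suc n}. if j < i then x j else if j = i then real e else x (j - 1))"
proof (intro ext)
  fix x j
  consider "x \<notin> cube n" | "x \<in> cube n" "\<not> j < Suc n" | "x \<in> cube n" "j < Suc n" "j < i"
    | "x \<in> cube n" "j < Suc n" "j = i" | "x \<in> cube n" "j < Suc n" "j > i" by linarith
  then show "linear_ext n (Suc n) (coface n i e) x j = (\<lambda>x\<in>cube n. \<lambda>j\<in>{..<Suc n}.
      if j < i then x j else if j = i then real e else x (j - 1)) x j"
  proof cases
    case 3
    then show ?thesis using assms
      by (subst linear_ext_var[where i = j]) (auto simp: coface_def)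
  next
    case 4
    then show ?thesis using assms
      by (subst linear_ext_const[where e = e]) (auto simp: coface_def)
  next
    case 5
    then show ?thesis using assms
      by (subst linear_ext_var[where i = "j - 1"]) (auto simp: coface_def)
  qed (auto simp: linear_ext_def)
qed

lemma linear_ext_codegen:
  assumes "i \<le> n"
  shows "linear_ext (Suc n) n (codegen n i) =
    (\<lambda>x\<in>cube (Suc n). \<lambda>j\<in>{..<n}. if j < i then x j else x (Suc j))"
proof (intro ext)
  fix x j
  consider "x \<notin> cube (Suc n)" | "x \<in> cube (Suc n)" "\<not> j < n" | "x \<in> cube (Suc n)" "j < n" by linarith
  then show "linear_ext (Suc n) n (codegen n i) x j =
      (\<lambda>x\<in>cube (Suc n). \<lambda>j\<in>{..<n}. if j < i then x j else x (Suc j)) x j"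
  proof cases
    case 3
    then show ?thesis
      by (subst linear_ext_var[where i = "if j < i then j else Suc j"]) (auto simp: codegen_def)
  qed (auto simp: linear_ext_def)
qed

lemma linear_ext_coperm:
  assumes "p permutes {..<n}"
  shows "linear_ext n n (coperm n p) = (\<lambda>x\<in>cube n. \<lambda>j\<in>{..<n}. x (p j))"
proof (intro ext)
  fix x j
  consider "x \<notin> cube n" | "x \<in> cube n" "\<not> j < n" | "x \<in> cube n" "j < n" by linarith
  then show "linear_ext n n (coperm n p) x j = (\<lambda>x\<in>cube n. \<lambda>j\<in>{..<n}. x (p j)) x j"
  proof cases
    case 3
    moreover have "p j < n" using 3 permutes_in_image[OF assms, of j] by auto
    ultimately show ?thesis
      by (subst linear_ext_var[where i = "p j"]) (auto simp: coperm_def)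
  qed (auto simp: linear_ext_def)
qed

lemma box_coordinates:
  assumes "box_hom m n f"
  shows "f \<in> grid 1 m \<rightarrow>\<^sub>E grid 1 n \<and> (\<forall>j<n. (\<exists>e\<le>1. \<forall>v\<in>grid 1 m. f v j = e) \<or> (\<exists>i<m. \<forall>v\<in>grid 1 m. f v j = v i))"
  using assms
proof induction
  case (box_id n)
  then show ?case by (auto simp: box_id_def)
next
  case (box_coface i n e)
  have "(\<exists>e'\<le>1. \<forall>v\<in>grid 1 n. coface n i e v j = e') \<or> (\<exists>l<n. \<forall>v\<in>grid 1 n. coface n i e v j = v l)"
    if "j < Suc n" for j
  proof -
    consider "j < i" | "j = i" | "j > i" by linarith
    then show ?thesis
    proof cases
      case 1 then show ?thesis using box_coface that
        by (intro disjI2 exI[of _ j]) (auto simp: coface_def)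
    next
      case 2 then show ?thesis using box_coface that
        by (intro disjI1 exI[of _ e]) (auto simp: coface_def)
    next
      case 3 then show ?thesis using box_coface that
        by (intro disjI2 exI[of _ "j - 1"]) (auto simp: coface_def)
    qed
  qed
  moreover have "coface n i e \<in> grid 1 n \<rightarrow>\<^sub>E grid 1 (Suc n)"
    using box_coface by (fastforce simp: coface_def grid_def PiE_iff)
  ultimately show ?case by blast
next
  case (box_codegen i n)
  have "\<exists>l<Suc n. \<forall>v\<in>grid 1 (Suc n). codegen n i v j = v l" if "j < n" for j
    using that by (intro exI[of _ "if j < i then j else Suc j"]) (auto simp: codegen_def)
  moreover have "codegen n i \<in> grid 1 (Suc n) \<rightarrow>\<^sub>E grid 1 n"
    using box_codegen by (auto simp: codegen_def grid_def PiE_iff)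
  ultimately show ?case by blast
next
  case (box_coperm p n)
  have p: "p j < n" if "j < n" for j using that permutes_in_image[OF box_coperm, of j] by auto
  then have "\<exists>l<n. \<forall>v\<in>grid 1 n. coperm n p v j = v l" if "j < n" for j
    using that by (intro exI[of _ "p j"]) (auto simp: coperm_def)
  moreover have "coperm n p \<in> grid 1 n \<rightarrow>\<^sub>E grid 1 n"
    using p by (auto simp: coperm_def grid_def PiE_iff)
  ultimately show ?case by blast
next
  case (box_compose l m f n g)
  have f: "f v \<in> grid 1 m" if "v \<in> grid 1 l" for v using box_compose.IH(1) that by (auto dest: PiE_mem)
  have g: "g v \<in> grid 1 n" if "v \<in> grid 1 m" for v using box_compose.IH(2) that by (auto dest: PiE_mem)
  have "(\<exists>e\<le>1. \<forall>v\<in>grid 1 l. g (f v) j = e) \<or> (\<exists>i<l. \<forall>v\<in>grid 1 l. g (f v) j = v i)" if "j < n" for j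
  proof -
    have "(\<exists>e\<le>1. \<forall>v\<in>grid 1 m. g v j = e) \<or> (\<exists>i<m. \<forall>v\<in>grid 1 m. g v j = v i)"
      using conjunct2[OF box_compose.IH(2)] that by (elim allE impE)
    then show ?thesis
    proof (elim disjE exE conjE)
      fix e assume "e \<le> 1" "\<forall>v\<in>grid 1 m. g v j = e"
      then have "e \<le> 1 \<and> (\<forall>v\<in>grid 1 l. g (f v) j = e)" using f by simp
      then show ?thesis by blast
    next
      fix i assume "i < m" and i: "\<forall>v\<in>grid 1 m. g v j = v i"
      have gf: "g (f v) j = f v i" if "v \<in> grid 1 l" for v using i f[OF that] by simp
      have "(\<exists>e\<le>1. \<forall>v\<in>grid 1 l. f v i = e) \<or> (\<exists>k<l. \<forall>v\<in>grid 1 l. f v i = v k)"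
        using conjunct2[OF box_compose.IH(1)] \<open>i < m\<close> by (elim allE impE)
      then show ?thesis by (simp add: gf)
    qed
  qed
  moreover have "compose (grid 1 l) g f \<in> grid 1 l \<rightarrow>\<^sub>E grid 1 n"
    using f g by (auto simp: compose_def)
  ultimately show ?case by (auto simp: compose_eq)
qed

lemma linear_ext_box:
  assumes "box_hom m n f" "x \<in> cube m"
  shows "linear_ext m n f x \<in> cube n"
proof -
  have "linear_ext m n f x j \<in> {0..1}" if j: "j < n" for j
  proof -
    consider e where "e \<le> 1" "\<forall>v\<in>grid 1 m. f v j = e" | i where "i < m" "\<forall>v\<in>grid 1 m. f v j = v i"
      using conjunct2[OF box_coordinates[OF assms(1)], rule_format, OF j] by auto
    then show ?thesis
    proof cases
      case 1
      then show ?thesis using linear_ext_const[of x m j n f e] assms j by auto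
    next
      case 2
      then show ?thesis using linear_ext_var[of x m j n i f] assms j by (auto simp: cube_def)
    qed
  qed
  then show ?thesis using assms(2) by (auto simp: cube_def linear_ext_def)
qed

lemma linear_ext_compose:
  assumes f: "box_hom l m f" and g: "box_hom m n g"
  shows "linear_ext l n (compose (grid 1 l) g f) = compose (cube l) (linear_ext m n g) (linear_ext l m f)"
proof (intro ext)
  fix x j
  show "linear_ext l n (compose (grid 1 l) g f) x j = compose (cube l) (linear_ext m n g) (linear_ext l m f) x j"
  proof (cases "x \<in> cube l \<and> j < n")
    case False
    then show ?thesis using linear_ext_box[OF f] by (auto simp: compose_def linear_ext_def)
  next
    case True
    then have x: "x \<in> cube l" and j: "j < n" by auto
    note fx = linear_ext_box[OF f x]
    have fv: "f v \<in> grid 1 m" if "v \<in> grid 1 l" for v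
      using box_coordinates[OF f] that by (auto dest: PiE_mem)
    consider e where "\<forall>v\<in>grid 1 m. g v j = e" | i where "i < m" "\<forall>v\<in>grid 1 m. g v j = v i"
      using conjunct2[OF box_coordinates[OF g], rule_format, OF j] by auto
    then show ?thesis
    proof cases
      case 1
      then have "linear_ext m n g (linear_ext l m f x) j = e" using linear_ext_const[OF fx j] by blast
      moreover have "linear_ext l n (compose (grid 1 l) g f) x j = e"
        using 1 fv by (intro linear_ext_const[OF x j]) (auto simp: compose_eq)
      ultimately show ?thesis using x by (simp add: compose_eq)
    next
      case 2
      then have *: "linear_ext m n g (linear_ext l m f x) j = linear_ext l m f x i"
        using linear_ext_var[OF fx j 2(1)] by blast
      have "linear_ext l n (compose (grid 1 l) g f) x j = linear_ext l m f x i"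
        using 2 fv x j by (simp add: linear_ext_def compose_eq)
      then show ?thesis using x * by (simp add: compose_eq)
    qed
  qed
qed

text \<open>The relation defining the coend over \<open>n\<close> of \<open>C\<^sub>n \<times> F n\<close>, where \<open>F\<close> is a covariant functor on
  the category of cubes with action \<open>push\<close> on morphisms.\<close>

definition glue_points :: "'a cset \<Rightarrow> (nat \<Rightarrow> 'x set) \<Rightarrow> (nat \<times> 'a \<times> 'x) set" where
  "glue_points C F = {(n, c, x). c \<in> cells C n \<and> x \<in> F n}"

definition glue_rel :: "'a cset \<Rightarrow> (nat \<Rightarrow> 'x set) \<Rightarrow> (nat \<Rightarrow> nat \<Rightarrow> mor \<Rightarrow> 'x \<Rightarrow> 'x) \<Rightarrow> (nat \<times> 'a \<times> 'x) rel" where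
  "glue_rel C F push = gen_equiv (glue_points C F)
     {((m, act C m n f c, x), (n, c, push m n f x)) | m n f c x.
        box_hom m n f \<and> c \<in> cells C n \<and> x \<in> F m}"

text \<open>The colimit of directed cubes over the cells of \<open>C\<close>, taken in the category of streams.  It is also
  the colimit in the full subcategory of weak Hausdorff k-streams: it is a k-stream, being a colimit of
  compact Hausdorff streams, and its underlying space is the topological realization of \<open>C\<close>, obtained by
  successively attaching quotients of cubes by groups of coordinate permutations along their
  boundaries, and hence Hausdorff.\<close>

abbreviation real_rel :: "'a cset \<Rightarrow> (nat \<times> 'a \<times> (nat \<Rightarrow> real)) rel" where
  "real_rel C \<equiv> glue_rel C cube linear_ext"

definition realization :: "'a cset \<Rightarrow> (nat \<times> 'a \<times> (nat \<Rightarrow> real)) set dstream" where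
  "realization C = final_stream (glue_points C cube // real_rel C)
     {(n, c). c \<in> cells C n} (\<lambda>(n, c). dcube n) (\<lambda>(n, c) x. real_rel C `` {(n, c, x)})"

text \<open>\<open>dcube n\<close> serves as the realization of the representable cubical set.\<close>

definition sing :: "'x dstream \<Rightarrow> ((nat \<Rightarrow> real) \<Rightarrow> 'x) cset" where
  "sing X = \<lparr>cells = (\<lambda>n. {h \<in> extensional (cube n). stream_map (dcube n) X h}),
     act = (\<lambda>m n f h. compose (cube m) h (linear_ext m n f))\<rparr>"

type_synonym 'a scell = "(nat \<Rightarrow> real) \<Rightarrow> (nat \<times> 'a \<times> (nat \<Rightarrow> real)) set"

definition SS :: "'a cset \<Rightarrow> 'a scell cset" where
  "SS C = sing (realization C)"

definition SS_unit :: "'a cset \<Rightarrow> nat \<Rightarrow> 'a \<Rightarrow> 'a scell" where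
  "SS_unit C n c = (\<lambda>x\<in>cube n. real_rel C `` {(n, c, x)})"


section \<open>Subdivision\<close>

definition boolean_interval :: "'l::lattice set \<Rightarrow> 'l set \<Rightarrow> bool" where
  "boolean_interval L B \<longleftrightarrow> (\<exists>a\<in>L. \<exists>b\<in>L. a \<le> b \<and> B = {x\<in>L. a \<le> x \<and> x \<le> b}) \<and>
     (\<exists>m h. bij_betw h (grid 1 m) B \<and> (\<forall>x\<in>grid 1 m. \<forall>y\<in>grid 1 m. x \<le> y \<longleftrightarrow> h x \<le> h y))"

text \<open>The cubical set \<open>\<box>[L]\<close> for a finite distributive lattice \<open>L\<close>, given as a sublattice of a type.\<close>

definition lattice_cset :: "'l::distrib_lattice set \<Rightarrow> ((nat \<Rightarrow> nat) \<Rightarrow> 'l) cset" where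
  "lattice_cset L = \<lparr>cells = (\<lambda>m. {f \<in> grid 1 m \<rightarrow>\<^sub>E L.
       (\<forall>x\<in>grid 1 m. \<forall>y\<in>grid 1 m. f (inf x y) = inf (f x) (f y) \<and> f (sup x y) = sup (f x) (f y)) \<and>
       (\<forall>B. boolean_interval (grid 1 m) B \<longrightarrow> boolean_interval L (f ` B))}),
     act = (\<lambda>k m g f. compose (grid 1 k) f g)\<rparr>"

text \<open>Under the identification of \<open>[2]\<^sup>n\<close> with the monotone functions \<open>\<zeta> : [1] \<rightarrow> [1]\<^sup>n\<close>, the point \<open>z\<close>
  corresponds to \<open>\<zeta>\<close> with \<open>\<zeta> e = end_of n e z\<close>, and \<open>z = \<zeta> 0 + \<zeta> 1\<close>.\<close>

definition end_of :: "nat \<Rightarrow> nat \<Rightarrow> (nat \<Rightarrow> nat) \<Rightarrow> nat \<Rightarrow> nat" where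
  "end_of n e z = (\<lambda>i\<in>{..<n}. if z i + e \<ge> 2 then 1 else 0)"

definition sd2_mor :: "nat \<Rightarrow> nat \<Rightarrow> mor \<Rightarrow> mor" where
  "sd2_mor m n f = (\<lambda>z\<in>grid 2 m. \<lambda>j\<in>{..<n}. f (end_of m 0 z) j + f (end_of m 1 z) j)"

text \<open>\<open>sd2_cube n\<close> is the subdivision of the representable \<open>\<box>[1]\<^sup>n\<close>, natural in \<open>[1]\<^sup>n\<close> via \<open>sd2_mor\<close>.\<close>

abbreviation sd2_cube :: "nat \<Rightarrow> mor cset" where
  "sd2_cube n \<equiv> lattice_cset (grid 2 n)"

definition ex2 :: "'a cset \<Rightarrow> (nat \<Rightarrow> mor \<Rightarrow> 'a) cset" where
  "ex2 C = \<lparr>cells = (\<lambda>n. chom (sd2_cube n) C),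
     act = (\<lambda>m n f h. ccomp (sd2_cube m) h (\<lambda>k s. compose (grid 1 k) (sd2_mor m n f) s))\<rparr>"

definition ex2_map :: "(nat \<Rightarrow> 'a \<Rightarrow> 'b) \<Rightarrow> nat \<Rightarrow> (nat \<Rightarrow> mor \<Rightarrow> 'a) \<Rightarrow> nat \<Rightarrow> mor \<Rightarrow> 'b" where
  "ex2_map g = (\<lambda>n h. ccomp (sd2_cube n) g h)"

text \<open>The composite of the cell \<open>[0,1]\<^sup>k \<rightarrow> \<parallel>sd\<^sub>2 \<box>[1]\<^sup>m\<parallel>\<close> given by \<open>s : [1]\<^sup>k \<rightarrow> [2]\<^sup>m\<close> with
  \<open>\<phi> : \<parallel>sd\<^sub>2 \<box>[1]\<^sup>m\<parallel> \<cong> [0,1]\<^sup>m\<close>.\<close>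

definition sd2_cell :: "nat \<Rightarrow> nat \<Rightarrow> mor \<Rightarrow> (nat \<Rightarrow> real) \<Rightarrow> nat \<Rightarrow> real" where
  "sd2_cell k m s = (\<lambda>x\<in>cube k. \<lambda>j\<in>{..<m}. linear_ext k m s x j / 2)"


section \<open>Cubcats\<close>

text \<open>\<open>(sharp C)\<^sub>m\<close> is the coend over \<open>n\<close> of \<open>C\<^sub>n \<times> (sing (dcube n))\<^sub>m\<close>.\<close>

type_synonym 'a sharp_cell = "(nat \<times> 'a \<times> ((nat \<Rightarrow> real) \<Rightarrow> nat \<Rightarrow> real)) set"

definition sharp_rel :: "'a cset \<Rightarrow> nat \<Rightarrow> (nat \<times> 'a \<times> ((nat \<Rightarrow> real) \<Rightarrow> nat \<Rightarrow> real)) rel" where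
  "sharp_rel C m = glue_rel C (\<lambda>n. cells (sing (dcube n)) m)
     (\<lambda>n n' f h. compose (cube m) (linear_ext n n' f) h)"

definition sharp :: "'a cset \<Rightarrow> 'a sharp_cell cset" where
  "sharp C = \<lparr>cells = (\<lambda>m. glue_points C (\<lambda>n. cells (sing (dcube n)) m) // sharp_rel C m),
     act = (\<lambda>k m f X. sharp_rel C k `` ((\<lambda>(n, c, h). (n, c, act (sing (dcube n)) k m f h)) ` X))\<rparr>"

definition sharp_unit :: "'a cset \<Rightarrow> nat \<Rightarrow> 'a \<Rightarrow> 'a sharp_cell" where
  "sharp_unit C n c = sharp_rel C n `` {(n, c, \<lambda>x\<in>cube n. x)}"

definition phi_sharp :: "'a cset \<Rightarrow> nat \<Rightarrow> 'a sharp_cell \<Rightarrow> nat \<Rightarrow> mor \<Rightarrow> 'a sharp_cell" where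
  "phi_sharp C m X = (\<lambda>k. \<lambda>s\<in>cells (sd2_cube m) k.
     sharp_rel C k `` ((\<lambda>(n, c, h). (n, c, compose (cube k) h (sd2_cell k m s))) ` X))"

definition cubcat :: "'a cset \<Rightarrow> bool" where
  "cubcat C \<longleftrightarrow> cubical_set C \<and> (\<exists>\<rho>\<in>chom (sharp C) C. \<exists>\<mu>\<in>chom (ex2 C) C.
     (\<forall>n. \<forall>c\<in>cells C n. \<rho> n (sharp_unit C n c) = c) \<and>
     (\<forall>m. \<forall>X\<in>cells (sharp C) m. \<rho> m X = \<mu> m (ex2_map \<rho> m (phi_sharp C m X))))"


section \<open>The boundary of a cube\<close>

lemma box_id_neutral: "box_hom m n f \<Longrightarrow> compose (grid 1 m) (box_id n) f = f"
  using box_coordinates[of m n f] by (auto simp: compose_def box_id_def PiE_iff extensional_def fun_eq_iff)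

lemma boundary_maximal:
  shows "subpresheaf (representable n) (cells (boundary n))"
    and "cells (boundary n) \<noteq> cells (representable n)"
    and "subpresheaf (representable n) D \<Longrightarrow> D \<noteq> cells (representable n) \<Longrightarrow> D m \<subseteq> cells (boundary n) m"
proof -
  have id: "box_id n \<notin> D n" if D: "subpresheaf (representable n) D" "D \<noteq> cells (representable n)" for D
  proof
    assume i: "box_id n \<in> D n"
    have "f \<in> D m" if "box_hom m n f" for m f
      using D(1) i that box_id_neutral[OF that]
      unfolding subpresheaf_def by (force simp: representable_def)
    then have "D = cells (representable n)"
      using D(1) unfolding subpresheaf_def by (fastforce simp: representable_def)
    then show False using D(2) by blast
  qed
  have cells: "cells (boundary n) =
      (\<lambda>m. \<Union> {D m | D. subpresheaf (representable n) D \<and> D \<noteq> cells (representable n)})"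
    by (simp add: boundary_def)
  show "subpresheaf (representable n) (cells (boundary n))"
    unfolding cells subpresheaf_def by blast
  have "box_id n \<notin> cells (boundary n) n" using id by (auto simp: cells)
  moreover have "box_id n \<in> cells (representable n) n" by (simp add: representable_def box_hom.box_id)
  ultimately show "cells (boundary n) \<noteq> cells (representable n)" by metis
  show "D m \<subseteq> cells (boundary n) m"
    if "subpresheaf (representable n) D" "D \<noteq> cells (representable n)"
    using that by (auto simp: cells)
qed

end

(* A structure map rho : C^# -> C evaluates a cell c of C at monotone maps h of cubes, and mu glues the cells obtained
   after subdivision. A map th from a cube into the realization need not lift to a cell, even locally, because the cells
   may have symmetries. Instead one reparametrizes: if G q is 0 near 0, is 1 near 1, and is locally
   constant at every level at which a coordinate of th q matters (coordinates in degenerate directions do not), then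
   near q the map |G q| (th q) is given by a cell of C evaluated at a monotone map that does not depend on the choice
   of representatives. After sufficiently many subdivisions rho evaluates these local data and mu glues them to a cell
   r(id) of C, constant on the boundary if th is. The system G exists since along a directed path only boundedly many
   levels can be obstructed in decreasing order. Reparametrizing gives th ~ |G|(th), and a path in a larger cube that
   sweeps through its blocks of coordinates one after the other gives |G|(th) ~ |r(id)|: this is surjectivity.
   For injectivity r is independent of G up to homotopy, sends homotopies to homotopies, and returns the class of p
   if th = |p|. *)

theory Submission
 imports Defs
begin

text \<open>Directed homotopies run in one direction only, and the identity is in general not
  comparable with a reparametrization; hence comparisons are zigzags that meet in a pointwise
  maximum, and everything is built from \<open>max\<close>, \<open>min\<close>, averages and ramps,
  which preserve monotonicity. Monotonicity of \<open>G\<close> in its parameter is the obstacle to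
  its construction: along a directed path one may pass from a ramp at one level only to a ramp at a
  lower one. This is why the levels decrease and why a bound on decreasing obstructions is what is
  needed. Whether a coordinate matters is asked only after the coordinates close to 0 or 1 have been
  replaced by faces: at 0 and 1 this makes the answer independent of the representative, and the
  margins 1/3 and 2/3 make the replacement persist nearby. The path through blocks exists because
  \<open>mu\<close> is an arbitrary cubical function: nothing is known about the realization of a
  glued cell at an interior point. Each point of that path, however, lies on a face along which the
  block means vary little, and on such a face \<open>r\<close> is given by \<open>rho\<close>
  without gluing.\<close>

type_synonym vec = "nat => real"
type_synonym gsys = "vec => real => real"
type_synonym 'a rpt = "(nat \<times> 'a \<times> vec) set"


section \<open>Box morphisms in coordinates\<close>

text \<open>A box morphism is encoded by its coordinates: \<open>Inl e\<close> is a constant,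
  \<open>Inr i\<close> the \<open>i\<close>-th variable. Injectivity of the variables excludes
  diagonals; no order is imposed on them, because coordinate permutations are morphisms.\<close>

definition bspec :: "nat => nat => (nat => nat + nat) => bool" where
 "bspec k n ph \<longleftrightarrow> (ALL j<n. case ph j of Inl e => e \<le> 1 | Inr i => i < k) \<and>
  (ALL j<n. ALL j'<n. ALL i. ph j = Inr i --> ph j' = Inr i --> j = j')"

definition bmap :: "nat => nat => (nat => nat + nat) => mor" where
 "bmap k n ph = (\<lambda>x\<in>grid 1 k. \<lambda>j\<in>{..<n}. case ph j of Inl e => e | Inr i => x i)"

definition lmap :: "nat => nat => (nat => nat + nat) => vec => nat => real" where
 "lmap k n ph = (\<lambda>x\<in>cube k. \<lambda>j\<in>{..<n}. case ph j of Inl e => real e | Inr i => x i)"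

abbreviation scomp :: "(nat => nat + nat) => (nat => nat + nat) => nat => nat + nat" where
 "scomp ps ph \<equiv> (\<lambda>j. case ps j of Inl e => Inl e | Inr i => ph i)"

lemma bspecI:
 assumes "\<And>j e. j < n ==> ph j = Inl e ==> e \<le> 1" "\<And>j i. j < n ==> ph j = Inr i ==> i < k"
  "\<And>j j' i. j < n ==> j' < n ==> ph j = Inr i ==> ph j' = Inr i ==> j = j'"
 shows "bspec k n ph"
 using assms unfolding bspec_def by (auto split: sum.splits)

lemma bspecD:
 assumes "bspec k n ph"
 shows "j < n ==> ph j = Inl e ==> e \<le> 1" "j < n ==> ph j = Inr i ==> i < k"
  "j < n ==> j' < n ==> ph j = Inr i ==> ph j' = Inr i ==> j = j'"
proof -
 have a: "ALL j<n. case ph j of Inl e => e \<le> 1 | Inr i => i < k"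
  and b: "ALL j<n. ALL j'<n. ALL i. ph j = Inr i --> ph j' = Inr i --> j = j'"
  using assms unfolding bspec_def by (rule conjunct1, rule conjunct2)
 show "e \<le> 1" if "j < n" "ph j = Inl e" using a[rule_format, OF that(1)] that(2) by simp
 show "i < k" if "j < n" "ph j = Inr i" using a[rule_format, OF that(1)] that(2) by simp
 show "j = j'" if "j < n" "j' < n" "ph j = Inr i" "ph j' = Inr i" using b that by blast
qed

lemma grid_bound: "x : grid k n ==> i < n ==> x i \<le> k"
 using PiE_mem[of x "{..<n}" "\<lambda>_. {0..k}" i] by (simp add: grid_def)

lemma bmap_grid:
 assumes "bspec k n ph" "x : grid 1 k"
 shows "bmap k n ph x : grid 1 n"
proof -
 have "(case ph j of Inl e => e | Inr i => x i) \<le> 1" if "j < n" for j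
 proof (cases "ph j")
  case (Inl e)
  thus ?thesis using bspecD(1)[OF assms(1) that] by simp
 next
  case (Inr i)
  thus ?thesis using bspecD(2)[OF assms(1) that] grid_bound[OF assms(2)] by simp
 qed
 thus ?thesis using assms(2) by (auto simp: bmap_def grid_def)
qed

lemma cube_coord: "x : cube n ==> i < n ==> 0 \<le> x i \<and> x i \<le> 1"
 using PiE_mem[of x "{..<n}" "\<lambda>_. {0..1}" i] by (simp add: cube_def)

lemma lmap_cube:
 assumes "bspec k n ph" "x : cube k"
 shows "lmap k n ph x : cube n"
proof -
 have "(case ph j of Inl e => real e | Inr i => x i) : {0..1}" if "j < n" for j
 proof (cases "ph j")
  case (Inl e)
  thus ?thesis using bspecD(1)[OF assms(1) that] by simp
 next
  case (Inr i)
  thus ?thesis using bspecD(2)[OF assms(1) that] cube_coord[OF assms(2)] by simp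
 qed
 thus ?thesis using assms(2) by (auto simp: lmap_def cube_def)
qed

lemma bmap_comp:
 assumes "bspec l m ph" "bspec m n ps"
 shows "compose (grid 1 l) (bmap m n ps) (bmap l m ph) = bmap l n (scomp ps ph)"
proof (intro ext)
 fix x j
 show "compose (grid 1 l) (bmap m n ps) (bmap l m ph) x j = bmap l n (scomp ps ph) x j"
 proof (cases "x : grid 1 l \<and> j < n")
  case True
  hence x: "x : grid 1 l" and j: "j < n" by auto
  note g = bmap_grid[OF assms(1) x]
  show ?thesis
  proof (cases "ps j")
   case (Inl e)
   thus ?thesis using x j g by (simp add: compose_eq bmap_def[of m n] bmap_def[of l n])
  next
   case (Inr i)
   hence "i < m" using bspecD(2)[OF assms(2) j] by simp
   thus ?thesis using x j g Inr
    by (simp add: compose_eq bmap_def[of m n] bmap_def[of l n]) (simp add: bmap_def)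
  qed
 next
  case False
  thus ?thesis using bmap_grid[OF assms(1), of x] by (auto simp: compose_def bmap_def[of m n] bmap_def[of l n])
 qed
qed

lemma bspec_comp:
 assumes "bspec l m ph" "bspec m n ps"
 shows "bspec l n (scomp ps ph)"
proof (rule bspecI)
 fix j j' i assume j: "j < n" "j' < n" "scomp ps ph j = Inr i" "scomp ps ph j' = Inr i"
 then obtain a b where ab: "ps j = Inr a" "ps j' = Inr b" "ph a = Inr i" "ph b = Inr i"
  by (auto split: sum.splits)
 hence "a = b" using bspecD(2)[OF assms(2)] bspecD(3)[OF assms(1)] j by blast
 thus "j = j'" using bspecD(3)[OF assms(2)] j ab by blast
next
 fix j e assume j: "j < n" "scomp ps ph j = Inl e"
 show "e \<le> 1"
 proof (cases "ps j")
  case (Inl a)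
  thus ?thesis using j bspecD(1)[OF assms(2) j(1)] by simp
 next
  case (Inr i)
  thus ?thesis using j bspecD(1)[OF assms(1)] bspecD(2)[OF assms(2) j(1) Inr] by simp
 qed
next
 fix j i assume j: "j < n" "scomp ps ph j = Inr i"
 then obtain a where "ps j = Inr a" "ph a = Inr i" by (cases "ps j") auto
 thus "i < l" using bspecD(2)[OF assms(2) j(1)] bspecD(2)[OF assms(1)] by blast
qed

text \<open>Induction on the sum of the dimensions: a constant coordinate splits off a coface, a
  variable that does not occur splits off a codegeneracy, and when neither exists the variables are
  merely permuted.\<close>

lemma box_bmap:
 assumes "bspec k n ph"
 shows "box_hom k n (bmap k n ph)"
 using assms
proof (induction "k + n" arbitrary: k n ph rule: less_induct)
 case less
 note S = bspecD[OF less.prems]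
 show ?case
 proof (cases "EX j<n. EX e. ph j = Inl e")
  case True
  then obtain j e where j: "j < n" "ph j = Inl e" by blast
  then obtain n' where n: "n = Suc n'" by (cases n) auto
  define ph' where "ph' = (\<lambda>i. ph (if i < j then i else Suc i))"
  have b: "bspec k n' ph'"
  proof (rule bspecI)
   fix a a' i assume "a < n'" "a' < n'" "ph' a = Inr i" "ph' a' = Inr i"
   hence "(if a < j then a else Suc a) = (if a' < j then a' else Suc a')"
    using S(3)[of "if a < j then a else Suc a" "if a' < j then a' else Suc a'" i] n
    by (auto simp: ph'_def split: if_splits)
   thus "a = a'" by (auto split: if_splits)
  next
   fix a e assume "a < n'" "ph' a = Inl e"
   thus "e \<le> 1" using S(1)[of "if a < j then a else Suc a" e] n by (auto simp: ph'_def)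
  next
   fix a i assume "a < n'" "ph' a = Inr i"
   thus "i < k" using S(2)[of "if a < j then a else Suc a" i] n by (auto simp: ph'_def)
  qed
  have "bmap k n ph = compose (grid 1 k) (coface n' j e) (bmap k n' ph')"
  proof (intro ext)
   fix x a
   show "bmap k n ph x a = compose (grid 1 k) (coface n' j e) (bmap k n' ph') x a"
   proof (cases "x : grid 1 k \<and> a < n")
    case True
    have g: "bmap k n' ph' x : grid 1 n'" using bmap_grid[OF b] True by blast
    consider "a < j" | "a = j" | "a > j" by linarith
    thus ?thesis
    proof cases
     case 1
     thus ?thesis using True g j n by (auto simp: compose_def coface_def bmap_def ph'_def)
    next
     case 2
     thus ?thesis using True g j n by (auto simp: compose_def coface_def bmap_def)
    next
     case 3
     then obtain a' where "a = Suc a'" by (cases a) auto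
     thus ?thesis using 3 True g j n by (auto simp: compose_def coface_def bmap_def ph'_def)
    qed
   next
    case False
    thus ?thesis using bmap_grid[OF b, of x] n by (auto simp: compose_def coface_def bmap_def)
   qed
  qed
  moreover have "box_hom k n' (bmap k n' ph')" using less.hyps[OF _ b] n by simp
  moreover have "box_hom n' n (coface n' j e)" unfolding n using S(1)[OF j] j(1) n by (intro box_coface) auto
  ultimately show ?thesis using box_compose by metis
 next
  case False
  define io where "io = (\<lambda>j. case ph j of Inl e => 0 | Inr i => i)"
  have io: "ph j = Inr (io j)" if "j < n" for j
   using False that by (auto simp: io_def split: sum.splits)
  have lt: "io j < k" if "j < n" for j using S(2)[OF that io[OF that]] .
  have inj: "inj_on io {..<n}" using S(3) io by (auto intro!: inj_onI)
  show ?thesis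
  proof (cases "k = n")
   case True
   define p where "p = (\<lambda>j. if j < n then io j else j)"
   have "inj_on p {..<n}" using inj by (auto simp: p_def inj_on_def)
   moreover have "p ` {..<n} \<subseteq> {..<n}" using lt True by (auto simp: p_def)
   ultimately have "bij_betw p {..<n} {..<n}"
    by (simp add: bij_betw_def endo_inj_surj)
   hence "p permutes {..<n}" by (intro bij_imp_permutes) (auto simp: p_def)
   hence "box_hom n n (coperm n p)" by (rule box_coperm)
   moreover have "coperm n p = bmap k n ph" unfolding True
    by (auto simp: coperm_def bmap_def p_def io intro!: restrict_ext)
   ultimately show ?thesis using True by simp
  next
   case False
   have "n \<le> k" using card_inj_on_le[OF inj, of "{..<k}"] lt by auto
   hence nk: "n < k" using False by simp
   have "EX i<k. i \<notin> io ` {..<n}"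
   proof (rule ccontr)
    assume "\<not> ?thesis"
    hence "{..<k} \<subseteq> io ` {..<n}" by auto
    hence "k \<le> n" using surj_card_le[of "{..<n}" "{..<k}" io] by simp
    thus False using nk by simp
   qed
   then obtain i where i: "i < k" "\<And>j. j < n ==> io j \<noteq> i" by blast
   then obtain k' where k: "k = Suc k'" by (cases k) auto
   define ph' where "ph' = (\<lambda>j. Inr (if io j < i then io j else io j - 1) :: nat + nat)"
   have b: "bspec k' n ph'"
   proof (rule bspecI)
    fix a a' l assume a: "a < n" "a' < n" "ph' a = Inr l" "ph' a' = Inr l"
    hence "io a = io a'" using i(2)[OF a(1)] i(2)[OF a(2)] by (auto simp: ph'_def split: if_splits)
    thus "a = a'" using inj a by (auto dest: inj_onD)
   next
    fix a l assume a: "a < n" "ph' a = Inr l"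
    thus "l < k'" using i(1) i(2)[OF a(1)] lt[OF a(1)] k by (auto simp: ph'_def split: if_splits)
   qed (auto simp: ph'_def)
   have "bmap k n ph = compose (grid 1 k) (bmap k' n ph') (codegen k' i)"
   proof (intro ext)
    fix x a
    show "bmap k n ph x a = compose (grid 1 k) (bmap k' n ph') (codegen k' i) x a"
    proof (cases "x : grid 1 k \<and> a < n")
     case True
     have i': "i \<le> k'" using i(1) k by simp
     have g: "codegen k' i x : grid 1 k'"
      using box_coordinates[OF box_codegen[OF i']] True k by (auto dest: PiE_mem)
     show ?thesis using True g i(2)[of a] lt[of a] io[of a] k i(1)
      by (auto simp: compose_def codegen_def bmap_def ph'_def)
    next
     case False
     thus ?thesis using box_coordinates[OF box_codegen[of i k']] i(1) k
      by (auto simp: compose_def bmap_def dest: PiE_mem)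
    qed
   qed
   moreover have "box_hom k' n (bmap k' n ph')" using less.hyps[OF _ b] k by simp
   moreover have "box_hom k k' (codegen k' i)" unfolding k using i(1) k by (intro box_hom.box_codegen) auto
   ultimately show ?thesis using box_compose by metis
  qed
 qed
qed

lemma box_spec:
 assumes "box_hom k n f"
 shows "EX ph. bspec k n ph \<and> f = bmap k n ph"
 using assms
proof induction
 case (box_id n)
 have "bmap n n Inr = box_id n"
  by (auto simp: bmap_def box_id_def grid_def extensional_def PiE_iff intro!: restrict_ext ext)
 thus ?case by (intro exI[of _ Inr]) (auto intro: bspecI)
next
 case (box_coface i n e)
 let ?ph = "\<lambda>j. if j < i then Inr j else if j = i then Inl e else Inr (j - 1)"
 have "bspec n (Suc n) ?ph" using box_coface by (intro bspecI) (auto split: if_splits)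
 moreover have "coface n i e = bmap n (Suc n) ?ph" by (auto simp: bmap_def coface_def intro!: restrict_ext)
 ultimately show ?case by blast
next
 case (box_codegen i n)
 let ?ph = "\<lambda>j. Inr (if j < i then j else Suc j)"
 have "bspec (Suc n) n ?ph" using box_codegen by (intro bspecI) (auto split: if_splits)
 moreover have "codegen n i = bmap (Suc n) n ?ph" by (auto simp: bmap_def codegen_def intro!: restrict_ext)
 ultimately show ?case by blast
next
 case (box_coperm p n)
 let ?ph = "\<lambda>j. Inr (p j)"
 have "bspec n n ?ph" using permutes_in_image[OF box_coperm] permutes_inj[OF box_coperm]
  by (intro bspecI) (auto dest: injD)
 moreover have "coperm n p = bmap n n ?ph" by (auto simp: bmap_def coperm_def intro!: restrict_ext)
 ultimately show ?case by blast
next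
 case (box_compose l m f n g)
 thus ?case using bmap_comp bspec_comp by metis
qed

lemma linear_ext_bmap:
 assumes "bspec k n ph"
 shows "linear_ext k n (bmap k n ph) = lmap k n ph"
proof (intro ext)
 fix x j
 show "linear_ext k n (bmap k n ph) x j = lmap k n ph x j"
 proof (cases "x : cube k \<and> j < n")
  case True
  hence x: "x : cube k" and j: "j < n" by auto
  show ?thesis
  proof (cases "ph j")
   case (Inl e)
   hence "linear_ext k n (bmap k n ph) x j = real e"
    by (intro linear_ext_const[OF x j]) (simp add: bmap_def j)
   thus ?thesis using Inl x j by (simp add: lmap_def)
  next
   case (Inr i)
   hence "linear_ext k n (bmap k n ph) x j = x i"
    using bspecD(2)[OF assms j Inr] by (intro linear_ext_var[OF x j]) (simp_all add: bmap_def j)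
   thus ?thesis using Inr x j by (simp add: lmap_def)
  qed
 next
  case False
  thus ?thesis by (auto simp: linear_ext_def lmap_def)
 qed
qed

lemma cube_undef: "x : cube n ==> \<not> i < n ==> x i = undefined"
 by (auto simp: cube_def PiE_iff extensional_def)

lemma cube_eqI: "x : cube n ==> y : cube n ==> (\<And>i. i < n ==> x i = y i) ==> x = y"
 by (rule ext) (metis cube_undef)

lemma cube_restrictI: "(\<And>i. i < n ==> 0 \<le> f i \<and> f i \<le> 1) ==> (\<lambda>i\<in>{..<n}. f i) : cube n"
 by (auto simp: cube_def)

lemma lmap_id: "x : cube n ==> lmap n n Inr x = x"
 by (rule cube_eqI[of _ n]) (auto simp: lmap_def intro: cube_restrictI dest: cube_coord)

section \<open>Topology and order of cubes\<close>

text \<open>Balls of the maximum metric are chosen because they are order-convex: with two points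
  they contain the order interval between them.\<close>

definition cb :: "nat => vec => real => vec set" where
 "cb n x e = {y : cube n. ALL i<n. \<bar>y i - x i\<bar> < e}"

definition le :: "nat => vec => vec => bool" where
 "le n x y \<longleftrightarrow> (ALL i<n. x i \<le> y i)"

lemma leI: "(\<And>i. i < n ==> x i \<le> y i) ==> le n x y"
 by (simp add: le_def)

lemma leD: "le n x y ==> i < n ==> x i \<le> y i"
 by (simp add: le_def)

lemma le_refl: "le n x x"
 by (simp add: le_def)

lemma le_trans: "le n x y ==> le n y z ==> le n x z"
 by (force simp: le_def)

definition ivl :: "nat => vec => vec => vec set" where
 "ivl n x y = {z : cube n. le n x z \<and> le n z y}"

lemma topspace_cube: "topspace (cube_topology n) = cube n"
 by (simp add: cube_topology_def cube_def)

lemma cb_cube: "cb n x e \<subseteq> cube n"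
 by (auto simp: cb_def)

lemma cube_iff: "x : cube n \<longleftrightarrow> (ALL i<n. 0 \<le> x i \<and> x i \<le> 1) \<and> x : extensional {..<n}"
 by (simp add: cube_def PiE_iff Ball_def)

lemma cb_mono: "d \<le> e ==> cb n x d \<subseteq> cb n x e"
 by (force simp: cb_def)

lemma cb_self: "x : cube n ==> e > 0 ==> x : cb n x e"
 by (simp add: cb_def)

lemma cb_ivl:
 assumes "x : cb n z e" "y : cb n z e"
 shows "ivl n x y \<subseteq> cb n z e"
proof
 fix w assume w: "w : ivl n x y"
 have "\<bar>w i - z i\<bar> < e" if "i < n" for i
 proof -
  have "\<bar>x i - z i\<bar> < e" "\<bar>y i - z i\<bar> < e" "x i \<le> w i" "w i \<le> y i"
   using assms w that by (auto simp: cb_def ivl_def le_def)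
  thus ?thesis by linarith
 qed
 thus "w : cb n z e" using w by (simp add: cb_def ivl_def)
qed

lemma openin_cube:
 "openin (cube_topology n) U \<longleftrightarrow> U \<subseteq> cube n \<and> (ALL x:U. EX e>0. cb n x e \<subseteq> U)"
proof (intro iffI conjI ballI)
 assume U: "openin (cube_topology n) U"
 thus "U \<subseteq> cube n" using openin_subset topspace_cube by metis
 fix x assume "x : U"
 then obtain V where V: "\<And>i. i < n ==> openin (top_of_set {0..1}) (V i)" "x : Pi\<^sub>E {..<n} V" "Pi\<^sub>E {..<n} V \<subseteq> U"
  using U unfolding cube_topology_def openin_product_topology_alt by (metis lessThan_iff)
 have "EX e>0. ALL t:{0..1}. \<bar>t - x i\<bar> < e --> t : V i" if i: "i < n" for i
 proof -
  have xi: "x i : V i" using V(2) i by (auto simp: PiE_iff)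
  obtain e where "e > 0" "\<And>t. t : {0..1} ==> dist t (x i) < e ==> t : V i"
   using V(1)[OF i] xi unfolding openin_euclidean_subtopology_iff by metis
  thus ?thesis unfolding dist_real_def by blast
 qed
 then obtain e where e: "\<And>i. i < n ==> e i > (0::real)"
   "\<And>i t. i < n ==> t : {0..1} ==> \<bar>t - x i\<bar> < e i ==> t : V i" by metis
 define d where "d = Min (insert 1 (e ` {..<n}))"
 have d: "d > 0" unfolding d_def using e(1) by (subst Min_gr_iff) auto
 have de: "d \<le> e i" if "i < n" for i unfolding d_def using that by (intro Min_le) auto
 have "cb n x d \<subseteq> Pi\<^sub>E {..<n} V"
 proof
  fix y assume y: "y : cb n x d"
  hence "y : cube n" by (simp add: cb_def)
  have "y i : V i" if "i < n" for i
   using e(2)[OF that, of "y i"] y de[OF that] cube_coord[OF \<open>y : cube n\<close> that] that by (force simp: cb_def)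
  thus "y : Pi\<^sub>E {..<n} V" using \<open>y : cube n\<close> by (auto simp: cube_def PiE_iff)
 qed
 thus "EX e>0. cb n x e \<subseteq> U" using d V(3) by blast
next
 assume U: "U \<subseteq> cube n \<and> (ALL x:U. EX e>0. cb n x e \<subseteq> U)"
 show "openin (cube_topology n) U"
  unfolding cube_topology_def openin_product_topology_alt
 proof
  fix x assume x: "x : U"
  then obtain e where e: "e > 0" "cb n x e \<subseteq> U" using U by blast
  define V where "V = (\<lambda>i. {0..1} \<inter> ball (x i) e)"
  have "Pi\<^sub>E {..<n} V \<subseteq> cb n x e"
  proof
   fix y assume y: "y : Pi\<^sub>E {..<n} V"
   hence "y : cube n" unfolding cube_def PiE_iff V_def by simp
   moreover have "\<bar>y i - x i\<bar> < e" if "i < n" for i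
    using y that unfolding PiE_iff V_def by (simp add: dist_real_def abs_minus_commute)
   ultimately show "y : cb n x e" by (simp add: cb_def)
  qed
  moreover have "x : Pi\<^sub>E {..<n} V" using x U e(1) by (auto simp: V_def cube_def PiE_iff)
  moreover have "openin (top_of_set {0..1}) (V i)" for i by (simp add: V_def openin_open_Int)
  ultimately show "EX V. finite {i : {..<n}. V i \<noteq> topspace (top_of_set {0..1})} \<and>
    (ALL i:{..<n}. openin (top_of_set {0..1}) (V i)) \<and> x : Pi\<^sub>E {..<n} V \<and> Pi\<^sub>E {..<n} V \<subseteq> U"
   using e(2) by (intro exI[of _ V]) auto
 qed
qed

lemma openin_cubeD: "openin (cube_topology n) U ==> x : U ==> EX e>0. cb n x e \<subseteq> U"
 by (simp add: openin_cube)

lemma openin_cb: "openin (cube_topology n) (cb n x e)"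
 unfolding openin_cube
proof (intro conjI ballI cb_cube)
 fix y assume y: "y : cb n x e"
 define d where "d = Min (insert 1 ((\<lambda>i. e - \<bar>y i - x i\<bar>) ` {..<n}))"
 have d: "d > 0" unfolding d_def using y by (subst Min_gr_iff) (auto simp: cb_def)
 have de: "d \<le> e - \<bar>y i - x i\<bar>" if "i < n" for i unfolding d_def using that by (intro Min_le) auto
 have "cb n y d \<subseteq> cb n x e" using de by (force simp: cb_def)
 thus "EX e'>0. cb n y e' \<subseteq> cb n x e" using d by blast
qed

lemma compact_space_cube: "compact_space (cube_topology n)"
 unfolding cube_topology_def
 by (intro compact_space_product_topology[THEN iffD2] disjI2 ballI) (simp add: compact_space_subtopology compactin_euclidean_iff)

text \<open>Compactness in the form of an induction principle. The properties it is used for mostly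
  assert that some bound exists, so that a union needs only the smaller, the larger or the sum of
  two bounds.\<close>

lemma cube_compact_induct:
 assumes local: "\<And>x. x : cube n ==> EX e>0. R (cb n x e)"
  and sub: "\<And>S T. R S ==> T \<subseteq> S ==> R T"
  and un: "\<And>S T. R S ==> R T ==> R (S \<union> T)"
  and empty: "R {}"
 shows "R (cube n)"
proof -
 obtain e where e: "\<And>x. x : cube n ==> e x > 0" "\<And>x. x : cube n ==> R (cb n x (e x))"
  using local by metis
 let ?\<U> = "(\<lambda>x. cb n x (e x)) ` cube n"
 have "cube n \<subseteq> \<Union> ?\<U>" using cb_self e(1) by blast
 moreover have "ALL U:?\<U>. openin (cube_topology n) U" using openin_cb by blast
 ultimately obtain \<F> where \<F>: "finite \<F>" "\<F> \<subseteq> ?\<U>" "cube n \<subseteq> \<Union> \<F>"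
  using compact_space_cube[of n] unfolding compact_space_alt topspace_cube by meson
 have "R (\<Union> \<F>)" using \<F>(1,2)
 proof (induction \<F>)
  case empty
  thus ?case using assms(4) by simp
 next
  case (insert U \<F>)
  thus ?case using un[of U "\<Union> \<F>"] e(2) by auto
 qed
 thus ?thesis using sub \<F>(3) by blast
qed

text \<open>The Lebesgue number of a cover: half of an admissible radius at \<open>x\<close> is
  admissible at all centres within that half radius of \<open>x\<close>, and compactness leaves
  finitely many radii.\<close>

lemma cube_lebesgue:
 assumes local: "\<And>x. x : cube n ==> EX e>0. R (cb n x e)"
  and sub: "\<And>S T. R S ==> T \<subseteq> S ==> R T"
 shows "EX d>0. ALL x:cube n. R (cb n x d)"
proof -
 have "EX d>0. ALL x:cube n \<inter> cube n. R (cb n x d)"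
 proof (rule cube_compact_induct[where R = "\<lambda>S. EX d>0. ALL x:S \<inter> cube n. R (cb n x d)"])
  fix x assume x: "x : cube n"
  then obtain e where e: "e > 0" "R (cb n x e)" using local by blast
  have "cb n y (e/2) \<subseteq> cb n x e" if y: "y : cb n x (e/2)" for y
  proof
   fix z assume z: "z : cb n y (e/2)"
   have "\<bar>z i - x i\<bar> < e" if "i < n" for i
   proof -
    have "\<bar>z i - y i\<bar> < e/2" "\<bar>y i - x i\<bar> < e/2" using y z that by (auto simp: cb_def)
    thus ?thesis by linarith
   qed
   thus "z : cb n x e" using z by (simp add: cb_def)
  qed
  hence "R (cb n y (e/2))" if "y : cb n x (e/2)" for y using sub[OF e(2)] that by blast
  thus "EX d>0. EX d'>0. ALL y:cb n x d \<inter> cube n. R (cb n y d')"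
   using e(1) by (intro exI[of _ "e/2"] conjI) auto
 next
  fix S T assume "EX d>0. ALL x:S \<inter> cube n. R (cb n x d)" "EX d>0. ALL x:T \<inter> cube n. R (cb n x d)"
  then obtain d d' where "d > 0" "d' > 0" and d: "\<And>x. x : S \<inter> cube n ==> R (cb n x d)"
   and d': "\<And>x. x : T \<inter> cube n ==> R (cb n x d')" by blast
  thus "EX d>0. ALL x:(S \<union> T) \<inter> cube n. R (cb n x d)"
   using sub[OF _ cb_mono] by (intro exI[of _ "min d d'"] conjI ballI) (auto intro: sub[OF d cb_mono] sub[OF d' cb_mono])
 qed (use zero_less_one in blast)+
 thus ?thesis by simp
qed

subsection \<open>Monotone continuous functions\<close>

definition cmono :: "nat => (vec => real) => bool" where
 "cmono k g \<longleftrightarrow> continuous_map (cube_topology k) euclideanreal g \<and>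
  (ALL x:cube k. ALL y:cube k. le k x y --> g x \<le> g y) \<and> (ALL x:cube k. 0 \<le> g x \<and> g x \<le> 1)"

definition cmap :: "nat => nat => (vec => nat => real) => bool" where
 "cmap k n f \<longleftrightarrow> (ALL x:cube k. f x : cube n) \<and> (ALL i<n. cmono k (\<lambda>x. f x i))"

lemma continuous_cube_iff:
 "continuous_map (cube_topology k) euclideanreal g \<longleftrightarrow>
  (ALL x:cube k. ALL e>0. EX d>0. ALL y:cb k x d. \<bar>g y - g x\<bar> < e)"
proof
 assume g: "continuous_map (cube_topology k) euclideanreal g"
 show "ALL x:cube k. ALL e>0. EX d>0. ALL y:cb k x d. \<bar>g y - g x\<bar> < e"
 proof (intro ballI allI impI)
  fix x and e :: real assume x: "x : cube k" and e: "e > 0"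
  have o: "openin (cube_topology k) {y : topspace (cube_topology k). g y : ball (g x) e}"
   using g open_ball[of "g x" e] unfolding continuous_map_def open_openin[symmetric] by blast
  have m: "x : {y : topspace (cube_topology k). g y : ball (g x) e}"
   using x e by (simp add: topspace_cube)
  obtain d where "d > 0" "cb k x d \<subseteq> {y : topspace (cube_topology k). g y : ball (g x) e}"
   using openin_cubeD[OF o m] by blast
  moreover have "\<bar>g y - g x\<bar> < e" if "g y : ball (g x) e" for y
   using that by (simp add: dist_commute[of "g x"] dist_real_def)
  ultimately show "EX d>0. ALL y:cb k x d. \<bar>g y - g x\<bar> < e" by blast
 qed
next
 assume R: "ALL x:cube k. ALL e>0. EX d>0. ALL y:cb k x d. \<bar>g y - g x\<bar> < e"
 show "continuous_map (cube_topology k) euclideanreal g"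
  unfolding continuous_map_def
 proof (intro conjI allI impI)
  fix U assume "openin euclideanreal U"
  hence U: "open U" using open_openin by blast
  show "openin (cube_topology k) {x : topspace (cube_topology k). g x : U}"
   unfolding openin_cube topspace_cube
  proof (intro conjI ballI)
   fix x assume "x : {x : cube k. g x : U}"
   hence x: "x : cube k" "g x : U" by auto
   obtain e where e: "e > 0" "ball (g x) e \<subseteq> U" using openE[OF U x(2)] by blast
   obtain d where "d > 0" "ALL y:cb k x d. \<bar>g y - g x\<bar> < e" using R x(1) e(1) by blast
   moreover have "g y : U" if "\<bar>g y - g x\<bar> < e" for y
    using that e(2) by (auto simp: dist_commute[of "g x"] dist_real_def)
   ultimately show "EX e>0. cb k x e \<subseteq> {x : cube k. g x : U}"
    using cb_cube by (intro exI[of _ d]) blast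
  qed auto
 qed simp
qed

lemma cmonoD:
 assumes "cmono k g"
 shows "x : cube k ==> y : cube k ==> le k x y ==> g x \<le> g y" "x : cube k ==> 0 \<le> g x"
  "x : cube k ==> g x \<le> 1" "x : cube k ==> e > 0 ==> EX d>0. ALL y:cb k x d. \<bar>g y - g x\<bar> < e"
 using assms unfolding cmono_def continuous_cube_iff by blast+

lemma cmono_cong: "(\<And>x. x : cube k ==> f x = g x) ==> cmono k f \<longleftrightarrow> cmono k g"
 unfolding cmono_def using continuous_map_eq[of "cube_topology k" euclideanreal f g]
  continuous_map_eq[of "cube_topology k" euclideanreal g f] by (auto simp: topspace_cube)

lemma cmono_const: "0 \<le> c ==> c \<le> 1 ==> cmono k (\<lambda>_. c)"
 by (simp add: cmono_def)

lemma cmono_coord: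
 assumes "i < k"
 shows "cmono k (\<lambda>x. x i)"
proof -
 have "EX d>0. ALL y:cb k x d. \<bar>y i - x i\<bar> < e" if "e > 0" for x and e :: real
  using assms that by (intro exI[of _ e]) (auto simp: cb_def)
 thus ?thesis using assms cube_coord by (auto simp: cmono_def continuous_cube_iff le_def)
qed

lemma cmono_max: "cmono k f ==> cmono k g ==> cmono k (\<lambda>x. max (f x) (g x))"
 unfolding cmono_def by (auto intro!: continuous_map_real_max simp: max.coboundedI1 max.coboundedI2)

lemma cmono_min: "cmono k f ==> cmono k g ==> cmono k (\<lambda>x. min (f x) (g x))"
 unfolding cmono_def by (auto intro!: continuous_map_real_min simp: min.coboundedI1 min.coboundedI2)

lemma cmono_ramp:
 assumes "cmono k f" "0 \<le> c"
 shows "cmono k (\<lambda>x. min 1 (max 0 (c * f x - b)))"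
proof -
 have "continuous_map (cube_topology k) euclideanreal (\<lambda>x. min 1 (max 0 (c * f x - b)))"
  using assms(1) unfolding cmono_def
  by (intro continuous_map_real_min continuous_map_real_max continuous_map_diff continuous_map_real_mult) auto
 moreover have "min 1 (max 0 (c * f x - b)) \<le> min 1 (max 0 (c * f y - b))"
  if "x : cube k" "y : cube k" "le k x y" for x y
  using mult_left_mono[OF cmonoD(1)[OF assms(1) that] assms(2)] by linarith
 ultimately show ?thesis by (simp add: cmono_def)
qed

lemma cmapD:
 assumes "cmap k n f"
 shows "x : cube k ==> f x : cube n" "i < n ==> cmono k (\<lambda>x. f x i)"
  "x : cube k ==> y : cube k ==> le k x y ==> le n (f x) (f y)"
proof -
 show f: "f x : cube n" if "x : cube k" for x using assms that by (simp add: cmap_def)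
 show c: "cmono k (\<lambda>x. f x i)" if "i < n" for i using assms that by (simp add: cmap_def)
 show "le n (f x) (f y)" if "x : cube k" "y : cube k" "le k x y" using cmonoD(1)[OF c that] by (intro leI)
qed

lemma cmap_cont:
 assumes f: "cmap k n f" and x: "x : cube k" and e: "e > 0"
 shows "EX d>0. ALL y:cb k x d. f y : cb n (f x) e"
proof -
 obtain d where d: "\<And>i. i < n ==> d i > 0" "\<And>i y. i < n ==> y : cb k x (d i) ==> \<bar>f y i - f x i\<bar> < e"
  using cmonoD(4)[OF cmapD(2)[OF f] x e] by metis
 define c where "c = Min (insert 1 (d ` {..<n}))"
 have c: "c > 0" unfolding c_def using d(1) by (subst Min_gr_iff) auto
 have cd: "c \<le> d i" if "i < n" for i unfolding c_def using that by (intro Min_le) auto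
 have "f y : cb n (f x) e" if y: "y : cb k x c" for y
 proof -
  have "\<bar>f y i - f x i\<bar> < e" if "i < n" for i
   using d(2)[OF that] subsetD[OF cb_mono[OF cd[OF that]] y] by blast
  moreover have "f y : cube n" using cmapD(1)[OF f] subsetD[OF cb_cube y] by blast
  ultimately show ?thesis by (simp add: cb_def)
 qed
 thus ?thesis using c by blast
qed

lemma cmap_vimage_open:
 assumes f: "cmap k n f" and U: "openin (cube_topology n) U"
 shows "openin (cube_topology k) {x : cube k. f x : U}"
 unfolding openin_cube
proof (intro conjI ballI)
 fix x assume "x : {x : cube k. f x : U}"
 hence x: "x : cube k" "f x : U" by auto
 obtain e where e: "e > 0" "cb n (f x) e \<subseteq> U" using openin_cubeD[OF U x(2)] by blast
 obtain d where "d > 0" "ALL y:cb k x d. f y : cb n (f x) e" using cmap_cont[OF f x(1) e(1)] by blast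
 thus "EX e>0. cb k x e \<subseteq> {x : cube k. f x : U}" using e(2) cb_cube by (intro exI[of _ d]) blast
qed auto

lemma cmono_comp:
 assumes "cmono n g" "cmap k n f"
 shows "cmono k (\<lambda>x. g (f x))"
 unfolding cmono_def continuous_cube_iff
proof (intro conjI ballI impI allI)
 fix x and e :: real assume x: "x : cube k" and "e > 0"
 then obtain d where "d > 0" and d: "ALL y:cb n (f x) d. \<bar>g y - g (f x)\<bar> < e"
  using cmonoD(4)[OF assms(1) cmapD(1)[OF assms(2)]] by blast
 thus "EX d>0. ALL y:cb k x d. \<bar>g (f y) - g (f x)\<bar> < e"
  using cmap_cont[OF assms(2) x \<open>d > 0\<close>] by blast
qed (use cmonoD[OF assms(1)] cmapD[OF assms(2)] in auto)

lemma cmapI: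
 assumes "\<And>i. i < n ==> cmono k (\<lambda>x. f x i)" "\<And>x. x : cube k ==> f x : extensional {..<n}"
 shows "cmap k n f"
proof -
 have "f x : cube n" if "x : cube k" for x
  unfolding cube_iff using cmonoD(2,3)[OF assms(1) that] assms(2)[OF that] by blast
 thus ?thesis using assms(1) by (simp add: cmap_def)
qed

lemma cmap_cong: "(\<And>x. x : cube k ==> f x = g x) ==> cmap k n f \<longleftrightarrow> cmap k n g"
proof -
 assume fg: "\<And>x. x : cube k ==> f x = g x"
 have "cmono k (\<lambda>x. f x i) \<longleftrightarrow> cmono k (\<lambda>x. g x i)" for i by (rule cmono_cong) (simp add: fg)
 thus ?thesis by (simp add: cmap_def fg)
qed

lemma cmap_comp:
 assumes g: "cmap m n g" and f: "cmap k m f"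
 shows "cmap k n (\<lambda>x. g (f x))"
 unfolding cmap_def
proof (intro conjI ballI allI impI)
 show "g (f x) : cube n" if "x : cube k" for x using cmapD(1)[OF g] cmapD(1)[OF f that] .
 show "cmono k (\<lambda>x. g (f x) i)" if "i < n" for i using cmono_comp[OF cmapD(2)[OF g that] f] .
qed

lemma cmap_id: "cmap n n (\<lambda>x. x)"
 by (simp add: cmap_def cmono_coord)

lemma cmap_restrictI: "(\<And>i. i < n ==> cmono k (\<lambda>x. f x i)) ==> cmap k n (\<lambda>x. \<lambda>i\<in>{..<n}. f x i)"
 by (rule cmapI) auto

lemma cmap_lmap:
 assumes "bspec k n ph"
 shows "cmap k n (lmap k n ph)"
proof (rule cmapI)
 fix i assume i: "i < n"
 show "cmono k (\<lambda>x. lmap k n ph x i)"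
 proof (cases "ph i")
  case (Inl e)
  hence "cmono k (\<lambda>x. real e)" using bspecD(1)[OF assms i] by (intro cmono_const) auto
  thus ?thesis by (rule cmono_cong[THEN iffD1, rotated]) (simp add: lmap_def i Inl)
 next
  case (Inr l)
  hence "cmono k (\<lambda>x. x l)" using bspecD(2)[OF assms i] by (intro cmono_coord)
  thus ?thesis by (rule cmono_cong[THEN iffD1, rotated]) (simp add: lmap_def i Inr)
 qed
qed (simp add: lmap_def)

lemma cmap_linear_ext:
 assumes "box_hom k n f"
 shows "cmap k n (linear_ext k n f)"
 using box_spec[OF assms] linear_ext_bmap cmap_lmap by metis

subsection \<open>The circulation of a cube\<close>

text \<open>Chains of points whose order intervals lie in \<open>U\<close> stand in for monotone
  paths in \<open>U\<close>; no paths have to be constructed.\<close>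

definition crel :: "nat => vec set => vec rel" where
 "crel n U = gen_preorder U {(x, y). x : U \<and> y : U \<and> le n x y \<and> ivl n x y \<subseteq> U}"

lemma crel_preorder: "preorder_on U (crel n U)"
 unfolding crel_def by (rule gen_preorder(1)) auto

lemma crel_trans: "(x, y) : crel n U ==> (y, z) : crel n U ==> (x, z) : crel n U"
 using crel_preorder[of U n] unfolding preorder_on_def trans_def by blast

lemma crel_subset: "crel n U \<subseteq> U \<times> U"
 using crel_preorder[of U n] unfolding preorder_on_def by blast

lemma crelI: "x : U ==> y : U ==> le n x y ==> ivl n x y \<subseteq> U ==> (x, y) : crel n U"
 unfolding crel_def by (rule subsetD[OF gen_preorder(2)]) auto

lemma crel_least:
 assumes "preorder_on U R"
  and "\<And>x y. x : U ==> y : U ==> le n x y ==> ivl n x y \<subseteq> U ==> (x, y) : R"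
 shows "crel n U \<subseteq> R"
 unfolding crel_def by (rule gen_preorder(3)) (use assms in auto)

lemma crel_le: "(x, y) : crel n U ==> le n x y"
proof -
 have "crel n U \<subseteq> {(x, y). x : U \<and> y : U \<and> le n x y}"
  by (rule crel_least) (auto simp: preorder_on_def refl_on_def trans_def intro: le_trans le_refl)
 thus "(x, y) : crel n U ==> le n x y" by blast
qed

lemma crel_mono:
 assumes "U \<subseteq> V"
 shows "crel n U \<subseteq> crel n V"
proof -
 have "crel n U \<subseteq> crel n V \<inter> U \<times> U"
 proof (rule crel_least)
  show "preorder_on U (crel n V \<inter> U \<times> U)"
   using crel_preorder[of V n] assms unfolding preorder_on_def refl_on_def trans_def by blast
 qed (use assms in \<open>auto intro!: crelI\<close>)
 thus ?thesis by blast
qed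

definition seg :: "nat => vec => vec => real => nat => real" where
 "seg n x y s = (\<lambda>i\<in>{..<n}. x i + s * (y i - x i))"

lemma seg_0: "x : cube n ==> seg n x y 0 = x"
 by (auto simp: seg_def cube_undef)

lemma seg_1: "y : cube n ==> seg n x y 1 = y"
 by (auto simp: seg_def cube_undef)

lemma seg_between:
 assumes "x : cube n" "y : cube n" "le n x y" "0 \<le> s" "s \<le> 1"
 shows "seg n x y s : ivl n x y" "seg n x y s : cube n"
proof -
 have *: "x i \<le> x i + s * (y i - x i) \<and> x i + s * (y i - x i) \<le> y i" if "i < n" for i
  using assms(4,5) leD[OF assms(3) that] mult_left_le_one_le[of "y i - x i" s] by auto
 have "0 \<le> x i + s * (y i - x i) \<and> x i + s * (y i - x i) \<le> 1" if "i < n" for i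
  using *[OF that] cube_coord[OF assms(1) that] cube_coord[OF assms(2) that] by auto
 thus "seg n x y s : cube n" unfolding seg_def by (rule cube_restrictI)
 thus "seg n x y s : ivl n x y" using * by (simp add: ivl_def seg_def le_def)
qed

lemma seg_mono:
 assumes "le n x y" "s \<le> s'"
 shows "le n (seg n x y s) (seg n x y s')"
 using assms by (auto simp: seg_def le_def intro!: mult_right_mono)

lemma seg_cont:
 assumes "x : cube n" "y : cube n" "le n x y" "0 \<le> s'" "s' \<le> 1" "\<bar>s' - s\<bar> < e"
 shows "seg n x y s' : cb n (seg n x y s) e"
proof -
 have "\<bar>(x i + s' * (y i - x i)) - (x i + s * (y i - x i))\<bar> < e" if "i < n" for i
 proof -
  have "\<bar>(x i + s' * (y i - x i)) - (x i + s * (y i - x i))\<bar> = \<bar>s' - s\<bar> * \<bar>y i - x i\<bar>"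
   by (simp add: abs_mult[symmetric] algebra_simps)
  also have "\<dots> \<le> \<bar>s' - s\<bar> * 1"
   using cube_coord[OF assms(1) that] cube_coord[OF assms(2) that] by (intro mult_left_mono) auto
  finally show ?thesis using assms(6) by simp
 qed
 thus ?thesis using seg_between(2)[OF assms(1-5)] by (simp add: cb_def seg_def)
qed

text \<open>Bisection along the straight segment from \<open>x\<close> to \<open>y\<close>: a
  transitive relation that holds across each point, from just below to just above, holds between the
  ends.\<close>

lemma seg_chain:
 assumes xy: "x : cube n" "y : cube n" "le n x y"
  and trans: "\<And>a b c. P a b ==> P b c ==> P a c"
  and local: "\<And>z. z : ivl n x y ==> EX e>0. ALL a:cb n z e. ALL b:cb n z e. le n a z --> le n z b --> P a b"
 shows "P x y"
proof -
 \<comment> \<open>Clamping the parameter extends the segment to all reals, since the bisection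
   principle also looks at parameters slightly outside the unit interval.\<close>
 define ga where "ga = (\<lambda>s. seg n x y (min 1 (max 0 s)))"
 have "P (ga 0) (ga 1)"
 proof (rule Bolzano[where P = "\<lambda>a b. P (ga a) (ga b)" and a = "0::real" and b = 1])
  fix s :: real assume s: "0 \<le> s" "s \<le> 1"
  hence g: "ga s = seg n x y s" by (simp add: ga_def)
  hence "ga s : ivl n x y" using seg_between(1)[OF xy s] by simp
  then obtain e where e: "e > 0" "ALL a:cb n (ga s) e. ALL b:cb n (ga s) e.
    le n a (ga s) --> le n (ga s) b --> P a b"
   using local by blast
  have "P (ga a) (ga b)" if "a \<le> s" "s \<le> b" "b - a < e" for a b
  proof (rule e(2)[rule_format])
   show "ga a : cb n (ga s) e" "ga b : cb n (ga s) e"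
    unfolding g unfolding ga_def using that s by (auto intro!: seg_cont[OF xy])
   show "le n (ga a) (ga s)" "le n (ga s) (ga b)"
    unfolding ga_def using that by (intro seg_mono[OF xy(3)]; linarith)+
  qed
  thus "EX d>0. ALL a b. a \<le> s \<and> s \<le> b \<and> b - a < d --> P (ga a) (ga b)" using e(1) by blast
 qed (auto intro: trans)
 thus ?thesis using seg_0[OF xy(1)] seg_1[OF xy(2)] by (simp add: ga_def)
qed

text \<open>The segment is cut so finely that the image of each piece lies in a ball inside
  \<open>U\<close>; as balls are order-convex, the generating relation applies to each
  piece.\<close>

lemma crel_cmap:
 assumes f: "cmap k n f" and U: "openin (cube_topology n) U"
  and xy: "(x, y) : crel k {z : cube k. f z : U}"
 shows "(f x, f y) : crel n U"
proof -
 let ?V = "{z : cube k. f z : U}"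
 have "crel k ?V \<subseteq> {(x, y). x : ?V \<and> y : ?V \<and> (f x, f y) : crel n U}"
 proof (rule crel_least)
  show "preorder_on ?V {(x, y). x : ?V \<and> y : ?V \<and> (f x, f y) : crel n U}"
   using crel_preorder[of U n] unfolding preorder_on_def refl_on_def trans_def by blast
  fix x y assume x: "x : ?V" and y: "y : ?V" and xy: "le k x y" "ivl k x y \<subseteq> ?V"
  have "(f x, f y) : crel n U"
  proof (rule seg_chain[of x k y "\<lambda>a b. (f a, f b) : crel n U"])
   fix z assume "z : ivl k x y"
   hence z: "z : cube k" "f z : U" using xy(2) by auto
   obtain e where e: "e > 0" "cb n (f z) e \<subseteq> U" using openin_cubeD[OF U z(2)] by blast
   obtain d where d: "d > 0" "ALL w:cb k z d. f w : cb n (f z) e" using cmap_cont[OF f z(1) e(1)] by blast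
   have "(f a, f b) : crel n U" if ab: "a : cb k z d" "b : cb k z d" "le k a z" "le k z b" for a b
   proof (rule crelI)
    show "f a : U" "f b : U" using ab d(2) e(2) by blast+
    have "le k a b" using le_trans[OF ab(3,4)] .
    thus "le n (f a) (f b)" using cmapD(3)[OF f] ab cb_cube by blast
    show "ivl n (f a) (f b) \<subseteq> U" using cb_ivl[of "f a" n "f z" e "f b"] ab d(2) e(2) by blast
   qed
   thus "EX e>0. ALL a:cb k z e. ALL b:cb k z e. le k a z --> le k z b --> (f a, f b) : crel n U"
    using d(1) by blast
  qed (use x y xy in \<open>auto intro: crel_trans\<close>)
  thus "(x, y) : {(x, y). x : ?V \<and> y : ?V \<and> (f x, f y) : crel n U}" using x y by simp
 qed
 thus ?thesis using xy by blast
qed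

lemma crel_cube: "crel n (cube n) = {(x, y). x : cube n \<and> y : cube n \<and> le n x y}"
proof
 show "crel n (cube n) \<subseteq> {(x, y). x : cube n \<and> y : cube n \<and> le n x y}"
 proof
  fix p assume p: "p : crel n (cube n)"
  obtain x y where xy: "p = (x, y)" by (cases p)
  thus "p : {(x, y). x : cube n \<and> y : cube n \<and> le n x y}"
   using p crel_le[of x y n "cube n"] subsetD[OF crel_subset p] by simp
 qed
 show "{(x, y). x : cube n \<and> y : cube n \<and> le n x y} \<subseteq> crel n (cube n)"
  by (auto intro!: crelI simp: ivl_def)
qed

text \<open>Each sufficiently short piece of a segment has its order interval in a single member of
  the cover.\<close>

lemma crel_Union:
 assumes O: "\<And>U. U : \<O> ==> openin (cube_topology n) U"
 shows "crel n (\<Union>\<O>) = gen_preorder (\<Union>\<O>) (\<Union>U\<in>\<O>. crel n U)"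
proof
 have r: "(\<Union>U\<in>\<O>. crel n U) \<subseteq> \<Union>\<O> \<times> \<Union>\<O>" using crel_subset by blast
 note G = gen_preorder[OF r]
 show "gen_preorder (\<Union>\<O>) (\<Union>U\<in>\<O>. crel n U) \<subseteq> crel n (\<Union>\<O>)"
  by (rule G(3)[OF crel_preorder]) (use crel_mono in blast)
 have tr: "(a, b) : gen_preorder (\<Union>\<O>) (\<Union>U\<in>\<O>. crel n U) ==>
  (b, c) : gen_preorder (\<Union>\<O>) (\<Union>U\<in>\<O>. crel n U) ==>
  (a, c) : gen_preorder (\<Union>\<O>) (\<Union>U\<in>\<O>. crel n U)" for a b c
  using G(1) unfolding preorder_on_def trans_def by blast
 show "crel n (\<Union>\<O>) \<subseteq> gen_preorder (\<Union>\<O>) (\<Union>U\<in>\<O>. crel n U)"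
 proof (rule crel_least[OF G(1)])
  fix x y assume x: "x : \<Union>\<O>" and y: "y : \<Union>\<O>" and xy: "le n x y" "ivl n x y \<subseteq> \<Union>\<O>"
  have c: "x : cube n" "y : cube n" using x y O openin_subset topspace_cube by blast+
  show "(x, y) : gen_preorder (\<Union>\<O>) (\<Union>U\<in>\<O>. crel n U)"
  proof (rule seg_chain[OF c xy(1)])
   fix z assume "z : ivl n x y"
   then obtain U where U: "U : \<O>" "z : U" using xy(2) by blast
   obtain e where e: "e > 0" "cb n z e \<subseteq> U" using openin_cubeD[OF O[OF U(1)] U(2)] by blast
   have "(a, b) : crel n U" if "a : cb n z e" "b : cb n z e" "le n a z" "le n z b" for a b
    using that e(2) cb_ivl[OF that(1,2)] le_trans[OF that(3,4)] by (intro crelI) blast+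
   thus "EX e>0. ALL a:cb n z e. ALL b:cb n z e. le n a z --> le n z b -->
     (a, b) : gen_preorder (\<Union>\<O>) (\<Union>U\<in>\<O>. crel n U)"
    using G(2) U(1) e(1) by blast
  qed (rule tr)
 qed
qed

lemma circulation_crel:
 "circulation (cube_topology n) (\<lambda>U. if openin (cube_topology n) U then crel n U else {})"
 unfolding circulation_def
proof (intro conjI allI impI)
 fix \<O> assume O: "ALL U:\<O>. openin (cube_topology n) U"
 hence "openin (cube_topology n) (\<Union>\<O>)" by (intro openin_Union) blast
 moreover have "(\<Union>U\<in>\<O>. if openin (cube_topology n) U then crel n U else {}) = (\<Union>U\<in>\<O>. crel n U)"
  using O by auto
 ultimately show "(if openin (cube_topology n) (\<Union>\<O>) then crel n (\<Union>\<O>) else {}) =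
   gen_preorder (\<Union>\<O>) (\<Union>U\<in>\<O>. if openin (cube_topology n) U then crel n U else {})"
  using crel_Union O by simp
qed (simp_all add: crel_preorder)

lemma open_compl_ivl:
 assumes "x : cube n" "y : cube n"
 shows "openin (cube_topology n) (cube n - ivl n x y)"
 unfolding openin_cube
proof (intro conjI ballI)
 fix z assume z: "z : cube n - ivl n x y"
 then obtain i where i: "i < n" "z i < x i \<or> y i < z i" by (auto simp: ivl_def not_le le_def)
 define e where "e = max (x i - z i) (z i - y i)"
 have "e > 0" using i(2) by (auto simp: e_def)
 moreover have "cb n z e \<subseteq> cube n - ivl n x y"
 proof
  fix w assume w: "w : cb n z e"
  hence "\<bar>w i - z i\<bar> < e" using i(1) by (simp add: cb_def)
  hence "w i < x i \<or> y i < w i" by (auto simp: e_def max_def split: if_splits)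
  thus "w : cube n - ivl n x y" using w i(1) by (auto simp: cb_def ivl_def not_le le_def intro: exI[of _ i])
 qed
 ultimately show "EX e>0. cb n z e \<subseteq> cube n - ivl n x y" by blast
qed auto

text \<open>Deleting the closed interval \<open>ivl n x y\<close> from the cube leaves an open set which, together with \<open>U\<close>, covers
 the cube, so that \<open>x \<le> y\<close> must already be witnessed inside \<open>U\<close>.\<close>

lemma circulation_unique:
 assumes c: "circulation (cube_topology n) c"
  and top: "c (cube n) = {(x, y). x : cube n \<and> y : cube n \<and> le n x y}"
 shows "c = (\<lambda>U. if openin (cube_topology n) U then crel n U else {})"
proof
 fix U
 let ?T = "cube_topology n"
 have pre: "preorder_on V (c V)" if "openin ?T V" for V using c that by (simp add: circulation_def)
 have sub: "c V \<subseteq> V \<times> V" if "openin ?T V" for V using pre[OF that] by (simp add: preorder_on_def)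
 have un: "c (\<Union>\<O>) = gen_preorder (\<Union>\<O>) (\<Union>V\<in>\<O>. c V)" if "\<And>V. V : \<O> ==> openin ?T V" for \<O>
  using circulation_Union[OF c that] .
 have oc: "openin ?T (cube n)" using openin_topspace[of ?T] by (simp add: topspace_cube)
 have mono: "c V \<subseteq> c W" if "openin ?T V" "openin ?T W" "V \<subseteq> W" for V W
  using circ_mono[of "\<lparr>topo = ?T, circ = c\<rparr>" V W] c that by (simp add: is_stream_def)
 have le: "le n a b" if "(a, b) : c V" "openin ?T V" for a b V
  using mono[OF that(2) oc] that openin_subset[OF that(2)] top topspace_cube by fastforce
 have "c U = crel n U" if U: "openin ?T U"
 proof
  show "crel n U \<subseteq> c U"
  proof (rule crel_least[OF pre[OF U]])
   fix x y assume x: "x : U" and y: "y : U" and xy: "le n x y" "ivl n x y \<subseteq> U"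
   have xc: "x : cube n" "y : cube n" using x y openin_subset[OF U] topspace_cube by auto
   define V where "V = cube n - ivl n x y"
   \<comment> \<open>\<open>Q\<close> is transitive because a chain of comparable points that starts
     and ends in the order interval never leaves it; so the part of the relation that comes from
     \<open>V\<close> cannot contribute between points of the interval.\<close>
   define Q where "Q = {(a, b). a : cube n \<and> b : cube n \<and> le n a b \<and>
    (a : ivl n x y --> b : ivl n x y --> (a, b) : c U)}"
   have V: "openin ?T V" unfolding V_def by (rule open_compl_ivl[OF xc])
   have cov: "\<Union>{U, V} = cube n" using xy(2) openin_subset[OF U] topspace_cube by (auto simp: V_def)
   have cube: "c (cube n) = gen_preorder (cube n) (c U \<union> c V)"
    using un[of "{U, V}"] U V unfolding cov by auto
   have "gen_preorder (cube n) (c U \<union> c V) \<subseteq> Q"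
   proof (rule gen_preorder(3))
    show "c U \<union> c V \<subseteq> cube n \<times> cube n" using sub[OF U] sub[OF V] cov by blast
    have tr: "(a, d) : Q" if ab: "(a, b) : Q" and bd: "(b, d) : Q" for a b d
    proof -
     have le: "le n a d" using ab bd le_trans unfolding Q_def by blast
     have "(a, d) : c U" if ad: "a : ivl n x y" "d : ivl n x y"
     proof -
      have "b : ivl n x y" using ad ab bd unfolding Q_def ivl_def by (auto intro: le_trans)
      hence "(a, b) : c U" "(b, d) : c U" using ab bd ad unfolding Q_def by auto
      thus ?thesis using pre[OF U] unfolding preorder_on_def trans_def by blast
     qed
     thus ?thesis using le ab bd unfolding Q_def by auto
    qed
    show "preorder_on (cube n) Q"
     unfolding preorder_on_def
    proof (intro conjI)
     show "trans Q" using tr by (intro transI)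
     show "refl_on (cube n) Q" using pre[OF U] xy(2)
      unfolding Q_def preorder_on_def refl_on_def by (auto simp: le_refl)
    qed (auto simp: Q_def)
    show "c U \<union> c V \<subseteq> Q"
     using le[OF _ U] le[OF _ V] sub[OF U] sub[OF V] cov unfolding Q_def V_def by auto
   qed
   moreover have "(x, y) : c (cube n)" using top xc xy by simp
   ultimately have "(x, y) : Q" using cube by blast
   thus "(x, y) : c U" using xy(1) xc le_refl by (auto simp: Q_def ivl_def)
  qed
  \<comment> \<open>For the converse \<open>U\<close> is covered by balls: inside a ball
    comparability alone already gives the generating relation.\<close>
  define \<O> where "\<O> = {cb n z e |z e. cb n z e \<subseteq> U}"
  have O: "openin ?T V" if "V : \<O>" for V using that openin_cb by (auto simp: \<O>_def)
  have UO: "\<Union>\<O> = U"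
  proof
   show "U \<subseteq> \<Union>\<O>"
   proof
    fix z assume z: "z : U"
    then obtain e where "e > 0" "cb n z e \<subseteq> U" using openin_cubeD[OF U] by blast
    thus "z : \<Union>\<O>" using cb_self[of z n e] z openin_subset[OF U] topspace_cube unfolding \<O>_def by blast
   qed
  qed (auto simp: \<O>_def)
  have "c U = gen_preorder U (\<Union>V\<in>\<O>. c V)" using un[OF O, of \<O>] UO by simp
  also have "\<dots> \<subseteq> crel n U"
  proof (rule gen_preorder(3)[OF _ crel_preorder])
   show "(\<Union>V\<in>\<O>. c V) \<subseteq> U \<times> U" using sub[OF O] UO by blast
   show "(\<Union>V\<in>\<O>. c V) \<subseteq> crel n U"
   proof (rule UN_least)
    fix V assume V: "V : \<O>"
    then obtain z e where z: "V = cb n z e" "cb n z e \<subseteq> U" by (auto simp: \<O>_def)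
    show "c V \<subseteq> crel n U"
    proof
     fix p assume p: "p : c V"
     obtain a b where ab: "p = (a, b)" by (cases p)
     have "a : V" "b : V" "le n a b" using p ab sub[OF O[OF V]] le[OF _ O[OF V]] by auto
     thus "p : crel n U" using cb_ivl[of a n z e b] z unfolding ab by (intro crelI) blast+
    qed
   qed
  qed
  finally show "c U \<subseteq> crel n U" .
 qed
 moreover have "c U = {}" if "\<not> openin ?T U" using c that by (simp add: circulation_def)
 ultimately show "c U = (if openin ?T U then crel n U else {})" by simp
qed

lemma circ_dcube: "circ (dcube n) = (\<lambda>U. if openin (cube_topology n) U then crel n U else {})"
proof -
 let ?c = "\<lambda>U. if openin (cube_topology n) U then crel n U else {}"
 have oc: "openin (cube_topology n) (cube n)"
  using openin_topspace[of "cube_topology n"] by (simp add: topspace_cube)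
 have "(THE c. circulation (cube_topology n) c \<and>
   c (cube n) = {(x, y). x : cube n \<and> y : cube n \<and> (ALL i<n. x i \<le> y i)}) = ?c"
 proof (rule the_equality)
  show "circulation (cube_topology n) ?c \<and> ?c (cube n) = {(x, y). x : cube n \<and> y : cube n \<and> (ALL i<n. x i \<le> y i)}"
   using circulation_crel oc crel_cube[of n] by (simp add: le_def)
 qed (use circulation_unique[of n] in \<open>simp add: le_def\<close>)
 thus ?thesis by (simp add: dcube_def)
qed

lemma topo_dcube [simp]: "topo (dcube n) = cube_topology n"
 by (simp add: dcube_def)

lemma is_stream_dcube: "is_stream (dcube n)"
 unfolding is_stream_def topo_dcube circ_dcube by (rule circulation_crel)

lemma stream_map_dcube: "stream_map (dcube k) X f \<longleftrightarrow> continuous_map (cube_topology k) (topo X) f \<and>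
  (ALL U x y. openin (topo X) U --> (x, y) : crel k {z : cube k. f z : U} --> (f x, f y) : circ X U)"
proof -
 have "openin (cube_topology k) {z : cube k. f z : U}"
  if "continuous_map (cube_topology k) (topo X) f" "openin (topo X) U" for U
  using that unfolding continuous_map_def topspace_cube by blast
 thus ?thesis unfolding stream_map_def topo_dcube circ_dcube topspace_cube by auto
qed

lemma cmap_continuous:
 assumes "cmap k n f"
 shows "continuous_map (cube_topology k) (cube_topology n) f"
 using cmap_vimage_open[OF assms] cmapD(1)[OF assms] unfolding continuous_map_def topspace_cube by blast

text \<open>Monotonicity is the circulation condition for the whole cube, on which
  \<open>crel\<close> is the coordinatewise order. Cells of \<open>sing (dcube n)\<close> thereby
  become tuples of monotone continuous functions.\<close>

lemma stream_map_cmap: "stream_map (dcube k) (dcube n) f \<longleftrightarrow> cmap k n f"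
proof
 assume f: "cmap k n f"
 show "stream_map (dcube k) (dcube n) f"
  unfolding stream_map_dcube topo_dcube circ_dcube using cmap_continuous[OF f] crel_cmap[OF f] by simp
next
 assume f: "stream_map (dcube k) (dcube n) f"
 have c: "continuous_map (cube_topology k) (cube_topology n) f" using f by (simp add: stream_map_dcube)
 have fc: "f x : cube n" if "x : cube k" for x
  using c that unfolding continuous_map_def topspace_cube by blast
 have oc: "openin (cube_topology n) (cube n)"
  using openin_topspace[of "cube_topology n"] by (simp add: topspace_cube)
 have "{z : cube k. f z : cube n} = cube k" using fc by blast
 hence mono: "le n (f x) (f y)" if "x : cube k" "y : cube k" "le k x y" for x y
  using f that oc unfolding stream_map_dcube topo_dcube circ_dcube crel_cube by (auto dest!: spec[of _ "cube n"] simp: crel_cube)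
 show "cmap k n f"
  unfolding cmap_def
 proof (intro conjI ballI fc allI impI)
  fix i assume i: "i < n"
  have "continuous_map (cube_topology k) euclideanreal ((\<lambda>x. x i) \<circ> f)"
   using continuous_map_compose[OF c] cmono_coord[OF i] unfolding cmono_def by blast
  thus "cmono k (\<lambda>x. f x i)"
   using leD[OF mono i] cube_coord[OF fc i] unfolding cmono_def comp_def by blast
 qed
qed

lemma cells_sing_dcube: "cells (sing (dcube n)) k = {f : extensional (cube k). cmap k n f}"
 by (simp add: sing_def stream_map_cmap)

section \<open>Points of the directed realization\<close>

lemma gen_equiv:
 assumes "r \<subseteq> A \<times> A"
 shows "equiv A (gen_equiv A r)" "r \<subseteq> gen_equiv A r"
  "equiv A R ==> r \<subseteq> R ==> gen_equiv A r \<subseteq> R"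
proof -
 have A: "A \<times> A : {R. equiv A R \<and> r \<subseteq> R}"
  using assms by (auto simp: equiv_def refl_on_def sym_def trans_def)
 show "equiv A (gen_equiv A r)"
 proof (rule equivI)
  show "gen_equiv A r \<subseteq> A \<times> A" unfolding gen_equiv_def using A by (rule Inter_lower)
  show "refl_on A (gen_equiv A r)" by (auto simp: gen_equiv_def equiv_def refl_on_def)
  show "sym (gen_equiv A r)" by (auto simp: gen_equiv_def equiv_def sym_def)
  show "trans (gen_equiv A r)"
   unfolding gen_equiv_def by (rule trans_INTER[of _ id, simplified]) (auto simp: equiv_def)
 qed
 show "r \<subseteq> gen_equiv A r" unfolding gen_equiv_def by (rule Inter_greatest) simp
 show "gen_equiv A r \<subseteq> R" if "equiv A R" "r \<subseteq> R"
  unfolding gen_equiv_def by (rule Inter_lower) (simp add: that)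
qed

lemma gen_equiv_respects:
 assumes ab: "(a, b) : gen_equiv A r" and r: "r \<subseteq> A \<times> A"
  and f: "\<And>u v. (u, v) : r ==> f u = f v"
 shows "f a = f b"
proof -
 have "gen_equiv A r \<subseteq> {(u, v). u : A \<and> v : A \<and> f u = f v}"
 proof (rule gen_equiv(3)[OF r])
  show "equiv A {(u, v). u : A \<and> v : A \<and> f u = f v}"
   by (rule equivI) (auto simp: refl_on_def sym_def trans_def)
  show "r \<subseteq> {(u, v). u : A \<and> v : A \<and> f u = f v}" using r f by blast
 qed
 thus ?thesis using ab by blast
qed

lemma cubical_setD:
 assumes "cubical_set C"
 shows "box_hom m n f ==> c : cells C n ==> act C m n f c : cells C m"
  "c : cells C n ==> act C n n (box_id n) c = c"
  "box_hom l m f ==> box_hom m n g ==> c : cells C n ==>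
   act C l n (compose (grid 1 l) g f) c = act C l m f (act C m n g c)"
 using assms unfolding cubical_set_def by blast+

definition pt :: "'a cset => nat => 'a => vec => 'a rpt" where
 "pt C n c x = real_rel C `` {(n, c, x)}"

definition points :: "'a cset => 'a rpt set" where
 "points C = glue_points C cube // real_rel C"

definition glue_gen :: "'a cset => (nat => 'x set) => (nat => nat => mor => 'x => 'x) => (nat \<times> 'a \<times> 'x) rel" where
 "glue_gen C F push = {((m, act C m n f c, x), (n, c, push m n f x)) | m n f c x.
    box_hom m n f \<and> c : cells C n \<and> x : F m}"

lemma glue_rel_gen: "glue_rel C F push = gen_equiv (glue_points C F) (glue_gen C F push)"
 by (simp add: glue_rel_def glue_gen_def)

lemma glue_gen_subset:
 assumes "cubical_set C" "\<And>m n f x. box_hom m n f ==> x : F m ==> push m n f x : F n"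
 shows "glue_gen C F push \<subseteq> glue_points C F \<times> glue_points C F"
 using assms(2) cubical_setD(1)[OF assms(1)] unfolding glue_gen_def glue_points_def by blast

lemma mem_glue: "(n, c, x) : glue_points C F \<longleftrightarrow> c : cells C n \<and> x : F n"
 by (simp add: glue_points_def)

lemma real_gen_subset:
 "cubical_set C ==> glue_gen C cube linear_ext \<subseteq> glue_points C cube \<times> glue_points C cube"
 by (rule glue_gen_subset) (auto intro: linear_ext_box)

lemma real_equiv: "cubical_set C ==> equiv (glue_points C cube) (real_rel C)"
 unfolding glue_rel_gen by (rule gen_equiv(1)[OF real_gen_subset])

lemma pt_eq_iff:
 assumes "cubical_set C" "c : cells C n" "x : cube n" "c' : cells C n'" "x' : cube n'"
 shows "pt C n c x = pt C n' c' x' \<longleftrightarrow> ((n, c, x), (n', c', x')) : real_rel C"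
 unfolding pt_def using eq_equiv_class_iff[OF real_equiv[OF assms(1)]] assms by (simp add: mem_glue)

lemma pt_act:
 assumes C: "cubical_set C" and "box_hom m n f" "c : cells C n" "x : cube m"
 shows "pt C m (act C m n f c) x = pt C n c (linear_ext m n f x)"
proof -
 have "((m, act C m n f c, x), (n, c, linear_ext m n f x)) : glue_gen C cube linear_ext"
  unfolding glue_gen_def using assms by blast
 hence "((m, act C m n f c, x), (n, c, linear_ext m n f x)) : real_rel C"
  unfolding glue_rel_gen using gen_equiv(2)[OF real_gen_subset[OF C]] by blast
 thus ?thesis
  using pt_eq_iff[OF C cubical_setD(1)[OF C assms(2,3)] assms(4) assms(3) linear_ext_box[OF assms(2,4)]] by simp
qed

text \<open>Functions on the realization are the functions of a cell and a point of the cube that are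
 natural in the cube.\<close>

lemma pt_respects:
 assumes C: "cubical_set C" and "pt C n c x = pt C n' c' x'"
  and "c : cells C n" "x : cube n" "c' : cells C n'" "x' : cube n'"
  and F: "\<And>m n f c x. box_hom m n f ==> c : cells C n ==> x : cube m ==>
   F m (act C m n f c) x = F n c (linear_ext m n f x)"
 shows "F n c x = F n' c' x'"
proof -
 have "((n, c, x), (n', c', x')) : gen_equiv (glue_points C cube) (glue_gen C cube linear_ext)"
  using pt_eq_iff[OF C] assms(2-6) by (simp add: glue_rel_gen)
 hence "(\<lambda>(n, c, x). F n c x) (n, c, x) = (\<lambda>(n, c, x). F n c x) (n', c', x')"
  by (rule gen_equiv_respects[OF _ real_gen_subset[OF C]]) (auto simp: glue_gen_def F)
 thus ?thesis by simp
qed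

lemma pt_points: "cubical_set C ==> c : cells C n ==> x : cube n ==> pt C n c x : points C"
 unfolding pt_def points_def by (rule quotientI) (simp add: mem_glue)

lemma pointsE:
 assumes "Z : points C"
 obtains n c x where "c : cells C n" "x : cube n" "Z = pt C n c x"
 using assms unfolding points_def pt_def quotient_def glue_points_def by blast

definition chart_pre :: "'a cset => nat => 'a => 'a rpt set => vec set" where
 "chart_pre C n c U = {x : cube n. pt C n c x : U}"

lemma topo_realization: "topo (realization C) =
  final_topology (points C) {(n, c). c : cells C n} (\<lambda>i. topo ((\<lambda>(n, c). dcube n) i)) (\<lambda>(n, c) x. pt C n c x)"
 by (simp add: realization_def final_stream_def Let_def points_def pt_def)

lemma openin_real:
 "openin (topo (realization C)) U \<longleftrightarrow>
  U \<subseteq> points C \<and> (ALL n. ALL c:cells C n. openin (cube_topology n) (chart_pre C n c U))"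
proof -
 have "(case i of (n, c) => dcube n) = dcube (fst i)" for i :: "nat \<times> 'a" by (simp add: case_prod_beta)
 thus ?thesis
  unfolding topo_realization openin_final
  by (auto simp: topspace_cube chart_pre_def case_prod_beta)
qed

lemma topspace_real:
 assumes "cubical_set C"
 shows "topspace (topo (realization C)) = points C"
proof -
 have "chart_pre C n c (points C) = cube n" if "c : cells C n" for n c
  using pt_points[OF assms that] by (auto simp: chart_pre_def)
 hence "openin (topo (realization C)) (points C)"
  unfolding openin_real using openin_topspace[of "cube_topology _"] by (simp add: topspace_cube)
 moreover have "topspace (topo (realization C)) \<subseteq> points C"
  using openin_topspace[of "topo (realization C)"] unfolding openin_real by blast
 ultimately show ?thesis using openin_subset by blast
qed

lemma is_stream_real: "is_stream (realization C)"
 unfolding realization_def by (rule is_stream_final_stream) (auto intro: is_stream_dcube)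

lemma circ_real_preorder: "openin (topo (realization C)) U ==> preorder_on U (circ (realization C) U)"
 using is_stream_real unfolding is_stream_def circulation_def by blast

lemma circ_real_trans:
 "openin (topo (realization C)) U ==> (x, y) : circ (realization C) U ==> (y, z) : circ (realization C) U ==>
  (x, z) : circ (realization C) U"
 using circ_real_preorder unfolding preorder_on_def trans_def by blast

lemma circ_real:
 assumes "openin (topo (realization C)) U"
 shows "circ (realization C) U = gen_preorder U
  (\<Union>(n, c)\<in>{(n, c). c : cells C n}. (\<lambda>(x, y). (pt C n c x, pt C n c y)) ` crel n (chart_pre C n c U))"
proof -
 define f where "f = (\<lambda>(n, c) x. pt C n c x)"
 define Y where "Y = (\<lambda>(n::nat, c::'a). dcube n)"
 have eq: "realization C = final_stream (points C) {(n, c). c : cells C n} Y f"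
  by (simp add: realization_def f_def points_def pt_def Y_def)
 have fT: "openin (final_topology (points C) {(n, c). c : cells C n} (\<lambda>i. topo (Y i)) f) U"
  using assms unfolding eq by (simp add: final_stream_def Let_def)
 have c: "circ (realization C) U = gen_preorder U
    (\<Union>i\<in>{(n, c). c : cells C n}. (\<lambda>(x, y). (f i x, f i y)) ` circ (Y i) {y : topspace (topo (Y i)). f i y : U})"
  unfolding eq final_stream_def Let_def using fT by simp
 have "circ (Y i) {y : topspace (topo (Y i)). f i y : U} = crel (fst i) (chart_pre C (fst i) (snd i) U)"
  if "i : {(n, c). c : cells C n}" for i
 proof -
  obtain n c where i: "i = (n, c)" by (cases i)
  have "openin (cube_topology n) (chart_pre C n c U)" using assms that i unfolding openin_real by simp
  moreover have "{y : topspace (topo (Y i)). f i y : U} = chart_pre C n c U"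
   by (simp add: i Y_def f_def topspace_cube chart_pre_def)
  ultimately show ?thesis by (simp add: i Y_def circ_dcube)
 qed
 hence "(\<Union>i\<in>{(n, c). c : cells C n}. (\<lambda>(x, y). (f i x, f i y)) ` circ (Y i) {y : topspace (topo (Y i)). f i y : U})
  = (\<Union>(n, c)\<in>{(n, c). c : cells C n}. (\<lambda>(x, y). (pt C n c x, pt C n c y)) ` crel n (chart_pre C n c U))"
  by (intro SUP_cong refl) (auto simp: f_def)
 thus ?thesis using c by simp
qed

lemma circ_real_gen:
 "(\<Union>(n, c)\<in>{(n, c). c : cells C n}. (\<lambda>(x, y). (pt C n c x, pt C n c y)) ` crel n (chart_pre C n c U)) \<subseteq> U \<times> U"
 using crel_subset unfolding chart_pre_def by fast

lemma circ_chart: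
 assumes U: "openin (topo (realization C)) U" and c: "c : cells C n" and xy: "(x, y) : crel n (chart_pre C n c U)"
 shows "(pt C n c x, pt C n c y) : circ (realization C) U"
proof -
 have "(pt C n c x, pt C n c y) :
   (\<Union>(n, c)\<in>{(n, c). c : cells C n}. (\<lambda>(x, y). (pt C n c x, pt C n c y)) ` crel n (chart_pre C n c U))"
  using c xy by force
 thus ?thesis unfolding circ_real[OF U] using gen_preorder(2)[OF circ_real_gen] by blast
qed

lemma circ_least:
 assumes U: "openin (topo (realization C)) U" and R: "preorder_on U R"
  and "\<And>n c x y. c : cells C n ==> (x, y) : crel n (chart_pre C n c U) ==> (pt C n c x, pt C n c y) : R"
 shows "circ (realization C) U \<subseteq> R"
 unfolding circ_real[OF U] by (rule gen_preorder(3)[OF circ_real_gen R]) (use assms(3) in auto)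

lemma stream_chart:
 assumes "cubical_set C" "c : cells C n"
 shows "stream_map (dcube n) (realization C) (pt C n c)"
 unfolding stream_map_dcube continuous_map_def topspace_cube topspace_real[OF assms(1)]
 using pt_points[OF assms] circ_chart[OF _ assms(2)] assms(2)
 by (auto simp: openin_real chart_pre_def)

subsection \<open>Stream maps out of cubes\<close>

lemma stream_map_comp_cmap:
 assumes f: "stream_map (dcube n) X f" and g: "cmap k n g"
 shows "stream_map (dcube k) X (\<lambda>x. f (g x))"
 unfolding stream_map_dcube
proof (intro conjI allI impI)
 have c: "continuous_map (cube_topology n) (topo X) f" using f by (simp add: stream_map_dcube)
 show "continuous_map (cube_topology k) (topo X) (\<lambda>x. f (g x))"
  using continuous_map_compose[OF cmap_continuous[OF g] c] by (simp add: comp_def)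
 fix U x y assume U: "openin (topo X) U" and xy: "(x, y) : crel k {z : cube k. f (g z) : U}"
 have o: "openin (cube_topology n) {z : cube n. f z : U}"
  using c U unfolding continuous_map_def topspace_cube by blast
 have "{z : cube k. f (g z) : U} = {z : cube k. g z : {z : cube n. f z : U}}"
  using cmapD(1)[OF g] by blast
 hence "(g x, g y) : crel n {z : cube n. f z : U}" using crel_cmap[OF g o, of x y] xy by simp
 thus "(f (g x), f (g y)) : circ X U" using f U by (simp add: stream_map_dcube)
qed

lemma stream_map_cong:
 assumes "stream_map (dcube k) X f" "\<And>x. x : cube k ==> f x = g x"
 shows "stream_map (dcube k) X g"
 unfolding stream_map_dcube
proof (intro conjI allI impI)
 show "continuous_map (cube_topology k) (topo X) g"
  using assms continuous_map_eq[of "cube_topology k" "topo X" f g] by (simp add: stream_map_dcube topspace_cube)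
 fix U x y assume U: "openin (topo X) U" and xy: "(x, y) : crel k {z : cube k. g z : U}"
 have "{z : cube k. g z : U} = {z : cube k. f z : U}" using assms(2) by auto
 hence "(f x, f y) : circ X U" using assms(1) U xy by (simp add: stream_map_dcube)
 moreover have "x : cube k" "y : cube k" using xy crel_subset by blast+
 ultimately show "(g x, g y) : circ X U" using assms(2) by simp
qed

text \<open>Continuity is local, and for the circulation a segment is cut into pieces on each of
  which \<open>f\<close> agrees with one stream map. This admits maps that are described by
  different representatives in different places.\<close>

lemma stream_map_local:
 assumes X: "is_stream X"
  and local: "\<And>q. q : cube k ==> EX e>0. EX g. stream_map (dcube k) X g \<and> (ALL y:cb k q e. f y = g y)"
 shows "stream_map (dcube k) X f"
 unfolding stream_map_dcube
proof (intro conjI allI impI)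
 have pre: "preorder_on U (circ X U)" if "openin (topo X) U" for U
  using X that unfolding is_stream_def circulation_def by blast
 have ft: "f q : topspace (topo X)" if q: "q : cube k" for q
 proof -
  obtain e g where e: "e > 0" and "stream_map (dcube k) X g" "ALL y:cb k q e. f y = g y" using local[OF q] by blast
  thus ?thesis using cb_self[OF q e] q
   unfolding stream_map_dcube continuous_map_def topspace_cube by fastforce
 qed
 have op: "openin (cube_topology k) {x : cube k. f x : U}" if U: "openin (topo X) U" for U
  unfolding openin_cube
 proof (intro conjI ballI)
  fix q assume "q : {x : cube k. f x : U}"
  hence q: "q : cube k" "f q : U" by auto
  obtain e g where e: "e > 0" and g: "stream_map (dcube k) X g" "ALL y:cb k q e. f y = g y" using local[OF q(1)] by blast
  have "openin (cube_topology k) {x : cube k. g x : U}"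
   using g(1) U unfolding stream_map_dcube continuous_map_def topspace_cube by blast
  moreover have "q : {x : cube k. g x : U}" using q g(2) cb_self[OF q(1) e] by auto
  ultimately obtain d where d: "d > 0" "cb k q d \<subseteq> {x : cube k. g x : U}" using openin_cubeD by blast
  have "cb k q (min d e) \<subseteq> cb k q d \<inter> cb k q e" by (simp add: cb_mono)
  hence "cb k q (min d e) \<subseteq> {x : cube k. f x : U}" using d(2) g(2) by (auto simp: subset_iff)
  thus "EX e>0. cb k q e \<subseteq> {x : cube k. f x : U}" using d(1) e by (intro exI[of _ "min d e"]) simp
 qed auto
 show "continuous_map (cube_topology k) (topo X) f"
  unfolding continuous_map_def topspace_cube using ft op by blast
 fix U x y assume U: "openin (topo X) U" and xy: "(x, y) : crel k {z : cube k. f z : U}"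
 let ?V = "{z : cube k. f z : U}"
 have tr: "(a, b) : circ X U ==> (b, c) : circ X U ==> (a, c) : circ X U" for a b c
  using pre[OF U] unfolding preorder_on_def trans_def by blast
 have "crel k ?V \<subseteq> {(x, y). x : ?V \<and> y : ?V \<and> (f x, f y) : circ X U}"
 proof (rule crel_least)
  show "preorder_on ?V {(x, y). x : ?V \<and> y : ?V \<and> (f x, f y) : circ X U}"
   using pre[OF U] unfolding preorder_on_def refl_on_def trans_def by blast
  fix x y assume x: "x : ?V" and y: "y : ?V" and xy: "le k x y" "ivl k x y \<subseteq> ?V"
  have "(f x, f y) : circ X U"
  proof (rule seg_chain[of x k y "\<lambda>a b. (f a, f b) : circ X U"])
   fix z assume "z : ivl k x y"
   hence z: "z : ?V" using xy(2) by blast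
   then obtain e1 where e1: "e1 > 0" "cb k z e1 \<subseteq> ?V" using openin_cubeD[OF op[OF U]] by blast
   obtain e g where e: "e > 0" and g: "stream_map (dcube k) X g" "ALL y:cb k z e. f y = g y" using local z by blast
   define d where "d = min e e1"
   have d: "d > 0" "cb k z d \<subseteq> cb k z e" "cb k z d \<subseteq> ?V"
    using e e1(1) cb_mono[of d e k z] order_trans[OF cb_mono[of d e1 k z] e1(2)] by (auto simp: d_def)
   have "(f a, f b) : circ X U" if ab: "a : cb k z d" "b : cb k z d" "le k a z" "le k z b" for a b
   proof -
    have "ivl k a b \<subseteq> {z : cube k. g z : U}" using cb_ivl[OF ab(1,2)] d g(2) by fastforce
    moreover have "a : {z : cube k. g z : U}" "b : {z : cube k. g z : U}" using ab d g(2) by fastforce+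
    ultimately have "(a, b) : crel k {z : cube k. g z : U}" using le_trans[OF ab(3,4)] by (intro crelI)
    hence "(g a, g b) : circ X U" using g(1) U by (simp add: stream_map_dcube)
    thus ?thesis using ab d g(2) by (metis subsetD)
   qed
   thus "EX e>0. ALL a:cb k z e. ALL b:cb k z e. le k a z --> le k z b --> (f a, f b) : circ X U"
    using d(1) by blast
  qed (use x y xy tr in auto)
  thus "(x, y) : {(x, y). x : ?V \<and> y : ?V \<and> (f x, f y) : circ X U}" using x y by simp
 qed
 thus "(f x, f y) : circ X U" using xy by blast
qed

subsection \<open>Coordinatewise endomorphisms of the realization\<close>

definition gact :: "nat => (real => real) => vec => nat => real" where
 "gact n g x = (\<lambda>i\<in>{..<n}. g (x i))"

definition unit_fun :: "(real => real) => bool" where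
 "unit_fun g \<longleftrightarrow> g 0 = 0 \<and> g 1 = 1 \<and> (ALL t. 0 \<le> t --> t \<le> 1 --> 0 \<le> g t \<and> g t \<le> 1)"

text \<open>The saturated image avoids the choice of a representative; that it is a single class is
  \<open>push_pt\<close>.\<close>

definition push :: "'a cset => (real => real) => 'a rpt => 'a rpt" where
 "push C g Z = real_rel C `` ((\<lambda>(n, c, x). (n, c, gact n g x)) ` Z)"

lemma gact_cube: "unit_fun g ==> x : cube n ==> gact n g x : cube n"
 unfolding gact_def by (rule cube_restrictI) (use cube_coord in \<open>auto simp: unit_fun_def\<close>)

text \<open>Box morphisms copy coordinates and insert 0 or 1, and \<open>g\<close> fixes 0 and
  1.\<close>

lemma gact_lmap:
 assumes g: "unit_fun g" and s: "bspec m n ph" and x: "x : cube m"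
 shows "gact n g (lmap m n ph x) = lmap m n ph (gact m g x)"
proof (rule cube_eqI)
 show "gact n g (lmap m n ph x) : cube n" by (rule gact_cube[OF g lmap_cube[OF s x]])
 show "lmap m n ph (gact m g x) : cube n" by (rule lmap_cube[OF s gact_cube[OF g x]])
 fix j assume j: "j < n"
 show "gact n g (lmap m n ph x) j = lmap m n ph (gact m g x) j"
 proof (cases "ph j")
  case (Inl e)
  hence "e = 0 \<or> e = 1" using bspecD(1)[OF s j] by force
  thus ?thesis using Inl j x g gact_cube[OF g x] by (elim disjE) (simp_all add: lmap_def gact_def[of n] unit_fun_def)
 next
  case (Inr i)
  thus ?thesis using j x gact_cube[OF g x] bspecD(2)[OF s j]
   by (simp add: lmap_def gact_def[of n]) (simp add: gact_def)
 qed
qed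

lemma gact_linear_ext:
 assumes "unit_fun g" "box_hom m n f" "x : cube m"
 shows "gact n g (linear_ext m n f x) = linear_ext m n f (gact m g x)"
 using box_spec[OF assms(2)] linear_ext_bmap gact_lmap[OF assms(1) _ assms(3)] by metis

lemma push_pt:
 assumes C: "cubical_set C" and g: "unit_fun g" and c: "c : cells C n" and x: "x : cube n"
 shows "push C g (pt C n c x) = pt C n c (gact n g x)"
proof -
 have *: "pt C n' c' (gact n' g x') = pt C n c (gact n g x)" if "(n', c', x') : pt C n c x" for n' c' x'
 proof -
  have r: "((n, c, x), (n', c', x')) : real_rel C" using that by (simp add: pt_def)
  hence m: "c' : cells C n'" "x' : cube n'"
   using real_equiv[OF C] unfolding equiv_def glue_points_def by auto
  have "pt C n c x = pt C n' c' x'" using pt_eq_iff[OF C c x m] r by simp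
  thus ?thesis
   using pt_respects[OF C _ c x m, where F = "\<lambda>n c x. pt C n c (gact n g x)"]
    pt_act[OF C _ _ gact_cube[OF g]] gact_linear_ext[OF g] by simp
 qed
 have "(n, c, x) : pt C n c x"
  unfolding pt_def using equiv_class_self[OF real_equiv[OF C]] c x by (simp add: mem_glue)
 hence "pt C n c (gact n g x) \<subseteq> push C g (pt C n c x)"
  unfolding push_def pt_def[of C n c "gact n g x"] by force
 moreover have "push C g (pt C n c x) \<subseteq> pt C n c (gact n g x)"
  unfolding push_def using * unfolding pt_def[of C _ _ "gact _ g _"] by fastforce
 ultimately show ?thesis by blast
qed

section \<open>Concatenating and cutting points of cubes\<close>

definition cat :: "nat => nat => vec => vec => nat => real" where
 "cat p n q x = (\<lambda>i\<in>{..<p + n}. if i < p then q i else x (i - p))"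

definition lcut :: "nat => vec => nat => real" where
 "lcut p y = (\<lambda>i\<in>{..<p}. y i)"

definition rcut :: "nat => nat => vec => nat => real" where
 "rcut p n y = (\<lambda>i\<in>{..<n}. y (p + i))"

lemma cat_cube: "q : cube p ==> x : cube n ==> cat p n q x : cube (p + n)"
 unfolding cat_def by (rule cube_restrictI) (use cube_coord in auto)

lemma lcut_cube: "y : cube (p + n) ==> lcut p y : cube p"
 unfolding lcut_def by (rule cube_restrictI) (use cube_coord in auto)

lemma rcut_cube: "y : cube (p + n) ==> rcut p n y : cube n"
 unfolding rcut_def by (rule cube_restrictI) (use cube_coord in auto)

lemma lcut_cat: "q : cube p ==> lcut p (cat p n q x) = q"
 by (auto simp: lcut_def cat_def fun_eq_iff cube_undef)

lemma rcut_cat: "x : cube n ==> rcut p n (cat p n q x) = x"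
 by (auto simp: rcut_def cat_def fun_eq_iff cube_undef)

lemma cmap_lcut: "cmap (p + n) p (lcut p)"
 unfolding lcut_def by (rule cmap_restrictI) (simp add: cmono_coord)

lemma cmap_rcut: "cmap (p + n) n (rcut p n)"
 unfolding rcut_def by (rule cmap_restrictI) (simp add: cmono_coord)

lemma cmap_cat:
 assumes "cmap k p f" "cmap k n g"
 shows "cmap k (p + n) (\<lambda>u. cat p n (f u) (g u))"
proof -
 have "cmono k (\<lambda>u. if i < p then f u i else g u (i - p))" if "i < p + n" for i
  using that cmapD(2)[OF assms(1), of i] cmapD(2)[OF assms(2), of "i - p"] by (cases "i < p") auto
 thus ?thesis unfolding cat_def by (rule cmap_restrictI)
qed

lemma cb_cat: "q' : cb p q e ==> x' : cb n x e ==> cat p n q' x' : cb (p + n) (cat p n q x) e"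
 using cat_cube[of q' p x' n] by (auto simp: cb_def cat_def)

section \<open>Systems of reparametrizations with a parameter in a cube\<close>

text \<open>Joint monotonicity and continuity in the parameter and the level are expressed by
  substitution of monotone maps from arbitrary cubes, which spares a separate treatment of functions
  on products.\<close>

definition gfun :: "nat => gsys => bool" where
 "gfun m G \<longleftrightarrow> (ALL k a g. cmap k m a --> cmono k g --> cmono k (\<lambda>u. G (a u) (g u))) \<and>
  (ALL q:cube m. G q 0 = 0 \<and> G q 1 = 1)"

lemma gfun_cmono: "gfun m G ==> cmap k m a ==> cmono k g ==> cmono k (\<lambda>u. G (a u) (g u))"
 by (simp add: gfun_def)

lemma cmap_const: "x : cube n ==> cmap k n (\<lambda>_. x)"
 unfolding cmap_def by (auto intro!: cmono_const dest: cube_coord)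

text \<open>The bounds are read off from constant functions on the 0-dimensional cube.\<close>

lemma gfun_unit:
 assumes "gfun m G" "q : cube m"
 shows "unit_fun (G q)"
proof -
 have "cmono 0 (\<lambda>u. G q t)" if "0 \<le> t" "t \<le> 1" for t
  using gfun_cmono[OF assms(1) cmap_const[OF assms(2)] cmono_const[OF that]] .
 moreover have "(\<lambda>_. undefined) : cube 0" by (simp add: cube_def)
 ultimately have "0 \<le> G q t \<and> G q t \<le> 1" if "0 \<le> t" "t \<le> 1" for t
  using cmonoD(2,3) that by blast
 thus ?thesis using assms unfolding unit_fun_def gfun_def by blast
qed

lemma gfun_cmap: "gfun m G ==> cmap k m a ==> cmap k n h ==> cmap k n (\<lambda>u. gact n (G (a u)) (h u))"
 unfolding gact_def by (rule cmap_restrictI) (use gfun_cmono cmapD(2) in blast)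

lemma gfun_cont:
 assumes G: "gfun p G" and q: "q : cube p" and x: "x : cube n" and e: "e > 0"
 shows "EX d>0. ALL q':cb p q d. ALL x':cb n x d. gact n (G q') x' : cb n (gact n (G q) x) e"
proof -
 have m: "cmap (p + n) n (\<lambda>y. gact n (G (lcut p y)) (rcut p n y))"
  by (rule gfun_cmap[OF G cmap_lcut cmap_rcut])
 obtain d where d: "d > 0" "ALL y:cb (p + n) (cat p n q x) d.
   gact n (G (lcut p y)) (rcut p n y) : cb n (gact n (G q) x) e"
  using cmap_cont[OF m cat_cube[OF q x] e] lcut_cat[OF q] rcut_cat[OF x] by auto
 have "gact n (G q') x' : cb n (gact n (G q) x) e" if "q' : cb p q d" "x' : cb n x d" for q' x'
 proof -
  have "q' : cube p" "x' : cube n" using that cb_cube by blast+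
  thus ?thesis using d(2)[rule_format, OF cb_cat[OF that]] lcut_cat rcut_cat by simp
 qed
 thus ?thesis using d(1) by blast
qed

text \<open>A chart controls one cell at a time, whereas \<open>th\<close> moves between cells.
  Continuity therefore comes from a tube: the points that all parameters in a compact box send into
  \<open>V\<close> form an open set. For the circulation, the step from \<open>a\<close> to
  \<open>b\<close> first moves the parameter with the point fixed, within one chart, and then the
  point with the parameter fixed.\<close>

lemma stream_push:
 assumes C: "cubical_set C" and G: "gfun p G" and th: "stream_map (dcube p) (realization C) th"
 shows "stream_map (dcube p) (realization C) (\<lambda>q. push C (G q) (th q))"
proof -
 define J where "J = (\<lambda>q. push C (G q) (th q))"
 let ?T = "topo (realization C)"
 have thp: "th q : points C" if "q : cube p" for q
  using th that unfolding stream_map_dcube continuous_map_def topspace_cube topspace_real[OF C] by blast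
 have Jp: "J q : points C" if q: "q : cube p" for q
 proof -
  obtain n c x where n: "c : cells C n" "x : cube n" "th q = pt C n c x" using thp[OF q] by (rule pointsE)
  thus ?thesis
   using push_pt[OF C gfun_unit[OF G q] n(1,2)] pt_points[OF C n(1) gact_cube[OF gfun_unit[OF G q] n(2)]]
   by (simp add: J_def)
 qed
 have tube: "EX e>0. EX B. openin ?T B \<and> th q0 : B \<and> (ALL q:cb p q0 e. ALL Z:B. push C (G q) Z : V)"
  if V: "openin ?T V" and q0: "q0 : cube p" "J q0 : V" for V q0
 proof -
  obtain n c x where z: "c : cells C n" "x : cube n" "th q0 = pt C n c x" using thp[OF q0(1)] by (rule pointsE)
  have "openin (cube_topology n) (chart_pre C n c V)" using V z(1) by (simp add: openin_real)
  moreover have "gact n (G q0) x : chart_pre C n c V"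
   using q0 z push_pt[OF C gfun_unit[OF G q0(1)] z(1,2)] gact_cube[OF gfun_unit[OF G q0(1)] z(2)]
   by (simp add: J_def chart_pre_def)
  ultimately obtain e1 where e1: "e1 > 0" "cb n (gact n (G q0) x) e1 \<subseteq> chart_pre C n c V"
   using openin_cubeD by blast
  obtain e where e: "e > 0" "ALL q':cb p q0 e. ALL x':cb n x e. gact n (G q') x' : cb n (gact n (G q0) x) e1"
   using gfun_cont[OF G q0(1) z(2) e1(1)] by blast
  \<comment> \<open>A closed box of half the radius: compact, and contained in the ball on which the
    chart at \<open>q0\<close> is under control.\<close>
  define K where "K = {y : cube p. ALL i<p. \<bar>y i - q0 i\<bar> \<le> e/2}"
  have K: "K \<subseteq> cb p q0 e" using e(1) by (auto simp: K_def cb_def)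
  define B where "B = {Z : points C. ALL q:K. push C (G q) Z : V}"
  have "th q0 : B"
  proof -
   have "push C (G q) (pt C n c x) : V" if q: "q : K" for q
   proof -
    have qp: "q : cube p" using q by (simp add: K_def)
    have "gact n (G q) x : chart_pre C n c V"
     using e(2) e1(2) q K cb_self[OF z(2) e(1)] by blast
    thus ?thesis using push_pt[OF C gfun_unit[OF G qp] z(1,2)] by (simp add: chart_pre_def)
   qed
   thus ?thesis using pt_points[OF C z(1,2)] by (simp add: B_def z(3))
  qed
  moreover have "openin ?T B"
   unfolding openin_real
  proof (intro conjI allI ballI)
   fix n' c' assume c': "c' : cells C n'"
   have W: "openin (cube_topology n') (chart_pre C n' c' V)" using V c' by (simp add: openin_real)
   have B': "chart_pre C n' c' B = {x : cube n'. ALL q:K. gact n' (G q) x : chart_pre C n' c' V}"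
   proof -
    have "push C (G q) (pt C n' c' x) : V \<longleftrightarrow> gact n' (G q) x : chart_pre C n' c' V"
     if "x : cube n'" "q : K" for x q
    proof -
     have "q : cube p" using that(2) by (simp add: K_def)
     thus ?thesis using push_pt[OF C gfun_unit[OF G] c' that(1)] gact_cube[OF gfun_unit[OF G] that(1)]
      by (simp add: chart_pre_def)
    qed
    moreover have "chart_pre C n' c' B = {x : cube n'. pt C n' c' x : B}" by (simp only: chart_pre_def)
    ultimately show ?thesis using pt_points[OF C c'] by (auto simp: B_def)
   qed
   show "openin (cube_topology n') (chart_pre C n' c' B)"
    unfolding openin_cube
   proof (intro conjI ballI)
    show "chart_pre C n' c' B \<subseteq> cube n'" by (auto simp: chart_pre_def)
    fix x0 assume x0: "x0 : chart_pre C n' c' B"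
    hence x0c: "x0 : cube n'" by (simp add: chart_pre_def)
    \<comment> \<open>Compactness of \<open>K\<close>, run over the whole cube: a parameter outside
      \<open>K\<close> has a ball that misses \<open>K\<close>, where nothing is asked.\<close>
    have "EX d>0. ALL q:cube p \<inter> K. ALL x:cb n' x0 d. gact n' (G q) x : chart_pre C n' c' V"
    proof (rule cube_compact_induct[where R = "\<lambda>S. EX d>0. ALL q:S \<inter> K. ALL x:cb n' x0 d. gact n' (G q) x : chart_pre C n' c' V"])
     fix q assume q: "q : cube p"
     show "EX e>0. EX d>0. ALL q:cb p q e \<inter> K. ALL x:cb n' x0 d. gact n' (G q) x : chart_pre C n' c' V"
     proof (cases "q : K")
      case True
      hence "gact n' (G q) x0 : chart_pre C n' c' V" using x0 B' by blast
      then obtain e2 where e2: "e2 > 0" "cb n' (gact n' (G q) x0) e2 \<subseteq> chart_pre C n' c' V"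
       using openin_cubeD[OF W] by blast
      then obtain d where "d > 0" "ALL q':cb p q d. ALL x':cb n' x0 d. gact n' (G q') x' : cb n' (gact n' (G q) x0) e2"
       using gfun_cont[OF G q x0c] by blast
      thus ?thesis using e2(2) by blast
     next
      case False
      then obtain i where i: "i < p" "\<bar>q i - q0 i\<bar> > e/2" using q by (auto simp: K_def not_le)
      have "y \<notin> K" if "y : cb p q (\<bar>q i - q0 i\<bar> - e/2)" for y
      proof
       assume "y : K"
       hence "\<bar>y i - q0 i\<bar> \<le> e/2" using i(1) by (simp add: K_def)
       moreover have "\<bar>y i - q i\<bar> < \<bar>q i - q0 i\<bar> - e/2" using that i(1) by (simp add: cb_def)
       ultimately show False by linarith
      qed
      hence "cb p q (\<bar>q i - q0 i\<bar> - e/2) \<inter> K = {}" by blast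
      thus ?thesis using i(2)
       by (intro exI[of _ "\<bar>q i - q0 i\<bar> - e/2"]) (auto intro: exI[of _ "1::real"])
     qed
    next
     fix S T assume "EX d>0. ALL q:S \<inter> K. ALL x:cb n' x0 d. gact n' (G q) x : chart_pre C n' c' V"
      "EX d>0. ALL q:T \<inter> K. ALL x:cb n' x0 d. gact n' (G q) x : chart_pre C n' c' V"
     then obtain d d' where "d > 0" "ALL q:S \<inter> K. ALL x:cb n' x0 d. gact n' (G q) x : chart_pre C n' c' V"
      "d' > 0" "ALL q:T \<inter> K. ALL x:cb n' x0 d'. gact n' (G q) x : chart_pre C n' c' V" by blast
     moreover have "cb n' x0 (min d d') \<subseteq> cb n' x0 d \<inter> cb n' x0 d'" by (simp add: cb_mono)
     ultimately show "EX d>0. ALL q:(S \<union> T) \<inter> K. ALL x:cb n' x0 d. gact n' (G q) x : chart_pre C n' c' V"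
      by (intro exI[of _ "min d d'"]) auto
    next
     fix S T assume "EX d>0. ALL q:S \<inter> K. ALL x:cb n' x0 d. gact n' (G q) x : chart_pre C n' c' V" "T \<subseteq> S"
     thus "EX d>0. ALL q:T \<inter> K. ALL x:cb n' x0 d. gact n' (G q) x : chart_pre C n' c' V" by blast
    qed (use zero_less_one in blast)
    then obtain d where d: "d > 0" "ALL q:cube p \<inter> K. ALL x:cb n' x0 d. gact n' (G q) x : chart_pre C n' c' V"
     by blast
    have "K \<subseteq> cube p" by (auto simp: K_def)
    hence "cb n' x0 d \<subseteq> chart_pre C n' c' B" using d(2) cb_cube[of n' x0 d] unfolding B' by blast
    thus "EX e>0. cb n' x0 e \<subseteq> chart_pre C n' c' B" using d(1) by blast
   qed
  qed (auto simp: B_def)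
  moreover have "cb p q0 (e/2) \<subseteq> K" by (auto simp: K_def cb_def)
  moreover have "ALL q:K. ALL Z:B. push C (G q) Z : V" by (simp add: B_def)
  ultimately show ?thesis using e(1) by (intro exI[of _ "e/2"] conjI exI[of _ B]) auto
 qed
 have openth: "openin (cube_topology p) {q : cube p. th q : B}" if "openin ?T B" for B
  using th that unfolding stream_map_dcube continuous_map_def topspace_cube by blast
 have nb: "EX e>0. EX B. openin ?T B \<and> (ALL q:cb p q0 e. th q : B) \<and> (ALL q:cb p q0 e. ALL Z:B. push C (G q) Z : V)"
  if V: "openin ?T V" and q0: "q0 : cube p" "J q0 : V" for V q0
 proof -
  obtain e B where e: "e > 0" and B: "openin ?T B" "th q0 : B" "ALL q:cb p q0 e. ALL Z:B. push C (G q) Z : V"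
   using tube[OF V q0] by blast
  obtain d where d: "d > 0" "cb p q0 d \<subseteq> {q : cube p. th q : B}"
   using openin_cubeD[OF openth[OF B(1)], of q0] q0(1) B(2) by blast
  have "cb p q0 (min d e) \<subseteq> cb p q0 d \<inter> cb p q0 e" by (simp add: cb_mono)
  thus ?thesis using d e B by (intro exI[of _ "min d e"]) (auto intro!: exI[of _ B])
 qed
 have "stream_map (dcube p) (realization C) J"
  unfolding stream_map_dcube
 proof (intro conjI allI impI)
  show "continuous_map (cube_topology p) ?T J"
   unfolding continuous_map_def topspace_cube topspace_real[OF C]
  proof (intro conjI allI impI)
   show "J : cube p \<rightarrow> points C" using Jp by blast
   fix V assume V: "openin ?T V"
   show "openin (cube_topology p) {x : cube p. J x : V}"
    unfolding openin_cube
   proof (intro conjI ballI)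
    fix q0 assume "q0 : {x : cube p. J x : V}"
    hence q0: "q0 : cube p" "J q0 : V" by simp_all
    obtain e B where e: "e > 0" "ALL q:cb p q0 e. th q : B" "ALL q:cb p q0 e. ALL Z:B. push C (G q) Z : V"
     using nb[OF V q0] by blast
    hence "cb p q0 e \<subseteq> {x : cube p. J x : V}" using cb_cube[of p q0 e] unfolding J_def by blast
    thus "EX e>0. cb p q0 e \<subseteq> {x : cube p. J x : V}" using e(1) by blast
   qed auto
  qed
  fix V x y assume V: "openin ?T V" and xy: "(x, y) : crel p {z : cube p. J z : V}"
  let ?U = "{z : cube p. J z : V}"
  have "crel p ?U \<subseteq> {(x, y). x : ?U \<and> y : ?U \<and> (J x, J y) : circ (realization C) V}"
  proof (rule crel_least)
   show "preorder_on ?U {(x, y). x : ?U \<and> y : ?U \<and> (J x, J y) : circ (realization C) V}"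
    using circ_real_preorder[OF V] unfolding preorder_on_def refl_on_def trans_def by blast
   fix x y assume x: "x : ?U" and y: "y : ?U" and xy: "le p x y" "ivl p x y \<subseteq> ?U"
   have "(J x, J y) : circ (realization C) V"
   proof (rule seg_chain[of x p y "\<lambda>a b. (J a, J b) : circ (realization C) V"])
    fix z assume "z : ivl p x y"
    hence z: "z : cube p" "J z : V" using xy(2) by auto
    obtain e B where e: "e > 0" and B: "openin ?T B" "ALL q:cb p z e. th q : B"
      "ALL q:cb p z e. ALL Z:B. push C (G q) Z : V"
     using nb[OF V z] by blast
    have "(J a, J b) : circ (realization C) V"
     if ab: "a : cb p z e" "b : cb p z e" "le p a z" "le p z b" for a b
    proof -
     have abl: "le p a b" using le_trans[OF ab(3,4)] .
     have abc: "a : cube p" "b : cube p" using ab cb_cube by blast+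
     have iv: "ivl p a b \<subseteq> cb p z e" by (rule cb_ivl[OF ab(1,2)])
     obtain n c xi where z: "c : cells C n" "xi : cube n" "th a = pt C n c xi" using thp[OF abc(1)] by (rule pointsE)
     have W: "openin (cube_topology n) (chart_pre C n c V)" using V z(1) by (simp add: openin_real)
     have sub: "{q : cube p. gact n (G q) xi : chart_pre C n c V} \<supseteq> cb p z e"
     proof
      fix q assume q: "q : cb p z e"
      hence qc: "q : cube p" using cb_cube by blast
      have "push C (G q) (pt C n c xi) : V" using B(2,3) q ab(1) z(3) by metis
      thus "q : {q : cube p. gact n (G q) xi : chart_pre C n c V}"
       using push_pt[OF C gfun_unit[OF G qc] z(1,2)] gact_cube[OF gfun_unit[OF G qc] z(2)] qc
       by (simp add: chart_pre_def)
     qed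
     have "(a, b) : crel p {q : cube p. gact n (G q) xi : chart_pre C n c V}"
      using sub ab iv abl by (intro crelI) blast+
     hence "(gact n (G a) xi, gact n (G b) xi) : crel n (chart_pre C n c V)"
      by (rule crel_cmap[OF gfun_cmap[OF G cmap_id cmap_const[OF z(2)]] W])
     hence 1: "(push C (G a) (th a), push C (G b) (th a)) : circ (realization C) V"
      using circ_chart[OF V z(1)] push_pt[OF C gfun_unit[OF G abc(1)] z(1,2)]
       push_pt[OF C gfun_unit[OF G abc(2)] z(1,2)] z(3) by simp
     have "(a, b) : crel p {q : cube p. th q : B}"
      using B(2) ab iv abl cb_cube[of p z e] by (intro crelI) blast+
     hence "(th a, th b) : circ (realization C) B" using th B(1) by (simp add: stream_map_dcube)
     moreover have "circ (realization C) B \<subseteq> {(Z, Z'). Z : B \<and> Z' : B \<and>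
       (push C (G b) Z, push C (G b) Z') : circ (realization C) V}"
     proof (rule circ_least[OF B(1)])
      show "preorder_on B {(Z, Z'). Z : B \<and> Z' : B \<and> (push C (G b) Z, push C (G b) Z') : circ (realization C) V}"
       using circ_real_preorder[OF V] B(3) ab(2) unfolding preorder_on_def refl_on_def trans_def by blast
      fix n' c' xi xi' assume c': "c' : cells C n'" and x: "(xi, xi') : crel n' (chart_pre C n' c' B)"
      have W': "openin (cube_topology n') (chart_pre C n' c' V)" using V c' by (simp add: openin_real)
      have pb: "push C (G b) (pt C n' c' w) = pt C n' c' (gact n' (G b) w)" if "w : cube n'" for w
       by (rule push_pt[OF C gfun_unit[OF G abc(2)] c' that])
      have "chart_pre C n' c' B \<subseteq> {w : cube n'. gact n' (G b) w : chart_pre C n' c' V}"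
       using B(3)[rule_format, OF ab(2)] pb[symmetric] gact_cube[OF gfun_unit[OF G abc(2)]]
       by (auto simp: chart_pre_def)
      hence "(gact n' (G b) xi, gact n' (G b) xi') : crel n' (chart_pre C n' c' V)"
       using x crel_mono by (intro crel_cmap[OF gfun_cmap[OF G cmap_const[OF abc(2)] cmap_id] W']) blast
      hence "(pt C n' c' (gact n' (G b) xi), pt C n' c' (gact n' (G b) xi')) : circ (realization C) V"
       by (rule circ_chart[OF V c'])
      moreover have "xi : chart_pre C n' c' B" "xi' : chart_pre C n' c' B" using x crel_subset by blast+
      ultimately show "(pt C n' c' xi, pt C n' c' xi') : {(Z, Z'). Z : B \<and> Z' : B \<and>
        (push C (G b) Z, push C (G b) Z') : circ (realization C) V}"
       using pb by (simp add: chart_pre_def)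
     qed
     ultimately have "(push C (G b) (th a), push C (G b) (th b)) : circ (realization C) V" by blast
     thus ?thesis using circ_real_trans[OF V 1] by (simp add: J_def)
    qed
    thus "EX e>0. ALL a:cb p z e. ALL b:cb p z e. le p a z --> le p z b --> (J a, J b) : circ (realization C) V"
     using e by blast
   qed (use x y xy in \<open>auto intro: circ_real_trans[OF V]\<close>)
   thus "(x, y) : {(x, y). x : ?U \<and> y : ?U \<and> (J x, J y) : circ (realization C) V}" using x y by simp
  qed
  thus "(J x, J y) : circ (realization C) V" using xy by blast
 qed
 thus ?thesis by (simp add: J_def)
qed

section \<open>Cells of the subdivided cube\<close>

text \<open>In each direction a cell of the subdivided cube is at one of the three levels 0, 1, 2 or
  runs through the lower or the upper half, according to whether the shift \<open>d j\<close> is 0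
  or 1.\<close>

definition sspec :: "nat => nat => (nat => nat + nat) => (nat => nat) => bool" where
 "sspec k m ps d \<longleftrightarrow> (ALL j<m. ALL e. ps j = Inl e --> e \<le> 2) \<and> (ALL j<m. ALL i. ps j = Inr i --> i < k \<and> d j \<le> 1) \<and>
  (ALL j<m. ALL j'<m. ALL i. ps j = Inr i --> ps j' = Inr i --> j = j')"

definition smap :: "nat => nat => (nat => nat + nat) => (nat => nat) => mor" where
 "smap k m ps d = (\<lambda>x\<in>grid 1 k. \<lambda>j\<in>{..<m}. case ps j of Inl e => e | Inr i => x i + d j)"

lemma sspecD:
 assumes "sspec k m ps d"
 shows "j < m ==> ps j = Inl e ==> e \<le> 2" "j < m ==> ps j = Inr i ==> i < k"
  "j < m ==> ps j = Inr i ==> d j \<le> 1"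
  "j < m ==> j' < m ==> ps j = Inr i ==> ps j' = Inr i ==> j = j'"
 using assms unfolding sspec_def by simp_all

lemma grid_undef: "x : grid k n ==> \<not> i < n ==> x i = undefined"
 by (auto simp: grid_def PiE_iff extensional_def)

lemma grid_restrictI: "(\<And>i. i < n ==> f i \<le> k) ==> (\<lambda>i\<in>{..<n}. f i) : grid k n"
 by (auto simp: grid_def)

lemma grid_le: "x : grid k n ==> y : grid k' n ==> x \<le> y \<longleftrightarrow> (ALL i<n. x i \<le> y i)"
 unfolding le_fun_def using grid_undef by (metis order_refl)

lemma grid_eqI: "x : grid k n ==> y : grid k' n ==> (\<And>i. i < n ==> x i = y i) ==> x = y"
 by (rule ext) (metis grid_undef)

lemma grid_update: "x : grid k n ==> i < n ==> e \<le> k ==> x(i := e) : grid k n"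
 by (auto simp: grid_def PiE_iff extensional_def)

lemma smap_grid:
 assumes "sspec k m ps d" "x : grid 1 k"
 shows "smap k m ps d x : grid 2 m"
proof -
 have "(case ps j of Inl e => e | Inr i => x i + d j) \<le> 2" if "j < m" for j
 proof (cases "ps j")
  case (Inl e)
  thus ?thesis using sspecD(1)[OF assms(1) that] by simp
 next
  case (Inr i)
  thus ?thesis
   using sspecD(3)[OF assms(1) that Inr] grid_bound[OF assms(2) sspecD(2)[OF assms(1) that Inr]] by simp
 qed
 thus ?thesis using grid_restrictI[of m "\<lambda>j. case ps j of Inl e => e | Inr i => x i + d j" 2] assms(2)
  by (simp add: smap_def)
qed

text \<open>The interval is a product of two-element chains, one for each coordinate in the set
  \<open>D\<close> where its ends differ.\<close>

lemma interval_boolean: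
 assumes p: "p : grid N m" and q: "q : grid N m" and pq: "\<And>i. i < m ==> p i \<le> q i \<and> q i \<le> p i + 1"
 shows "boolean_interval (grid N m) {y : grid N m. p \<le> y \<and> y \<le> q}"
proof -
 define D where "D = {i. i < m \<and> p i < q i}"
 define n where "n = card D"
 have "finite D" by (simp add: D_def)
 then obtain be where be: "bij_betw be {..<n} D"
  using ex_bij_betw_nat_finite[of D] unfolding n_def atLeast0LessThan by blast
 define al where "al = the_inv_into {..<n} be"
 have al: "al i < n" "be (al i) = i" if "i : D" for i
  using bij_betwE[OF bij_betw_the_inv_into[OF be]] f_the_inv_into_f_bij_betw[OF be] that by (auto simp: al_def)
 have beD: "be i : D" if "i < n" for i using bij_betwE[OF be] that by blast
 have albe: "al (be i) = i" if "i < n" for i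
  using the_inv_into_f_f[OF bij_betw_imp_inj_on[OF be]] that by (simp add: al_def)
 have D: "p i < q i \<and> q i = p i + 1 \<and> i < m" if "i : D" for i using that pq[of i] by (force simp: D_def)
 define h where "h = (\<lambda>x::nat=>nat. \<lambda>i\<in>{..<m}. if i : D then p i + x (al i) else p i)"
 let ?B = "{y : grid N m. p \<le> y \<and> y \<le> q}"
 have h: "h x : ?B" if x: "x : grid 1 n" for x
 proof -
  have b: "p i \<le> h x i \<and> h x i \<le> q i" if i: "i < m" for i
   using pq[OF i] D[of i] grid_bound[OF x al(1)[of i]] i by (auto simp: h_def)
  hence "h x i \<le> N" if "i < m" for i using grid_bound[OF q that] that order_trans by blast
  hence "h x : grid N m" unfolding h_def by (intro grid_restrictI) auto
  thus ?thesis using b p q by (auto simp: grid_le)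
 qed
 have le: "x \<le> y \<longleftrightarrow> h x \<le> h y" if x: "x : grid 1 n" and y: "y : grid 1 n" for x y
 proof -
  have hg: "h x : grid N m" "h y : grid N m" using h[OF x] h[OF y] by auto
  show ?thesis
   unfolding grid_le[OF x y] grid_le[OF hg]
  proof
   assume "ALL i<n. x i \<le> y i"
   thus "ALL i<m. h x i \<le> h y i" using al(1) by (auto simp: h_def)
  next
   assume a: "ALL i<m. h x i \<le> h y i"
   show "ALL i<n. x i \<le> y i"
   proof (intro allI impI)
    fix i assume i: "i < n"
    hence "h x (be i) \<le> h y (be i)" using a D[OF beD] by blast
    thus "x i \<le> y i" using beD[OF i] D[OF beD[OF i]] albe[OF i] by (simp add: h_def)
   qed
  qed
 qed
 have "bij_betw h (grid 1 n) ?B"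
 proof (rule bij_betwI')
  fix x y assume "x : grid 1 n" "y : grid 1 n"
  thus "(h x = h y) = (x = y)" using le[of x y] le[of y x] by (auto intro: antisym)
 next
  fix y assume y: "y : ?B"
  define x where "x = (\<lambda>i\<in>{..<n}. y (be i) - p (be i))"
  have yb: "p i \<le> y i \<and> y i \<le> q i" if "i < m" for i using y that by (simp add: le_fun_def)
  have x: "x : grid 1 n"
   unfolding x_def
  proof (rule grid_restrictI)
   fix i assume "i < n"
   thus "y (be i) - p (be i) \<le> 1" using D[OF beD] yb[of "be i"] by fastforce
  qed
  have "h x = y"
  proof (rule grid_eqI)
   show "h x : grid N m" using h[OF x] by blast
   show "y : grid N m" using y by blast
   fix i assume i: "i < m"
   show "h x i = y i"
   proof (cases "i : D")
    case True
    thus ?thesis using i al[OF True] yb[OF i] by (simp add: h_def x_def)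
   next
    case False
    hence "p i = q i" using pq[OF i] i by (auto simp: D_def)
    thus ?thesis using False i yb[OF i] by (simp add: h_def)
   qed
  qed
  thus "EX x:grid 1 n. y = h x" using x by blast
 qed (use h in blast)
 hence "EX m' h. bij_betw h (grid 1 m') ?B \<and> (ALL x:grid 1 m'. ALL y:grid 1 m'. x \<le> y \<longleftrightarrow> h x \<le> h y)"
  using le by blast
 moreover have "p \<le> q" using pq p q by (simp add: grid_le)
 ultimately show ?thesis unfolding boolean_interval_def using p q by blast
qed

lemma cells_lattice: "cells (lattice_cset L) m = {f : grid 1 m \<rightarrow>\<^sub>E L.
   (ALL x:grid 1 m. ALL y:grid 1 m. f (inf x y) = inf (f x) (f y) \<and> f (sup x y) = sup (f x) (f y)) \<and>
   (ALL B. boolean_interval (grid 1 m) B --> boolean_interval L (f ` B))}"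
 by (simp add: lattice_cset_def)

lemma inf_sup_grid: "x : grid k n ==> y : grid k n ==> inf x y : grid k n"
 "x : grid k n ==> y : grid k n ==> sup x y : grid k n"
 by (auto simp: grid_def PiE_iff extensional_def inf_nat_def sup_nat_def min.coboundedI1)

text \<open>The image of an interval is again an interval, and its ends differ by at most 1 in each
  coordinate since every variable occurs with coefficient 1.\<close>

lemma smap_cell:
 assumes S: "sspec k m ps d"
 shows "smap k m ps d : cells (sd2_cube m) k"
 unfolding cells_lattice
proof (intro CollectI conjI ballI allI impI)
 let ?s = "smap k m ps d"
 show "?s : grid 1 k \<rightarrow>\<^sub>E grid 2 m" using smap_grid[OF S] by (auto simp: smap_def)
 fix x y assume x: "x : grid 1 k" and y: "y : grid 1 k"
 have sx: "?s x : grid 2 m" "?s y : grid 2 m" using smap_grid[OF S] x y by blast+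
 show "?s (inf x y) = inf (?s x) (?s y)"
 proof (rule grid_eqI)
  show "?s (inf x y) : grid 2 m" by (rule smap_grid[OF S inf_sup_grid(1)[OF x y]])
  show "inf (?s x) (?s y) : grid 2 m" by (rule inf_sup_grid(1)[OF sx])
  fix j assume "j < m"
  thus "?s (inf x y) j = inf (?s x) (?s y) j"
   using x y inf_sup_grid(1)[OF x y] by (cases "ps j") (simp_all add: smap_def inf_nat_def min_def)
 qed
 show "?s (sup x y) = sup (?s x) (?s y)"
 proof (rule grid_eqI)
  show "?s (sup x y) : grid 2 m" by (rule smap_grid[OF S inf_sup_grid(2)[OF x y]])
  show "sup (?s x) (?s y) : grid 2 m" by (rule inf_sup_grid(2)[OF sx])
  fix j assume "j < m"
  thus "?s (sup x y) j = sup (?s x) (?s y) j"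
   using x y inf_sup_grid(2)[OF x y] by (cases "ps j") (simp_all add: smap_def sup_nat_def max_def)
 qed
next
 let ?s = "smap k m ps d"
 fix B assume "boolean_interval (grid 1 k) B"
 then obtain a b where ab: "a : grid 1 k" "b : grid 1 k" "a \<le> b" "B = {x : grid 1 k. a \<le> x \<and> x \<le> b}"
  unfolding boolean_interval_def by blast
 have s: "?s x j = (case ps j of Inl e => e | Inr i => x i + d j)" if "x : grid 1 k" "j < m" for x j
  using that by (simp add: smap_def)
 have lt: "a i \<le> b i" "b i \<le> 1" if "i < k" for i using ab(3) grid_bound[OF ab(2) that] by (simp_all add: le_fun_def)
 have sab: "?s a j \<le> ?s b j \<and> ?s b j \<le> ?s a j + 1" if "j < m" for j
  using lt sspecD(2)[OF S that] by (cases "ps j") (fastforce simp: s[OF ab(1) that] s[OF ab(2) that])+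
 have "?s ` B = {y : grid 2 m. ?s a \<le> y \<and> y \<le> ?s b}"
 proof
  show "?s ` B \<subseteq> {y : grid 2 m. ?s a \<le> y \<and> y \<le> ?s b}"
  proof (rule image_subsetI)
   fix x assume "x : B"
   hence x: "x : grid 1 k" "a \<le> x" "x \<le> b" using ab(4) by auto
   have "?s a j \<le> ?s x j \<and> ?s x j \<le> ?s b j" if "j < m" for j
    using x(2,3) by (cases "ps j") (simp_all add: s[OF ab(1) that] s[OF ab(2) that] s[OF x(1) that] le_fun_def)
   thus "?s x : {y : grid 2 m. ?s a \<le> y \<and> y \<le> ?s b}"
    using grid_le[OF smap_grid[OF S ab(1)] smap_grid[OF S x(1)]] grid_le[OF smap_grid[OF S x(1)] smap_grid[OF S ab(2)]]
     smap_grid[OF S x(1)] by simp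
  qed
  show "{y : grid 2 m. ?s a \<le> y \<and> y \<le> ?s b} \<subseteq> ?s ` B"
  proof
   fix y assume y: "y : {y : grid 2 m. ?s a \<le> y \<and> y \<le> ?s b}"
   hence yg: "y : grid 2 m" and yb: "?s a j \<le> y j \<and> y j \<le> ?s b j" if "j < m" for j
    by (simp_all add: le_fun_def)
   \<comment> \<open>The preimage of \<open>y\<close>: variables that occur are recovered by undoing
     the shift, the others may take any value in the interval and get the lower end
     \<open>a i\<close>.\<close>
   define x where "x = (\<lambda>i\<in>{..<k}. if EX j<m. ps j = Inr i then y (THE j. j < m \<and> ps j = Inr i) - d (THE j. j < m \<and> ps j = Inr i) else a i)"
   have xj: "x i = y j - d j" if "j < m" "ps j = Inr i" for i j
   proof -
    have "(THE j. j < m \<and> ps j = Inr i) = j" using that sspecD(4)[OF S] by blast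
    thus ?thesis using that sspecD(2)[OF S that] by (auto simp: x_def)
   qed
   have xa: "x i = a i" if "i < k" "\<nexists>j. j < m \<and> ps j = Inr i" for i using that by (auto simp: x_def)
   have xb: "a i \<le> x i \<and> x i \<le> b i" if i: "i < k" for i
   proof (cases "EX j<m. ps j = Inr i")
    case True
    then obtain j where j: "j < m" "ps j = Inr i" by blast
    thus ?thesis using yb[OF j(1)] xj[OF j] by (simp add: s[OF ab(1)] s[OF ab(2)]) linarith
   next
    case False
    thus ?thesis using xa[OF i] lt[OF i] by simp
   qed
   have xg: "x : grid 1 k"
   proof -
    have "(\<lambda>i\<in>{..<k}. x i) : grid 1 k" by (rule grid_restrictI) (use xb lt in \<open>meson order_trans\<close>)
    moreover have "(\<lambda>i\<in>{..<k}. x i) = x" by (rule ext) (simp add: x_def)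
    ultimately show ?thesis by simp
   qed
   have "?s x = y"
   proof (rule grid_eqI[OF smap_grid[OF S xg]])
    show "y : grid 2 m" using y by blast
    fix j assume j: "j < m"
    show "?s x j = y j"
    proof (cases "ps j")
     case (Inl e)
     thus ?thesis using yb[OF j] by (simp add: s[OF ab(1) j] s[OF ab(2) j] s[OF xg j])
    next
     case (Inr i)
     thus ?thesis using yb[OF j] xj[OF j Inr] by (simp add: s[OF ab(1) j] s[OF ab(2) j] s[OF xg j])
    qed
   qed
   moreover have "x : B" using ab xg xb by (simp add: grid_le)
   ultimately show "y : ?s ` B" by blast
  qed
 qed
 thus "boolean_interval (grid 2 m) (?s ` B)"
  using interval_boolean[OF smap_grid[OF S ab(1)] smap_grid[OF S ab(2)] sab] by simp
qed

section \<open>Classification of the cells of the subdivided cube\<close>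

lemma edge_boolean:
 assumes v: "v : grid 1 k" and i: "i < k" "v i = 0"
 shows "boolean_interval (grid 1 k) {v, v(i := 1)}"
proof -
 have v': "v(i := 1) : grid 1 k" using grid_update[OF v i(1)] by simp
 have "{y : grid 1 k. v \<le> y \<and> y \<le> v(i := 1)} = {v, v(i := 1)}"
 proof
  show "{y : grid 1 k. v \<le> y \<and> y \<le> v(i := 1)} \<subseteq> {v, v(i := 1)}"
  proof
   fix y assume y: "y : {y : grid 1 k. v \<le> y \<and> y \<le> v(i := 1)}"
   have "y l = v l" if "l \<noteq> i" for l using y that by (auto simp: le_fun_def split: if_splits intro: antisym)
   moreover have "y i = 0 \<or> y i = 1" using y grid_bound[of y 1 k i] i(1) by auto
   ultimately have "y = v(i := 0) \<or> y = v(i := 1)" by (metis fun_upd_apply ext)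
   moreover have "v(i := 0) = v" using i(2) by auto
   ultimately show "y : {v, v(i := 1)}" by auto
  qed
 qed (use v v' i in \<open>auto simp: le_fun_def\<close>)
 moreover have "boolean_interval (grid 1 k) {y : grid 1 k. v \<le> y \<and> y \<le> v(i := 1)}"
  using i grid_bound[OF v] by (intro interval_boolean[OF v v']) auto
 ultimately show ?thesis by simp
qed

text \<open>The bottom \<open>z\<close> is compared with the unit vectors \<open>u i\<close>. A
  coordinate that grows from \<open>z\<close> to \<open>u i\<close> depends on the variable
  \<open>i\<close> alone: meets with \<open>u i\<close> force it to its bottom value whenever that
  variable is 0. A coordinate that grows for no \<open>i\<close> is constant, because every point is
  a join of unit vectors. Finally no edge moves two coordinates, as moving only one of them would
  give a point strictly between the images of its ends.\<close>

lemma cell_smap: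
 assumes s: "s : cells (sd2_cube m) k"
 shows "EX ps d. sspec k m ps d \<and> s = smap k m ps d"
proof -
 have sg: "s : grid 1 k \<rightarrow>\<^sub>E grid 2 m"
  and hom: "\<And>x y. x : grid 1 k ==> y : grid 1 k ==> s (inf x y) = inf (s x) (s y) \<and> s (sup x y) = sup (s x) (s y)"
  and bool: "\<And>B. boolean_interval (grid 1 k) B ==> boolean_interval (grid 2 m) (s ` B)"
  using s unfolding cells_lattice by blast+
 have sm: "s x : grid 2 m" if "x : grid 1 k" for x using PiE_mem[OF sg that] .
 define z :: "nat => nat" where "z = (\<lambda>i\<in>{..<k}. 0)"
 have z: "z : grid 1 k" unfolding z_def by (rule grid_restrictI) simp
 define u where "u = (\<lambda>i. z(i := 1))"
 have u: "u i : grid 1 k" if "i < k" for i using grid_update[OF z that] by (simp add: u_def)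
 have mono: "s x j \<le> s y j" if "x : grid 1 k" "y : grid 1 k" "x \<le> y" for x y j
 proof -
  have "s x = inf (s x) (s y)" using hom[OF that(1,2)] that(3) by (simp add: inf_absorb1)
  thus ?thesis by (metis inf.cobounded2 le_fun_def)
 qed
 have z_le: "z \<le> x" if "x : grid 1 k" for x using that z by (simp add: grid_le) (simp add: z_def)
 \<comment> \<open>Every point between the images of the two ends of an edge is one of these images.\<close>
 have edge: "w = s v \<or> w = s (v(i := 1))"
  if "v : grid 1 k" "i < k" "v i = 0" "w : grid 2 m" "s v \<le> w" "w \<le> s (v(i := 1))" for v i w
 proof -
  have "boolean_interval (grid 2 m) (s ` {v, v(i := 1)})" by (rule bool[OF edge_boolean[OF that(1-3)]])
  then obtain a b where ab: "s ` {v, v(i := 1)} = {x : grid 2 m. a \<le> x \<and> x \<le> b}"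
   unfolding boolean_interval_def by blast
  hence "a \<le> s v" "s (v(i := 1)) \<le> b" by auto
  hence "w : s ` {v, v(i := 1)}" unfolding ab using that by auto
  thus ?thesis by auto
 qed
 have step: "s (u i) j \<le> s z j + 1" if i: "i < k" and j: "j < m" for i j
 proof (rule ccontr)
  assume c: "\<not> ?thesis"
  have zi: "z i = 0" using i by (simp add: z_def)
  let ?w = "(s z)(j := s z j + 1)"
  have "s (u i) j \<le> 2" using grid_bound[OF sm[OF u[OF i]] j] .
  hence w: "?w : grid 2 m" using c by (intro grid_update[OF sm[OF z] j]) simp
  have "s z \<le> ?w" by (simp add: le_fun_def)
  moreover have "?w \<le> s (z(i := 1))"
   using mono[OF z u[OF i] z_le[OF u[OF i]]] c by (auto simp: le_fun_def u_def)
  ultimately have "?w = s z \<or> ?w = s (z(i := 1))" using edge[OF z i zi w] by blast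
  hence "?w j = s z j \<or> ?w j = s (u i) j" unfolding u_def by (metis (no_types))
  thus False using c by simp
 qed
 have var: "s v j = v i + s z j" if i: "i < k" and j: "j < m" and lt: "s z j < s (u i) j" and v: "v : grid 1 k" for v i j
 proof -
  have ui: "s (u i) j = s z j + 1" using step[OF i j] lt by simp
  have low: "s w j = s z j" if w: "w : grid 1 k" "w i = 0" for w
  proof -
   have "inf w (u i) = z"
    by (rule grid_eqI[OF inf_sup_grid(1)[OF w(1) u[OF i]] z]) (use w(2) in \<open>auto simp: u_def z_def inf_nat_def\<close>)
   hence "s z j = inf (s w j) (s (u i) j)" using hom[OF w(1) u[OF i]] by (metis inf_apply)
   thus ?thesis using lt by (simp add: inf_nat_def min_def split: if_splits)
  qed
  have "v i = 0 \<or> v i = 1" using grid_bound[OF v i] by auto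
  thus ?thesis
  proof
   assume "v i = 0"
   thus ?thesis using low[OF v] by simp
  next
   assume vi: "v i = 1"
   let ?w = "v(i := 0)"
   have w: "?w : grid 1 k" by (rule grid_update[OF v i]) simp
   have "sup ?w (u i) = v"
    by (rule grid_eqI[OF inf_sup_grid(2)[OF w u[OF i]] v]) (use vi in \<open>auto simp: u_def z_def sup_nat_def\<close>)
   hence "s v j = sup (s ?w j) (s (u i) j)" using hom[OF w u[OF i]] by (metis sup_apply)
   thus ?thesis using low[OF w] ui vi by (simp add: sup_nat_def)
  qed
 qed
 have const: "s v j = s z j" if j: "j < m" and no: "\<And>i. i < k ==> \<not> s z j < s (u i) j" and v: "v : grid 1 k" for v j
 proof -
  define V where "V = (\<lambda>l::nat. \<lambda>i\<in>{..<k}. if i < l then v i else 0)"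
  have V: "V l : grid 1 k" for l unfolding V_def by (rule grid_restrictI) (use grid_bound[OF v] in auto)
  have "s (V l) j = s z j" if "l \<le> k" for l using that
  proof (induction l)
   case 0
   have "V 0 = z" by (simp add: V_def z_def)
   thus ?case by simp
  next
   case (Suc l)
   hence l: "l < k" by simp
   have "v l = 0 \<or> v l = 1" using grid_bound[OF v l] by auto
   thus ?case
   proof
    assume "v l = 0"
    hence "V (Suc l) = V l" by (auto simp: V_def fun_eq_iff less_Suc_eq)
    thus ?thesis using Suc by simp
   next
    assume vl: "v l = 1"
    have "sup (V l) (u l) = V (Suc l)"
     by (rule grid_eqI[OF inf_sup_grid(2)[OF V u[OF l]] V]) (use vl in \<open>auto simp: V_def u_def z_def sup_nat_def\<close>)
    hence "s (V (Suc l)) j = sup (s (V l) j) (s (u l) j)" using hom[OF V u[OF l], of l] by (metis sup_apply)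
    moreover have "s z j \<le> s (u l) j" using mono[OF z u[OF l] z_le[OF u[OF l]]] .
    ultimately show ?thesis using Suc no[OF l] by (simp add: sup_nat_def)
   qed
  qed
  from this[of k] show ?thesis using grid_eqI[OF V v, of k] by (simp add: V_def)
 qed
 define ps where "ps = (\<lambda>j. if EX i<k. s z j < s (u i) j then Inr (SOME i. i < k \<and> s z j < s (u i) j) else Inl (s z j))"
 define d where "d = (\<lambda>j. s z j)"
 have psi: "i < k \<and> s z j < s (u i) j" if "ps j = Inr i" for i j
 proof -
  from that have ex: "EX i. i < k \<and> s z j < s (u i) j" by (auto simp: ps_def split: if_splits)
  hence "i = (SOME i. i < k \<and> s z j < s (u i) j)" using that by (simp add: ps_def)
  thus ?thesis using someI_ex[OF ex] by simp
 qed
 have "sspec k m ps d"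
  unfolding sspec_def
 proof (intro conjI allI impI)
  fix j e assume "j < m" "ps j = Inl e"
  thus "e \<le> 2" using grid_bound[OF sm[OF z]] by (auto simp: ps_def split: if_splits)
 next
  fix j i assume j: "j < m" "ps j = Inr i"
  thus "i < k" using psi by blast
  thus "d j \<le> 1" using psi[OF j(2)] grid_bound[OF sm[OF u[of i]] j(1)] by (simp add: d_def)
 next
  fix j j' i assume j: "j < m" "j' < m" "ps j = Inr i" "ps j' = Inr i"
  note i = psi[OF j(3)] psi[OF j(4)]
  hence ik: "i < k" by simp
  show "j = j'"
  proof (rule ccontr)
   assume ne: "j \<noteq> j'"
   let ?w = "(s z)(j := s (u i) j)"
   have w: "?w : grid 2 m" by (rule grid_update[OF sm[OF z] j(1) grid_bound[OF sm[OF u[OF ik]] j(1)]])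
   have "s z \<le> ?w" using i by (simp add: le_fun_def)
   moreover have "?w \<le> s (z(i := 1))"
    using mono[OF z u[OF ik] z_le[OF u[OF ik]]] by (auto simp: le_fun_def u_def)
   moreover have "z i = 0" using ik by (simp add: z_def)
   ultimately have "?w = s z \<or> ?w = s (u i)" using edge[OF z ik _ w] unfolding u_def by blast
   hence "?w j = s z j \<or> ?w j' = s (u i) j'" by (metis (no_types))
   thus False using i ne by auto
  qed
 qed
 moreover have "s = smap k m ps d"
 proof
  fix v
  show "s v = smap k m ps d v"
  proof (cases "v : grid 1 k")
   case False
   thus ?thesis using PiE_arb[OF sg] by (simp add: smap_def)
  next
   case v: True
   show ?thesis
   proof (rule grid_eqI[OF sm[OF v] smap_grid[OF calculation v]])
    fix j assume j: "j < m"
    show "s v j = smap k m ps d v j"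
    proof (cases "ps j")
     case (Inl e)
     hence "\<And>i. i < k ==> \<not> s z j < s (u i) j" "e = s z j" by (auto simp: ps_def split: if_splits)
     thus ?thesis using const[OF j _ v] Inl v j by (simp add: smap_def)
    next
     case (Inr i)
     thus ?thesis using var[OF _ j _ v] psi[OF Inr] v j by (simp add: smap_def d_def)
    qed
   qed
  qed
 qed
 ultimately show ?thesis by blast
qed

section \<open>The subdivision cells as affine maps of real cubes\<close>

definition smap2 :: "nat => nat => (nat => nat + nat) => (nat => nat) => vec => nat => real" where
 "smap2 k m ps d = (\<lambda>x\<in>cube k. \<lambda>j\<in>{..<m}. case ps j of Inl e => real e / 2 | Inr i => (x i + real (d j)) / 2)"

lemma linear_ext_shift:
 assumes "x : cube m" "j < n" "i < m" "\<And>v. v : grid 1 m ==> f v j = v i + e"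
 shows "linear_ext m n f x j = x i + real e"
proof -
 let ?w = "\<lambda>v. \<Prod>i<m. if v i = 0 then 1 - x i else x i"
 have "linear_ext m n f x j = (\<Sum>v\<in>grid 1 m. ?w v * real (f v j))" using assms by (simp add: linear_ext_def)
 also have "\<dots> = (\<Sum>v\<in>grid 1 m. ?w v * real (v i) + ?w v * real e)"
  by (rule sum.cong) (simp_all add: assms(4) distrib_left)
 also have "\<dots> = (\<Sum>v\<in>grid 1 m. ?w v * real (v i)) + (\<Sum>v\<in>grid 1 m. ?w v * real e)" by (rule sum.distrib)
 also have "(\<Sum>v\<in>grid 1 m. ?w v * real (v i)) = linear_ext m n (\<lambda>v _. v i) x j"
  using assms by (simp add: linear_ext_def)
 also have "\<dots> = x i" by (rule linear_ext_var[OF assms(1-3)]) simp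
 also have "(\<Sum>v\<in>grid 1 m. ?w v * real e) = linear_ext m n (\<lambda>v _. e) x j"
  using assms by (simp add: linear_ext_def)
 also have "\<dots> = real e" by (rule linear_ext_const[OF assms(1,2)]) simp
 finally show ?thesis .
qed

lemma sd2_cell_smap:
 assumes S: "sspec k m ps d"
 shows "sd2_cell k m (smap k m ps d) = smap2 k m ps d"
proof (intro ext)
 fix x j
 show "sd2_cell k m (smap k m ps d) x j = smap2 k m ps d x j"
 proof (cases "x : cube k \<and> j < m")
  case True
  hence x: "x : cube k" and j: "j < m" by auto
  show ?thesis
  proof (cases "ps j")
   case (Inl e)
   have "linear_ext k m (smap k m ps d) x j = real e"
    by (rule linear_ext_const[OF x j]) (simp add: smap_def j Inl)
   thus ?thesis using x j Inl by (simp add: sd2_cell_def smap2_def)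
  next
   case (Inr i)
   have "linear_ext k m (smap k m ps d) x j = x i + real (d j)"
    by (rule linear_ext_shift[OF x j sspecD(2)[OF S j Inr]]) (simp add: smap_def j Inr)
   thus ?thesis using x j Inr by (simp add: sd2_cell_def smap2_def)
  qed
 next
  case False
  thus ?thesis by (auto simp: sd2_cell_def smap2_def)
 qed
qed

lemma cmap_smap2:
 assumes S: "sspec k m ps d"
 shows "cmap k m (smap2 k m ps d)"
proof (rule cmapI)
 fix j assume j: "j < m"
 show "cmono k (\<lambda>x. smap2 k m ps d x j)"
 proof (cases "ps j")
  case (Inl e)
  hence "cmono k (\<lambda>x. real e / 2)" using sspecD(1)[OF S j Inl] by (intro cmono_const) auto
  thus ?thesis by (rule cmono_cong[THEN iffD1, rotated]) (simp add: smap2_def j Inl)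
 next
  case (Inr i)
  have i: "i < k" "d j \<le> 1" using sspecD(2,3)[OF S j Inr] .
  hence "cmono k (\<lambda>x. min 1 (max 0 ((1/2) * x i - (- real (d j) / 2))))"
   by (intro cmono_ramp cmono_coord) auto
  thus ?thesis
  proof (rule cmono_cong[THEN iffD1, rotated])
   fix x assume x: "x : cube k"
   have "0 \<le> x i" "x i \<le> 1" using cube_coord[OF x i(1)] by auto
   moreover have "real (d j) = 0 \<or> real (d j) = 1" using i(2) by auto
   ultimately show "min 1 (max 0 ((1/2) * x i - (- real (d j) / 2))) = smap2 k m ps d x j"
    using x j Inr by (auto simp: smap2_def)
  qed
 qed
qed (simp add: smap2_def)

lemma cmap_sd2_cell: "s : cells (sd2_cube m) k ==> cmap k m (sd2_cell k m s)"
 using cell_smap sd2_cell_smap cmap_smap2 by metis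

text \<open>Every coordinate is constant or a single variable scaled by 1/2. This is what lets
  repeated subdivision reach a Lebesgue number.\<close>

lemma sd2_cell_contract:
 assumes "s : cells (sd2_cube m) k" "x : cube k" "y : cube k" "\<And>i. i < k ==> \<bar>x i - y i\<bar> \<le> e" "0 \<le> e" "j < m"
 shows "\<bar>sd2_cell k m s x j - sd2_cell k m s y j\<bar> \<le> e / 2"
proof -
 obtain ps d where S: "sspec k m ps d" "s = smap k m ps d" using cell_smap[OF assms(1)] by blast
 show ?thesis
 proof (cases "ps j")
  case (Inl a)
  thus ?thesis using assms by (simp add: S(2) sd2_cell_smap[OF S(1)] smap2_def)
 next
  case (Inr i)
  have "\<bar>x i - y i\<bar> \<le> e" using assms(4) sspecD(2)[OF S(1) assms(6) Inr] by blast
  thus ?thesis using assms Inr by (simp add: S(2) sd2_cell_smap[OF S(1)] smap2_def diff_divide_distrib[symmetric])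
 qed
qed

lemma sd2_comp_box:
 assumes s: "s : cells (sd2_cube m) k" and f: "box_hom l k f"
 shows "compose (grid 1 l) s f : cells (sd2_cube m) l"
  and "x : cube l ==> sd2_cell l m (compose (grid 1 l) s f) x = sd2_cell k m s (linear_ext l k f x)"
proof -
 obtain ps d where S: "sspec k m ps d" "s = smap k m ps d" using cell_smap[OF s] by blast
 obtain ph where F: "bspec l k ph" "f = bmap l k ph" using box_spec[OF f] by blast
 define ps' where "ps' = (\<lambda>j. case ps j of Inl e => Inl e | Inr i => (case ph i of Inl e => Inl (e + d j) | Inr i' => Inr i'))"
 have S': "sspec l m ps' d"
  unfolding sspec_def
 proof (intro conjI allI impI)
  fix j e assume j: "j < m" "ps' j = Inl e"
  show "e \<le> 2"
  proof (cases "ps j")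
   case (Inl a)
   thus ?thesis using j sspecD(1)[OF S(1) j(1) Inl] by (simp add: ps'_def)
  next
   case (Inr i)
   then obtain a where "ph i = Inl a" "e = a + d j" using j by (auto simp: ps'_def split: sum.splits)
   thus ?thesis using bspecD(1)[OF F(1) sspecD(2)[OF S(1) j(1) Inr], of a] sspecD(3)[OF S(1) j(1) Inr] by simp
  qed
 next
  fix j i assume j: "j < m" "ps' j = Inr i"
  then obtain a where a: "ps j = Inr a" "ph a = Inr i" by (auto simp: ps'_def split: sum.splits)
  show "i < l" using bspecD(2)[OF F(1) sspecD(2)[OF S(1) j(1) a(1)] a(2)] .
  show "d j \<le> 1" using sspecD(3)[OF S(1) j(1) a(1)] .
 next
  fix j j' i assume j: "j < m" "j' < m" "ps' j = Inr i" "ps' j' = Inr i"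
  obtain a where a: "ps j = Inr a" "ph a = Inr i" using j(3) by (auto simp: ps'_def split: sum.splits)
  obtain b where b: "ps j' = Inr b" "ph b = Inr i" using j(4) by (auto simp: ps'_def split: sum.splits)
  have "a = b"
   using bspecD(3)[OF F(1) sspecD(2)[OF S(1) j(1) a(1)] sspecD(2)[OF S(1) j(2) b(1)] a(2) b(2)] .
  thus "j = j'" using sspecD(4)[OF S(1) j(1,2) a(1)] b(1) by simp
 qed
 have eq: "compose (grid 1 l) s f = smap l m ps' d"
 proof (intro ext)
  fix v j
  show "compose (grid 1 l) s f v j = smap l m ps' d v j"
  proof (cases "v : grid 1 l")
   case v: True
   have fv: "f v : grid 1 k" using bmap_grid[OF F(1) v] F(2) by simp
   show ?thesis
   proof (cases "j < m")
    case j: True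
    show ?thesis
    proof (cases "ps j")
     case (Inl e)
     thus ?thesis using v fv j by (simp add: compose_eq S(2) smap_def ps'_def)
    next
     case (Inr i)
     have "f v i = (case ph i of Inl e => e | Inr i => v i)"
      using v sspecD(2)[OF S(1) j Inr] by (simp add: F(2) bmap_def)
     thus ?thesis using v fv j Inr by (cases "ph i") (simp_all add: compose_eq S(2) smap_def ps'_def)
    qed
   qed (use v fv in \<open>simp add: compose_eq S(2) smap_def\<close>)
  qed (simp add: compose_def smap_def)
 qed
 thus "compose (grid 1 l) s f : cells (sd2_cube m) l" using smap_cell[OF S'] by simp
 show "sd2_cell l m (compose (grid 1 l) s f) x = sd2_cell k m s (linear_ext l k f x)" if x: "x : cube l"
 proof
  fix j
  have fx: "linear_ext l k f x = lmap l k ph x" "lmap l k ph x : cube k"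
   using linear_ext_bmap[OF F(1)] F(2) lmap_cube[OF F(1) x] by simp_all
  have e1: "sd2_cell l m (compose (grid 1 l) s f) = smap2 l m ps' d" by (simp only: eq sd2_cell_smap[OF S'])
  have e2: "sd2_cell k m s = smap2 k m ps d" by (simp only: S(2) sd2_cell_smap[OF S(1)])
  show "sd2_cell l m (compose (grid 1 l) s f) x j = sd2_cell k m s (linear_ext l k f x) j"
   unfolding e1 e2 fx(1)
  proof (cases "j < m")
   case j: True
   show "smap2 l m ps' d x j = smap2 k m ps d (lmap l k ph x) j"
   proof (cases "ps j")
    case (Inl e)
    thus ?thesis using x fx(2) j by (simp add: smap2_def ps'_def)
   next
    case (Inr i)
    have "lmap l k ph x i = (case ph i of Inl e => real e | Inr i => x i)"
     using x sspecD(2)[OF S(1) j Inr] by (simp add: lmap_def)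
    thus ?thesis using x fx(2) j Inr by (cases "ph i") (simp_all add: smap2_def ps'_def)
   qed
  qed (use x fx(2) in \<open>simp add: smap2_def\<close>)
 qed
qed

text \<open>A point of the subdivided cube is the sum of its two ends, so under a subdivided box
  morphism a constant \<open>e\<close> becomes \<open>2 * e\<close>, whereas a variable keeps its
  level and its shift.\<close>

lemma sd2_mor_comp:
 assumes s: "s : cells (sd2_cube l) i" and f: "box_hom l k f"
 shows "compose (grid 1 i) (sd2_mor l k f) s : cells (sd2_cube k) i"
  and "x : cube i ==> sd2_cell i k (compose (grid 1 i) (sd2_mor l k f) s) x = linear_ext l k f (sd2_cell i l s x)"
proof -
 obtain ps d where S: "sspec i l ps d" "s = smap i l ps d" using cell_smap[OF s] by blast
 obtain ph where F: "bspec l k ph" "f = bmap l k ph" using box_spec[OF f] by blast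
 define ps' where "ps' = (\<lambda>j. case ph j of Inl e => Inl (2 * e) | Inr a => ps a)"
 define d' where "d' = (\<lambda>j. case ph j of Inl e => 0 | Inr a => d a)"
 have S': "sspec i k ps' d'"
  unfolding sspec_def
 proof (intro conjI allI impI)
  fix j e assume j: "j < k" "ps' j = Inl e"
  show "e \<le> 2"
  proof (cases "ph j")
   case (Inl a)
   thus ?thesis using j bspecD(1)[OF F(1) j(1) Inl] by (auto simp: ps'_def)
  next
   case (Inr a)
   thus ?thesis using j sspecD(1)[OF S(1) bspecD(2)[OF F(1) j(1) Inr]] by (simp add: ps'_def)
  qed
 next
  fix j a assume j: "j < k" "ps' j = Inr a"
  then obtain b where b: "ph j = Inr b" "ps b = Inr a" by (auto simp: ps'_def split: sum.splits)
  show "a < i" using sspecD(2)[OF S(1) bspecD(2)[OF F(1) j(1) b(1)] b(2)] .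
  show "d' j \<le> 1" using sspecD(3)[OF S(1) bspecD(2)[OF F(1) j(1) b(1)] b(2)] b(1) by (simp add: d'_def)
 next
  fix j j' a assume j: "j < k" "j' < k" "ps' j = Inr a" "ps' j' = Inr a"
  obtain b where b: "ph j = Inr b" "ps b = Inr a" using j(3) by (auto simp: ps'_def split: sum.splits)
  obtain c where c: "ph j' = Inr c" "ps c = Inr a" using j(4) by (auto simp: ps'_def split: sum.splits)
  have "b = c"
   using sspecD(4)[OF S(1) bspecD(2)[OF F(1) j(1) b(1)] bspecD(2)[OF F(1) j(2) c(1)] b(2) c(2)] .
  thus "j = j'" using bspecD(3)[OF F(1) j(1,2) b(1)] c(1) by simp
 qed
 have eq: "compose (grid 1 i) (sd2_mor l k f) s = smap i k ps' d'"
 proof (intro ext)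
  fix v j
  show "compose (grid 1 i) (sd2_mor l k f) s v j = smap i k ps' d' v j"
  proof (cases "v : grid 1 i")
   case v: True
   have sv: "s v : grid 2 l" using smap_grid[OF S(1) v] S(2) by simp
   have e: "end_of l e (s v) : grid 1 l" for e unfolding end_of_def by (rule grid_restrictI) simp
   show ?thesis
   proof (cases "j < k")
    case j: True
    have lhs: "compose (grid 1 i) (sd2_mor l k f) s v j = f (end_of l 0 (s v)) j + f (end_of l 1 (s v)) j"
     using v sv j by (simp add: compose_eq sd2_mor_def)
    show ?thesis
    proof (cases "ph j")
     case (Inl e)
     thus ?thesis unfolding lhs using v j e by (simp add: F(2) bmap_def smap_def ps'_def)
    next
     case (Inr a)
     have a: "a < l" using bspecD(2)[OF F(1) j Inr] .
     have "s v a \<le> 2" using grid_bound[OF sv a] .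
     hence "f (end_of l 0 (s v)) j + f (end_of l 1 (s v)) j = s v a"
      using j e Inr a by (simp add: F(2) bmap_def) (auto simp: end_of_def)
     thus ?thesis unfolding lhs using v j a Inr by (cases "ps a") (simp_all add: S(2) smap_def ps'_def d'_def)
    qed
   qed (use v sv in \<open>simp add: compose_eq sd2_mor_def smap_def\<close>)
  qed (simp add: compose_def smap_def)
 qed
 thus "compose (grid 1 i) (sd2_mor l k f) s : cells (sd2_cube k) i" using smap_cell[OF S'] by simp
 show "sd2_cell i k (compose (grid 1 i) (sd2_mor l k f) s) x = linear_ext l k f (sd2_cell i l s x)" if x: "x : cube i"
 proof
  fix j
  have sx: "smap2 i l ps d x : cube l" using cmapD(1)[OF cmap_smap2[OF S(1)] x] .
  have fe: "linear_ext l k f = lmap l k ph" using linear_ext_bmap[OF F(1)] F(2) by simp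
  have e1: "sd2_cell i k (compose (grid 1 i) (sd2_mor l k f) s) = smap2 i k ps' d'"
   by (simp only: eq sd2_cell_smap[OF S'])
  have e2: "sd2_cell i l s = smap2 i l ps d" by (simp only: S(2) sd2_cell_smap[OF S(1)])
  show "sd2_cell i k (compose (grid 1 i) (sd2_mor l k f) s) x j = linear_ext l k f (sd2_cell i l s x) j"
   unfolding e1 e2 fe
  proof (cases "j < k")
   case j: True
   show "smap2 i k ps' d' x j = lmap l k ph (smap2 i l ps d x) j"
   proof (cases "ph j")
    case (Inl e)
    thus ?thesis using x sx j by (simp add: smap2_def[of i k] lmap_def ps'_def)
   next
    case (Inr a)
    thus ?thesis using x sx j bspecD(2)[OF F(1) j Inr]
     by (cases "ps a"; simp add: smap2_def[of i k] lmap_def ps'_def d'_def) (simp_all add: smap2_def)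
   qed
  qed (use x sx in \<open>simp add: smap2_def[of i k] lmap_def\<close>)
 qed
qed

section \<open>The structure maps of a cubcat\<close>

text \<open>The actions on \<open>sharp\<close> and on Day convolutions are defined by saturated
  images of classes. They are computed on one representative once the map respects the generating
  pairs.\<close>

lemma class_image_gen:
 assumes r: "r \<subseteq> A \<times> A" and s: "equiv B s" and a: "a : A"
  and f: "\<And>u v. (u, v) : r ==> (f u, f v) : s"
 shows "s `` (f ` (gen_equiv A r `` {a})) = s `` {f a}"
proof -
 have *: "s `` {f u} = s `` {f a}" if "u : gen_equiv A r `` {a}" for u
  using gen_equiv_respects[OF _ r, of a u "\<lambda>u. s `` {f u}"] that equiv_class_eq[OF s f] by auto
 have "a : gen_equiv A r `` {a}" using equiv_class_self[OF gen_equiv(1)[OF r] a] .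
 thus ?thesis using * by blast
qed

lemma cmap_restrict: "cmap k n h ==> restrict h (cube k) : cells (sing (dcube n)) k"
 unfolding cells_sing_dcube using cmap_cong[of k h "restrict h (cube k)" n] by simp

text \<open>The restriction lets \<open>h\<close> be any function that is right on the cube, so that
  composites need no extensionality.\<close>

definition sc :: "'a cset => nat => nat => 'a => (vec => nat => real) => 'a sharp_cell" where
 "sc C k n c h = sharp_rel C k `` {(n, c, restrict h (cube k))}"

abbreviation sharp_pts :: "'a cset => nat => (nat \<times> 'a \<times> (vec => nat => real)) set" where
 "sharp_pts C k \<equiv> glue_points C (\<lambda>n. cells (sing (dcube n)) k)"

abbreviation sharp_gen :: "'a cset => nat => (nat \<times> 'a \<times> (vec => nat => real)) rel" where
 "sharp_gen C k \<equiv> glue_gen C (\<lambda>n. cells (sing (dcube n)) k) (\<lambda>n n' f h. compose (cube k) (linear_ext n n' f) h)"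

lemma sharp_rel_gen: "sharp_rel C k = gen_equiv (sharp_pts C k) (sharp_gen C k)"
 by (simp add: sharp_rel_def glue_rel_gen)

lemma sharp_gen_subset: "cubical_set C ==> sharp_gen C k \<subseteq> sharp_pts C k \<times> sharp_pts C k"
proof (rule glue_gen_subset)
 fix m n f h assume f: "box_hom m n f" and h: "h : cells (sing (dcube m)) k"
 have "cmap k n (\<lambda>u. linear_ext m n f (h u))"
  using h cmap_comp[OF cmap_linear_ext[OF f]] by (simp add: cells_sing_dcube)
 thus "compose (cube k) (linear_ext m n f) h : cells (sing (dcube n)) k"
  using cmap_restrict by (simp add: compose_def restrict_def)
qed

lemma sharp_equiv: "cubical_set C ==> equiv (sharp_pts C k) (sharp_rel C k)"
 unfolding sharp_rel_gen by (rule gen_equiv(1)[OF sharp_gen_subset])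

lemma sc_cong: "(\<And>x. x : cube k ==> h x = h' x) ==> sc C k n c h = sc C k n c h'"
 unfolding sc_def using restrict_cong[of "cube k" "cube k" h h'] by (simp add: simp_implies_def)

lemma sc_nat:
 assumes C: "cubical_set C" and f: "box_hom m n f" and c: "c : cells C n" and h: "cmap k m h"
 shows "sc C k m (act C m n f c) h = sc C k n c (\<lambda>u. linear_ext m n f (h u))"
proof -
 let ?h = "restrict h (cube k)"
 have "compose (cube k) (linear_ext m n f) ?h = restrict (\<lambda>u. linear_ext m n f (h u)) (cube k)"
  by (auto simp: compose_def restrict_def fun_eq_iff)
 hence "((m, act C m n f c, ?h), (n, c, restrict (\<lambda>u. linear_ext m n f (h u)) (cube k))) : sharp_gen C k"
  unfolding glue_gen_def using f c cmap_restrict[OF h] by force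
 hence "((m, act C m n f c, ?h), (n, c, restrict (\<lambda>u. linear_ext m n f (h u)) (cube k))) : sharp_rel C k"
  unfolding sharp_rel_gen using gen_equiv(2)[OF sharp_gen_subset[OF C]] by blast
 thus ?thesis unfolding sc_def by (rule equiv_class_eq[OF sharp_equiv[OF C]])
qed

lemma sc_image:
 assumes C: "cubical_set C" and c: "c : cells C n" and h: "cmap k n h" and g: "cmap l k g"
 shows "sharp_rel C l `` ((\<lambda>(n, c, h). (n, c, restrict (\<lambda>u. h (g u)) (cube l))) ` sc C k n c h) =
  sc C l n c (\<lambda>u. h (g u))"
proof -
 let ?F = "\<lambda>(n, c::'a, h). (n::nat, c, restrict (\<lambda>u. h (g u)) (cube l)) :: nat \<times> 'a \<times> (vec => nat => real)"
 have "sharp_rel C l `` (?F ` (gen_equiv (sharp_pts C k) (sharp_gen C k) `` {(n, c, restrict h (cube k))})) =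
   sharp_rel C l `` {?F (n, c, restrict h (cube k))}"
 proof (rule class_image_gen[OF sharp_gen_subset[OF C] sharp_equiv[OF C]])
  show "(n, c, restrict h (cube k)) : sharp_pts C k" using c cmap_restrict[OF h] by (simp add: mem_glue)
  fix u v assume "(u, v) : sharp_gen C k"
  then obtain m' n' f c' h' where uv: "u = (m', act C m' n' f c', h')"
    "v = (n', c', compose (cube k) (linear_ext m' n' f) h')"
   and f: "box_hom m' n' f" and c': "c' : cells C n'" and h': "h' : cells (sing (dcube m')) k"
   unfolding glue_gen_def by blast
  have hc: "cmap k m' h'" using h' by (simp add: cells_sing_dcube)
  have "restrict (\<lambda>u. h' (g u)) (cube l) : cells (sing (dcube m')) l"
   by (rule cmap_restrict[OF cmap_comp[OF hc g]])
  moreover have "restrict (\<lambda>u. compose (cube k) (linear_ext m' n' f) h' (g u)) (cube l) =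
    compose (cube l) (linear_ext m' n' f) (restrict (\<lambda>u. h' (g u)) (cube l))"
   using cmapD(1)[OF g] by (auto simp: compose_def fun_eq_iff)
  ultimately have "(?F u, ?F v) : sharp_gen C l"
   unfolding uv glue_gen_def using f c' by auto
  thus "(?F u, ?F v) : sharp_rel C l"
   unfolding sharp_rel_gen using gen_equiv(2)[OF sharp_gen_subset[OF C]] by blast
 qed
 moreover have "?F (n, c, restrict h (cube k)) = (n, c, restrict (\<lambda>u. h (g u)) (cube l))"
  using cmapD(1)[OF g] by (auto simp: restrict_def fun_eq_iff)
 ultimately show ?thesis by (simp only: sc_def sharp_rel_gen)
qed

lemma sc_cell: "c : cells C n ==> cmap k n h ==> sc C k n c h : cells (sharp C) k"
 unfolding sc_def sharp_def by (auto intro!: quotientI simp: mem_glue cmap_restrict)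

lemma sc_act:
 assumes C: "cubical_set C" and c: "c : cells C n" and h: "cmap k n h" and f: "box_hom l k f"
 shows "act (sharp C) l k f (sc C k n c h) = sc C l n c (\<lambda>u. h (linear_ext l k f u))"
proof -
 have "act (sharp C) l k f (sc C k n c h) =
   sharp_rel C l `` ((\<lambda>(n, c, h). (n, c, restrict (\<lambda>u. h (linear_ext l k f u)) (cube l))) ` sc C k n c h)"
  by (simp add: sharp_def sing_def compose_def restrict_def)
 thus ?thesis using sc_image[OF C c h cmap_linear_ext[OF f]] by simp
qed

lemma phi_sc:
 assumes C: "cubical_set C" and c: "c : cells C n" and h: "cmap k n h" and s: "s : cells (sd2_cube k) l"
 shows "phi_sharp C k (sc C k n c h) l s = sc C l n c (\<lambda>u. h (sd2_cell l k s u))"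
proof -
 have "phi_sharp C k (sc C k n c h) l s =
   sharp_rel C l `` ((\<lambda>(n, c, h). (n, c, restrict (\<lambda>u. h (sd2_cell l k s u)) (cube l))) ` sc C k n c h)"
  using s by (simp add: phi_sharp_def compose_def restrict_def)
 thus ?thesis using sc_image[OF C c h cmap_sd2_cell[OF s]] by simp
qed

text \<open>The two structure maps, with the coend removed: \<open>rho k n c h\<close> is the value of \<open>\<rho>\<close> at the cell
 represented by \<open>c\<close> and \<open>h : [0,1]\<^sup>k \<rightarrow> [0,1]\<^sup>n\<close>.\<close>

locale cubcat_data =
 fixes C :: "'a cset" and rho :: "nat => nat => 'a => (vec => nat => real) => 'a"
  and mu :: "nat => (nat => mor => 'a) => 'a"
 assumes C: "cubical_set C"
  and rho_cell: "c : cells C n ==> cmap k n h ==> rho k n c h : cells C k"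
  and rho_cong: "(\<And>u. u : cube k ==> h u = h' u) ==> rho k n c h = rho k n c h'"
  and rho_act: "c : cells C n ==> cmap k n h ==> box_hom l k f ==>
   act C l k f (rho k n c h) = rho l n c (\<lambda>u. h (linear_ext l k f u))"
  and rho_nat: "c : cells C n ==> cmap k m h ==> box_hom m n f ==>
   rho k m (act C m n f c) h = rho k n c (\<lambda>u. linear_ext m n f (h u))"
  and rho_id: "c : cells C n ==> rho n n c (\<lambda>u. u) = c"
  and mu_cell: "ph : chom (sd2_cube k) C ==> mu k ph : cells C k"
  and mu_act: "ph : chom (sd2_cube k) C ==> box_hom l k f ==>
   act C l k f (mu k ph) = mu l (\<lambda>i. \<lambda>s\<in>cells (sd2_cube l) i. ph i (compose (grid 1 i) (sd2_mor l k f) s))"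
  and rho_mu: "c : cells C n ==> cmap k n h ==>
   rho k n c h = mu k (\<lambda>l. \<lambda>s\<in>cells (sd2_cube k) l. rho l n c (\<lambda>u. h (sd2_cell l k s u)))"

lemma cubcat_data_exists:
 assumes "cubcat C"
 shows "EX rho mu. cubcat_data C rho mu"
proof -
 from assms obtain \<rho> \<mu> where C: "cubical_set C" and \<rho>: "\<rho> : chom (sharp C) C" and \<mu>: "\<mu> : chom (ex2 C) C"
  and unit: "\<And>n c. c : cells C n ==> \<rho> n (sharp_unit C n c) = c"
  and eq: "\<And>m X. X : cells (sharp C) m ==> \<rho> m X = \<mu> m (ex2_map \<rho> m (phi_sharp C m X))"
  unfolding cubcat_def by blast
 have \<rho>c: "\<rho> n X : cells C n" if "X : cells (sharp C) n" for n X using \<rho> that unfolding chom_def by blast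
 have \<rho>a: "\<rho> m (act (sharp C) m n f X) = act C m n f (\<rho> n X)" if "X : cells (sharp C) n" "box_hom m n f" for m n f X
  using \<rho> that unfolding chom_def by blast
 have \<mu>c: "\<mu> n X : cells C n" if "X : cells (ex2 C) n" for n X using \<mu> that unfolding chom_def by blast
 have \<mu>a: "\<mu> m (act (ex2 C) m n f X) = act C m n f (\<mu> n X)" if "X : cells (ex2 C) n" "box_hom m n f" for m n f X
  using \<mu> that unfolding chom_def by blast
 have "cubcat_data C (\<lambda>k n c h. \<rho> k (sc C k n c h)) \<mu>"
 proof
  show "cubical_set C" by fact
  show "\<rho> k (sc C k n c h) : cells C k" if "c : cells C n" "cmap k n h" for c n k h
   using \<rho>c[OF sc_cell[OF that]] .
  show "\<rho> k (sc C k n c h) = \<rho> k (sc C k n c h')" if "\<And>u. u : cube k ==> h u = h' u" for k n c h h'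
   using sc_cong[of k h h'] that by metis
  show "act C l k f (\<rho> k (sc C k n c h)) = \<rho> l (sc C l n c (\<lambda>u. h (linear_ext l k f u)))"
   if "c : cells C n" "cmap k n h" "box_hom l k f" for c n k h l f
   using \<rho>a[OF sc_cell[OF that(1,2)] that(3)] sc_act[OF C that] by simp
  show "\<rho> k (sc C k m (act C m n f c) h) = \<rho> k (sc C k n c (\<lambda>u. linear_ext m n f (h u)))"
   if "c : cells C n" "cmap k m h" "box_hom m n f" for c n k m h f
   using sc_nat[OF C that(3,1,2)] by simp
  show "\<rho> n (sc C n n c (\<lambda>u. u)) = c" if "c : cells C n" for c n
   using unit[OF that] by (simp add: sharp_unit_def sc_def)
  show "\<mu> k ph : cells C k" if "ph : chom (sd2_cube k) C" for ph k
   using \<mu>c that by (simp add: ex2_def)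
  show "act C l k f (\<mu> k ph) = \<mu> l (\<lambda>i. \<lambda>s\<in>cells (sd2_cube l) i. ph i (compose (grid 1 i) (sd2_mor l k f) s))"
   if "ph : chom (sd2_cube k) C" "box_hom l k f" for ph k l f
   using \<mu>a[of ph k l f] that by (simp add: ex2_def ccomp_def compose_def restrict_def)
  show "\<rho> k (sc C k n c h) = \<mu> k (\<lambda>l. \<lambda>s\<in>cells (sd2_cube k) l. \<rho> l (sc C l n c (\<lambda>u. h (sd2_cell l k s u))))"
   if "c : cells C n" "cmap k n h" for c n k h
  proof -
   have "ex2_map \<rho> k (phi_sharp C k (sc C k n c h)) =
     (\<lambda>l. \<lambda>s\<in>cells (sd2_cube k) l. \<rho> l (sc C l n c (\<lambda>u. h (sd2_cell l k s u))))"
    using phi_sc[OF C that] by (auto simp: ex2_map_def ccomp_def compose_def restrict_def fun_eq_iff)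
   thus ?thesis using eq[OF sc_cell[OF that]] by simp
  qed
 qed
 thus ?thesis by blast
qed

section \<open>Degenerate directions at a point of the realization\<close>

lemma bmap_cong: "(\<And>j. j < n ==> ph j = ps j) ==> bmap k n ph = bmap k n ps"
 by (auto simp: bmap_def intro!: restrict_ext)

lemma act_spec:
 assumes "cubical_set C" "c : cells C n" "bspec l m ph" "bspec m n ps"
 shows "act C l m (bmap l m ph) (act C m n (bmap m n ps) c) = act C l n (bmap l n (scomp ps ph)) c"
 using cubical_setD(3)[OF assms(1) box_bmap[OF assms(3)] box_bmap[OF assms(4)] assms(2)] bmap_comp[OF assms(3,4)]
 by simp

definition setter :: "nat => (nat => nat + nat) => bool" where
 "setter n ka \<longleftrightarrow> (ALL j<n. ka j = Inr j \<or> ka j = Inl 0 \<or> ka j = Inl 1)"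

definition psp :: "nat set => nat => nat => nat + nat" where
 "psp S e = (\<lambda>j. if j : S then Inl e else Inr j)"

text \<open>Coordinates close to 0 or 1 are replaced by faces. The upper threshold is a parameter
  because it must sometimes be moved away from the coordinates of a given point.\<close>

definition ksp :: "real => vec => nat => nat + nat" where
 "ksp hi x = (\<lambda>j. if x j < 1/3 then Inl 0 else if x j > hi then Inl 1 else Inr j)"

definition av :: "'a cset => nat => (nat => nat + nat) => 'a => 'a" where
 "av C n ka c = act C n n (bmap n n ka) c"

text \<open>After the collapse \<open>ka\<close> the cell is degenerate in direction
  \<open>i\<close>. This is tested by the idempotent that resets the coordinate, which keeps the
  dimension fixed and needs no cell of lower dimension.\<close>

definition ghost :: "'a cset => nat => (nat => nat + nat) => 'a => nat => bool" where
 "ghost C n ka c i \<longleftrightarrow> av C n (scomp ka (psp {i} 0)) c = av C n ka c"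

lemma setter_bspec: "setter n ka ==> bspec n n ka"
 unfolding setter_def by (rule bspecI) (metis One_nat_def le0 order_refl sum.inject sum.distinct)+

lemma setter_psp: "e \<le> 1 ==> setter n (psp S e)"
 by (auto simp: setter_def psp_def)

lemma setter_ksp: "setter n (ksp hi x)"
 by (auto simp: setter_def ksp_def)

lemma setterE:
 assumes "setter n ka" "j < n"
 obtains "ka j = Inr j" | e where "ka j = Inl e" "e \<le> 1"
 using assms unfolding setter_def by force

lemma setter_comp: "setter n ka ==> setter n ka' ==> setter n (scomp ka ka')"
proof -
 assume k: "setter n ka" "setter n ka'"
 show ?thesis unfolding setter_def
 proof (intro allI impI)
  fix j assume j: "j < n"
  have "ka j = Inr j \<or> ka j = Inl 0 \<or> ka j = Inl 1" "ka' j = Inr j \<or> ka' j = Inl 0 \<or> ka' j = Inl 1"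
   using k j by (auto simp: setter_def)
  thus "scomp ka ka' j = Inr j \<or> scomp ka ka' j = Inl 0 \<or> scomp ka ka' j = Inl 1" by (elim disjE) simp_all
 qed
qed

lemma av_cell: "cubical_set C ==> c : cells C n ==> setter n ka ==> av C n ka c : cells C n"
 unfolding av_def using cubical_setD(1)[OF _ box_bmap[OF setter_bspec]] .

lemma av_cong: "(\<And>j. j < n ==> ph j = ps j) ==> av C n ph c = av C n ps c"
 unfolding av_def using bmap_cong[of n ph ps] by metis

lemma av_av:
 assumes "cubical_set C" "c : cells C n" "setter n ka" "setter n ka'"
 shows "av C n ka' (av C n ka c) = av C n (scomp ka ka') c"
 unfolding av_def by (rule act_spec[OF assms(1,2) setter_bspec[OF assms(4)] setter_bspec[OF assms(3)]])

lemma ghost_iff: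
 assumes "cubical_set C" "c : cells C n" "setter n ka"
 shows "ghost C n ka c i \<longleftrightarrow> av C n (psp {i} 0) (av C n ka c) = av C n ka c"
 unfolding ghost_def using av_av[OF assms setter_psp[of 0 n "{i}"]] by simp

lemma ghost_const:
 assumes "setter n ka" "ka i = Inl e"
 shows "ghost C n ka c i"
 unfolding ghost_def
proof (rule av_cong)
 fix j assume "j < n"
 thus "scomp ka (psp {i} 0) j = ka j"
  using assms by (cases rule: setterE[OF assms(1) \<open>j < n\<close>]) (auto simp: psp_def)
qed

text \<open>Collapsing more coordinates restricts the cell to a smaller face, on which degeneracies
  persist; a coordinate that is itself collapsed is trivially degenerate.\<close>

lemma ghost_refine:
 assumes C: "cubical_set C" "c : cells C n" and k: "setter n ka" "setter n ka'"
  and ref: "\<And>j e. j < n ==> ka j = Inl e ==> ka' j = Inl e" and g: "ghost C n ka c i"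
 shows "ghost C n ka' c i"
proof (cases "i < n \<and> (EX e. ka' i = Inl e)")
 case True
 thus ?thesis using ghost_const[OF k(2)] by metis
next
 case False
 note p = setter_psp[of 0 n "{i}", simplified]
 have 1: "av C n (scomp ka ka') c = av C n ka' c"
 proof (rule av_cong)
  fix j assume j: "j < n"
  thus "scomp ka ka' j = ka' j" using ref[OF j] by (cases rule: setterE[OF k(1) j]) auto
 qed
 have 2: "av C n (scomp (scomp ka (psp {i} 0)) ka') c = av C n (scomp ka' (psp {i} 0)) c"
 proof (rule av_cong)
  fix j assume j: "j < n"
  show "scomp (scomp ka (psp {i} 0)) ka' j = scomp ka' (psp {i} 0) j"
  proof (cases rule: setterE[OF k(1) j])
   case 1
   have "ka' j = Inr j" if "j = i" using False j that by (cases rule: setterE[OF k(2) j]) auto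
   thus ?thesis using 1 by (cases rule: setterE[OF k(2) j]) (auto simp: psp_def)
  qed (use ref[OF j] in auto)
 qed
 have "av C n (scomp ka' (psp {i} 0)) c = av C n ka' (av C n (scomp ka (psp {i} 0)) c)"
  using av_av[OF C setter_comp[OF k(1) p] k(2)] 2 by simp
 also have "\<dots> = av C n ka' (av C n ka c)" using g by (simp add: ghost_def)
 also have "\<dots> = av C n ka' c" using av_av[OF C k] 1 by simp
 finally show ?thesis by (simp add: ghost_def)
qed

text \<open>A cell fixed by resetting \<open>i\<close> to 0 has been pulled back along a map that
  forgets the coordinate \<open>i\<close>; resetting it to 1 then fixes the cell as well. The
  coordinates in \<open>S\<close> are treated one after the other.\<close>

lemma ghost_set:
 assumes C: "cubical_set C" "c : cells C n" and k: "setter n ka"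
  and S: "finite S" "\<And>i. i : S ==> ghost C n ka c i" and e: "e \<le> 1"
 shows "av C n (scomp ka (psp S e)) c = av C n ka c"
proof -
 let ?d = "av C n ka c"
 have d: "?d : cells C n" by (rule av_cell[OF C k])
 have one: "av C n (psp {i} e) ?d = ?d" if i: "i : S" for i
 proof -
  have z: "av C n (psp {i} 0) ?d = ?d" using S(2)[OF i] ghost_iff[OF C k] by simp
  have "av C n (psp {i} e) (av C n (psp {i} 0) ?d) = av C n (scomp (psp {i} 0) (psp {i} e)) ?d"
   by (rule av_av[OF C(1) d setter_psp setter_psp[OF e]]) simp
  also have "\<dots> = av C n (psp {i} 0) ?d" by (rule av_cong) (auto simp: psp_def)
  finally show ?thesis using z by simp
 qed
 have "av C n (psp S e) ?d = ?d" using S(1) one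
 proof (induction S)
  case empty
  have "bmap n n (psp {} e) = box_id n"
   unfolding bmap_def psp_def box_id_def
  proof (rule restrict_ext)
   fix x assume "x : grid 1 n"
   hence "restrict x {..<n} = x" unfolding grid_def by (rule PiE_restrict)
   thus "(\<lambda>j\<in>{..<n}. case if j : {} then Inl e else Inr j of Inl e => e | Inr i => x i) = x" by simp
  qed
  hence "av C n (psp {} e) ?d = act C n n (box_id n) ?d" unfolding av_def by simp
  thus ?case using cubical_setD(2)[OF C(1) d] by simp
 next
  case (insert i S)
  have "av C n (psp (insert i S) e) ?d = av C n (scomp (psp {i} e) (psp S e)) ?d"
   by (rule av_cong) (auto simp: psp_def)
  also have "\<dots> = av C n (psp S e) (av C n (psp {i} e) ?d)"
   by (rule av_av[OF C(1) d setter_psp[OF e] setter_psp[OF e], symmetric])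
  finally show ?case using insert by simp
 qed
 thus ?thesis using av_av[OF C k setter_psp[OF e]] by simp
qed

text \<open>Degeneracy is carried back along \<open>ga\<close>, a one-sided inverse of
  \<open>ph\<close> on the variables. The constants of \<open>ph\<close> do no harm: there the point
  has coordinate 0 or 1, so that \<open>ksp\<close> collapses that coordinate to the same constant
  and restricting along \<open>ph\<close> loses nothing of the collapsed cell.\<close>

lemma ghost_natural_image:
 assumes C: "cubical_set C" "c : cells C n" and S: "bspec m n ph" and x: "x : cube m"
  and hi: "0 \<le> hi" "hi < 1" and j: "j < n" "ph j = Inr i"
 shows "ghost C m (ksp hi x) (act C m n (bmap m n ph) c) i \<longleftrightarrow> ghost C n (ksp hi (lmap m n ph x)) c j"
proof -
 let ?y = "lmap m n ph x"
 note i = bspecD(2)[OF S j]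
 note px = setter_psp[of 0 m "{i}", simplified] and py = setter_psp[of 0 n "{j}", simplified]
 have y: "?y a = (case ph a of Inl e => real e | Inr i => x i)" if "a < n" for a using x that by (simp add: lmap_def)
 have ke: "ksp hi ?y a = Inl e" if "a < n" "ph a = Inl e" for a e
 proof -
  have "e = 0 \<or> e = 1" using bspecD(1)[OF S that] by linarith
  thus ?thesis using y[OF that(1)] that(2) hi by (auto simp: ksp_def)
 qed
 have kr: "ksp hi ?y a = (case ksp hi x l of Inl e => Inl e | Inr _ => Inr a)" if "a < n" "ph a = Inr l" for a l
  using y[OF that(1)] that(2) by (simp add: ksp_def)
 have kx: "ksp hi x l = Inr l' ==> l' = l" for l l' by (auto simp: ksp_def split: if_splits)
 define ga where "ga = (\<lambda>l. if EX a<n. ph a = Inr l then Inr (THE a. a < n \<and> ph a = Inr l) else Inl 0 :: nat + nat)"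
 have ga: "ga l = Inr a" if "a < n" "ph a = Inr l" for a l
 proof -
  have "(THE a. a < n \<and> ph a = Inr l) = a" using that bspecD(3)[OF S] by blast
  thus ?thesis using that by (auto simp: ga_def)
 qed
 have g: "bspec n m ga"
 proof (rule bspecI)
  fix l a assume "ga l = Inr a"
  then obtain b where "b < n" "ph b = Inr l" by (auto simp: ga_def split: if_splits)
  thus "a < n" using ga \<open>ga l = Inr a\<close> by force
 next
  fix l l' a assume la: "ga l = Inr a" "ga l' = Inr a"
  then obtain b b' where b: "b < n" "ph b = Inr l" "b' < n" "ph b' = Inr l'" by (auto simp: ga_def split: if_splits)
  hence "b = a" "b' = a" using ga la by force+
  thus "l = l'" using b by simp
 qed (auto simp: ga_def split: if_splits)
 have A: "act C m m (bmap m m (scomp (ksp hi x) (psp {i} 0))) (act C m n (bmap m n ph) c) =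
   act C m n (bmap m n (scomp ph (scomp (ksp hi x) (psp {i} 0)))) c"
  by (rule act_spec[OF C setter_bspec[OF setter_comp[OF setter_ksp px]] S])
 have B: "act C m m (bmap m m (ksp hi x)) (act C m n (bmap m n ph) c) = act C m n (bmap m n (scomp ph (ksp hi x))) c"
  by (rule act_spec[OF C setter_bspec[OF setter_ksp] S])
 have fA: "act C m n (bmap m n (scomp ph (scomp (ksp hi x) (psp {i} 0)))) c =
   act C m n (bmap m n ph) (av C n (scomp (ksp hi ?y) (psp {j} 0)) c)"
  unfolding av_def act_spec[OF C S setter_bspec[OF setter_comp[OF setter_ksp py]]]
 proof (rule arg_cong[where f = "\<lambda>f. act C m n f c"], rule bmap_cong)
  fix a assume a: "a < n"
  show "scomp ph (scomp (ksp hi x) (psp {i} 0)) a = scomp (scomp (ksp hi ?y) (psp {j} 0)) ph a"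
  proof (cases "ph a")
   case (Inr l)
   thus ?thesis using kr[OF a Inr] kx[of l] j bspecD(3)[OF S a j(1) Inr] by (cases "ksp hi x l") (auto simp: psp_def)
  qed (simp add: ke[OF a])
 qed
 have fB: "act C m n (bmap m n (scomp ph (ksp hi x))) c = act C m n (bmap m n ph) (av C n (ksp hi ?y) c)"
  unfolding av_def act_spec[OF C S setter_bspec[OF setter_ksp]]
 proof (rule arg_cong[where f = "\<lambda>f. act C m n f c"], rule bmap_cong)
  fix a assume a: "a < n"
  show "scomp ph (ksp hi x) a = scomp (ksp hi ?y) ph a"
  proof (cases "ph a")
   case (Inr l)
   thus ?thesis using kr[OF a Inr] kx[of l] by (cases "ksp hi x l") auto
  qed (simp add: ke[OF a])
 qed
 have gA: "act C n m (bmap n m ga) (act C m n (bmap m n (scomp ph (scomp (ksp hi x) (psp {i} 0)))) c) =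
   av C n (scomp (ksp hi ?y) (psp {j} 0)) c"
  unfolding av_def act_spec[OF C g bspec_comp[OF setter_bspec[OF setter_comp[OF setter_ksp px]] S]]
 proof (rule arg_cong[where f = "\<lambda>f. act C n n f c"], rule bmap_cong)
  fix a assume a: "a < n"
  show "scomp (scomp ph (scomp (ksp hi x) (psp {i} 0))) ga a = scomp (ksp hi ?y) (psp {j} 0) a"
  proof (cases "ph a")
   case (Inr l)
   thus ?thesis using kr[OF a Inr] kx[of l] j bspecD(3)[OF S a j(1) Inr] ga[OF a Inr]
    by (cases "ksp hi x l") (auto simp: psp_def)
  qed (simp add: ke[OF a])
 qed
 have gB: "act C n m (bmap n m ga) (act C m n (bmap m n (scomp ph (ksp hi x))) c) = av C n (ksp hi ?y) c"
  unfolding av_def act_spec[OF C g bspec_comp[OF setter_bspec[OF setter_ksp] S]]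
 proof (rule arg_cong[where f = "\<lambda>f. act C n n f c"], rule bmap_cong)
  fix a assume a: "a < n"
  show "scomp (scomp ph (ksp hi x)) ga a = ksp hi ?y a"
  proof (cases "ph a")
   case (Inr l)
   thus ?thesis using kr[OF a Inr] kx[of l] ga[OF a Inr] by (cases "ksp hi x l") auto
  qed (simp add: ke[OF a])
 qed
 show ?thesis
 proof
  assume "ghost C m (ksp hi x) (act C m n (bmap m n ph) c) i"
  hence "act C m n (bmap m n (scomp ph (scomp (ksp hi x) (psp {i} 0)))) c = act C m n (bmap m n (scomp ph (ksp hi x))) c"
   unfolding ghost_def av_def A B .
  thus "ghost C n (ksp hi ?y) c j" unfolding ghost_def using gA gB by metis
 next
  assume "ghost C n (ksp hi ?y) c j"
  thus "ghost C m (ksp hi x) (act C m n (bmap m n ph) c) i"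
   unfolding ghost_def using A B fA fB unfolding av_def by metis
 qed
qed

lemma ghost_natural_other:
 assumes C: "cubical_set C" "c : cells C n" and S: "bspec m n ph" and i: "\<And>j. j < n ==> ph j \<noteq> Inr i"
  and k: "setter m ka"
 shows "ghost C m ka (act C m n (bmap m n ph) c) i"
proof -
 note p = setter_psp[of 0 m "{i}", simplified]
 have "act C m m (bmap m m (scomp ka (psp {i} 0))) (act C m n (bmap m n ph) c) =
   act C m n (bmap m n (scomp ph (scomp ka (psp {i} 0)))) c"
  by (rule act_spec[OF C setter_bspec[OF setter_comp[OF k p]] S])
 also have "bmap m n (scomp ph (scomp ka (psp {i} 0))) = bmap m n (scomp ph ka)"
 proof (rule bmap_cong)
  fix j assume j: "j < n"
  show "scomp ph (scomp ka (psp {i} 0)) j = scomp ph ka j"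
  proof (cases "ph j")
   case (Inr l)
   have l: "l < m" "l \<noteq> i" using bspecD(2)[OF S j Inr] i[OF j] Inr by auto
   thus ?thesis using Inr by (cases rule: setterE[OF k l(1)]) (auto simp: psp_def)
  qed simp
 qed
 also have "act C m n (bmap m n (scomp ph ka)) c = act C m m (bmap m m ka) (act C m n (bmap m n ph) c)"
  by (rule act_spec[OF C setter_bspec[OF k] S, symmetric])
 finally show ?thesis by (simp add: ghost_def av_def)
qed

section \<open>Counting the coordinates that matter at a point of the realization\<close>

definition reals :: "'a cset => real => real set => nat => 'a => vec => nat set" where
 "reals C hi I n c x = {i. i < n \<and> x i : I \<and> \<not> ghost C n (ksp hi x) c i}"

lemma finite_reals: "finite (reals C hi I n c x)"
 by (simp add: reals_def)

text \<open>The variables of the morphism match the coordinates in which they occur. Constant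
  coordinates are collapsed, variables that do not occur are degenerate, and neither is
  counted.\<close>

lemma reals_natural:
 assumes C: "cubical_set C" "c : cells C n" and f: "box_hom m n f" and x: "x : cube m"
  and hi: "0 \<le> hi" "hi < 1"
 shows "card (reals C hi I m (act C m n f c) x) = card (reals C hi I n c (linear_ext m n f x))"
proof -
 obtain ph where S: "bspec m n ph" and f: "f = bmap m n ph" using box_spec[OF f] by blast
 let ?y = "lmap m n ph x"
 let ?io = "\<lambda>j. case ph j of Inl e => 0 | Inr i => i"
 have r: "EX i. ph j = Inr i" if j: "j : reals C hi I n c ?y" for j
 proof (cases "ph j")
  case (Inl e)
  have jn: "j < n" using j by (simp add: reals_def)
  have "e = 0 \<or> e = 1" using bspecD(1)[OF S jn Inl] by linarith
  hence "ksp hi ?y j = Inl e" using jn x Inl hi by (auto simp: ksp_def lmap_def)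
  hence "ghost C n (ksp hi ?y) c j" by (rule ghost_const[OF setter_ksp])
  thus ?thesis using j by (simp add: reals_def)
 qed simp
 have "bij_betw ?io (reals C hi I n c ?y) (reals C hi I m (act C m n f c) x)"
 proof (rule bij_betwI')
  fix j j' assume j: "j : reals C hi I n c ?y" "j' : reals C hi I n c ?y"
  then obtain i i' where "ph j = Inr i" "ph j' = Inr i'" using r by blast
  thus "(?io j = ?io j') = (j = j')" using bspecD(3)[OF S] j by (auto simp: reals_def)
 next
  fix j assume j: "j : reals C hi I n c ?y"
  obtain i where i: "ph j = Inr i" using r[OF j] by blast
  thus "?io j : reals C hi I m (act C m n f c) x"
   using j ghost_natural_image[OF C S x hi _ i] bspecD(2)[OF S _ i] x by (auto simp: reals_def f lmap_def)
 next
  fix i assume i: "i : reals C hi I m (act C m n f c) x"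
  have "EX j<n. ph j = Inr i"
  proof (rule ccontr)
   assume "\<not> ?thesis"
   hence "ghost C m (ksp hi x) (act C m n (bmap m n ph) c) i"
    using ghost_natural_other[OF C S _ setter_ksp] by blast
   thus False using i by (simp add: reals_def f)
  qed
  then obtain j where j: "j < n" "ph j = Inr i" by blast
  hence "j : reals C hi I n c ?y"
   using i ghost_natural_image[OF C S x hi j] x by (auto simp: reals_def f lmap_def)
  thus "EX j:reals C hi I n c ?y. i = ?io j" using j(2) by (intro bexI[of _ j]) auto
 qed
 thus ?thesis using bij_betw_same_card f linear_ext_bmap[OF S] by metis
qed

definition nreal :: "'a cset => real => real set => 'a rpt => nat" where
 "nreal C hi I Z = (THE k. ALL n c x. c : cells C n --> x : cube n --> Z = pt C n c x --> k = card (reals C hi I n c x))"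

lemma nreal_pt:
 assumes C: "cubical_set C" and c: "c : cells C n" "x : cube n" and hi: "0 \<le> hi" "hi < 1"
 shows "nreal C hi I (pt C n c x) = card (reals C hi I n c x)"
 unfolding nreal_def
proof (rule the_equality)
 show "ALL n' c' x'. c' : cells C n' --> x' : cube n' --> pt C n c x = pt C n' c' x' -->
   card (reals C hi I n c x) = card (reals C hi I n' c' x')"
  using pt_respects[OF C _ c, where F = "\<lambda>n c x. card (reals C hi I n c x)"] reals_natural[OF C _ _ _ hi] by blast
qed (use c in blast)

text \<open>Collapses are given by strict inequalities, so they persist nearby, although new ones
  can appear next to a coordinate equal to 1/3 or \<open>hi\<close>. The semicontinuity of the
  counts rests on this asymmetry.\<close>

lemma ksp_near:
 assumes hi: "1/3 \<le> hi"
 shows "EX e>0. ALL y:cb n x e. ALL j<n. ALL a. ksp hi x j = Inl a --> ksp hi y j = Inl a"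
proof -
 define d where "d = (\<lambda>j. if x j < 1/3 then 1/3 - x j else if x j > hi then x j - hi else 1)"
 define e where "e = Min (insert 1 (d ` {..<n}))"
 have "d j > 0" for j by (simp add: d_def)
 hence e: "e > 0" unfolding e_def by (subst Min_gr_iff) auto
 have ed: "e \<le> d j" if "j < n" for j unfolding e_def using that by (intro Min_le) auto
 have "ksp hi y j = Inl a" if y: "y : cb n x e" and j: "j < n" and a: "ksp hi x j = Inl a" for y j a
 proof -
  have "\<bar>y j - x j\<bar> < d j" using y j ed[OF j] by (force simp: cb_def)
  thus ?thesis using a hi by (auto simp: ksp_def d_def split: if_splits)
 qed
 thus ?thesis using e by blast
qed

lemma open_real:
 assumes C: "cubical_set C"
  and "\<And>n c x. c : cells C n ==> x : cube n ==> pt C n c x : B ==> EX e>0. ALL y:cb n x e. pt C n c y : B"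
 shows "openin (topo (realization C)) (points C \<inter> B)"
 unfolding openin_real
proof (intro conjI allI ballI)
 fix n c assume c: "c : cells C n"
 show "openin (cube_topology n) (chart_pre C n c (points C \<inter> B))"
  unfolding openin_cube
 proof (intro conjI ballI)
  fix x assume x: "x : chart_pre C n c (points C \<inter> B)"
  then obtain e where "e > 0" "ALL y:cb n x e. pt C n c y : B"
   using assms(2)[OF c, of x] by (auto simp: chart_pre_def)
  moreover have "pt C n c y : points C" "y : cube n" if "y : cb n x e" for y
   using pt_points[OF C c] that cb_cube by blast+
  ultimately show "EX e>0. cb n x e \<subseteq> chart_pre C n c (points C \<inter> B)"
   by (intro exI[of _ e]) (auto simp: chart_pre_def)
 qed (auto simp: chart_pre_def)
qed auto

text \<open>Near \<open>x\<close> at least as many coordinates are collapsed, hence at least as many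
  are degenerate.\<close>

lemma open_nreal_le:
 assumes C: "cubical_set C" and hi3: "1/3 \<le> hi" and hi1: "hi < 1"
 shows "openin (topo (realization C)) (points C \<inter> {Z. nreal C hi UNIV Z \<le> D})"
proof -
 have hi: "0 \<le> hi" "hi < 1" using hi3 hi1 by simp_all
 show ?thesis
 proof (rule open_real[OF C])
 fix n c x assume c: "c : cells C n" and x: "x : cube n" and Z: "pt C n c x : {Z. nreal C hi UNIV Z \<le> D}"
 obtain e where e: "e > 0" "ALL y:cb n x e. ALL j<n. ALL a. ksp hi x j = Inl a --> ksp hi y j = Inl a"
  using ksp_near[OF hi3] by blast
 have "nreal C hi UNIV (pt C n c y) \<le> D" if y: "y : cb n x e" for y
 proof -
  have "reals C hi UNIV n c y \<subseteq> reals C hi UNIV n c x"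
   using ghost_refine[OF C c setter_ksp setter_ksp, of hi x hi y] e(2) y by (auto simp: reals_def)
  hence "card (reals C hi UNIV n c y) \<le> card (reals C hi UNIV n c x)" by (rule card_mono[OF finite_reals])
  moreover have "y : cube n" using y cb_cube by blast
  ultimately show ?thesis using Z nreal_pt[OF C c _ hi] x by force
 qed
 thus "EX e>0. ALL y:cb n x e. pt C n c y : {Z. nreal C hi UNIV Z \<le> D}" using e(1) by auto
 qed
qed

text \<open>A coordinate whose level lies outside the closed set stays outside, and one that is
  degenerate stays degenerate.\<close>

lemma open_nreal_zero:
 assumes C: "cubical_set C" and hi3: "1/3 \<le> hi" and hi1: "hi < 1" and K: "closed K"
 shows "openin (topo (realization C)) (points C \<inter> {Z. nreal C hi K Z = 0})"
proof -
 have hi: "0 \<le> hi" "hi < 1" using hi3 hi1 by simp_all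
 show ?thesis
 proof (rule open_real[OF C])
 fix n c x assume c: "c : cells C n" and x: "x : cube n" and Z: "pt C n c x : {Z. nreal C hi K Z = 0}"
 hence no: "reals C hi K n c x = {}" using nreal_pt[OF C c x hi] card_0_eq[OF finite_reals] by (metis mem_Collect_eq)
 obtain e where e: "e > 0" "ALL y:cb n x e. ALL j<n. ALL a. ksp hi x j = Inl a --> ksp hi y j = Inl a"
  using ksp_near[OF hi3] by blast
 have "EX d>0. x i \<notin> K --> (ALL t. \<bar>t - x i\<bar> < d --> t \<notin> K)" for i
 proof (cases "x i : K")
  case False
  then obtain d where "d > 0" "ball (x i) d \<subseteq> - K" using K open_contains_ball[of "- K"] by auto
  thus ?thesis by (intro exI[of _ d]) (auto simp: dist_real_def abs_minus_commute[of "x i"] subset_iff)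
 qed (use zero_less_one in blast)
 then obtain d where d: "\<And>i. d i > 0" "\<And>i t. x i \<notin> K ==> \<bar>t - x i\<bar> < d i ==> t \<notin> K" by metis
 define r where "r = Min (insert e (d ` {..<n}))"
 have r: "r > 0" unfolding r_def using d(1) e(1) by (subst Min_gr_iff) auto
 have re: "r \<le> e" "i < n ==> r \<le> d i" for i unfolding r_def by (auto intro: Min_le)
 have "nreal C hi K (pt C n c y) = 0" if y: "y : cb n x r" for y
 proof -
  have "ghost C n (ksp hi y) c i" if i: "i < n" "y i : K" for i
  proof -
   have "\<bar>y i - x i\<bar> < d i" using y i(1) re(2)[OF i(1)] by (force simp: cb_def)
   hence "x i : K" using d(2) i(2) by blast
   hence "ghost C n (ksp hi x) c i" using no i(1) by (auto simp: reals_def)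
   moreover have "y : cb n x e" using y cb_mono[OF re(1)] by blast
   ultimately show ?thesis using ghost_refine[OF C c setter_ksp setter_ksp, of hi x hi y] e(2) by blast
  qed
  hence "reals C hi K n c y = {}" by (auto simp: reals_def)
  moreover have "y : cube n" using y cb_cube by blast
  ultimately show ?thesis using nreal_pt[OF C c _ hi] by simp
 qed
 thus "EX e>0. ALL y:cb n x e. pt C n c y : {Z. nreal C hi K Z = 0}" using r by auto
 qed
qed

text \<open>Coming from below to \<open>z\<close>, a coordinate that matters keeps mattering since
  \<open>z\<close> has no more collapses than its neighbours. Going up from \<open>z\<close>, new
  collapses arise only from coordinates equal to \<open>hi\<close>; by \<open>rob\<close> these are
  degenerate at \<open>z\<close>, and so nothing is lost. Levels only increase, and \<open>I\<close>
  is closed upwards.\<close>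

lemma nreal_mono_circ:
 assumes C: "cubical_set C" and hi: "1/3 \<le> hi" "hi < 1" and W: "openin (topo (realization C)) W"
  and rob: "\<And>Z. Z : W ==> nreal C hi {hi} Z = 0"
  and I: "\<And>s t. s : I ==> s \<le> t ==> t : I" and ZZ: "(Z, Z') : circ (realization C) W"
 shows "nreal C hi I Z \<le> nreal C hi I Z'"
proof -
 have hi0: "0 \<le> hi" using hi by simp
 let ?R = "{(Z, Z'). Z : W \<and> Z' : W \<and> nreal C hi I Z \<le> nreal C hi I Z'}"
 have "circ (realization C) W \<subseteq> ?R"
 proof (rule circ_least[OF W])
  show "preorder_on W ?R" by (auto simp: preorder_on_def refl_on_def trans_def)
  fix n c x y assume c: "c : cells C n" and xy: "(x, y) : crel n (chart_pre C n c W)"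
  let ?U = "chart_pre C n c W"
  let ?N = "\<lambda>x. card (reals C hi I n c x)"
  have Uc: "?U \<subseteq> cube n" by (auto simp: chart_pre_def)
  have "crel n ?U \<subseteq> {(x, y). x : ?U \<and> y : ?U \<and> ?N x \<le> ?N y}"
  proof (rule crel_least)
   fix x y assume x: "x : ?U" and y: "y : ?U" and le: "le n x y" "ivl n x y \<subseteq> ?U"
   have "?N x \<le> ?N y"
   proof (rule seg_chain[of x n y "\<lambda>a b. ?N a \<le> ?N b"])
    fix z assume "z : ivl n x y"
    hence z: "z : cube n" "pt C n c z : W" using le(2) by (auto simp: chart_pre_def)
    have hg: "ghost C n (ksp hi z) c j" if "j < n" "z j = hi" for j
    proof -
     have "reals C hi {hi} n c z = {}" using rob[OF z(2)] nreal_pt[OF C c z(1) hi0 hi(2)] card_0_eq[OF finite_reals] by metis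
     thus ?thesis using that by (auto simp: reals_def)
    qed
    obtain e where e: "e > 0" "ALL y:cb n z e. ALL j<n. ALL a. ksp hi z j = Inl a --> ksp hi y j = Inl a"
     using ksp_near[OF hi(1)] by blast
    define d where "d = (\<lambda>j. if z j < hi then hi - z j else 1)"
    define r where "r = Min (insert e (d ` {..<n}))"
    have r: "r > 0" unfolding r_def using e(1) by (subst Min_gr_iff) (auto simp: d_def)
    have re: "r \<le> e" "i < n ==> r \<le> d i" for i unfolding r_def by (auto intro: Min_le)
    have down: "?N a \<le> ?N z" if a: "a : cb n z r" "le n a z" for a
    proof (rule card_mono[OF finite_reals], rule subsetI)
     fix i assume i: "i : reals C hi I n c a"
     have "a : cb n z e" using a(1) cb_mono[OF re(1)] by blast
     hence "\<not> ghost C n (ksp hi z) c i"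
      using ghost_refine[OF C c setter_ksp setter_ksp, of hi z hi a i] e(2) i by (auto simp: reals_def)
     thus "i : reals C hi I n c z" using i I leD[OF a(2)] by (auto simp: reals_def)
    qed
    have up: "?N z \<le> ?N b" if b: "b : cb n z r" "le n z b" for b
    proof (rule card_mono[OF finite_reals], rule subsetI)
     fix i assume i: "i : reals C hi I n c z"
     hence ii: "i < n" "z i : I" "\<not> ghost C n (ksp hi z) c i" by (auto simp: reals_def)
     \<comment> \<open>The coordinates that may pass the threshold above \<open>z\<close>. As they
       are degenerate at \<open>z\<close>, setting them to 1 in advance leaves the collapsed cell
       unchanged, and afterwards \<open>b\<close> has no collapse beyond \<open>?ka\<close>.\<close>
     define S where "S = {j. j < n \<and> z j = hi}"
     have S: "finite S" "\<And>j. j : S ==> ghost C n (ksp hi z) c j" using hg by (auto simp: S_def)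
     have iS: "i \<notin> S" using S(2) ii(3) by blast
     let ?ka = "scomp (ksp hi z) (psp S 1)"
     have k1: "av C n ?ka c = av C n (ksp hi z) c" by (rule ghost_set[OF C c setter_ksp S order_refl])
     have sk: "setter n ?ka" using setter_comp[OF setter_ksp setter_psp[of 1 n S]] by simp
     have "\<not> ghost C n (ksp hi b) c i"
     proof
      assume g: "ghost C n (ksp hi b) c i"
      have "ghost C n ?ka c i"
      proof (rule ghost_refine[OF C c setter_ksp sk _ g])
       fix j a assume j: "j < n" and a: "ksp hi b j = Inl a"
       have zb: "z j \<le> b j" using leD[OF b(2) j] .
       have "\<bar>b j - z j\<bar> < d j" using b(1) j re(2)[OF j] by (force simp: cb_def)
       hence "b j > hi ==> z j \<ge> hi" by (auto simp: d_def split: if_splits)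
       thus "?ka j = Inl a" using a zb j hi(1)
        by (auto simp: ksp_def psp_def S_def split: if_splits)
      qed
      hence "av C n (psp {i} 0) (av C n ?ka c) = av C n ?ka c" using ghost_iff[OF C c sk] by blast
      thus False using ii(3) ghost_iff[OF C c setter_ksp] k1 by metis
     qed
     thus "i : reals C hi I n c b" using ii I leD[OF b(2)] by (auto simp: reals_def)
    qed
    show "EX e>0. ALL a:cb n z e. ALL b:cb n z e. le n a z --> le n z b --> ?N a \<le> ?N b"
     using r down up order_trans by blast
   qed (use x y Uc le in auto)
   thus "(x, y) : {(x, y). x : ?U \<and> y : ?U \<and> ?N x \<le> ?N y}" using x y by simp
  qed (auto simp: preorder_on_def refl_on_def trans_def)
  hence "x : ?U" "y : ?U" "?N x \<le> ?N y" using xy by blast+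
  thus "(pt C n c x, pt C n c y) : ?R"
   using nreal_pt[OF C c _ hi0 hi(2)] by (simp add: chart_pre_def)
 qed
 thus ?thesis using ZZ by blast
qed

section \<open>Adapted systems of reparametrizations\<close>

lemma openin_cubeI:
 assumes "U \<subseteq> cube m" "\<And>x. x : U ==> EX e>0. ALL y:cb m x e. y : U"
 shows "openin (cube_topology m) U"
 unfolding openin_cube
proof (intro conjI ballI assms(1))
 fix x assume "x : U"
 then obtain e where "e > 0" "ALL y:cb m x e. y : U" using assms(2) by blast
 thus "EX e>0. cb m x e \<subseteq> U" by (intro exI[of _ e]) auto
qed

section \<open>Monotone separation of closed subsets of the cube\<close>

definition up_closed :: "nat => vec set => bool" where
 "up_closed m K \<longleftrightarrow> (ALL p:K. ALL q:cube m. le m p q --> q : K)"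

definition cclosed :: "nat => vec set => bool" where
 "cclosed m K \<longleftrightarrow> K \<subseteq> cube m \<and> openin (cube_topology m) (cube m - K)"

lemma cclosedD: "cclosed m K ==> x : cube m ==> x \<notin> K ==> EX e>0. cb m x e \<inter> K = {}"
 unfolding cclosed_def using openin_cubeD[of m "cube m - K" x] by blast

lemma cclosed_Int: "cclosed m K ==> cclosed m L ==> cclosed m (K \<inter> L)"
 unfolding cclosed_def by (auto simp: Diff_Int intro: openin_Un)

lemma cclosed_diff:
 assumes "cclosed m K" "openin (cube_topology m) U"
 shows "cclosed m (K - U)"
proof -
 have "cube m - (K - U) = (cube m - K) \<union> U" using openin_subset[OF assms(2)] topspace_cube[of m] by blast
 thus ?thesis using assms by (auto simp: cclosed_def intro: openin_Un)
qed

lemma cclosed_point: "q : cube m ==> cclosed m {q}"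
proof -
 assume q: "q : cube m"
 have "openin (cube_topology m) (cube m - {q})"
 proof (rule openin_cubeI)
  fix x assume "x : cube m - {q}"
  then obtain i where i: "i < m" "x i \<noteq> q i" using cube_eqI[OF _ q] by blast
  have "ALL y:cb m x \<bar>x i - q i\<bar>. y : cube m - {q}" using i by (force simp: cb_def)
  thus "EX e>0. ALL y:cb m x e. y : cube m - {q}" using i(2) by (intro exI[of _ "\<bar>x i - q i\<bar>"]) simp
 qed auto
 thus ?thesis using q by (simp add: cclosed_def)
qed

text \<open>The order relation is closed, so by compactness its failure on all pairs is uniform.
  Pairs are handled as points of the cube of dimension \<open>m + m\<close>.\<close>

lemma uniform_gap:
 assumes L: "cclosed m L" and K: "cclosed m K" and LK: "\<And>p q. p : L ==> q : K ==> \<not> le m p q"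
 shows "EX d>0. ALL p:L. ALL q:K. EX i<m. d < p i - q i"
proof -
 let ?R = "\<lambda>S. EX d>0. ALL z:S. lcut m z : L --> rcut m m z : K --> (EX i<m. d < z i - z (m + i))"
 have "?R (cube (m + m))"
 proof (rule cube_compact_induct[where R = ?R])
  fix z assume z: "z : cube (m + m)"
  have near: "lcut m y : cb m (lcut m z) e" "rcut m m y : cb m (rcut m m z) e" if "y : cb (m + m) z e" for y e
   using that lcut_cube[of y m m] rcut_cube[of y m m] by (auto simp: cb_def lcut_def rcut_def)
  show "EX e>0. ?R (cb (m + m) z e)"
  proof (cases "lcut m z : L \<and> rcut m m z : K")
   case True
   then obtain i where i: "i < m" "z (m + i) < z i"
    using LK[of "lcut m z" "rcut m m z"] by (auto simp: le_def lcut_def rcut_def not_le)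
   define d where "d = (z i - z (m + i)) / 3"
   have "d < y i - y (m + i)" if "y : cb (m + m) z d" for y
   proof -
    have "\<bar>y i - z i\<bar> < d" "\<bar>y (m + i) - z (m + i)\<bar> < d" using that i(1) by (auto simp: cb_def)
    moreover have "3 * d = z i - z (m + i)" by (simp add: d_def)
    ultimately show ?thesis by linarith
   qed
   thus ?thesis using i by (intro exI[of _ d] conjI) (auto simp: d_def)
  next
   case False
   then obtain e where "e > 0" "cb m (lcut m z) e \<inter> L = {} \<or> cb m (rcut m m z) e \<inter> K = {}"
    using cclosedD[OF L lcut_cube[OF z]] cclosedD[OF K rcut_cube[OF z]] by metis
   thus ?thesis using near zero_less_one by (intro exI[of _ e] conjI) blast+
  qed
 next
  fix S T assume "?R S" "?R T"
  then obtain d e where "d > 0" "ALL z:S. lcut m z : L --> rcut m m z : K --> (EX i<m. d < z i - z (m + i))"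
   "e > 0" "ALL z:T. lcut m z : L --> rcut m m z : K --> (EX i<m. e < z i - z (m + i))" by blast
  thus "?R (S \<union> T)" by (intro exI[of _ "min d e"]) force
 qed (use zero_less_one in blast)+
 then obtain d where d: "d > 0" "\<And>z. z : cube (m + m) ==> lcut m z : L ==> rcut m m z : K ==> EX i<m. d < z i - z (m + i)" by blast
 have "EX i<m. d < p i - q i" if pq: "p : L" "q : K" for p q
 proof -
  have c: "p : cube m" "q : cube m" using pq L K by (auto simp: cclosed_def)
  have "EX i<m. d < cat m m p q i - cat m m p q (m + i)"
   using d(2)[OF cat_cube[OF c]] pq by (simp add: lcut_cat[OF c(1)] rcut_cat[OF c(2)])
  thus ?thesis by (auto simp: cat_def)
 qed
 thus ?thesis using d(1) by blast
qed

text \<open>The gap between \<open>A\<close> and a single point \<open>q\<close> survives every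
  displacement of \<open>q\<close> that is smaller than the gap.\<close>

lemma cclosed_upper:
 assumes A: "cclosed m A"
 shows "cclosed m {q : cube m. EX p:A. le m p q}"
proof -
 have "openin (cube_topology m) (cube m - {q : cube m. EX p:A. le m p q})"
 proof (rule openin_cubeI)
  fix q assume "q : cube m - {q : cube m. EX p:A. le m p q}"
  then obtain d where d: "d > 0" "ALL p:A. EX i<m. d < p i - q i"
   using uniform_gap[OF A cclosed_point[of q m]] by auto
  have "\<not> le m p y" if "y : cb m q d" "p : A" for y p
   using d(2) that by (force simp: le_def cb_def)
  thus "EX e>0. ALL y:cb m q e. y : cube m - {q : cube m. EX p:A. le m p q}"
   using d(1) cb_cube by blast
 qed auto
 thus ?thesis by (auto simp: cclosed_def)
qed

text \<open>The function is a ramp in the one-sided distance of a point from \<open>L\<close>.\<close>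

lemma separate_closed:
 assumes L: "cclosed m L" "up_closed m L" and K: "cclosed m K" and LK: "L \<inter> K = {}"
 shows "EX f U V. cmono m f \<and> openin (cube_topology m) U \<and> L \<subseteq> U \<and> (ALL y:U. f y = 1) \<and>
  openin (cube_topology m) V \<and> K \<subseteq> V \<and> (ALL y:V. f y = 0)"
proof -
 have KL: "K \<subseteq> cube m" "L \<subseteq> cube m" using K L(1) by (auto simp: cclosed_def)
 have oc: "openin (cube_topology m) (cube m)" using openin_topspace[of "cube_topology m"] by (simp add: topspace_cube)
 obtain d where d: "d > 0" "ALL p:L. ALL q:K. EX i<m. d < p i - q i"
  using uniform_gap[OF L(1) K] L(2) LK KL unfolding up_closed_def by blast
 show ?thesis
 proof (cases "L = {}")
  case True
  show ?thesis
   by (rule exI[of _ "\<lambda>_. 0"], rule exI[of _ "{}"], rule exI[of _ "cube m"]) (use True oc KL cmono_const[of 0] in auto)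
 next
  case False
  \<comment> \<open>\<open>g p y\<close> is the amount by which \<open>y\<close> fails to lie above
    \<open>p\<close>, measured in the maximum norm.\<close>
  define g where "g p y = Max (insert 0 ((\<lambda>i. p i - y i) ` {..<m}))" for p y :: vec
  have g: "g p y \<le> c \<longleftrightarrow> 0 \<le> c \<and> (ALL i<m. p i - y i \<le> c)" for p y c by (auto simp: g_def)
  define G where "G y = (INF p\<in>L. g p y)" for y
  have g0: "0 \<le> g p y" for p y by (simp add: g_def)
  have bd: "bdd_below ((\<lambda>p. g p y) ` L)" for y using g0 by (intro bdd_belowI2)
  have lip: "G y \<le> G x + c" if "0 \<le> c" "\<And>i. i < m ==> x i - y i \<le> c" for x y c
  proof -
   have "G y - c \<le> g p x" if p: "p : L" for p
   proof -
    have "p i - y i \<le> g p x + c" if "i < m" for i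
    proof -
     have "p i - x i \<le> g p x" using g[of p x "g p x"] that by simp
     thus ?thesis using \<open>\<And>i. i < m ==> x i - y i \<le> c\<close>[OF that] by linarith
    qed
    hence "g p y \<le> g p x + c" using g0[of p x] \<open>0 \<le> c\<close> by (subst g) simp
    moreover have "G y \<le> g p y" unfolding G_def by (rule cINF_lower[OF bd p])
    ultimately show ?thesis by linarith
   qed
   hence "G y - c \<le> G x" unfolding G_def[of x] by (rule cINF_greatest[OF False])
   thus ?thesis by simp
  qed
  \<comment> \<open>The ramp is 1 up to distance d/3 and 0 from 2d/3 on. Points of \<open>K\<close>
    have distance at least \<open>d\<close>, so balls of radius d/3 around both sets are
    safe.\<close>
  define f where "f y = min 1 (max 0 (2 - 3 / d * G y))" for y
  have cont: "\<bar>G y - G x\<bar> \<le> e" if "y : cb m x e" "e > 0" for x y e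
  proof -
   have "x i - y i \<le> e" "y i - x i \<le> e" if "i < m" for i using \<open>y : cb m x e\<close> that by (force simp: cb_def)+
   thus ?thesis using lip[of e x y] lip[of e y x] \<open>e > 0\<close> by (simp add: abs_le_iff)
  qed
  have "cmono m f"
   unfolding cmono_def
  proof (intro conjI ballI impI)
   have G: "continuous_map (cube_topology m) euclideanreal G"
    unfolding continuous_cube_iff
   proof (intro ballI allI impI)
    fix x and e :: real assume "e > 0"
    thus "EX d>0. ALL y:cb m x d. \<bar>G y - G x\<bar> < e" using cont[of _ x "e / 2"] by (intro exI[of _ "e / 2"]) force
   qed
   show "continuous_map (cube_topology m) euclideanreal f"
    unfolding f_def by (intro continuous_map_real_min continuous_map_real_max continuous_map_diff continuous_map_real_mult G continuous_map_canonical_const)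
   show "f x \<le> f y" if "le m x y" for x y
   proof -
    have "G y \<le> G x" using lip[of 0 x y] that by (simp add: le_def)
    hence "3 / d * G y \<le> 3 / d * G x" using d(1) by (intro mult_left_mono) simp_all
    thus ?thesis by (simp add: f_def)
   qed
  qed (simp_all add: f_def)
  moreover have "f y = 1" if "y : cb m p (d / 3)" "p : L" for y p
  proof -
   have "p i - y i \<le> d / 3" if "i < m" for i
   proof -
    have "\<bar>y i - p i\<bar> < d / 3" using \<open>y : cb m p (d / 3)\<close> that by (simp add: cb_def)
    thus ?thesis by linarith
   qed
   hence "g p y \<le> d / 3" unfolding g using d(1) by simp
   hence "G y \<le> d / 3" using cINF_lower[OF bd that(2), of y] by (simp add: G_def)
   hence "3 / d * G y \<le> 1" using d(1) by (simp add: field_simps)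
   thus ?thesis by (simp add: f_def)
  qed
  moreover have "f y = 0" if yq: "y : cb m q (d / 3)" "q : K" for y q
  proof -
   have "d \<le> G q" unfolding G_def
   proof (rule cINF_greatest[OF False])
    fix p assume "p : L"
    then obtain i where "i < m" "d < p i - q i" using d(2) yq(2) by blast
    thus "d \<le> g p q" using g[of p q "g p q"] by force
   qed
   moreover have "\<bar>G y - G q\<bar> \<le> d / 3" using cont[OF that(1)] d(1) by simp
   ultimately have "2 * d \<le> 3 * G y" by linarith
   hence "2 \<le> 3 / d * G y" using d(1) by (simp add: field_simps)
   thus ?thesis by (simp add: f_def)
  qed
  ultimately show ?thesis
   using KL d(1)
   by (intro exI[of _ f] exI[of _ "\<Union>p\<in>L. cb m p (d / 3)"] exI[of _ "\<Union>q\<in>K. cb m q (d / 3)"])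
    (auto intro!: openin_Union openin_cb cb_self)
 qed
qed

section \<open>Obstructed levels and chains of obstructions\<close>

text \<open>A level at which an adapted system has to be locally constant. Coordinates below 1/3 or
  above 2/3 are collapsed, so such levels lie between 1/3 and 2/3.\<close>

definition bad :: "'a cset => (vec => 'a rpt) => real => vec => bool" where
 "bad C th T q \<longleftrightarrow> nreal C (2/3) {T} (th q) \<noteq> 0"

lemma stream_preimage:
 assumes "stream_map (dcube m) (realization C) th" "openin (topo (realization C)) U"
 shows "openin (cube_topology m) {q : cube m. th q : U}"
 using assms openin_continuous_map_preimage[of "cube_topology m" "topo (realization C)" th U]
 by (simp add: stream_map_dcube topspace_cube)

lemma stream_points:
 assumes "cubical_set C" "stream_map (dcube m) (realization C) th" "q : cube m"
 shows "th q : points C"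
 using assms continuous_map_image_subset_topspace[of "cube_topology m" "topo (realization C)" th]
 by (auto simp: stream_map_dcube topspace_cube topspace_real)

lemma open_not_bad:
 assumes C: "cubical_set C" and th: "stream_map (dcube m) (realization C) th" and K: "closed K"
  and q: "q : cube m" "nreal C (2/3) K (th q) = 0"
 shows "EX e>0. ALL q':cb m q e. nreal C (2/3) K (th q') = 0"
proof -
 let ?U = "{q : cube m. th q : points C \<inter> {Z. nreal C (2/3) K Z = 0}}"
 have "openin (cube_topology m) ?U"
  by (rule stream_preimage[OF th open_nreal_zero[OF C _ _ K]]) simp_all
 moreover have "q : ?U" using q stream_points[OF C th] by simp
 ultimately show ?thesis using openin_cubeD[of m ?U q] by blast
qed

lemma nreal_UNIV_le:
 assumes C: "cubical_set C" and hi: "0 \<le> hi" "hi < 1" and Z: "Z : points C" and IJ: "I \<subseteq> J"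
 shows "nreal C hi I Z \<le> nreal C hi J Z"
proof -
 obtain n c x where c: "c : cells C n" "x : cube n" "Z = pt C n c x" using pointsE[OF Z] .
 have "reals C hi I n c x \<subseteq> reals C hi J n c x" using IJ by (auto simp: reals_def)
 thus ?thesis using card_mono[OF finite_reals] nreal_pt[OF C c(1,2) hi] c(3) by metis
qed

text \<open>A higher threshold collapses fewer coordinates, so the one that obstructs still matters;
  it lies at the level \<open>t\<close>, not above it, and makes the difference of the two
  counts.\<close>

lemma nreal_hi:
 assumes C: "cubical_set C" and hi: "2/3 \<le> hi" "hi < 1" and Z: "Z : points C" and b: "nreal C (2/3) {t} Z \<noteq> 0"
 shows "nreal C hi {t<..} Z < nreal C hi {t..} Z"
proof -
 obtain n c x where c: "c : cells C n" "x : cube n" and Z: "Z = pt C n c x" using pointsE[OF Z] .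
 have "card (reals C (2/3) {t} n c x) \<noteq> 0" using b Z nreal_pt[OF C c] by simp
 then obtain i where "i : reals C (2/3) {t} n c x" by fastforce
 hence i: "i < n" "x i = t" "\<not> ghost C n (ksp (2/3) x) c i" by (auto simp: reals_def)
 have "\<not> ghost C n (ksp hi x) c i"
 proof
  assume g: "ghost C n (ksp hi x) c i"
  have "ghost C n (ksp (2/3) x) c i"
   by (rule ghost_refine[OF C c(1) setter_ksp setter_ksp _ g]) (use hi in \<open>auto simp: ksp_def split: if_splits\<close>)
  thus False using i(3) by blast
 qed
 hence "i : reals C hi {t..} n c x" "i \<notin> reals C hi {t<..} n c x" using i by (auto simp: reals_def)
 moreover have "reals C hi {t<..} n c x \<subseteq> reals C hi {t..} n c x" by (auto simp: reals_def)
 ultimately have "reals C hi {t<..} n c x \<subset> reals C hi {t..} n c x" by blast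
 hence "card (reals C hi {t<..} n c x) < card (reals C hi {t..} n c x)" by (rule psubset_card_mono[OF finite_reals])
 thus ?thesis using Z nreal_pt[OF C c] hi by simp
qed

text \<open>Arbitrary finite index sets are allowed so that bounds add up over a union: a chain is
  split according to the part in which each of its points lies.\<close>

definition chains_le :: "'a cset => nat => (vec => 'a rpt) => vec =>
  vec set => nat => bool" where
 "chains_le C m th t S D \<longleftrightarrow> (ALL K p. finite K --> (ALL k:K. p k : S \<and> bad C th (t k) (p k)) -->
  (ALL k:K. ALL l:K. k < l --> le m (p k) (p l)) --> card (K :: nat set) \<le> D)"

text \<open>Along a directed path, whenever a visible coordinate sits at a level that decreases strictly in time, the number of
 visible coordinates above that level strictly increases; locally, this number is bounded.\<close>

lemma bad_chains_bounded:
 assumes C: "cubical_set C" and th: "stream_map (dcube m) (realization C) th" and t: "\<And>k l. k < l ==> t l < (t k :: real)"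
 shows "EX D. chains_le C m th t (cube m) D"
proof -
 let ?R = "\<lambda>S. EX D. chains_le C m th t S D"
 show "?R (cube m)"
 proof (rule cube_compact_induct[where R = ?R])
  fix q assume q: "q : cube m"
  obtain n c x where c: "c : cells C n" "x : cube n" and Z: "th q = pt C n c x"
   using pointsE[OF stream_points[OF C th q]] .
  \<comment> \<open>The threshold is moved off the finitely many coordinates of \<open>x\<close>;
    then no coordinate that matters sits at the threshold at \<open>q\<close>, and this remains so
    in a neighbourhood.\<close>
  have "infinite ({2/3<..<1::real} - x ` {..<n})" by (rule Diff_infinite_finite) (auto simp: infinite_Ioo)
  then obtain hi where "hi : {2/3<..<1} - x ` {..<n}" by (metis finite.emptyI ex_in_conv)
  hence hi: "2/3 < hi" "hi < 1" and hx: "\<And>i. i < n ==> x i \<noteq> hi" by auto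
  have hi': "1/3 \<le> hi" "0 \<le> hi" using hi by simp_all
  define D where "D = nreal C hi UNIV (th q)"
  define W where "W = (points C \<inter> {Z. nreal C hi UNIV Z \<le> D}) \<inter> (points C \<inter> {Z. nreal C hi {hi} Z = 0})"
  have W: "openin (topo (realization C)) W"
   unfolding W_def by (intro openin_Int open_nreal_le[OF C hi'(1) hi(2)] open_nreal_zero[OF C hi'(1) hi(2)]) simp
  have "reals C hi {hi} n c x = {}" using hx by (auto simp: reals_def)
  hence "nreal C hi {hi} (th q) = 0" using nreal_pt[OF C c hi'(2) hi(2)] Z by simp
  hence "q : {q : cube m. th q : W}" using q stream_points[OF C th q] by (simp add: W_def D_def)
  then obtain e where e: "e > 0" "cb m q e \<subseteq> {q : cube m. th q : W}"
   using openin_cubeD[OF stream_preimage[OF th W]] by blast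
  have mono: "nreal C hi I (th p) \<le> nreal C hi I (th p')"
   if "p : cb m q e" "p' : cb m q e" "le m p p'" "\<And>s u. s : I ==> s \<le> u ==> u : I" for p p' I
  proof (rule nreal_mono_circ[OF C hi'(1) hi(2) W])
   have "(p, p') : crel m (cb m q e)" by (rule crelI[OF that(1,2,3) cb_ivl[OF that(1,2)]])
   hence "(p, p') : crel m {q : cube m. th q : W}" using crel_mono[OF e(2)] by blast
   thus "(th p, th p') : circ (realization C) W" using th W unfolding stream_map_dcube by blast
  qed (use that(4) in \<open>auto simp: W_def\<close>)
  have "card K \<le> D"
   if K: "finite K" "ALL k:K. p k : cb m q e \<and> bad C th (t k) (p k)" "ALL k:K. ALL l:K. k < l --> le m (p k) (p l)" for K p
  proof -
   let ?a = "\<lambda>k. nreal C hi {t k<..} (th (p k))"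
   have pW: "th (p k) : points C" "nreal C hi UNIV (th (p k)) \<le> D" if "k : K" for k
    using K(2) e(2) that by (auto simp: W_def)
   have s: "?a k < nreal C hi {t k..} (th (p k))" if "k : K" for k
    using nreal_hi[OF C _ hi(2) pW(1)[OF that]] hi(1) K(2) that by (simp add: bad_def)
   have lt: "?a k < ?a l" if kl: "k : K" "l : K" "k < l" for k l
   proof -
    have "nreal C hi {t k..} (th (p k)) \<le> nreal C hi {t k..} (th (p l))"
     using K(2,3) kl by (intro mono) auto
    also have "\<dots> \<le> ?a l"
     using t[OF kl(3)] by (intro nreal_UNIV_le[OF C hi'(2) hi(2) pW(1)[OF kl(2)]]) auto
    finally show ?thesis using s[OF kl(1)] by simp
   qed
   have "inj_on ?a K"
   proof (rule inj_onI)
    fix k l assume "k : K" "l : K" "?a k = ?a l"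
    thus "k = l" using lt[of k l] lt[of l k] by (cases k l rule: linorder_cases) auto
   qed
   moreover have "?a ` K \<subseteq> {..<D}"
   proof
    fix y assume "y : ?a ` K"
    then obtain k where k: "k : K" "y = ?a k" by blast
    have "y < nreal C hi {t k..} (th (p k))" using s[OF k(1)] k(2) by simp
    also have "\<dots> \<le> nreal C hi UNIV (th (p k))" by (rule nreal_UNIV_le[OF C hi'(2) hi(2) pW(1)[OF k(1)]]) simp
    finally show "y : {..<D}" using pW(2)[OF k(1)] by simp
   qed
   ultimately show ?thesis using card_inj_on_le[of ?a K "{..<D}"] by simp
  qed
  thus "EX e>0. ?R (cb m q e)" using e(1) unfolding chains_le_def by blast
 next
  fix S T assume "?R S" "?R T"
  then obtain D E where DE: "chains_le C m th t S D" "chains_le C m th t T E" by blast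
  note D = DE(1)[unfolded chains_le_def, rule_format] and E = DE(2)[unfolded chains_le_def, rule_format]
  have "card K \<le> D + E" if K: "finite K" "ALL k:K. p k : S \<union> T \<and> bad C th (t k) (p k)"
   "ALL k:K. ALL l:K. k < l --> le m (p k) (p l)" for K :: "nat set" and p
  proof -
   let ?A = "{k : K. p k : S}" and ?B = "{k : K. p k : T}"
   have "card ?A \<le> D" using K by (intro D[of ?A p]) auto
   moreover have "card ?B \<le> E" using K by (intro E[of ?B p]) auto
   moreover have "K = ?A \<union> ?B" using K(2) by blast
   hence "card K \<le> card ?A + card ?B" by (metis card_Un_le)
   ultimately show ?thesis by linarith
  qed
  thus "?R (S \<union> T)" unfolding chains_le_def by blast
 next
  fix S T assume "?R S" "T \<subseteq> S"
  moreover have "chains_le C m th t T D" if "chains_le C m th t S D" for D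
   unfolding chains_le_def
  proof (intro allI impI)
   fix K p assume K: "finite K" "ALL k:K. p k : T \<and> bad C th (t k) (p k)" "ALL k:K. ALL l:K. k < l --> le m (p k) (p l)"
   have "ALL k:K. p k : S \<and> bad C th (t k) (p k)" using K(2) \<open>T \<subseteq> S\<close> by blast
   thus "card K \<le> D" using that K(1,3) unfolding chains_le_def by simp
  qed
  ultimately show "?R T" by blast
 next
  have "card K \<le> 0" if "ALL k:K. p k : {} \<and> bad C th (t k) (p k)" for K :: "nat set" and p
   using that by auto
  thus "?R {}" unfolding chains_le_def by blast
 qed
qed


section \<open>Construction of an adapted system\<close>

definition flatat :: "nat => gsys => vec => real => bool" where
 "flatat m G q T \<longleftrightarrow> (EX d>0. ALL q':cb m q d. ALL a b. \<bar>a - T\<bar> < d --> \<bar>b - T\<bar> < d --> G q' a = G q' b)"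

definition good :: "'a cset => nat => (vec => 'a rpt) =>
  gsys => bool" where
 "good C m th G \<longleftrightarrow> gfun m G \<and> (ALL q:cube m. ALL x. (x \<le> 1/3 --> G q x = 0) \<and> (2/3 \<le> x --> G q x = 1)) \<and>
  (ALL q:cube m. ALL T. bad C th T q --> flatat m G q T)"

lemma flatat_cong_near:
 assumes F: "flatat m F q T" and e: "e > 0" and eq: "\<And>q' a. q' : cb m q e ==> \<bar>a - T\<bar> < e ==> G q' a = F q' a"
 shows "flatat m G q T"
proof -
 obtain d where d: "d > 0" "ALL q':cb m q d. ALL a b. \<bar>a - T\<bar> < d --> \<bar>b - T\<bar> < d --> F q' a = F q' b"
  using F unfolding flatat_def by blast
 have "cb m q (min d e) \<subseteq> cb m q d" "cb m q (min d e) \<subseteq> cb m q e" by (auto intro!: cb_mono)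
 thus ?thesis unfolding flatat_def
  by (intro exI[of _ "min d e"]) (use d e eq in \<open>auto simp: subset_iff\<close>)
qed

lemma flatatI:
 assumes "e > 0" "\<And>q' a b. q' : cb m q e ==> \<bar>a - T\<bar> < e ==> \<bar>b - T\<bar> < e ==> G q' a = G q' b"
 shows "flatat m G q T"
 using assms unfolding flatat_def by blast

text \<open>A representative has finitely many coordinates, so a whole closed interval of levels
  around \<open>T\<close> is free of obstructions at \<open>q\<close>; being closed, it stays free
  nearby.\<close>

lemma not_bad_near:
 assumes C: "cubical_set C" and th: "stream_map (dcube m) (realization C) th" and q: "q : cube m" and b: "\<not> bad C th T q"
 shows "EX e>0. ALL q':cb m q e. ALL T'. \<bar>T' - T\<bar> \<le> e --> \<not> bad C th T' q'"
proof -
 obtain n c x where c: "c : cells C n" "x : cube n" and Z: "th q = pt C n c x"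
  using pointsE[OF stream_points[OF C th q]] .
 have n: "nreal C (2/3) I (th q) = card (reals C (2/3) I n c x)" for I using Z nreal_pt[OF C c] by simp
 have "EX d>0. x i = T \<or> d < \<bar>x i - T\<bar>" for i
  by (cases "x i = T", use zero_less_one in blast, rule exI[of _ "\<bar>x i - T\<bar> / 2"]) simp
 then obtain d where d: "\<And>i. d i > 0" "\<And>i. x i = T \<or> d i < \<bar>x i - T\<bar>" by metis
 define r where "r = Min (insert 1 (d ` {..<n}))"
 have r: "r > 0" unfolding r_def using d(1) by (subst Min_gr_iff) auto
 have re: "i < n ==> r \<le> d i" for i unfolding r_def by (auto intro: Min_le)
 have eq: "x i = T" if "i < n" "x i : {T - r..T + r}" for i
 proof -
  have "\<bar>x i - T\<bar> \<le> d i" using that re[of i] by auto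
  thus ?thesis using d(2)[of i] by auto
 qed
 have "reals C (2/3) {T - r..T + r} n c x \<subseteq> reals C (2/3) {T} n c x" using eq by (auto simp: reals_def)
 hence "nreal C (2/3) {T - r..T + r} (th q) = 0" using b card_mono[OF finite_reals] n unfolding bad_def by (metis le_zero_eq)
 then obtain e where e: "e > 0" "ALL q':cb m q e. nreal C (2/3) {T - r..T + r} (th q') = 0"
  using open_not_bad[OF C th _ q, of "{T - r..T + r}"] by auto
 have "\<not> bad C th T' q'" if q': "q' : cb m q (min e r)" and T': "\<bar>T' - T\<bar> \<le> min e r" for q' T'
 proof -
  have "q' : cb m q e" using q' cb_mono[of "min e r" e m q] by auto
  moreover have "{T'} \<subseteq> {T - r..T + r}" using T' by auto
  moreover have "th q' : points C" using stream_points[OF C th] q' cb_cube by blast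
  ultimately have "nreal C (2/3) {T'} (th q') \<le> nreal C (2/3) {T - r..T + r} (th q')"
   by (intro nreal_UNIV_le[OF C]) simp_all
  moreover have "nreal C (2/3) {T - r..T + r} (th q') = 0" using e(2) \<open>q' : cb m q e\<close> by blast
  ultimately have "nreal C (2/3) {T'} (th q') = 0" by simp
  thus ?thesis by (simp add: bad_def)
 qed
 thus ?thesis using e(1) r by (intro exI[of _ "min e r"]) auto
qed

lemma cclosed_bad:
 assumes C: "cubical_set C" and th: "stream_map (dcube m) (realization C) th"
 shows "cclosed m {q : cube m. bad C th T q}"
proof -
 have "openin (cube_topology m) (cube m - {q : cube m. bad C th T q})"
 proof (rule openin_cubeI)
  fix q assume "q : cube m - {q : cube m. bad C th T q}"
  then obtain e where e: "e > 0" "ALL q':cb m q e. ALL T'. \<bar>T' - T\<bar> \<le> e --> \<not> bad C th T' q'"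
   using not_bad_near[OF C th, of q T] by blast
  thus "EX e>0. ALL y:cb m q e. y : cube m - {q : cube m. bad C th T q}"
   using cb_cube[of m q e] by (intro exI[of _ e]) auto
 qed auto
 thus ?thesis by (auto simp: cclosed_def)
qed

lemma up_closed_upper: "up_closed m {q : cube m. EX p:A. le m p q}"
 unfolding up_closed_def using le_trans by blast

text \<open>The system is a maximum of ramps around the decreasing levels \<open>tlev k\<close>, the \<open>k\<close>-th of which is active on a
 neighbourhood of \<open>late k\<close>, the set of points above a chain of \<open>k\<close> points at which the levels before \<open>k\<close> are bad.\<close>

definition tlev :: vec where
 "tlev k = 1/3 + 1 / (real k + 4)"

text \<open>The offset by one half makes these levels separate consecutive values of
  \<open>tlev\<close>; the first one is 13/21, just below 2/3.\<close>

definition ulev :: vec where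
 "ulev k = 1/3 + 1 / (real k + 7/2)"

lemma lev: "ulev (Suc k) < tlev k" "tlev k < ulev k" "1/3 < ulev k" "ulev 0 < 2/3" "k < l ==> tlev l < tlev k"
 by (auto simp: tlev_def ulev_def field_simps)

primrec late :: "'a cset => nat => (vec => 'a rpt) => nat => vec set" where
 "late C m th 0 = cube m"
| "late C m th (Suc k) = {q : cube m. EX p:late C m th k \<inter> {q : cube m. bad C th (tlev k) q}. le m p q}"

lemma late_closed:
 assumes "cubical_set C" "stream_map (dcube m) (realization C) th"
 shows "cclosed m (late C m th k)" "up_closed m (late C m th k)"
proof -
 show "cclosed m (late C m th k)"
 proof (induction k)
  case (Suc k)
  show ?case unfolding late.simps by (rule cclosed_upper[OF cclosed_Int[OF Suc cclosed_bad[OF assms]]])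
 qed (simp add: cclosed_def)
 show "up_closed m (late C m th k)"
 proof (cases k)
  case (Suc k)
  show ?thesis unfolding Suc late.simps by (rule up_closed_upper)
 qed (simp add: up_closed_def)
qed

lemma late_chain:
 assumes "q : late C m th k"
 shows "EX p. (ALL i<k. p i : cube m \<and> bad C th (tlev i) (p i) \<and> le m (p i) q) \<and> (ALL i<k. ALL j<k. i < j --> le m (p i) (p j))"
 using assms
proof (induction k arbitrary: q)
 case (Suc k)
 then obtain r where r: "r : late C m th k" "r : cube m" "bad C th (tlev k) r" "le m r q" by auto
 obtain p where p: "ALL i<k. p i : cube m \<and> bad C th (tlev i) (p i) \<and> le m (p i) r"
  "ALL i<k. ALL j<k. i < j --> le m (p i) (p j)" using Suc.IH[OF r(1)] by blast
 have le: "le m (p i) q" if "i < k" for i using p(1) that r(4) le_trans by blast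
 show ?case
  by (rule exI[of _ "p(k := r)"]) (use p r le in \<open>auto simp: less_Suc_eq\<close>)
qed simp

text \<open>A point of the \<open>k\<close>-th set lies above a chain of \<open>k\<close> points
  obstructed at the first \<open>k\<close> levels, and such chains have bounded length.\<close>

lemma late_empty:
 assumes C: "cubical_set C" and th: "stream_map (dcube m) (realization C) th"
 shows "EX k. late C m th k = {}"
proof -
 obtain D where "chains_le C m th tlev (cube m) D" using bad_chains_bounded[OF C th, of tlev, OF lev(5)] by blast
 note D = this[unfolded chains_le_def, rule_format]
 have "q \<notin> late C m th (Suc D)" for q
 proof
  assume "q : late C m th (Suc D)"
  then obtain p where "ALL i<Suc D. p i : cube m \<and> bad C th (tlev i) (p i) \<and> le m (p i) q"
   "ALL i<Suc D. ALL j<Suc D. i < j --> le m (p i) (p j)" using late_chain by blast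
  hence "card {..<Suc D} \<le> D" by (intro D[of "{..<Suc D}" p]) auto
  thus False by simp
 qed
 thus ?thesis by blast
qed

text \<open>The partial systems of the recursion are monotone and continuous but need not reach 1
  yet.\<close>

definition psys :: "nat => gsys => bool" where
 "psys m G \<longleftrightarrow> (ALL k a g. cmap k m a --> cmono k g --> cmono k (\<lambda>u. G (a u) (g u)))"

text \<open>The invariant of a recursion that runs downwards in \<open>k\<close>. The levels from
  \<open>tlev k\<close> on have been treated, which is why the system is constant above
  \<open>ulev k\<close>, and near \<open>late C m th k\<close> they suffice to reach 1.\<close>

definition stage :: "'a cset => nat => (vec => 'a rpt) => nat =>
  gsys => vec set => bool" where
 "stage C m th k H V \<longleftrightarrow> psys m H \<and> (ALL q:cube m. ALL x. 0 \<le> H q x) \<and> (ALL q:cube m. \<forall>x\<le>1/3. H q x = 0) \<and>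
  (ALL q:cube m. ALL T. bad C th T q --> flatat m H q T) \<and> (ALL q:cube m. \<forall>x\<ge>ulev k. H q x = H q 1) \<and>
  openin (cube_topology m) V \<and> late C m th k \<subseteq> V \<and> (ALL q:V. \<forall>x\<ge>ulev k. H q x = 1)"

text \<open>The new ramp around \<open>tlev k\<close> is cut off by \<open>s\<close>, which is 1
  near \<open>late C m th k\<close> and 0 near the points that are obstructed at
  \<open>tlev k\<close> but lie outside \<open>U\<close>. At obstructed points inside
  \<open>U\<close> the old system has already reached 1 below the ramp, so the maximum does not
  notice it.\<close>

lemma system_step:
 assumes C: "cubical_set C" and th: "stream_map (dcube m) (realization C) th" and st: "stage C m th (Suc k) G U"
 shows "EX H V. stage C m th k H V"
proof -
 from st have G: "psys m G" "\<And>q x. q : cube m ==> x \<le> 1/3 ==> G q x = 0" "\<And>q x. q : cube m ==> 0 \<le> G q x"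
  and flat: "\<And>q T. q : cube m ==> bad C th T q ==> flatat m G q T"
  and const: "\<And>q x. q : cube m ==> ulev (Suc k) \<le> x ==> G q x = G q 1"
  and U: "openin (cube_topology m) U" "late C m th (Suc k) \<subseteq> U" "\<And>q x. q : U ==> ulev (Suc k) \<le> x ==> G q x = 1"
  unfolding stage_def by blast+
 let ?B = "{q : cube m. bad C th (tlev k) q}"
 have disj: "late C m th k \<inter> (?B - U) = {}"
 proof -
  have "late C m th k \<inter> ?B \<subseteq> late C m th (Suc k)" using le_refl by auto
  thus ?thesis using U(2) by blast
 qed
 obtain s V O0 where s: "cmono m s" "openin (cube_topology m) V" "late C m th k \<subseteq> V" "ALL y:V. s y = 1"
   "openin (cube_topology m) O0" "?B - U \<subseteq> O0" "ALL y:O0. s y = 0"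
  using separate_closed[OF late_closed[OF C th] cclosed_diff[OF cclosed_bad[OF C th] U(1)] disj] by (elim exE conjE)
 \<comment> \<open>Compactness makes the width of the unobstructed band of levels around
   \<open>tlev k\<close> uniform in \<open>q\<close>.\<close>
 let ?R = "\<lambda>S. EX e>0. ALL q:S. q : U \<or> q : O0 \<or> (ALL T. \<bar>T - tlev k\<bar> \<le> e --> \<not> bad C th T q)"
 have "?R (cube m)"
 proof (rule cube_compact_induct[where R = ?R])
  fix q assume q: "q : cube m"
  consider "q : U" | "q : O0" | "\<not> bad C th (tlev k) q" using q s(6) by blast
  thus "EX e>0. ?R (cb m q e)"
  proof cases
   case 1
   thus ?thesis using openin_cubeD[OF U(1)] zero_less_one by blast
  next
   case 2
   thus ?thesis using openin_cubeD[OF s(5)] zero_less_one by blast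
  next
   case 3
   thus ?thesis using not_bad_near[OF C th q] by blast
  qed
 next
  fix S T assume "?R S" "?R T"
  then obtain d e where d: "d > 0" "ALL q:S. q : U \<or> q : O0 \<or> (ALL T. \<bar>T - tlev k\<bar> \<le> d --> \<not> bad C th T q)"
   and e: "e > 0" "ALL q:T. q : U \<or> q : O0 \<or> (ALL T. \<bar>T - tlev k\<bar> \<le> e --> \<not> bad C th T q)" by blast
  thus "?R (S \<union> T)" by (intro exI[of _ "min d e"]) auto
 next
  show "?R {}" using zero_less_one by blast
 qed blast
 then obtain e0 where e0: "e0 > 0" "ALL q:cube m. q : U \<or> q : O0 \<or> (ALL T. \<bar>T - tlev k\<bar> \<le> e0 --> \<not> bad C th T q)" by blast
 \<comment> \<open>The ramp has to fit between \<open>ulev (Suc k)\<close> and \<open>ulev k\<close>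
   and inside the band of levels provided by \<open>e0\<close>.\<close>
 define e where "e = min e0 (min ((tlev k - ulev (Suc k)) / 2) ((ulev k - tlev k) / 2))"
 have e: "e > 0" "e \<le> e0" "ulev (Suc k) < tlev k - e" "tlev k + e < ulev k"
  using e0(1) lev(1,2)[of k] by (auto simp: e_def min_def field_simps)
 define r where "r = (\<lambda>x. min 1 (max 0 (1 / (2 * e) * x - (tlev k - e) / (2 * e))))"
 have r': "r x = min 1 (max 0 ((x - (tlev k - e)) / (2 * e)))" for x using e(1) by (simp add: r_def field_simps)
 have r0: "r x = 0" if "x \<le> tlev k - e" for x
 proof -
  have "(x - (tlev k - e)) / (2 * e) \<le> 0" using that e(1) by (simp add: field_simps)
  thus ?thesis by (simp add: r')
 qed
 have r1: "r x = 1" if "tlev k + e \<le> x" for x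
 proof -
  have "1 \<le> (x - (tlev k - e)) / (2 * e)" using that e(1) by (simp add: field_simps)
  thus ?thesis by (simp add: r')
 qed
 have r01: "0 \<le> r x" "r x \<le> 1" for x by (simp_all add: r_def)
 define H where "H = (\<lambda>q x. max (G q x) (min (s q) (r x)))"
 have s01: "0 \<le> s q" "s q \<le> 1" if "q : cube m" for q using cmonoD(2,3)[OF s(1) that] .
 have G1: "G q 1 \<le> 1" "0 \<le> G q 1" if "q : cube m" for q
 proof -
  have m: "cmono 0 (\<lambda>_. G q 1)"
   using G(1)[unfolded psys_def, rule_format, OF cmap_const[OF that] cmono_const[of 1 0]] by simp
  have u: "(\<lambda>_. undefined) : cube 0" by (simp add: cube_iff extensional_def)
  show "G q 1 \<le> 1" "0 \<le> G q 1" using cmonoD(2,3)[OF m u] by simp_all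
 qed
 have sub: "U \<subseteq> cube m" "V \<subseteq> cube m" "O0 \<subseteq> cube m"
  using openin_subset[OF U(1)] openin_subset[OF s(2)] openin_subset[OF s(5)] topspace_cube by auto
 have u3: "1/3 < ulev (Suc k)" "ulev (Suc k) \<le> 1" by (rule lev) (simp add: ulev_def field_simps)
 have uk: "ulev (Suc k) < ulev k" using lev(1,2)[of k] by simp
 have "psys m H"
  unfolding psys_def H_def
 proof (intro allI impI cmono_max cmono_min)
  fix l a g assume a: "cmap l m a" and g: "cmono l g"
  show "cmono l (\<lambda>u. G (a u) (g u))" using G(1) a g unfolding psys_def by blast
  show "cmono l (\<lambda>u. s (a u))" by (rule cmono_comp[OF s(1) a])
  show "cmono l (\<lambda>u. r (g u))" unfolding r_def using e(1) by (intro cmono_ramp g) simp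
 qed
 moreover have "H q x = 0" if "q : cube m" "x \<le> 1/3" for q x
  using G(2)[OF that] r0[of x] s01[OF that(1)] that(2) e(3) u3 by (simp add: H_def)
 moreover have "0 \<le> H q x" if "q : cube m" for q x
  using G(3)[OF that, of x] by (simp add: H_def le_max_iff_disj)
 moreover have hc: "H q x = H q 1" if "q : cube m" "ulev k \<le> x" for q x
 proof -
  have "G q x = G q 1" using const[OF that(1)] that(2) uk by simp
  moreover have "ulev k \<le> 1" by (simp add: ulev_def field_simps)
  hence "r x = 1" "r 1 = 1" using r1[of x] r1[of 1] that(2) e(4) by simp_all
  ultimately show ?thesis by (simp add: H_def)
 qed
 moreover have "H q x = 1" if "q : V" "ulev k \<le> x" for q x
 proof -
  have "G q x \<le> 1" using const[of q x] G1[of q] that sub uk by auto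
  moreover have "r x = 1" using r1 that(2) e(4) by simp
  ultimately show ?thesis using s(4) that(1) by (simp add: H_def)
 qed
 moreover have "flatat m H q T" if q: "q : cube m" and b: "bad C th T q" for q T
 proof -
  consider "T < tlev k - e" | "T > tlev k + e" | "\<bar>T - tlev k\<bar> \<le> e" by linarith
  thus ?thesis
  proof cases
   case 1
   show ?thesis
   proof (rule flatat_cong_near[OF flat[OF q b], of "tlev k - e - T"])
    fix q' a assume q': "q' : cb m q (tlev k - e - T)" and a: "\<bar>a - T\<bar> < tlev k - e - T"
    have "q' : cube m" using q' cb_cube by blast
    moreover have "r a = 0" using a by (intro r0) (simp add: abs_less_iff)
    ultimately show "H q' a = G q' a" using s01 G(3) by (simp add: H_def)
   qed (use 1 in simp)
  next
   case 2
   show ?thesis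
   proof (rule flatatI[of "T - tlev k - e"])
    fix q' a b assume q': "q' : cb m q (T - tlev k - e)" and a: "\<bar>a - T\<bar> < T - tlev k - e" and b: "\<bar>b - T\<bar> < T - tlev k - e"
    have "q' : cube m" using q' cb_cube by blast
    hence "G q' a = G q' 1" "G q' b = G q' 1" using const a b e(1,3) by (auto simp: abs_less_iff)
    moreover have "r a = 1" "r b = 1" using a b by (auto simp: abs_less_iff intro!: r1)
    ultimately show "H q' a = H q' b" by (simp add: H_def)
   qed (use 2 in simp)
  next
   case 3
   then consider "q : U" | "q : O0" using e0(2) q b e(2) by fastforce
   thus ?thesis
   proof cases
    case 1
    then obtain d where d: "d > 0" "cb m q d \<subseteq> U" using openin_cubeD[OF U(1)] by blast
    let ?d = "min d (tlev k - e - ulev (Suc k))"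
    show ?thesis
    proof (rule flatatI[of ?d])
     have H1: "H q' a = 1" if q': "q' : cb m q ?d" and a: "\<bar>a - T\<bar> < ?d" for q' a
     proof -
      have "q' : U" using q' d(2) cb_mono[of ?d d m q] by auto
      moreover have "ulev (Suc k) \<le> a" using a 3 by (auto simp: abs_less_iff abs_le_iff)
      ultimately show ?thesis using U(3)[of q' a] r01[of a] by (simp add: H_def)
     qed
     show "H q' a = H q' b" if "q' : cb m q ?d" "\<bar>a - T\<bar> < ?d" "\<bar>b - T\<bar> < ?d" for q' a b
      using H1 that by simp
    qed (use d(1) e(3) in simp)
   next
    case 2
    then obtain d where d: "d > 0" "cb m q d \<subseteq> O0" using openin_cubeD[OF s(5)] by blast
    let ?d = "min d (tlev k - e - ulev (Suc k))"
    show ?thesis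
    proof (rule flatatI[of ?d])
     have H1: "H q' a = G q' 1" if q': "q' : cb m q ?d" and a: "\<bar>a - T\<bar> < ?d" for q' a
     proof -
      have q0: "q' : O0" using q' d(2) cb_mono[of ?d d m q] by auto
      hence qc: "q' : cube m" using sub by blast
      have "ulev (Suc k) \<le> a" using a 3 by (auto simp: abs_less_iff abs_le_iff)
      hence "G q' a = G q' 1" by (rule const[OF qc])
      thus ?thesis using s(7) q0 r01[of a] G1[OF qc] by (simp add: H_def)
     qed
     show "H q' a = H q' b" if "q' : cb m q ?d" "\<bar>a - T\<bar> < ?d" "\<bar>b - T\<bar> < ?d" for q' a b
      using H1 that by simp
    qed (use d(1) e(3) in simp)
   qed
  qed
 qed
 ultimately show ?thesis using s(2,3) unfolding stage_def by blast
qed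

text \<open>The recursion starts with the zero system where \<open>late C m th R\<close> is empty,
  and ends at 0, where the set is the whole cube and the system therefore reaches 1
  everywhere.\<close>

theorem good_exists:
 assumes C: "cubical_set C" and th: "stream_map (dcube m) (realization C) th"
 shows "EX G. good C m th G"
proof -
 obtain R where R: "late C m th R = {}" using late_empty[OF C th] by blast
 have "EX H V. stage C m th k H V" if "k \<le> R" for k
  using that
 proof (induction k rule: inc_induct)
  case base
  have "flatat m (\<lambda>_ _. 0) q T" for q T by (rule flatatI[of 1]) simp_all
  thus ?case using R cmono_const[of 0]
   by (intro exI[of _ "\<lambda>_ _. 0"] exI[of _ "{}"]) (auto simp: psys_def stage_def)
 next
  case (step k)
  thus ?case using system_step[OF C th] by blast
 qed
 from this[of 0] obtain G V where G: "psys m G" "ALL q:cube m. \<forall>x\<le>1/3. G q x = 0"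
   "ALL q:cube m. ALL T. bad C th T q --> flatat m G q T" "late C m th 0 \<subseteq> V" "ALL q:V. \<forall>x\<ge>ulev 0. G q x = 1" unfolding stage_def by auto
 have "G q x = 1" if "q : cube m" "2/3 \<le> x" for q x
 proof -
  have "q : V" "ulev 0 \<le> x" using G(4) that lev(4) by auto
  thus ?thesis using G(5) by blast
 qed
 hence "good C m th G" unfolding good_def gfun_def using G(1,2,3) by (auto simp: psys_def)
 thus ?thesis by blast
qed

section \<open>Flat sets\<close>

definition sameG :: "gsys => vec set => nat => vec => vec => bool" where
 "sameG G A n x x' \<longleftrightarrow> (ALL q:A. ALL i<n. G q (x i) = G q (x' i))"

text \<open>The substitute for a lift of \<open>th\<close> to a single cell: besides the
  identifications of the realization, points of one cell are identified when no \<open>G q\<close>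
  with \<open>q\<close> in \<open>A\<close> separates them. Whatever is computed from the images
  under these \<open>G q\<close> in a natural way cannot tell equivalent representatives
  apart.\<close>

definition fl_gen :: "'a cset => gsys => vec set => (nat \<times> 'a \<times> vec) rel" where
 "fl_gen C G A = glue_gen C cube linear_ext \<union>
  {((n, c, x), (n, c, x')) | n c x x'. c : cells C n \<and> x : cube n \<and> x' : cube n \<and> sameG G A n x x'}"

definition fl :: "'a cset => gsys => vec set => (nat \<times> 'a \<times> vec) rel" where
 "fl C G A = gen_equiv (glue_points C cube) (fl_gen C G A)"

definition flat :: "'a cset => (vec => 'a rpt) =>
  gsys => vec set => bool" where
 "flat C th G A \<longleftrightarrow> (ALL q:A. ALL q':A. ALL n c x n' c' x'. c : cells C n --> x : cube n --> c' : cells C n' --> x' : cube n' -->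
  th q = pt C n c x --> th q' = pt C n' c' x' --> ((n, c, x), (n', c', x')) : fl C G A)"

lemma fl_gen_subset:
 assumes "cubical_set C"
 shows "fl_gen C G A \<subseteq> glue_points C cube \<times> glue_points C cube"
 unfolding fl_gen_def using real_gen_subset[OF assms] by (auto simp: mem_glue)

lemma fl_equiv: "cubical_set C ==> equiv (glue_points C cube) (fl C G A)"
 unfolding fl_def by (rule gen_equiv(1)[OF fl_gen_subset])

lemma fl_sym: "cubical_set C ==> (s, t) : fl C G A ==> (t, s) : fl C G A"
 using fl_equiv[of C G A] by (auto simp: equiv_def dest: symD)

lemma fl_trans: "cubical_set C ==> (s, t) : fl C G A ==> (t, u) : fl C G A ==> (s, u) : fl C G A"
 using fl_equiv[of C G A] unfolding equiv_def by (blast dest: transD)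

lemma fl_same:
 assumes "cubical_set C" "c : cells C n" "x : cube n" "x' : cube n" "sameG G A n x x'"
 shows "((n, c, x), (n, c, x')) : fl C G A"
proof -
 have "((n, c, x), (n, c, x')) : fl_gen C G A" using assms by (auto simp: fl_gen_def)
 thus ?thesis unfolding fl_def using gen_equiv(2)[OF fl_gen_subset[OF assms(1)]] by blast
qed

lemma fl_real:
 assumes "cubical_set C" "((n, c, x), (n', c', x')) : real_rel C"
 shows "((n, c, x), (n', c', x')) : fl C G A"
proof -
 have "real_rel C \<subseteq> fl C G A"
  unfolding glue_rel_gen
 proof (rule gen_equiv(3)[OF real_gen_subset[OF assms(1)] fl_equiv[OF assms(1)]])
  show "glue_gen C cube linear_ext \<subseteq> fl C G A"
   unfolding fl_def using gen_equiv(2)[OF fl_gen_subset[OF assms(1)]] by (auto simp: fl_gen_def)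
 qed
 thus ?thesis using assms(2) by blast
qed

lemma fl_pt:
 assumes "cubical_set C" "c : cells C n" "x : cube n" "c' : cells C n'" "x' : cube n'" "pt C n c x = pt C n' c' x'"
 shows "((n, c, x), (n', c', x')) : fl C G A"
 using fl_real[OF assms(1)] pt_eq_iff[OF assms(1-5)] assms(6) by blast

lemma fl_respects:
 assumes C: "cubical_set C" and r: "((n, c, x), (n', c', x')) : fl C G A"
  and F: "\<And>m n f c x. box_hom m n f ==> c : cells C n ==> x : cube m ==>
   F m (act C m n f c) x = F n c (linear_ext m n f x)"
  and FG: "\<And>n c x x'. c : cells C n ==> x : cube n ==> x' : cube n ==> sameG G A n x x' ==> F n c x = F n c x'"
 shows "F n c x = F n' c' x'"
proof -
 let ?F = "\<lambda>(n, c, x). F n c x"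
 have "?F (n, c, x) = ?F (n', c', x')"
 proof (rule gen_equiv_respects[OF r[unfolded fl_def] fl_gen_subset[OF C]])
  fix u w assume "(u, w) : fl_gen C G A"
  thus "?F u = ?F w" unfolding fl_gen_def glue_gen_def using F FG by auto
 qed
 thus ?thesis by simp
qed

lemma flat_respects:
 assumes C: "cubical_set C" and A: "flat C th G A" "q : A" "q' : A"
  and c: "c : cells C n" "x : cube n" "th q = pt C n c x" and c': "c' : cells C n'" "x' : cube n'" "th q' = pt C n' c' x'"
  and F: "\<And>m n f c x. box_hom m n f ==> c : cells C n ==> x : cube m ==>
   F m (act C m n f c) x = F n c (linear_ext m n f x)"
  and FG: "\<And>n c x x'. c : cells C n ==> x : cube n ==> x' : cube n ==> sameG G A n x x' ==> F n c x = F n c x'"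
 shows "F n c x = F n' c' x'"
proof (rule fl_respects[OF C _ F FG])
 show "((n, c, x), (n', c', x')) : fl C G A" using A c c' unfolding flat_def by blast
qed

text \<open>Fewer parameters separate fewer points, so the relation \<open>fl C G A\<close> grows
  when \<open>A\<close> shrinks.\<close>

lemma flat_subset:
 assumes C: "cubical_set C" and A: "flat C th G A" and BA: "B \<subseteq> A"
 shows "flat C th G B"
proof -
 have "fl_gen C G A \<subseteq> fl_gen C G B" using BA by (fastforce simp: fl_gen_def sameG_def)
 hence "fl_gen C G A \<subseteq> fl C G B" unfolding fl_def using gen_equiv(2)[OF fl_gen_subset[OF C, of G B]] by blast
 hence "fl C G A \<subseteq> fl C G B" unfolding fl_def[of C G A] by (rule gen_equiv(3)[OF fl_gen_subset[OF C] fl_equiv[OF C]])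
 thus ?thesis using A BA unfolding flat_def by blast
qed

text \<open>One neighbourhood of \<open>t\<close> must serve all \<open>q\<close> in
  \<open>A\<close>. This makes the set closed, as the openness of the vanishing of
  \<open>nreal\<close> requires.\<close>

definition steep :: "gsys => vec set => real set" where
 "steep G A = {t. \<not> (EX d>0. ALL q:A. ALL a b. \<bar>a - t\<bar> < d --> \<bar>b - t\<bar> < d --> G q a = G q b)}"

lemma closed_steep: "closed (steep G A)"
proof -
 have "open (- steep G A)"
  unfolding open_contains_ball
 proof
  fix t assume "t : - steep G A"
  then obtain d where d: "d > 0" "ALL q:A. ALL a b. \<bar>a - t\<bar> < d --> \<bar>b - t\<bar> < d --> G q a = G q b" by (auto simp: steep_def)
  have "s \<notin> steep G A" if s: "s : ball t (d / 2)" for s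
  proof -
   have st: "\<bar>s - t\<bar> < d / 2" using s by (simp add: dist_real_def abs_minus_commute)
   have "\<bar>a - t\<bar> < d" if "\<bar>a - s\<bar> < d / 2" for a using that st by linarith
   hence "ALL q:A. ALL a b. \<bar>a - s\<bar> < d / 2 --> \<bar>b - s\<bar> < d / 2 --> G q a = G q b" using d(2) by blast
   moreover have "d / 2 > 0" using d(1) by simp
   ultimately show ?thesis unfolding steep_def by blast
  qed
  thus "EX e>0. ball t e \<subseteq> - steep G A" using d(1) by (intro exI[of _ "d / 2"]) auto
 qed
 thus ?thesis by (simp add: closed_def)
qed

definition sys :: "nat => gsys => bool" where
 "sys m G \<longleftrightarrow> gfun m G \<and> (ALL q:cube m. ALL x. (x \<le> 1/3 --> G q x = 0) \<and> (2/3 \<le> x --> G q x = 1))"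

lemma good_sys: "good C m th G \<longleftrightarrow> sys m G \<and> (ALL q:cube m. ALL T. bad C th T q --> flatat m G q T)"
 by (auto simp: good_def sys_def)

lemma gact_eqD: "gact n g x = gact n g y ==> i < n ==> g (x i) = g (y i)"
 by (drule fun_cong[of _ _ i]) (simp add: gact_def)

text \<open>\<open>ka\<close> collapses the coordinates of \<open>x\<close> on which all the \<open>G q\<close> are \<open>0\<close> or \<open>1\<close>; of the remaining ones, those in \<open>S\<close> do not
 matter, and the others lie at levels near which all the \<open>G q\<close> are constant.\<close>

lemma chart_flat:
 assumes C: "cubical_set C" and G: "sys m G" and A: "A \<subseteq> cube m" and c: "c : cells C n" and x: "x : cube n"
  and r: "reals C (2/3) (steep G A) n c x = {}"
 shows "EX e>0. EX ka S. setter n ka \<and> av C n (psp S 0) (av C n ka c) = av C n ka c \<and>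
  (ALL y:cb n x e. ALL q:A. lmap n n ka (gact n (G q) y) = gact n (G q) y \<and>
   lmap n n (psp S 0) (gact n (G q) y) = lmap n n (psp S 0) (gact n (G q) x))"
proof -
 let ?ka = "ksp (2/3) x"
 define S where "S = {i. i < n \<and> ghost C n ?ka c i}"
 obtain e where e: "e > 0" "ALL y:cb n x e. ALL j<n. ALL a. ksp (2/3) x j = Inl a --> ksp (2/3) y j = Inl a"
  using ksp_near[of "2/3" n x] by auto
 have "EX d>0. i < n --> i \<notin> S --> (ALL q:A. ALL a b. \<bar>a - x i\<bar> < d --> \<bar>b - x i\<bar> < d --> G q a = G q b)" for i
 proof (cases "i < n \<and> i \<notin> S")
  case True
  hence "x i \<notin> steep G A" using r by (auto simp: reals_def S_def)
  thus ?thesis by (auto simp: steep_def)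
 qed (use zero_less_one in blast)
 then obtain d where d: "\<And>i. d i > 0"
  "\<And>i q a b. i < n ==> i \<notin> S ==> q : A ==> \<bar>a - x i\<bar> < d i ==> \<bar>b - x i\<bar> < d i ==> G q a = G q b" by metis
 define r where "r = Min (insert e (d ` {..<n}))"
 have r: "r > 0" unfolding r_def using d(1) e(1) by (subst Min_gr_iff) auto
 have re: "r \<le> e" "i < n ==> r \<le> d i" for i unfolding r_def by (auto intro: Min_le)
 have "av C n (scomp ?ka (psp S 0)) c = av C n ?ka c"
  by (rule ghost_set[OF C c setter_ksp]) (auto simp: S_def)
 hence 1: "av C n (psp S 0) (av C n ?ka c) = av C n ?ka c"
  using av_av[OF C c setter_ksp setter_psp[of 0]] by simp
 have 2: "lmap n n ?ka (gact n (G q) y) = gact n (G q) y \<and>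
   lmap n n (psp S 0) (gact n (G q) y) = lmap n n (psp S 0) (gact n (G q) x)" if y: "y : cb n x r" and q: "q : A" for y q
 proof -
  have yc: "y : cube n" using y cb_cube by blast
  have qc: "q : cube m" using q A by blast
  have Gq: "unit_fun (G q)" using gfun_unit G qc by (auto simp: sys_def)
  have gc: "gact n (G q) y : cube n" "gact n (G q) x : cube n" using gact_cube[OF Gq] yc x by auto
  have "lmap n n ?ka (gact n (G q) y) = gact n (G q) y"
  proof (rule cube_eqI[OF lmap_cube[OF setter_bspec[OF setter_ksp] gc(1)] gc(1)])
   fix i assume i: "i < n"
   have "G q (y i) = real a" if a: "?ka i = Inl a" for a
   proof -
    have "ksp (2/3) y i = Inl a" using e(2) a i y cb_mono[OF re(1)] by blast
    hence "a = 0 \<and> y i < 1/3 \<or> a = 1 \<and> y i > 2/3" by (auto simp: ksp_def split: if_splits)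
    thus ?thesis using G qc by (auto simp: sys_def)
   qed
   thus "lmap n n ?ka (gact n (G q) y) i = gact n (G q) y i"
    using i gc(1) by (cases rule: setterE[OF setter_ksp i, of "2/3" x]) (auto simp: lmap_def gact_def)
  qed
  moreover have "lmap n n (psp S 0) (gact n (G q) y) = lmap n n (psp S 0) (gact n (G q) x)"
  proof (rule cube_eqI[OF lmap_cube[OF setter_bspec[OF setter_psp] gc(1)] lmap_cube[OF setter_bspec[OF setter_psp] gc(2)]])
   fix i assume i: "i < n"
   have "G q (y i) = G q (x i)" if "i \<notin> S"
   proof (rule d(2)[OF i that q])
    show "\<bar>y i - x i\<bar> < d i" using y i re(2)[OF i] by (force simp: cb_def)
    show "\<bar>x i - x i\<bar> < d i" using d(1) by simp
   qed
   thus "lmap n n (psp S 0) (gact n (G q) y) i = lmap n n (psp S 0) (gact n (G q) x) i"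
    using i gc by (auto simp: lmap_def gact_def psp_def)
  qed simp_all
  ultimately show ?thesis by simp
 qed
 show ?thesis using r 1 2 setter_ksp by blast
qed

text \<open>Both points are moved to a common third one: collapsing by \<open>ka\<close> is
  invisible to \<open>G\<close>, so \<open>c\<close> may be replaced by its collapse; that cell is
  degenerate along \<open>S\<close>, so the coordinates in \<open>S\<close> may be reset; the
  remaining coordinates lie at levels where \<open>G\<close> does not separate \<open>y\<close> from
  \<open>x\<close>.\<close>

lemma chart_fl:
 assumes C: "cubical_set C" and G: "sys m G" and A: "A \<subseteq> cube m" and c: "c : cells C n" and x: "x : cube n"
  and r: "reals C (2/3) (steep G A) n c x = {}"
 shows "EX e>0. ALL y:cb n x e. ((n, c, y), (n, c, x)) : fl C G A"
proof -
 obtain e ka S where e: "e > 0" and k: "setter n ka" and S: "av C n (psp S 0) (av C n ka c) = av C n ka c"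
  and fl: "\<And>y q. y : cb n x e ==> q : A ==> lmap n n ka (gact n (G q) y) = gact n (G q) y \<and>
   lmap n n (psp S 0) (gact n (G q) y) = lmap n n (psp S 0) (gact n (G q) x)"
  using chart_flat[OF assms] by metis
 let ?d = "av C n ka c"
 have d: "?d : cells C n" by (rule av_cell[OF C c k])
 have p: "setter n (psp S 0)" by (rule setter_psp) simp
 have Gq: "unit_fun (G q)" if "q : A" for q using gfun_unit G A that by (auto simp: sys_def)
 note kb = setter_bspec[OF k] and pb = setter_bspec[OF p]
 have box: "((n, av C n ps c', y), (n, c', lmap n n ps y)) : fl C G A" if "setter n ps" "c' : cells C n" "y : cube n" for ps c' y
 proof (rule fl_pt[OF C av_cell[OF C that(2,1)] that(3,2) lmap_cube[OF setter_bspec[OF that(1)] that(3)]])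
  show "pt C n (av C n ps c') y = pt C n c' (lmap n n ps y)"
   using pt_act[OF C box_bmap[OF setter_bspec[OF that(1)]] that(2,3)] linear_ext_bmap[OF setter_bspec[OF that(1)]]
   by (simp add: av_def)
 qed
 have go: "((n, c, y), (n, ?d, lmap n n (psp S 0) x)) : fl C G A" if y: "y : cb n x e" for y
 proof -
  have yc: "y : cube n" using y cb_cube by blast
  have "sameG G A n y (lmap n n ka y)"
   unfolding sameG_def
  proof (intro ballI allI impI)
   fix q i assume q: "q : A" and i: "i < n"
   have "gact n (G q) (lmap n n ka y) = lmap n n ka (gact n (G q) y)" by (rule gact_lmap[OF Gq[OF q] kb yc])
   also have "\<dots> = gact n (G q) y" using fl[OF y q] by simp
   finally show "G q (y i) = G q (lmap n n ka y i)" by (rule gact_eqD[OF sym i])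
  qed
  hence 1: "((n, c, y), (n, c, lmap n n ka y)) : fl C G A" by (rule fl_same[OF C c yc lmap_cube[OF kb yc]])
  have 2: "((n, c, lmap n n ka y), (n, ?d, y)) : fl C G A" by (rule fl_sym[OF C box[OF k c yc]])
  have 3: "((n, ?d, y), (n, ?d, lmap n n (psp S 0) y)) : fl C G A" using box[OF p d yc] S by simp
  have "sameG G A n (lmap n n (psp S 0) y) (lmap n n (psp S 0) x)"
   unfolding sameG_def
  proof (intro ballI allI impI)
   fix q i assume q: "q : A" and i: "i < n"
   have "gact n (G q) (lmap n n (psp S 0) y) = lmap n n (psp S 0) (gact n (G q) y)" by (rule gact_lmap[OF Gq[OF q] pb yc])
   also have "\<dots> = lmap n n (psp S 0) (gact n (G q) x)" using fl[OF y q] by simp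
   also have "\<dots> = gact n (G q) (lmap n n (psp S 0) x)" by (rule gact_lmap[OF Gq[OF q] pb x, symmetric])
   finally show "G q (lmap n n (psp S 0) y i) = G q (lmap n n (psp S 0) x i)"
    by (rule gact_eqD[OF _ i])
  qed
  hence 4: "((n, ?d, lmap n n (psp S 0) y), (n, ?d, lmap n n (psp S 0) x)) : fl C G A"
   by (rule fl_same[OF C d lmap_cube[OF pb yc] lmap_cube[OF pb x]])
  show ?thesis using fl_trans[OF C 1 fl_trans[OF C 2 fl_trans[OF C 3 4]]] .
 qed
 have "((n, c, y), (n, c, x)) : fl C G A" if "y : cb n x e" for y
  using fl_trans[OF C go[OF that] fl_sym[OF C go[OF cb_self[OF x e]]]] .
 thus ?thesis using e by blast
qed

text \<open>Each coordinate of \<open>x\<close> that matters sits at an obstructed level, where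
  \<open>G\<close> is locally constant near \<open>q\<close>; there are finitely many of
  them.\<close>

lemma steep_nbhd:
 assumes C: "cubical_set C" and th: "stream_map (dcube m) (realization C) th" and G: "good C m th G" and q: "q : cube m"
  and c: "c : cells C n" "x : cube n" "th q = pt C n c x"
 shows "EX e>0. reals C (2/3) (steep G (cb m q e)) n c x = {}"
proof -
 have "EX d>0. i : reals C (2/3) UNIV n c x --> x i \<notin> steep G (cb m q d)" for i
 proof (cases "i : reals C (2/3) UNIV n c x")
  case True
  hence "i : reals C (2/3) {x i} n c x" by (auto simp: reals_def)
  hence "reals C (2/3) {x i} n c x \<noteq> {}" by blast
  hence "card (reals C (2/3) {x i} n c x) \<noteq> 0" using card_0_eq[OF finite_reals] by metis
  hence "bad C th (x i) q" using nreal_pt[OF C c(1,2)] c(3) by (simp add: bad_def)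
  then obtain d where d: "d > 0" "ALL q':cb m q d. ALL a b. \<bar>a - x i\<bar> < d --> \<bar>b - x i\<bar> < d --> G q' a = G q' b"
   using G q unfolding good_def flatat_def by blast
  hence "x i \<notin> steep G (cb m q d)" unfolding steep_def by blast
  thus ?thesis using d(1) by blast
 qed (use zero_less_one in blast)
 then obtain d where d: "\<And>i. d i > 0" "\<And>i. i : reals C (2/3) UNIV n c x ==> x i \<notin> steep G (cb m q (d i))" by metis
 define r where "r = Min (insert 1 (d ` {..<n}))"
 have r: "r > 0" unfolding r_def using d(1) by (subst Min_gr_iff) auto
 have re: "i < n ==> r \<le> d i" for i unfolding r_def by (auto intro: Min_le)
 have mono: "steep G A \<subseteq> steep G B" if "A \<subseteq> B" for A B using that unfolding steep_def by blast
 have "reals C (2/3) (steep G (cb m q r)) n c x = {}"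
 proof (rule ccontr)
  assume "\<not> ?thesis"
  then obtain i where i: "i : reals C (2/3) (steep G (cb m q r)) n c x" by blast
  hence i': "i < n" "x i : steep G (cb m q r)" "i : reals C (2/3) UNIV n c x" by (auto simp: reals_def)
  thus False using d(2) mono[OF cb_mono[OF re[OF i'(1)]]] by blast
 qed
 thus ?thesis using r by blast
qed

text \<open>Near \<open>q\<close> the map may run through many cells. Let \<open>U\<close> consist
  of the points, without a steep coordinate that matters, all of whose representatives are
  equivalent to the one at \<open>q\<close>. It is open because \<open>chart_fl\<close> applies in
  the chart of every representative of every point of \<open>U\<close>, not only at
  \<open>th q\<close>.\<close>

theorem flat_nbhd:
 assumes C: "cubical_set C" and th: "stream_map (dcube m) (realization C) th" and G: "good C m th G" and q: "q : cube m"
 shows "EX e>0. flat C th G (cb m q e)"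
proof -
 obtain n c x where c: "c : cells C n" "x : cube n" and Z: "th q = pt C n c x"
  using pointsE[OF stream_points[OF C th q]] .
 obtain d where d: "d > 0" "reals C (2/3) (steep G (cb m q d)) n c x = {}" using steep_nbhd[OF C th G q c Z] by blast
 let ?A = "cb m q d"
 have sG: "sys m G" using G by (simp add: good_sys)
 let ?S = "{Z. nreal C (2/3) (steep G ?A) Z = 0}"
 define U where "U = points C \<inter> {Z : ?S. ALL n' c' x'. c' : cells C n' --> x' : cube n' --> Z = pt C n' c' x' -->
  ((n', c', x'), (n, c, x)) : fl C G ?A}"
 have "openin (topo (realization C)) U"
  unfolding U_def
 proof (rule open_real[OF C])
  fix n1 c1 x1 assume c1: "c1 : cells C n1" and x1: "x1 : cube n1" and Z1: "pt C n1 c1 x1 : {Z : ?S. ALL n' c' x'. c' : cells C n' --> x' : cube n' --> Z = pt C n' c' x' -->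
   ((n', c', x'), (n, c, x)) : fl C G ?A}"
  have "openin (topo (realization C)) (points C \<inter> ?S)" by (rule open_nreal_zero[OF C _ _ closed_steep]) simp_all
  hence "openin (cube_topology n1) (chart_pre C n1 c1 (points C \<inter> ?S))" using c1 by (simp add: openin_real)
  moreover have "x1 : chart_pre C n1 c1 (points C \<inter> ?S)" using Z1 x1 pt_points[OF C c1 x1] by (simp add: chart_pre_def)
  ultimately obtain e1 where e1: "e1 > 0" "cb n1 x1 e1 \<subseteq> chart_pre C n1 c1 (points C \<inter> ?S)" using openin_cubeD by blast
  have "card (reals C (2/3) (steep G ?A) n1 c1 x1) = 0" using Z1 nreal_pt[OF C c1 x1] by simp
  hence r1: "reals C (2/3) (steep G ?A) n1 c1 x1 = {}" using card_0_eq[OF finite_reals] by metis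
  obtain e2 where e2: "e2 > 0" "ALL y:cb n1 x1 e2. ((n1, c1, y), (n1, c1, x1)) : fl C G ?A"
   using chart_fl[OF C sG cb_cube c1 x1 r1] by blast
  have rel1: "((n1, c1, x1), (n, c, x)) : fl C G ?A" using Z1 c1 x1 by blast
  let ?e = "min e1 e2"
  have sub: "cb n1 x1 ?e \<subseteq> cb n1 x1 e1" "cb n1 x1 ?e \<subseteq> cb n1 x1 e2" by (auto intro!: cb_mono)
  have "pt C n1 c1 y : {Z : ?S. ALL n' c' x'. c' : cells C n' --> x' : cube n' --> Z = pt C n' c' x' -->
   ((n', c', x'), (n, c, x)) : fl C G ?A}" if y: "y : cb n1 x1 ?e" for y
  proof -
   have yc: "y : cube n1" using y cb_cube by blast
   have "pt C n1 c1 y : ?S" using y sub(1) e1(2) by (auto simp: chart_pre_def)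
   moreover have "((n', c', x'), (n, c, x)) : fl C G ?A"
    if "c' : cells C n'" "x' : cube n'" "pt C n1 c1 y = pt C n' c' x'" for n' c' x'
   proof -
    have "((n', c', x'), (n1, c1, y)) : fl C G ?A" by (rule fl_pt[OF C that(1,2) c1 yc that(3)[symmetric]])
    moreover have "((n1, c1, y), (n1, c1, x1)) : fl C G ?A" using e2(2) sub(2) y by blast
    ultimately show ?thesis using rel1 fl_trans[OF C] by blast
   qed
   ultimately show ?thesis by blast
  qed
  thus "EX e>0. ALL y:cb n1 x1 e. pt C n1 c1 y : {Z : ?S. ALL n' c' x'. c' : cells C n' --> x' : cube n' --> Z = pt C n' c' x' -->
   ((n', c', x'), (n, c, x)) : fl C G ?A}" using e1(1) e2(1) by (intro exI[of _ ?e]) simp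
 qed
 hence "openin (cube_topology m) {q : cube m. th q : U}" by (rule stream_preimage[OF th])
 moreover have "th q : U"
 proof -
  have "((n', c', x'), (n, c, x)) : fl C G ?A" if "c' : cells C n'" "x' : cube n'" "th q = pt C n' c' x'" for n' c' x'
   using fl_pt[OF C that(1,2) c] that(3) Z by simp
  moreover have "nreal C (2/3) (steep G ?A) (th q) = 0" using nreal_pt[OF C c] Z d(2) by simp
  ultimately show ?thesis using pt_points[OF C c] Z by (simp add: U_def)
 qed
 ultimately obtain e where e: "e > 0" "cb m q e \<subseteq> {q : cube m. th q : U}" using openin_cubeD q by blast
 let ?B = "cb m q (min d e)"
 have BA: "?B \<subseteq> ?A" "?B \<subseteq> cb m q e" by (auto intro!: cb_mono)
 have rel: "((n1, c1, x1), (n, c, x)) : fl C G ?A" if "q1 : ?B" "c1 : cells C n1" "x1 : cube n1" "th q1 = pt C n1 c1 x1" for q1 n1 c1 x1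
 proof -
  have "th q1 : U" using that(1) BA(2) e(2) by blast
  thus ?thesis using that(2-4) unfolding U_def by blast
 qed
 have "fl_gen C G ?A \<subseteq> fl_gen C G ?B" using BA(1) by (fastforce simp: fl_gen_def sameG_def)
 hence "fl_gen C G ?A \<subseteq> fl C G ?B" unfolding fl_def using gen_equiv(2)[OF fl_gen_subset[OF C, of G ?B]] by blast
 hence AB: "fl C G ?A \<subseteq> fl C G ?B" unfolding fl_def[of C G ?A] by (rule gen_equiv(3)[OF fl_gen_subset[OF C] fl_equiv[OF C]])
 have "flat C th G ?B"
  unfolding flat_def using rel AB fl_trans[OF C] fl_sym[OF C] by (meson subsetD)
 thus ?thesis using d(1) e(1) by (intro exI[of _ "min d e"]) simp
qed

section \<open>Cells refining a map into the realization\<close>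

lemma act_representable_cell: "act (lattice_cset L) l k f s = compose (grid 1 l) s f"
 by (simp add: lattice_cset_def)

definition zero :: "nat => nat => real" where
 "zero k = (\<lambda>i\<in>{..<k}. 0)"

lemma zero_cube: "zero k : cube k"
 unfolding zero_def by (rule cube_restrictI) simp

text \<open>The totally degenerate \<open>k\<close>-cell on the vertex \<open>v\<close>.\<close>

definition cv :: "'a cset => 'a => nat => 'a" where
 "cv C v k = act C k 0 (bmap k 0 (\<lambda>_. Inl 0)) v"

lemma cube_0: "x : cube 0 \<longleftrightarrow> x = zero 0"
 by (auto simp: cube_iff zero_def extensional_def)

section \<open>Iterated subdivision into small pieces\<close>

text \<open>Every cell of the subdivided cube is followed, including those of other dimensions,
  because \<open>mu\<close> takes a whole cubical function as its input.\<close>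

primrec sm :: "(vec set => bool) => nat => nat => (vec => nat => real) => bool" where
 "sm P 0 = (\<lambda>k a. EX A. P A \<and> a ` cube k \<subseteq> A)"
| "sm P (Suc j) = (\<lambda>k a. ALL l. ALL s:cells (sd2_cube k) l. sm P j l (\<lambda>u. a (sd2_cell l k s u)))"

lemma sm_cong: "(\<And>u. u : cube k ==> a u = b u) ==> sm P j k a \<longleftrightarrow> sm P j k b"
proof (induction j arbitrary: k a b)
 case 0
 hence "a ` cube k = b ` cube k" by (rule image_cong[OF refl])
 thus ?case by simp
next
 case (Suc j)
 have "sm P j l (\<lambda>u. a (sd2_cell l k s u)) = sm P j l (\<lambda>u. b (sd2_cell l k s u))"
  if "s : cells (sd2_cube k) l" for l s
  using Suc.prems cmapD(1)[OF cmap_sd2_cell[OF that]] by (intro Suc.IH) simp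
 thus ?case by simp
qed

lemma sm_box: "sm P j k a ==> box_hom l k f ==> sm P j l (\<lambda>u. a (linear_ext l k f u))"
proof (induction j arbitrary: k a l f)
 case 0
 then obtain A where "P A" "a ` cube k \<subseteq> A" by auto
 moreover have "(\<lambda>u. a (linear_ext l k f u)) ` cube l \<subseteq> a ` cube k"
  using linear_ext_box[OF 0(2)] by blast
 ultimately show ?case unfolding sm.simps by blast
next
 case (Suc j)
 have "sm P j i (\<lambda>u. a (linear_ext l k f (sd2_cell i l s u)))" if s: "s : cells (sd2_cube l) i" for i s
 proof -
  have "sm P j i (\<lambda>u. a (sd2_cell i k (compose (grid 1 i) (sd2_mor l k f) s) u))"
   using Suc.prems(1) sd2_mor_comp(1)[OF s Suc.prems(2)] by simp
  thus ?thesis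
   by (rule sm_cong[THEN iffD1, rotated]) (rule arg_cong[where f = a], rule sd2_mor_comp(2)[OF s Suc.prems(2)])
 qed
 thus ?case by simp
qed

lemma sm_Suc: "sm P j k a ==> sm P (Suc j) k a"
proof (induction j arbitrary: k a)
 case 0
 then obtain A where A: "P A" "a ` cube k \<subseteq> A" by auto
 have "(\<lambda>u. a (sd2_cell l k s u)) ` cube l \<subseteq> A" if "s : cells (sd2_cube k) l" for l s
  using A(2) cmapD(1)[OF cmap_sd2_cell[OF that]] by blast
 thus ?case unfolding sm.simps using A(1) by blast
next
 case (Suc j)
 have "sm P (Suc j) l (\<lambda>u. a (sd2_cell l k s u))" if "s : cells (sd2_cube k) l" for l s
  using Suc.prems that by (intro Suc.IH) simp
 thus ?case unfolding sm.simps(2)[of P "Suc j"] by blast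
qed

lemma sm_le: "i \<le> j ==> sm P i k a ==> sm P j k a"
 by (induction j rule: dec_induct) (auto simp del: sm.simps intro: sm_Suc)

text \<open>In \<open>main\<close>, \<open>L\<close> is a Lipschitz constant of \<open>g\<close> for
  the maximum norm. It halves with each subdivision, until the image of a piece fits into a ball
  whose radius is the Lebesgue number \<open>d\<close>.\<close>

lemma sm_exists:
 assumes a: "cmap k m a" and loc: "\<And>q. q : cube m ==> EX e>0. P (cb m q e)"
 shows "EX j. sm P j k a"
proof -
 have "EX d>0. ALL x:cube k. EX A. P A \<and> a ` cb k x d \<subseteq> A"
 proof (rule cube_lebesgue[where R = "\<lambda>S. EX A. P A \<and> a ` S \<subseteq> A"])
  fix x assume x: "x : cube k"
  obtain e where e: "e > 0" "P (cb m (a x) e)" using loc[OF cmapD(1)[OF a x]] by blast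
  obtain d where "d > 0" "ALL y:cb k x d. a y : cb m (a x) e" using cmap_cont[OF a x e(1)] by blast
  thus "EX d>0. EX A. P A \<and> a ` cb k x d \<subseteq> A" using e(2) by blast
 qed blast
 then obtain d where d: "d > 0" "\<And>x. x : cube k ==> EX A. P A \<and> a ` cb k x d \<subseteq> A" by blast
 have main: "sm P j l (\<lambda>u. a (g u))"
  if "cmap l k g" "\<And>x y i e. x : cube l ==> y : cube l ==> 0 \<le> e ==> (\<And>i. i < l ==> \<bar>x i - y i\<bar> \<le> e) ==> i < k ==> \<bar>g x i - g y i\<bar> \<le> L * e"
   "L < d * 2 ^ j" for j l g L
  using that
 proof (induction j arbitrary: l g L)
  case 0
  have z: "g (zero l) : cube k" using cmapD(1)[OF 0(1) zero_cube] .
  obtain A where A: "P A" "a ` cb k (g (zero l)) d \<subseteq> A" using d(2)[OF z] by blast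
  have "g u : cb k (g (zero l)) d" if u: "u : cube l" for u
  proof -
   have "\<bar>g u i - g (zero l) i\<bar> \<le> L * 1" if "i < k" for i
   proof (rule 0(2)[OF u zero_cube])
    show "\<bar>u j - zero l j\<bar> \<le> 1" if "j < l" for j using cube_coord[OF u that] that by (simp add: zero_def)
   qed (use that in simp_all)
   thus ?thesis using 0(3) cmapD(1)[OF 0(1) u] unfolding cb_def by force
  qed
  thus ?case using A by auto
 next
  case (Suc j)
  have "sm P j l' (\<lambda>u. a (g (sd2_cell l' l s u)))" if s: "s : cells (sd2_cube l) l'" for l' s
  proof (rule Suc.IH[of l' "\<lambda>u. g (sd2_cell l' l s u)" "L / 2"])
   show "cmap l' k (\<lambda>u. g (sd2_cell l' l s u))" by (rule cmap_comp[OF Suc.prems(1) cmap_sd2_cell[OF s]])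
   show "L / 2 < d * 2 ^ j" using Suc.prems(3) by simp
   fix x y i and e :: real
   assume x: "x : cube l'" "y : cube l'" and e: "0 \<le> e" "\<And>i. i < l' ==> \<bar>x i - y i\<bar> \<le> e" and i: "i < k"
   have "\<bar>g (sd2_cell l' l s x) i - g (sd2_cell l' l s y) i\<bar> \<le> L * (e / 2)"
   proof (rule Suc.prems(2)[OF _ _ _ _ i])
    show "\<bar>sd2_cell l' l s x i - sd2_cell l' l s y i\<bar> \<le> e / 2" if "i < l" for i
     by (rule sd2_cell_contract[OF s x e(2,1) that])
   qed (use cmapD(1)[OF cmap_sd2_cell[OF s]] x e in auto)
   thus "\<bar>g (sd2_cell l' l s x) i - g (sd2_cell l' l s y) i\<bar> \<le> L / 2 * e" by simp
  qed
  thus ?case by simp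
 qed
 obtain j :: nat where j: "1 / d < 2 ^ j" using real_arch_pow[of 2 "1 / d"] by auto
 have "sm P j k (\<lambda>u. a (id u))"
  by (rule main[of k id 1]) (use cmap_id j d(1) in \<open>auto simp: field_simps id_def\<close>)
 thus ?thesis by auto
qed

lemma good_comp:
 assumes G: "good C m th G" and b: "cmap p m b"
 shows "good C p (\<lambda>q. th (b q)) (\<lambda>q. G (b q))"
proof -
 have "gfun p (\<lambda>q. G (b q))"
  unfolding gfun_def
 proof (intro conjI allI impI ballI)
  fix k a g assume "cmap k p a" "cmono k g"
  thus "cmono k (\<lambda>u. G (b (a u)) (g u))" using gfun_cmono[OF _ cmap_comp[OF b]] G by (simp add: good_def)
 qed (use G cmapD(1)[OF b] in \<open>auto simp: good_def gfun_def\<close>)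
 moreover have "flatat p (\<lambda>q. G (b q)) q T" if q: "q : cube p" and bd: "bad C (\<lambda>q. th (b q)) T q" for q T
 proof -
  have "bad C th T (b q)" using bd by (simp add: bad_def)
  hence "flatat m G (b q) T" using G cmapD(1)[OF b q] by (simp add: good_def)
  then obtain d where d: "d > 0" "ALL q':cb m (b q) d. ALL s t. \<bar>s - T\<bar> < d --> \<bar>t - T\<bar> < d --> G q' s = G q' t"
   unfolding flatat_def by blast
  obtain e where e: "e > 0" "ALL y:cb p q e. b y : cb m (b q) d" using cmap_cont[OF b q d(1)] by blast
  have sub: "cb p q (min d e) \<subseteq> cb p q e" by (auto intro!: cb_mono)
  show ?thesis
   by (rule flatatI[of "min d e"]) (use d e sub in auto)
 qed
 ultimately show ?thesis using G cmapD(1)[OF b] by (simp add: good_def)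
qed

context cubcat_data
begin

lemma rho_cv:
 assumes v: "v : cells C 0" and h: "cmap k 0 h"
 shows "rho k 0 v h = cv C v k"
proof -
 have t: "bspec k 0 (\<lambda>_. Inl 0)" by (simp add: bspec_def)
 have "cv C v k = act C k 0 (bmap k 0 (\<lambda>_. Inl 0)) (rho 0 0 v (\<lambda>u. u))" using rho_id[OF v] by (simp add: cv_def)
 also have "\<dots> = rho k 0 v (\<lambda>u. linear_ext k 0 (bmap k 0 (\<lambda>_. Inl 0)) u)" by (rule rho_act[OF v cmap_id box_bmap[OF t]])
 also have "\<dots> = rho k 0 v h"
 proof (rule rho_cong)
  fix u assume u: "u : cube k"
  show "linear_ext k 0 (bmap k 0 (\<lambda>_. Inl 0)) u = h u"
   using linear_ext_box[OF box_bmap[OF t] u] cmapD(1)[OF h u] by (simp add: cube_0)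
 qed
 finally show ?thesis ..
qed

section \<open>Evaluation on small pieces and gluing\<close>

text \<open>The representative of \<open>Z\<close> stays fixed and only the reparametrization moves
  with \<open>u\<close>. On a flat set every value of \<open>th\<close> may serve as
  \<open>Z\<close> with the same result, so that nothing depends on a choice.\<close>

definition RR :: "gsys => nat => (vec => nat => real) =>
  'a rpt => 'a" where
 "RR G k a Z = (THE d. ALL n c x. c : cells C n --> x : cube n --> Z = pt C n c x --> d = rho k n c (\<lambda>u. gact n (G (a u)) x))"

lemma gcmap: "gfun m G ==> cmap k m a ==> x : cube n ==> cmap k n (\<lambda>u. gact n (G (a u)) x)"
 using gfun_cmap[OF _ _ cmap_const] .

lemma RR_natural:
 assumes G: "gfun m G" and a: "cmap k m a" and f: "box_hom n' n f" and c: "c : cells C n" and x: "x : cube n'"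
 shows "rho k n' (act C n' n f c) (\<lambda>u. gact n' (G (a u)) x) = rho k n c (\<lambda>u. gact n (G (a u)) (linear_ext n' n f x))"
proof -
 have "rho k n' (act C n' n f c) (\<lambda>u. gact n' (G (a u)) x) = rho k n c (\<lambda>u. linear_ext n' n f (gact n' (G (a u)) x))"
  by (rule rho_nat[OF c gcmap[OF G a x] f])
 also have "\<dots> = rho k n c (\<lambda>u. gact n (G (a u)) (linear_ext n' n f x))"
  by (rule rho_cong) (rule gact_linear_ext[OF gfun_unit[OF G cmapD(1)[OF a]] f x, symmetric])
 finally show ?thesis .
qed

lemma RR_pt:
 assumes G: "gfun m G" and a: "cmap k m a" and c: "c : cells C n" "x : cube n"
 shows "RR G k a (pt C n c x) = rho k n c (\<lambda>u. gact n (G (a u)) x)"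
 unfolding RR_def
proof (rule the_equality)
 show "ALL n' c' x'. c' : cells C n' --> x' : cube n' --> pt C n c x = pt C n' c' x' -->
   rho k n c (\<lambda>u. gact n (G (a u)) x) = rho k n' c' (\<lambda>u. gact n' (G (a u)) x')"
 proof (intro allI impI)
  fix n' c' x' assume c': "c' : cells C n'" "x' : cube n'" and e: "pt C n c x = pt C n' c' x'"
  show "rho k n c (\<lambda>u. gact n (G (a u)) x) = rho k n' c' (\<lambda>u. gact n' (G (a u)) x')"
   by (rule pt_respects[OF C e c c', where F = "\<lambda>n c x. rho k n c (\<lambda>u. gact n (G (a u)) x)"])
    (rule RR_natural[OF G a])
 qed
qed (use c in blast)

lemma RR_cong: "(\<And>u. u : cube k ==> a u = b u) ==> RR G k a Z = RR G k b Z"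
proof -
 assume ab: "\<And>u. u : cube k ==> a u = b u"
 have "rho k n c (\<lambda>u. gact n (G (a u)) x) = rho k n c (\<lambda>u. gact n (G (b u)) x)" for n c x
  by (rule rho_cong) (simp add: ab)
 thus ?thesis by (simp add: RR_def)
qed

lemma RR_cell: "gfun m G ==> cmap k m a ==> Z : points C ==> RR G k a Z : cells C k"
 by (erule pointsE) (simp add: RR_pt rho_cell gcmap)

lemma RR_act:
 assumes G: "gfun m G" and a: "cmap k m a" and Z: "Z : points C" and f: "box_hom l k f"
 shows "act C l k f (RR G k a Z) = RR G l (\<lambda>u. a (linear_ext l k f u)) Z"
proof -
 obtain n c x where c: "c : cells C n" "x : cube n" "Z = pt C n c x" using pointsE[OF Z] .
 show ?thesis
  unfolding c(3) RR_pt[OF G a c(1,2)] RR_pt[OF G cmap_comp[OF a cmap_linear_ext[OF f]] c(1,2)]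
  by (rule rho_act[OF c(1) gcmap[OF G a c(2)] f])
qed

lemma RR_flat:
 assumes G: "gfun m G" and a: "cmap k m a" "a ` cube k \<subseteq> A" and A: "flat C th G A" "q : A" "q' : A"
  and Z: "th q : points C" "th q' : points C"
 shows "RR G k a (th q) = RR G k a (th q')"
proof -
 obtain n c x where c: "c : cells C n" "x : cube n" "th q = pt C n c x" using pointsE[OF Z(1)] .
 obtain n' c' x' where c': "c' : cells C n'" "x' : cube n'" "th q' = pt C n' c' x'" using pointsE[OF Z(2)] .
 have "rho k n c (\<lambda>u. gact n (G (a u)) x) = rho k n' c' (\<lambda>u. gact n' (G (a u)) x')"
 proof (rule flat_respects[OF C A c c', where F = "\<lambda>n c x. rho k n c (\<lambda>u. gact n (G (a u)) x)"])
  show "rho k n c (\<lambda>u. gact n (G (a u)) x) = rho k n c (\<lambda>u. gact n (G (a u)) x')" if s: "sameG G A n x x'" for n c x x'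
  proof (rule rho_cong)
   fix u assume "u : cube k"
   hence "a u : A" using a(2) by blast
   thus "gact n (G (a u)) x = gact n (G (a u)) x'" using s by (auto simp: sameG_def gact_def intro!: restrict_ext)
  qed
 qed (rule RR_natural[OF G a(1)])
 thus ?thesis using c c' RR_pt[OF G a(1)] by simp
qed

text \<open>The value of \<open>th\<close> at the image of the least vertex serves as the sample
  point; on small pieces any other would do.\<close>

primrec rr :: "(vec => 'a rpt) => gsys =>
  nat => nat => (vec => nat => real) => 'a" where
 "rr th G 0 = (\<lambda>k a. RR G k a (th (a (zero k))))"
| "rr th G (Suc j) = (\<lambda>k a. mu k (\<lambda>l. \<lambda>s\<in>cells (sd2_cube k) l. rr th G j l (\<lambda>u. a (sd2_cell l k s u))))"

lemma rr_cong: "(\<And>u. u : cube k ==> a u = b u) ==> rr th G j k a = rr th G j k b"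
proof (induction j arbitrary: k a b)
 case 0
 thus ?case using RR_cong[of k a b] zero_cube by simp
next
 case (Suc j)
 have "(\<lambda>l. \<lambda>s\<in>cells (sd2_cube k) l. rr th G j l (\<lambda>u. a (sd2_cell l k s u))) =
   (\<lambda>l. \<lambda>s\<in>cells (sd2_cube k) l. rr th G j l (\<lambda>u. b (sd2_cell l k s u)))"
  using Suc.prems cmapD(1)[OF cmap_sd2_cell] by (intro ext restrict_ext Suc.IH) simp
 thus ?case by simp
qed

lemma rr_comp: "rr (\<lambda>q. th (b q)) (\<lambda>q. G (b q)) j k a = rr th G j k (\<lambda>u. b (a u))"
 by (induction j arbitrary: k a) (auto simp: RR_def)

text \<open>That \<open>mu\<close> preserves totally degenerate cells follows from its compatibility
  with \<open>rho\<close>, applied to the vertex \<open>v\<close>.\<close>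

lemma rr_const:
 assumes v: "v : cells C 0" and G: "gfun m G" and a: "cmap k m a" and c: "\<And>u. u : cube k ==> th (a u) = pt C 0 v (zero 0)"
 shows "rr th G j k a = cv C v k"
 using a c
proof (induction j arbitrary: k a)
 case 0
 have z: "zero 0 : cube 0" by (simp add: cube_0)
 have "rr th G 0 k a = rho k 0 v (\<lambda>u. gact 0 (G (a u)) (zero 0))"
  using 0(2)[OF zero_cube] RR_pt[OF G 0(1) v z] by simp
 thus ?case using rho_cv[OF v gcmap[OF G 0(1) z]] by simp
next
 case (Suc j)
 have z: "zero 0 : cube 0" by (simp add: cube_0)
 have "(\<lambda>l. \<lambda>s\<in>cells (sd2_cube k) l. rr th G j l (\<lambda>u. a (sd2_cell l k s u))) =
   (\<lambda>l. \<lambda>s\<in>cells (sd2_cube k) l. rho l 0 v (\<lambda>u. zero 0))"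
 proof (rule ext, rule restrict_ext)
  fix l s assume s: "s : cells (sd2_cube k) l"
  have "rr th G j l (\<lambda>u. a (sd2_cell l k s u)) = cv C v l"
   using cmapD(1)[OF cmap_sd2_cell[OF s]] by (intro Suc.IH cmap_comp[OF Suc.prems(1) cmap_sd2_cell[OF s]] Suc.prems(2)) blast
  thus "rr th G j l (\<lambda>u. a (sd2_cell l k s u)) = rho l 0 v (\<lambda>u. zero 0)"
   using rho_cv[OF v cmap_const[OF z]] by simp
 qed
 moreover have "rho k 0 v (\<lambda>u. zero 0) = mu k (\<lambda>l. \<lambda>s\<in>cells (sd2_cube k) l. rho l 0 v (\<lambda>u. zero 0))"
  by (rule rho_mu[OF v cmap_const[OF z]])
 ultimately show ?case using rho_cv[OF v cmap_const[OF z], of k] by simp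
qed

text \<open>The least depth is merely a way to pick one; \<open>r_eq\<close> shows that each
  sufficient depth gives the same cell.\<close>

definition r :: "(vec => 'a rpt) => gsys =>
  nat => (vec => nat => real) => 'a" where
 "r th G k a = rr th G (LEAST j. sm (flat C th G) j k a) k a"

context
 fixes m :: nat and th G
 assumes th: "stream_map (dcube m) (realization C) th" and G: "good C m th G"
begin

lemma gf: "gfun m G"
 using G by (simp add: good_def)

text \<open>Membership and naturality are proved together, since \<open>mu\<close> is under control
  only on cubical functions: naturality at one depth is what makes the next depth
  meaningful.\<close>

lemma rr_natural:
 assumes P: "\<And>A. P A ==> flat C th G A" and a: "cmap k m a" and s: "sm P j k a"
 shows "rr th G j k a : cells C k \<and> (ALL l f. box_hom l k f --> act C l k f (rr th G j k a) = rr th G j l (\<lambda>u. a (linear_ext l k f u)))"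
 using a s
proof (induction j arbitrary: k a)
 case 0
 obtain A where A: "flat C th G A" "a ` cube k \<subseteq> A" using 0(2) P by auto
 have pz: "th (a u) : points C" if "u : cube k" for u using stream_points[OF C th cmapD(1)[OF 0(1) that]] .
 have "act C l k f (RR G k a (th (a (zero k)))) = RR G l (\<lambda>u. a (linear_ext l k f u)) (th (a (linear_ext l k f (zero l))))"
  if f: "box_hom l k f" for l f
 proof -
  note fz = linear_ext_box[OF f zero_cube]
  have "(\<lambda>u. a (linear_ext l k f u)) ` cube l \<subseteq> A" using A(2) linear_ext_box[OF f] by blast
  hence "RR G l (\<lambda>u. a (linear_ext l k f u)) (th (a (zero k))) = RR G l (\<lambda>u. a (linear_ext l k f u)) (th (a (linear_ext l k f (zero l))))"
   using A(2) zero_cube fz pz by (intro RR_flat[OF gf cmap_comp[OF 0(1) cmap_linear_ext[OF f]] _ A(1)]) auto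
  thus ?thesis using RR_act[OF gf 0(1) pz[OF zero_cube] f] by simp
 qed
 thus ?case using RR_cell[OF gf 0(1) pz[OF zero_cube]] by simp
next
 case (Suc j)
 define ph where "ph = (\<lambda>l. \<lambda>s\<in>cells (sd2_cube k) l. rr th G j l (\<lambda>u. a (sd2_cell l k s u)))"
 have sc: "cmap l m (\<lambda>u. a (sd2_cell l k s u))" if "s : cells (sd2_cube k) l" for l s
  by (rule cmap_comp[OF Suc.prems(1) cmap_sd2_cell[OF that]])
 have IH: "rr th G j l (\<lambda>u. a (sd2_cell l k s u)) : cells C l \<and> (ALL i f. box_hom i l f -->
   act C i l f (rr th G j l (\<lambda>u. a (sd2_cell l k s u))) = rr th G j i (\<lambda>u. a (sd2_cell l k s (linear_ext i l f u))))"
  if s: "s : cells (sd2_cube k) l" for l s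
  using Suc.IH[OF sc[OF s]] Suc.prems(2) s by simp
 have ch: "ph : chom (sd2_cube k) C"
  unfolding chom_def
 proof (intro CollectI conjI allI ballI impI)
  show "ph l : cells (sd2_cube k) l \<rightarrow>\<^sub>E cells C l" for l using IH by (auto simp: ph_def)
  fix i l f s assume s: "s : cells (sd2_cube k) l" and f: "box_hom i l f"
  have "ph i (act (sd2_cube k) i l f s) = rr th G j i (\<lambda>u. a (sd2_cell i k (compose (grid 1 i) s f) u))"
   using sd2_comp_box(1)[OF s f] by (simp add: ph_def act_representable_cell)
  also have "\<dots> = rr th G j i (\<lambda>u. a (sd2_cell l k s (linear_ext i l f u)))"
   by (rule rr_cong) (rule arg_cong[where f = a], rule sd2_comp_box(2)[OF s f])
  also have "\<dots> = act C i l f (ph l s)" using IH[OF s] f s by (simp add: ph_def)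
  finally show "ph i (act (sd2_cube k) i l f s) = act C i l f (ph l s)" .
 qed
 have "act C l k f (mu k ph) = rr th G (Suc j) l (\<lambda>u. a (linear_ext l k f u))" if f: "box_hom l k f" for l f
 proof -
  have "(\<lambda>i. \<lambda>s\<in>cells (sd2_cube l) i. ph i (compose (grid 1 i) (sd2_mor l k f) s)) =
    (\<lambda>i. \<lambda>s\<in>cells (sd2_cube l) i. rr th G j i (\<lambda>u. a (linear_ext l k f (sd2_cell i l s u))))"
  proof (rule ext, rule restrict_ext)
   fix i s assume s: "s : cells (sd2_cube l) i"
   have "ph i (compose (grid 1 i) (sd2_mor l k f) s) = rr th G j i (\<lambda>u. a (sd2_cell i k (compose (grid 1 i) (sd2_mor l k f) s) u))"
    using sd2_mor_comp(1)[OF s f] by (simp add: ph_def)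
   also have "\<dots> = rr th G j i (\<lambda>u. a (linear_ext l k f (sd2_cell i l s u)))"
    by (rule rr_cong) (rule arg_cong[where f = a], rule sd2_mor_comp(2)[OF s f])
   finally show "ph i (compose (grid 1 i) (sd2_mor l k f) s) = rr th G j i (\<lambda>u. a (linear_ext l k f (sd2_cell i l s u)))" .
  qed
  thus ?thesis using mu_act[OF ch f] by simp
 qed
 thus ?case using mu_cell[OF ch] by (simp add: ph_def)
qed

text \<open>On a small piece all subdivision cells may share one sample point. Their values are then
  the subdivision of a single value of \<open>rho\<close>, which \<open>mu\<close> glues back by
  \<open>rho_mu\<close>.\<close>

lemma rr_Suc:
 assumes P: "\<And>A. P A ==> flat C th G A" and a: "cmap k m a" and s: "sm P j k a"
 shows "rr th G (Suc j) k a = rr th G j k a"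
 using a s
proof (induction j arbitrary: k a)
 case 0
 obtain A where A: "flat C th G A" "a ` cube k \<subseteq> A" using 0(2) P by auto
 have pz: "th (a u) : points C" if "u : cube k" for u using stream_points[OF C th cmapD(1)[OF 0(1) that]] .
 obtain n c x where c: "c : cells C n" "x : cube n" and Z: "th (a (zero k)) = pt C n c x" using pointsE[OF pz[OF zero_cube]] .
 have "(\<lambda>l. \<lambda>s\<in>cells (sd2_cube k) l. rr th G 0 l (\<lambda>u. a (sd2_cell l k s u))) =
   (\<lambda>l. \<lambda>s\<in>cells (sd2_cube k) l. rho l n c (\<lambda>u. gact n (G (a (sd2_cell l k s u))) x))"
 proof (rule ext, rule restrict_ext)
  fix l s assume s: "s : cells (sd2_cube k) l"
  note sz = cmapD(1)[OF cmap_sd2_cell[OF s]]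
  note sc = cmap_comp[OF 0(1) cmap_sd2_cell[OF s]]
  have "rr th G 0 l (\<lambda>u. a (sd2_cell l k s u)) = RR G l (\<lambda>u. a (sd2_cell l k s u)) (th (a (sd2_cell l k s (zero l))))" by simp
  also have "\<dots> = RR G l (\<lambda>u. a (sd2_cell l k s u)) (th (a (zero k)))"
   using A(2) zero_cube sz pz by (intro RR_flat[OF gf sc _ A(1)]) auto
  also have "\<dots> = rho l n c (\<lambda>u. gact n (G (a (sd2_cell l k s u))) x)" unfolding Z by (rule RR_pt[OF gf sc c])
  finally show "rr th G 0 l (\<lambda>u. a (sd2_cell l k s u)) = rho l n c (\<lambda>u. gact n (G (a (sd2_cell l k s u))) x)" .
 qed
 hence "rr th G (Suc 0) k a = mu k (\<lambda>l. \<lambda>s\<in>cells (sd2_cube k) l. rho l n c (\<lambda>u. gact n (G (a (sd2_cell l k s u))) x))"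
  unfolding rr.simps(2) by simp
 also have "\<dots> = rho k n c (\<lambda>u. gact n (G (a u)) x)" by (rule rho_mu[OF c(1) gcmap[OF gf 0(1) c(2)], symmetric])
 also have "\<dots> = rr th G 0 k a" using Z RR_pt[OF gf 0(1) c] by simp
 finally show ?case .
next
 case (Suc j)
 have "(\<lambda>l. \<lambda>s\<in>cells (sd2_cube k) l. rr th G (Suc j) l (\<lambda>u. a (sd2_cell l k s u))) =
   (\<lambda>l. \<lambda>s\<in>cells (sd2_cube k) l. rr th G j l (\<lambda>u. a (sd2_cell l k s u)))"
  using Suc.prems by (intro ext restrict_ext Suc.IH cmap_comp[OF _ cmap_sd2_cell]) auto
 thus ?case unfolding rr.simps(2)[of th G "Suc j"] by simp
qed

lemma rr_le:
 assumes P: "\<And>A. P A ==> flat C th G A" and a: "cmap k m a" and s: "sm P i k a" and ij: "i \<le> j"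
 shows "rr th G j k a = rr th G i k a"
 using ij
proof (induction j rule: dec_induct)
 case (step j)
 thus ?case using rr_Suc[OF P a sm_le[OF step(1) s]] by simp
qed simp

lemma r_eq: "cmap k m a ==> sm (flat C th G) j k a ==> r th G k a = rr th G j k a"
 unfolding r_def by (rule rr_le[symmetric, OF _ _ LeastI]) (auto intro: Least_le)

lemma flat_sm: "cmap k m a ==> EX j. sm (flat C th G) j k a"
 by (rule sm_exists) (auto intro: flat_nbhd[OF C th G])

end

end

section \<open>Values and naturality of the glued cells\<close>

lemma pt_lmap:
 assumes C: "cubical_set C" and S: "bspec k n ph" and c: "c : cells C n" and x: "x : cube k"
 shows "pt C k (act C k n (bmap k n ph) c) x = pt C n c (lmap k n ph x)"
 using pt_act[OF C box_bmap[OF S] c x] linear_ext_bmap[OF S] by simp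

lemma pt_cv:
 assumes C: "cubical_set C" and v: "v : cells C 0" and x: "x : cube k"
 shows "pt C k (cv C v k) x = pt C 0 v (zero 0)"
proof -
 have t: "bspec k 0 (\<lambda>_. Inl 0)" by (simp add: bspec_def)
 show ?thesis using pt_lmap[OF C t v x] lmap_cube[OF t x] by (simp add: cv_def cube_0)
qed

lemma psp_lmap:
 assumes "x : cube n" "e \<le> 1"
 shows "lmap n n (psp S e) x : cube n" "j < n ==> lmap n n (psp S e) x j = (if j : S then real e else x j)"
  "(\<And>j. j < n ==> j : S ==> x j = real e) ==> lmap n n (psp S e) x = x"
proof -
 show 1: "lmap n n (psp S e) x : cube n" by (rule lmap_cube[OF setter_bspec[OF setter_psp[OF assms(2)]] assms(1)])
 show 2: "lmap n n (psp S e) x j = (if j : S then real e else x j)" if "j < n" for j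
  using that assms(1) by (simp add: lmap_def psp_def)
 show "lmap n n (psp S e) x = x" if "\<And>j. j < n ==> j : S ==> x j = real e"
  using that by (intro cube_eqI[OF 1 assms(1)]) (simp add: 2)
qed

context cubcat_data
begin

lemma rho_lmap:
 assumes c: "c : cells C n" and g: "bspec k n ph"
 shows "rho k n c (lmap k n ph) = act C k n (bmap k n ph) c"
 using rho_act[OF c cmap_id box_bmap[OF g]] rho_id[OF c] linear_ext_bmap[OF g] by simp

lemma rho_act_lmap:
 assumes c: "c : cells C n" and h: "cmap k n h" and g: "bspec l k ph"
 shows "act C l k (bmap l k ph) (rho k n c h) = rho l n c (\<lambda>u. h (lmap l k ph u))"
 using rho_act[OF c h box_bmap[OF g]] linear_ext_bmap[OF g] by simp

lemma rho_nat_lmap: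
 assumes c: "c : cells C n" and h: "cmap k m h" and g: "bspec m n ph"
 shows "rho k m (act C m n (bmap m n ph) c) h = rho k n c (\<lambda>u. lmap m n ph (h u))"
 using rho_nat[OF c h box_bmap[OF g]] linear_ext_bmap[OF g] by simp

lemma pt_rho:
 assumes c: "c : cells C n" and h: "cmap k n h" and g: "bspec l k ph" and u: "u : cube l"
 shows "pt C k (rho k n c h) (lmap l k ph u) = pt C l (rho l n c (\<lambda>u. h (lmap l k ph u))) u"
 using pt_lmap[OF C g rho_cell[OF c h] u] rho_act_lmap[OF c h g] by simp

lemma r_cong: "(\<And>u. u : cube k ==> a u = b u) ==> r th G k a = r th G k b"
proof -
 assume ab: "\<And>u. u : cube k ==> a u = b u"
 hence "sm P j k a = sm P j k b" for P j by (rule sm_cong)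
 thus ?thesis using rr_cong[of k a b, OF ab] by (simp add: r_def)
qed

lemma r_natural:
 assumes th: "stream_map (dcube m) (realization C) th" and G: "good C m th G" and a: "cmap k m a"
 shows "r th G k a : cells C k"
  and "bspec l k ph ==> act C l k (bmap l k ph) (r th G k a) = r th G l (\<lambda>u. a (lmap l k ph u))"
proof -
 obtain j where j: "sm (flat C th G) j k a" using flat_sm[OF th G a] by blast
 have n: "rr th G j k a : cells C k \<and> (ALL l f. box_hom l k f --> act C l k f (rr th G j k a) = rr th G j l (\<lambda>u. a (linear_ext l k f u)))"
  by (rule rr_natural[OF th G _ a j])
 note e = r_eq[OF th G a j]
 show "r th G k a : cells C k" using n e by simp
 assume p: "bspec l k ph"
 have s: "sm (flat C th G) j l (\<lambda>u. a (lmap l k ph u))" using sm_box[OF j box_bmap[OF p]] linear_ext_bmap[OF p] by simp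
 have "act C l k (bmap l k ph) (rr th G j k a) = rr th G j l (\<lambda>u. a (lmap l k ph u))"
  using n box_bmap[OF p] linear_ext_bmap[OF p] by metis
 thus "act C l k (bmap l k ph) (r th G k a) = r th G l (\<lambda>u. a (lmap l k ph u))"
  using e r_eq[OF th G cmap_comp[OF a cmap_lmap[OF p]] s] by simp
qed

lemma r_const:
 assumes "v : cells C 0" "gfun m G" "cmap k m a" "\<And>u. u : cube k ==> th (a u) = pt C 0 v (zero 0)"
 shows "r th G k a = cv C v k"
 unfolding r_def using assms by (rule rr_const)

lemma r_small:
 assumes th: "stream_map (dcube m) (realization C) th" and G: "good C m th G" and a: "cmap k m a"
  and A: "flat C th G A" "a ` cube k \<subseteq> A" and q: "q : A" "q : cube m"
 shows "r th G k a = RR G k a (th q)"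
proof -
 have "sm (flat C th G) 0 k a" using A by auto
 hence "r th G k a = RR G k a (th (a (zero k)))" using r_eq[OF th G a, of 0] by simp
 also have "\<dots> = RR G k a (th q)"
  using A(2) zero_cube q cmapD(1)[OF a] stream_points[OF C th]
  by (intro RR_flat[OF gf[OF th G] a A(2,1)]) auto
 finally show ?thesis .
qed

lemma r_comp:
 assumes th: "stream_map (dcube m) (realization C) th" and G: "good C m th G" and b: "cmap p m b" and a: "cmap k p a"
 shows "r (\<lambda>q. th (b q)) (\<lambda>q. G (b q)) k a = r th G k (\<lambda>u. b (a u))"
proof -
 note th' = stream_map_comp_cmap[OF th b] and G' = good_comp[OF G b] and ba = cmap_comp[OF b a]
 obtain i where i: "sm (flat C (\<lambda>q. th (b q)) (\<lambda>q. G (b q))) i k a" using flat_sm[OF th' G' a] by blast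
 obtain j where j: "sm (flat C th G) j k (\<lambda>u. b (a u))" using flat_sm[OF th G ba] by blast
 have "r (\<lambda>q. th (b q)) (\<lambda>q. G (b q)) k a = rr (\<lambda>q. th (b q)) (\<lambda>q. G (b q)) (max i j) k a"
  by (rule r_eq[OF th' G' a sm_le[OF _ i]]) simp
 also have "\<dots> = rr th G (max i j) k (\<lambda>u. b (a u))" by (rule rr_comp)
 also have "\<dots> = r th G k (\<lambda>u. b (a u))" by (rule r_eq[OF th G ba sm_le[OF _ j], symmetric]) simp
 finally show ?thesis .
qed

text \<open>For a chart the sample point can be released: on small sets \<open>p\<close> may be
  replaced by its collapse, which is degenerate along \<open>S\<close>, and in the other directions
  the reparametrized fixed point and moving point coincide. Smallness, \<open>P\<close>, is
  therefore flatness together with the data of \<open>chart_flat\<close>.\<close>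

lemma r_chart:
 assumes p: "p : cells C n" and G: "good C n (pt C n p) G" and a: "cmap k n a"
 shows "r (pt C n p) G k a = rho k n p (\<lambda>u. gact n (G (a u)) (a u))"
proof -
 note th = stream_chart[OF C p]
 let ?F = "flat C (pt C n p) G"
 define P where "P = (\<lambda>A. ?F A \<and> (EX ka S. setter n ka \<and> av C n (psp S 0) (av C n ka p) = av C n ka p \<and>
  (ALL y:A. ALL q:A. lmap n n ka (gact n (G q) y) = gact n (G q) y) \<and>
  (ALL y:A. ALL y':A. ALL q:A. lmap n n (psp S 0) (gact n (G q) y) = lmap n n (psp S 0) (gact n (G q) y'))))"
 have gG: "gfun n G" and sG: "sys n G" using G by (simp_all add: good_def sys_def)
 have loc: "EX e>0. P (cb n q e)" if q: "q : cube n" for q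
 proof -
  obtain d where d: "d > 0" "reals C (2/3) (steep G (cb n q d)) n p q = {}" using steep_nbhd[OF C th G q p q refl] by blast
  obtain e ka S where e: "e > 0" and k: "setter n ka" and S: "av C n (psp S 0) (av C n ka p) = av C n ka p"
   and fl: "\<And>y q'. y : cb n q e ==> q' : cb n q d ==> lmap n n ka (gact n (G q') y) = gact n (G q') y \<and>
    lmap n n (psp S 0) (gact n (G q') y) = lmap n n (psp S 0) (gact n (G q') q)"
   using chart_flat[OF C sG cb_cube p q d(2)] by metis
  obtain f where f: "f > 0" "?F (cb n q f)" using flat_nbhd[OF C th G q] by blast
  let ?e = "min f (min d e)"
  have sub: "cb n q ?e \<subseteq> cb n q f" "cb n q ?e \<subseteq> cb n q d" "cb n q ?e \<subseteq> cb n q e" by (auto intro!: cb_mono)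
  have "P (cb n q ?e)"
   unfolding P_def
  proof (intro conjI exI[of _ ka] exI[of _ S] ballI k S)
   show "?F (cb n q ?e)" by (rule flat_subset[OF C f(2) sub(1)])
   show "lmap n n ka (gact n (G q') y) = gact n (G q') y" if "y : cb n q ?e" "q' : cb n q ?e" for y q'
    using fl that sub by blast
   show "lmap n n (psp S 0) (gact n (G q') y) = lmap n n (psp S 0) (gact n (G q') y')"
    if "y : cb n q ?e" "y' : cb n q ?e" "q' : cb n q ?e" for y y' q'
   proof -
    have "lmap n n (psp S 0) (gact n (G q') y) = lmap n n (psp S 0) (gact n (G q') q)"
     "lmap n n (psp S 0) (gact n (G q') y') = lmap n n (psp S 0) (gact n (G q') q)" using fl that sub by blast+
    thus ?thesis by simp
   qed
  qed
  thus ?thesis using d(1) e f(1) by (intro exI[of _ ?e]) simp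
 qed
 have main: "rr (pt C n p) G j k a = rho k n p (\<lambda>u. gact n (G (a u)) (a u))" if "cmap k n a" "sm P j k a" for j k a
  using that
 proof (induction j arbitrary: k a)
  case 0
  then obtain A ka S where A: "a ` cube k \<subseteq> A" and k: "setter n ka" and S: "av C n (psp S 0) (av C n ka p) = av C n ka p"
   and f1: "ALL y:A. ALL q:A. lmap n n ka (gact n (G q) y) = gact n (G q) y"
   and f2: "ALL y:A. ALL y':A. ALL q:A. lmap n n (psp S 0) (gact n (G q) y) = lmap n n (psp S 0) (gact n (G q) y')"
   by (auto simp: P_def)
  note a = 0(1)
  have ps: "bspec n n (psp S 0)" by (rule setter_bspec[OF setter_psp]) simp
  note kb = setter_bspec[OF k] and kc = av_cell[OF C p k]
  have red: "rho k n p (\<lambda>u. gact n (G (a u)) (y u)) = rho k n (av C n ka p) (\<lambda>u. lmap n n (psp S 0) (gact n (G (a u)) (y u)))"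
   if y: "cmap k n y" "\<And>u. u : cube k ==> y u : A" for y
  proof -
   have h: "cmap k n (\<lambda>u. gact n (G (a u)) (y u))" by (rule gfun_cmap[OF gG a y(1)])
   have "rho k n p (\<lambda>u. gact n (G (a u)) (y u)) = rho k n p (\<lambda>u. lmap n n ka (gact n (G (a u)) (y u)))"
    by (rule rho_cong) (use f1 A y(2) in auto)
   also have "\<dots> = rho k n (av C n ka p) (\<lambda>u. gact n (G (a u)) (y u))"
    unfolding av_def by (rule rho_nat_lmap[OF p h kb, symmetric])
   also have "\<dots> = rho k n (act C n n (bmap n n (psp S 0)) (av C n ka p)) (\<lambda>u. gact n (G (a u)) (y u))"
    using S by (simp add: av_def)
   also have "\<dots> = rho k n (av C n ka p) (\<lambda>u. lmap n n (psp S 0) (gact n (G (a u)) (y u)))" by (rule rho_nat_lmap[OF kc h ps])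
   finally show ?thesis .
  qed
  have az: "a (zero k) : cube n" "a (zero k) : A" using cmapD(1)[OF a zero_cube] A zero_cube by blast+
  have "rr (pt C n p) G 0 k a = rho k n p (\<lambda>u. gact n (G (a u)) (a (zero k)))" using RR_pt[OF gG a p az(1)] by simp
  also have "\<dots> = rho k n (av C n ka p) (\<lambda>u. lmap n n (psp S 0) (gact n (G (a u)) (a (zero k))))"
   by (rule red[OF cmap_const[OF az(1)] az(2)])
  also have "\<dots> = rho k n (av C n ka p) (\<lambda>u. lmap n n (psp S 0) (gact n (G (a u)) (a u)))"
   by (rule rho_cong) (use f2 A az(2) in blast)
  also have "\<dots> = rho k n p (\<lambda>u. gact n (G (a u)) (a u))" by (rule red[OF a, symmetric]) (use A in blast)
  finally show ?case .
 next
  case (Suc j)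
  have "(\<lambda>l. \<lambda>s\<in>cells (sd2_cube k) l. rr (pt C n p) G j l (\<lambda>u. a (sd2_cell l k s u))) =
    (\<lambda>l. \<lambda>s\<in>cells (sd2_cube k) l. rho l n p (\<lambda>u. gact n (G (a (sd2_cell l k s u))) (a (sd2_cell l k s u))))"
   using Suc.prems by (intro ext restrict_ext Suc.IH cmap_comp[OF _ cmap_sd2_cell]) auto
  thus ?case using rho_mu[OF p gfun_cmap[OF gG Suc.prems(1) Suc.prems(1)]] by simp
 qed
 obtain j where j: "sm P j k a" using sm_exists[OF a loc] by blast
 obtain i where i: "sm ?F i k a" using flat_sm[OF th G a] by blast
 have "r (pt C n p) G k a = rr (pt C n p) G (max i j) k a"
  by (rule r_eq[OF th G a sm_le[OF _ i]]) simp
 also have "\<dots> = rho k n p (\<lambda>u. gact n (G (a u)) (a u))" by (rule main[OF a sm_le[OF _ j]]) simp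
 finally show ?thesis .
qed

end

section \<open>Homotopies relative to the boundary\<close>

definition snoc :: "nat => vec => real => nat => real" where
 "snoc n q s = (\<lambda>i\<in>{..<Suc n}. if i < n then q i else s)"

lemma snoc_cube: "q : cube n ==> 0 \<le> s ==> s \<le> 1 ==> snoc n q s : cube (Suc n)"
 unfolding snoc_def by (rule cube_restrictI) (auto simp: cube_coord)

lemma snoc_nth: "i < n ==> snoc n q s i = q i" "snoc n q s n = s"
 by (simp_all add: snoc_def)

lemma lcut_nth: "i < n ==> lcut n x i = x i"
 by (simp add: lcut_def)

lemma lcut_snoc: "q : cube n ==> lcut n (snoc n q s) = q"
 by (rule cube_eqI[of _ n]) (auto simp: lcut_def snoc_def cube_iff)

lemma cmap_init: "cmap (Suc n) n (lcut n)"
 using cmap_lcut[of n 1] by simp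

lemma init_cube: "x : cube (Suc n) ==> lcut n x : cube n"
 using cmapD(1)[OF cmap_init] .

lemma cmap_snoc:
 assumes "cmap k n f" "cmono k g"
 shows "cmap k (Suc n) (\<lambda>u. snoc n (f u) (g u))"
 unfolding snoc_def
proof (rule cmap_restrictI)
 fix i assume "i < Suc n"
 thus "cmono k (\<lambda>u. if i < n then f u i else g u)"
  using assms(2) cmapD(2)[OF assms(1), of i] by (cases "i < n") auto
qed

text \<open>One directed homotopy, with the last coordinate as time and the boundary of the cube
  held at \<open>Z\<close>. No symmetry or transitivity is claimed; what counts is the equivalence
  relation that it generates.\<close>

definition hts :: "'a cset => nat => 'a rpt => (vec => 'a rpt) =>
  (vec => 'a rpt) => bool" where
 "hts C n Z th0 th1 \<longleftrightarrow> (EX H. stream_map (dcube (Suc n)) (realization C) H \<and>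
  (ALL x:cube (Suc n). ALL j<n. x j = 0 \<or> x j = 1 --> H x = Z) \<and>
  (ALL q:cube n. H (snoc n q 0) = th0 q \<and> H (snoc n q 1) = th1 q))"

lemma htsI:
 assumes "stream_map (dcube (Suc n)) (realization C) H"
  and "\<And>x j. x : cube (Suc n) ==> j < n ==> x j = 0 \<or> x j = 1 ==> H x = Z"
  and "\<And>q. q : cube n ==> H (snoc n q 0) = th0 q" "\<And>q. q : cube n ==> H (snoc n q 1) = th1 q"
 shows "hts C n Z th0 th1"
 unfolding hts_def using assms by blast

section \<open>Homotopies that change the reparametrization\<close>

lemma push_cong:
 assumes C: "cubical_set C" and g: "unit_fun g" "unit_fun g'" and eq: "\<And>t. 0 \<le> t ==> t \<le> 1 ==> g t = g' t" and Z: "Z : points C"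
 shows "push C g Z = push C g' Z"
proof -
 obtain n c x where c: "c : cells C n" "x : cube n" "Z = pt C n c x" using pointsE[OF Z] .
 have "gact n g x = gact n g' x" using eq cube_coord[OF c(2)] by (auto simp: gact_def intro!: restrict_ext)
 thus ?thesis using push_pt[OF C g(1) c(1,2)] push_pt[OF C g(2) c(1,2)] c(3) by simp
qed

lemma push_ident:
 assumes C: "cubical_set C" and g: "unit_fun g" and eq: "\<And>t. 0 \<le> t ==> t \<le> 1 ==> g t = t" and Z: "Z : points C"
 shows "push C g Z = Z"
proof -
 obtain n c x where c: "c : cells C n" "x : cube n" "Z = pt C n c x" using pointsE[OF Z] .
 have "gact n g x = x"
  by (rule cube_eqI[OF gact_cube[OF g c(2)] c(2)]) (use eq cube_coord[OF c(2)] in \<open>simp add: gact_def\<close>)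
 thus ?thesis using push_pt[OF C g c(1,2)] c(3) by simp
qed

lemma hts_push:
 assumes C: "cubical_set C" and v: "v : cells C 0" and th: "stream_map (dcube n) (realization C) th"
  and bd: "\<And>q j. q : cube n ==> j < n ==> q j = 0 \<or> q j = 1 ==> th q = pt C 0 v (zero 0)" and G: "gfun (Suc n) G"
 shows "hts C n (pt C 0 v (zero 0)) (\<lambda>q. push C (G (snoc n q 0)) (th q)) (\<lambda>q. push C (G (snoc n q 1)) (th q))"
proof (rule htsI[of _ _ "\<lambda>x. push C (G x) (th (lcut n x))"])
 show "stream_map (dcube (Suc n)) (realization C) (\<lambda>x. push C (G x) (th (lcut n x)))"
  by (rule stream_push[OF C G stream_map_comp_cmap[OF th cmap_init]])
 fix x j assume x: "x : cube (Suc n)" and j: "j < n" "x j = 0 \<or> x j = 1"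
 have z: "zero 0 : cube 0" by (rule zero_cube)
 have "th (lcut n x) = pt C 0 v (zero 0)" by (rule bd[OF init_cube[OF x] j(1)]) (use j in \<open>simp add: lcut_nth\<close>)
 moreover have "gact 0 (G x) (zero 0) = zero 0"
  using gact_cube[OF gfun_unit[OF G x] z] by (simp add: cube_0)
 ultimately show "push C (G x) (th (lcut n x)) = pt C 0 v (zero 0)"
  using push_pt[OF C gfun_unit[OF G x] v z] by simp
qed (simp_all add: lcut_snoc)

text \<open>The last coordinate is time. The two systems start at the identity and at
  \<open>G\<close> respectively, and both end at the maximum of the two.\<close>

lemma gfun_join:
 assumes G: "gfun n G"
 shows "gfun (Suc n) (\<lambda>x t. max t (min (x n) (G (lcut n x) t)))" (is ?a)
  and "gfun (Suc n) (\<lambda>x t. max (min (x n) t) (G (lcut n x) t))" (is ?b)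
proof -
 have c: "cmono k (\<lambda>u. G (lcut n (a u)) (g u))" "cmono k (\<lambda>u. a u n)" if "cmap k (Suc n) a" "cmono k g" for k a g
  using gfun_cmono[OF G cmap_comp[OF cmap_init that(1)] that(2)] cmapD(2)[OF that(1)] by simp_all
 have e: "G (lcut n x) 0 = 0" "G (lcut n x) 1 = 1" "0 \<le> x n" "x n \<le> 1" if "x : cube (Suc n)" for x
  using G init_cube[OF that] cube_coord[OF that, of n] by (auto simp: gfun_def)
 show ?a
  unfolding gfun_def
 proof (intro conjI allI impI ballI)
  fix k a g assume a: "cmap k (Suc n) a" "cmono k g"
  show "cmono k (\<lambda>u. max (g u) (min (a u n) (G (lcut n (a u)) (g u))))" by (intro cmono_max cmono_min a(2) c(2)[OF a] c(1)[OF a])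
 qed (use e in simp_all)
 show ?b
  unfolding gfun_def
 proof (intro conjI allI impI ballI)
  fix k a g assume a: "cmap k (Suc n) a" "cmono k g"
  show "cmono k (\<lambda>u. max (min (a u n) (g u)) (G (lcut n (a u)) (g u)))" by (intro cmono_max cmono_min a(2) c(2)[OF a] c(1)[OF a])
 qed (use e in simp_all)
qed

lemma hts_reparam:
 assumes C: "cubical_set C" and v: "v : cells C 0" and th: "stream_map (dcube n) (realization C) th"
  and bd: "\<And>q j. q : cube n ==> j < n ==> q j = 0 \<or> q j = 1 ==> th q = pt C 0 v (zero 0)" and G: "gfun n G"
 shows "EX M. hts C n (pt C 0 v (zero 0)) th M \<and> hts C n (pt C 0 v (zero 0)) (\<lambda>q. push C (G q) (th q)) M"
proof -
 let ?Z = "pt C 0 v (zero 0)" and ?M = "\<lambda>q. push C (\<lambda>t. max t (G q t)) (th q)"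
 have p: "th q : points C" if "q : cube n" for q by (rule stream_points[OF C th that])
 have u: "unit_fun (G q)" if "q : cube n" for q by (rule gfun_unit[OF G that])
 have u': "unit_fun (\<lambda>t. max t (G q t))" if "q : cube n" for q using u[OF that] by (simp add: unit_fun_def le_max_iff_disj)
 note j = gfun_join[OF G]
 have s: "snoc n q 0 : cube (Suc n)" "snoc n q 1 : cube (Suc n)" if "q : cube n" for q
  using snoc_cube[OF that] by simp_all
 have ends: "snoc n q s n = s" "lcut n (snoc n q s) = q" if "q : cube n" for q s
  using that by (simp_all add: snoc_nth lcut_snoc)
 have G01: "0 \<le> G q t" "G q t \<le> 1" if "q : cube n" "0 \<le> t" "t \<le> 1" for q t using u[OF that(1)] that by (auto simp: unit_fun_def)
 have a0: "push C (\<lambda>t. max t (min (snoc n q 0 n) (G (lcut n (snoc n q 0)) t))) (th q) = th q" if q: "q : cube n" for q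
  by (rule push_ident[OF C gfun_unit[OF j(1) s(1)[OF q]] _ p[OF q]]) (use G01[OF q] ends[OF q] in simp)
 have a1: "push C (\<lambda>t. max t (min (snoc n q 1 n) (G (lcut n (snoc n q 1)) t))) (th q) = ?M q" if q: "q : cube n" for q
  by (rule push_cong[OF C gfun_unit[OF j(1) s(2)[OF q]] u'[OF q] _ p[OF q]]) (use G01[OF q] ends[OF q] in simp)
 have b0: "push C (\<lambda>t. max (min (snoc n q 0 n) t) (G (lcut n (snoc n q 0)) t)) (th q) = push C (G q) (th q)" if q: "q : cube n" for q
  by (rule push_cong[OF C gfun_unit[OF j(2) s(1)[OF q]] u[OF q] _ p[OF q]]) (use G01[OF q] ends[OF q] in simp)
 have b1: "push C (\<lambda>t. max (min (snoc n q 1 n) t) (G (lcut n (snoc n q 1)) t)) (th q) = ?M q" if q: "q : cube n" for q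
  by (rule push_cong[OF C gfun_unit[OF j(2) s(2)[OF q]] u'[OF q] _ p[OF q]]) (use G01[OF q] ends[OF q] in simp)
 have cong: "hts C n ?Z th0' th1'" if "hts C n ?Z th0 th1" "\<And>q. q : cube n ==> th0 q = th0' q" "\<And>q. q : cube n ==> th1 q = th1' q"
  for th0 th1 th0' th1' using that unfolding hts_def by simp
 have "hts C n ?Z th ?M" by (rule cong[OF hts_push[OF C v th bd j(1)] a0 a1])
 moreover have "hts C n ?Z (\<lambda>q. push C (G q) (th q)) ?M" by (rule cong[OF hts_push[OF C v th bd j(2)] b0 b1])
 ultimately show ?thesis by blast
qed

section \<open>Homotopies through cells of higher dimension\<close>

definition onp :: "'a cset => (nat => 'a => vec => 'b) => 'a rpt => 'b" where
 "onp C F Z = (THE d. ALL n c x. c : cells C n --> x : cube n --> Z = pt C n c x --> d = F n c x)"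

lemma onp_pt:
 assumes C: "cubical_set C" and c: "c : cells C n" "x : cube n"
  and F: "\<And>m n f c x. box_hom m n f ==> c : cells C n ==> x : cube m ==>
   F m (act C m n f c) x = F n c (linear_ext m n f x)"
 shows "onp C F (pt C n c x) = F n c x"
 unfolding onp_def
proof (rule the_equality)
 show "ALL n' c' x'. c' : cells C n' --> x' : cube n' --> pt C n c x = pt C n' c' x' --> F n c x = F n' c' x'"
 proof (intro allI impI)
  fix n' c' x' assume c': "c' : cells C n'" "x' : cube n'" and e: "pt C n c x = pt C n' c' x'"
  show "F n c x = F n' c' x'" by (rule pt_respects[OF C e c c', where F = F]) (rule F)
 qed
qed (use c in blast)

text \<open>In \<open>Q w s t\<close>, \<open>s\<close> is a variable of the cell to be evaluated,
  \<open>t\<close> the coordinate of a fixed representative in the same direction, and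
  \<open>w\<close> collects further variables. The end conditions take \<open>s\<close> and
  \<open>t\<close> equal, because a constant coordinate of a box morphism determines both.\<close>

definition qsys :: "nat => (vec => real => real => real) => bool" where
 "qsys L Q \<longleftrightarrow> (ALL k a g t. cmap k L a --> cmono k g --> 0 \<le> t --> t \<le> 1 --> cmono k (\<lambda>u. Q (a u) (g u) t)) \<and>
  (ALL w:cube L. Q w 0 0 = 0 \<and> Q w 1 1 = 1)"

definition hh :: "(vec => real => real => real) => nat => nat => vec => vec => nat => real" where
 "hh Q L n x w = (\<lambda>i\<in>{..<n}. Q (rcut n L w) (w i) (x i))"

lemma cmap_hh:
 assumes Q: "qsys L Q" and x: "x : cube n"
 shows "cmap (n + L) n (hh Q L n x)"
 unfolding hh_def
proof (rule cmap_restrictI)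
 fix i assume i: "i < n"
 thus "cmono (n + L) (\<lambda>w. Q (rcut n L w) (w i) (x i))"
  using Q cmap_rcut[of n L] cmono_coord[of i "n + L"] cube_coord[OF x i] unfolding qsys_def by simp
qed

lemma rcut_nth: "i < n ==> rcut p n y i = y (p + i)"
 by (simp add: rcut_def)

lemma cat_nth: "i < p ==> cat p n q x i = q i" "i < n ==> cat p n q x (p + i) = x i"
 by (simp_all add: cat_def)

context cubcat_data
begin

text \<open>A point in the realization of the \<open>(n + L)\<close>-cell obtained from
  \<open>c\<close>: its first coordinates are the reparametrized representative and its last ones
  are \<open>z\<close>. The variables that determine the cell and the point at which it is realized
  can thus be moved independently.\<close>

definition Lam :: "(vec => real => real => real) => gsys => nat => vec => vec =>
  nat => 'a => vec => 'a rpt" where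
 "Lam Q G L q z n c x = pt C (n + L) (rho (n + L) n c (hh Q L n x)) (cat n L (gact n (G q) x) z)"

text \<open>The box morphism acts on the first coordinates and is extended by the identity on the
  last \<open>L\<close>; at its constant coordinates the end conditions of \<open>qsys\<close>
  apply.\<close>

lemma Lam_nat:
 assumes Q: "qsys L Q" and G: "gfun m G" "q : cube m" and z: "z : cube L"
  and f: "box_hom k n f" and c: "c : cells C n" and x: "x : cube k"
 shows "Lam Q G L q z k (act C k n f c) x = Lam Q G L q z n c (linear_ext k n f x)"
proof -
 obtain ph where S: "bspec k n ph" and f: "f = bmap k n ph" using box_spec[OF f] by blast
 define ps where "ps = (\<lambda>j. if j < n then ph j else Inr (k + (j - n)) :: nat + nat)"
 have p: "bspec (k + L) (n + L) ps"
 proof (rule bspecI)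
  show "e \<le> 1" if "j < n + L" "ps j = Inl e" for j e
   using that bspecD(1)[OF S] by (auto simp: ps_def split: if_splits)
  show "i < k + L" if "j < n + L" "ps j = Inr i" for j i
  proof (cases "j < n")
   case True
   thus ?thesis using that bspecD(2)[OF S True, of i] by (simp add: ps_def)
  qed (use that in \<open>auto simp: ps_def\<close>)
  show "j = j'" if "j < n + L" "j' < n + L" "ps j = Inr i" "ps j' = Inr i" for j j' i
  proof (cases "j < n"; cases "j' < n")
   assume "j < n" "j' < n"
   thus ?thesis using that bspecD(3)[OF S, of j j' i] by (simp add: ps_def)
  next
   assume "j < n" "\<not> j' < n"
   thus ?thesis using that bspecD(2)[OF S, of j i] by (simp add: ps_def)
  next
   assume "\<not> j < n" "j' < n"
   thus ?thesis using that bspecD(2)[OF S, of j' i] by (simp add: ps_def)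
  qed (use that in \<open>auto simp: ps_def\<close>)
 qed
 have le: "linear_ext k n f x = lmap k n ph x" using linear_ext_bmap[OF S] f by simp
 let ?y = "lmap k n ph x"
 have y: "?y : cube n" by (rule lmap_cube[OF S x])
 have Gq: "unit_fun (G q)" by (rule gfun_unit[OF G])
 have gx: "gact k (G q) x : cube k" by (rule gact_cube[OF Gq x])
 have "rho (k + L) k (act C k n f c) (hh Q L k x) = rho (k + L) n c (\<lambda>w. lmap k n ph (hh Q L k x w))"
  unfolding f by (rule rho_nat_lmap[OF c cmap_hh[OF Q x] S])
 also have "\<dots> = rho (k + L) n c (\<lambda>w. hh Q L n ?y (lmap (k + L) (n + L) ps w))"
 proof (rule rho_cong)
  fix w assume w: "w : cube (k + L)"
  note pw = lmap_cube[OF p w]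
  have rc: "rcut n L (lmap (k + L) (n + L) ps w) = rcut k L w"
   using w by (auto simp: rcut_def lmap_def ps_def intro!: restrict_ext)
  have hk: "hh Q L k x w : cube k" by (rule cmapD(1)[OF cmap_hh[OF Q x] w])
  show "lmap k n ph (hh Q L k x w) = hh Q L n ?y (lmap (k + L) (n + L) ps w)"
  proof (rule cube_eqI[OF lmap_cube[OF S hk] cmapD(1)[OF cmap_hh[OF Q y] pw]])
   fix i assume i: "i < n"
   have rw: "rcut k L w : cube L" by (rule rcut_cube[OF w])
   show "lmap k n ph (hh Q L k x w) i = hh Q L n ?y (lmap (k + L) (n + L) ps w) i"
   proof (cases "ph i")
    case (Inl e)
    have "e = 0 \<or> e = 1" using bspecD(1)[OF S i Inl] by linarith
    hence "Q (rcut k L w) (real e) (real e) = real e" using Q rw by (auto simp: qsys_def)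
    thus ?thesis using i Inl hk x w unfolding hh_def rc by (simp add: lmap_def ps_def)
   next
    case (Inr l)
    have l: "l < k" by (rule bspecD(2)[OF S i Inr])
    have "lmap (k + L) (n + L) ps w i = w l" "?y i = x l" using i Inr w x by (simp_all add: lmap_def ps_def)
    moreover have "lmap k n ph (hh Q L k x w) i = hh Q L k x w l" using i Inr hk by (simp add: lmap_def)
    ultimately show ?thesis using i l unfolding hh_def rc by simp
   qed
  qed
 qed
 also have "\<dots> = act C (k + L) (n + L) (bmap (k + L) (n + L) ps) (rho (n + L) n c (hh Q L n ?y))"
  by (rule rho_act_lmap[OF c cmap_hh[OF Q y] p, symmetric])
 finally have e: "rho (k + L) k (act C k n f c) (hh Q L k x) =
   act C (k + L) (n + L) (bmap (k + L) (n + L) ps) (rho (n + L) n c (hh Q L n ?y))" .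
 have cc: "cat k L (gact k (G q) x) z : cube (k + L)" by (rule cat_cube[OF gx z])
 have gy: "gact n (G q) ?y = lmap k n ph (gact k (G q) x)" by (rule gact_lmap[OF Gq S x])
 have "lmap (k + L) (n + L) ps (cat k L (gact k (G q) x) z) = cat n L (gact n (G q) ?y) z"
 proof (rule cube_eqI[OF lmap_cube[OF p cc] cat_cube[OF gact_cube[OF Gq y] z]])
  fix i assume i: "i < n + L"
  show "lmap (k + L) (n + L) ps (cat k L (gact k (G q) x) z) i = cat n L (gact n (G q) ?y) z i"
  proof (cases "i < n")
   case True
   show ?thesis
   proof (cases "ph i")
    case (Inl e)
    thus ?thesis using i True cc gx unfolding gy by (simp add: lmap_def ps_def cat_def)
   next
    case (Inr l)
    have l: "l < k" by (rule bspecD(2)[OF S True Inr])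
    thus ?thesis using i True cc gx Inr unfolding gy by (simp add: lmap_def ps_def cat_def)
   qed
  next
   case False
   hence l: "i - n < L" using i by simp
   have "lmap (k + L) (n + L) ps (cat k L (gact k (G q) x) z) i = cat k L (gact k (G q) x) z (k + (i - n))"
    using i cc False by (simp add: lmap_def ps_def)
   also have "\<dots> = z (i - n)" by (rule cat_nth(2)[OF l])
   finally show ?thesis using i False by (simp add: cat_def)
  qed
 qed
 thus ?thesis unfolding Lam_def e le using pt_lmap[OF C p rho_cell[OF c cmap_hh[OF Q y]] cc] by simp
qed

text \<open>Since \<open>z\<close> lies on the face \<open>ph\<close>, the cell may be restricted to
  that face before it is realized. There \<open>Q\<close> depends on \<open>t\<close> only through
  the functions \<open>G q\<close> with \<open>q\<close> in \<open>A\<close>, which do not separate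
  \<open>x\<close> from \<open>x'\<close>.\<close>

lemma Lam_local:
 assumes Q: "qsys L Q" and G: "gfun m G" "q : cube m" and z: "z : cube L" and S: "setter L ph" and fz: "lmap L L ph z = z"
  and q: "q : A" and dep: "\<And>w s t t'. w : cube L ==> (\<And>q. q : A ==> G q t = G q t') ==> Q (lmap L L ph w) s t = Q (lmap L L ph w) s t'"
  and c: "c : cells C n" and x: "x : cube n" "x' : cube n" "sameG G A n x x'"
 shows "Lam Q G L q z n c x = Lam Q G L q z n c x'"
proof -
 define ps where "ps = (\<lambda>j. if j < n then Inr j else (case ph (j - n) of Inl e => Inl e | Inr l => Inr j) :: nat + nat)"
 have pc: "ps j = Inl e" if "j \<ge> n" "ph (j - n) = Inl e" for j e using that by (simp add: ps_def)
 have pr: "ps j = Inr j" if "j < n \<or> ph (j - n) = Inr (j - n)" for j using that by (auto simp: ps_def)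
 have p: "setter (n + L) ps"
  unfolding setter_def
 proof (intro allI impI)
  fix j assume j: "j < n + L"
  show "ps j = Inr j \<or> ps j = Inl 0 \<or> ps j = Inl 1"
  proof (cases "j < n")
   case False
   hence "ph (j - n) = Inr (j - n) \<or> ph (j - n) = Inl 0 \<or> ph (j - n) = Inl 1" using S j by (auto simp: setter_def)
   thus ?thesis using False pc pr by force
  qed (simp add: pr)
 qed
 note pb = setter_bspec[OF p] and Sb = setter_bspec[OF S]
 have Gq: "unit_fun (G q)" by (rule gfun_unit[OF G])
 have gx: "gact n (G q) x = gact n (G q) x'"
  using x(3) q by (auto simp: sameG_def gact_def intro!: restrict_ext)
 let ?P = "cat n L (gact n (G q) x) z"
 have P: "?P : cube (n + L)" by (rule cat_cube[OF gact_cube[OF Gq x(1)] z])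
 have rc: "rcut n L (lmap (n + L) (n + L) ps w) = lmap L L ph (rcut n L w)" if w: "w : cube (n + L)" for w
 proof (rule cube_eqI[OF rcut_cube[OF lmap_cube[OF pb w]] lmap_cube[OF Sb rcut_cube[OF w]]])
  fix i assume i: "i < L"
  show "rcut n L (lmap (n + L) (n + L) ps w) i = lmap L L ph (rcut n L w) i"
   using i w rcut_cube[OF w] pc[of "n + i"] pr[of "n + i"]
   by (cases rule: setterE[OF S i]) (simp_all add: rcut_def lmap_def)
 qed
 have fixP: "lmap (n + L) (n + L) ps ?P = ?P"
 proof (rule cube_eqI[OF lmap_cube[OF pb P] P])
  fix i assume i: "i < n + L"
  show "lmap (n + L) (n + L) ps ?P i = ?P i"
  proof (cases "i < n")
   case True
   thus ?thesis using i P pr by (simp add: lmap_def)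
  next
   case False
   define l where "l = i - n"
   have l: "l < L" "i = n + l" using i False by (auto simp: l_def)
   have "lmap (n + L) (n + L) ps ?P i = rcut n L (lmap (n + L) (n + L) ps ?P) l" using l by (simp add: rcut_nth)
   also have "\<dots> = lmap L L ph z l" using rc[OF P] rcut_cat[OF z, of n "gact n (G q) x"] by simp
   also have "\<dots> = ?P i" using fz l cat_nth(2)[of l L] by simp
   finally show ?thesis .
  qed
 qed
 have red: "Lam Q G L q z n c y = pt C (n + L) (rho (n + L) n c (\<lambda>w. hh Q L n y (lmap (n + L) (n + L) ps w))) ?P"
  if y: "y : cube n" "gact n (G q) y = gact n (G q) x" for y
  unfolding Lam_def using pt_rho[OF c cmap_hh[OF Q y(1)] pb P] fixP y(2) by simp
 have "rho (n + L) n c (\<lambda>w. hh Q L n x (lmap (n + L) (n + L) ps w)) = rho (n + L) n c (\<lambda>w. hh Q L n x' (lmap (n + L) (n + L) ps w))"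
 proof (rule rho_cong)
  fix w assume w: "w : cube (n + L)"
  have "Q (lmap L L ph (rcut n L w)) s (x i) = Q (lmap L L ph (rcut n L w)) s (x' i)" if "i < n" for s i
   using x(3) that by (intro dep[OF rcut_cube[OF w]]) (auto simp: sameG_def)
  thus "hh Q L n x (lmap (n + L) (n + L) ps w) = hh Q L n x' (lmap (n + L) (n + L) ps w)"
   unfolding hh_def rc[OF w] by (auto intro!: restrict_ext)
 qed
 thus ?thesis using red[OF x(1) refl] red[OF x(2) gx[symmetric]] by simp
qed

text \<open>Near \<open>x\<close>, flatness allows the representative of
  \<open>th (lcut n x)\<close> to be kept for all \<open>y\<close>, and with it the map becomes a
  chart composed with a monotone continuous map.\<close>

lemma stream_Lam:
 assumes th: "stream_map (dcube n) (realization C) th" and G: "gfun n G" and Q: "qsys L Q" and z: "cmap (Suc n) L z"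
  and loc: "\<And>x. x : cube (Suc n) ==> EX e>0. EX A ph. flat C th G A \<and> setter L ph \<and>
   (ALL y:cb (Suc n) x e. lcut n y : A \<and> lmap L L ph (z y) = z y) \<and>
   (ALL w:cube L. ALL s t t'. (ALL q:A. G q t = G q t') --> Q (lmap L L ph w) s t = Q (lmap L L ph w) s t')"
 shows "stream_map (dcube (Suc n)) (realization C) (\<lambda>x. onp C (Lam Q G L (lcut n x) (z x)) (th (lcut n x)))"
proof (rule stream_map_local[OF is_stream_real])
 fix x assume x: "x : cube (Suc n)"
 obtain e A ph where e: "e > 0" and A: "flat C th G A" and S: "setter L ph"
  and near: "\<And>y. y : cb (Suc n) x e ==> lcut n y : A \<and> lmap L L ph (z y) = z y"
  and dep: "\<And>w s t t'. w : cube L ==> (ALL q:A. G q t = G q t') ==> Q (lmap L L ph w) s t = Q (lmap L L ph w) s t'"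
  using loc[OF x] by metis
 obtain k c p where c: "c : cells C k" "p : cube k" "th (lcut n x) = pt C k c p"
  using pointsE[OF stream_points[OF C th init_cube[OF x]]] .
 let ?d = "rho (k + L) k c (hh Q L k p)"
 have d: "?d : cells C (k + L)" by (rule rho_cell[OF c(1) cmap_hh[OF Q c(2)]])
 define g where "g = (\<lambda>y. pt C (k + L) ?d (cat k L (gact k (G (lcut n y)) p) (z y)))"
 have "stream_map (dcube (Suc n)) (realization C) g"
  unfolding g_def
  by (rule stream_map_comp_cmap[OF stream_chart[OF C d] cmap_cat[OF gfun_cmap[OF G cmap_init cmap_const[OF c(2)]] z]])
 moreover have "onp C (Lam Q G L (lcut n y) (z y)) (th (lcut n y)) = g y" if y: "y : cb (Suc n) x e" for y
 proof -
  have yc: "y : cube (Suc n)" using y cb_cube by blast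
  note ly = init_cube[OF yc] and zy = cmapD(1)[OF z yc]
  obtain k' c' p' where c': "c' : cells C k'" "p' : cube k'" "th (lcut n y) = pt C k' c' p'"
   using pointsE[OF stream_points[OF C th ly]] .
  note nat = Lam_nat[OF Q G ly zy]
  have "onp C (Lam Q G L (lcut n y) (z y)) (th (lcut n y)) = Lam Q G L (lcut n y) (z y) k' c' p'"
   unfolding c'(3) by (rule onp_pt[OF C c'(1,2) nat])
  also have "\<dots> = Lam Q G L (lcut n y) (z y) k c p"
  proof (rule flat_respects[OF C A _ _ c' c, where F = "Lam Q G L (lcut n y) (z y)", OF _ _ nat])
   show "lcut n y : A" "lcut n x : A" using near[OF y] near[OF cb_self[OF x e]] by auto
   show "Lam Q G L (lcut n y) (z y) n' c x = Lam Q G L (lcut n y) (z y) n' c x'"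
    if "c : cells C n'" "x : cube n'" "x' : cube n'" "sameG G A n' x x'" for n' c x x'
    by (rule Lam_local[OF Q G ly zy S _ _ dep that]) (use near[OF y] in auto)
  qed
  finally show ?thesis by (simp add: g_def Lam_def)
 qed
 ultimately show "EX e>0. EX g. stream_map (dcube (Suc n)) (realization C) g \<and>
   (ALL y:cb (Suc n) x e. onp C (Lam Q G L (lcut n y) (z y)) (th (lcut n y)) = g y)"
  using e by blast
qed

end

section \<open>Every map into the realization is homotopic to a cell\<close>

lemma cmono_average:
 assumes f: "\<And>i. i < M ==> cmono k (f i)" and M: "M \<le> N" "N > 0"
 shows "cmono k (\<lambda>x. (\<Sum>i<M. f i x) / real N)"
proof -
 have c: "continuous_map (cube_topology k) euclideanreal (f i)" if "i < M" for i using f[OF that] by (simp add: cmono_def)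
 have "continuous_map (cube_topology k) euclideanreal (\<lambda>x. (\<Sum>i<M. f i x) / real N)"
  unfolding divide_inverse using c by (intro continuous_map_real_mult continuous_map_sum continuous_map_canonical_const) auto
 moreover have "(\<Sum>i<M. f i x) / real N \<le> (\<Sum>i<M. f i y) / real N" if "x : cube k" "y : cube k" "le k x y" for x y
  using f that M by (intro divide_right_mono sum_mono) (auto intro: cmonoD(1))
 moreover have "0 \<le> (\<Sum>i<M. f i x) / real N" if "x : cube k" for x
  using f that by (intro divide_nonneg_nonneg sum_nonneg) (auto intro: cmonoD(2))
 moreover have "(\<Sum>i<M. f i x) / real N \<le> 1" if "x : cube k" for x
 proof -
  have "(\<Sum>i<M. f i x) \<le> (\<Sum>i<M. 1)" using f that by (intro sum_mono) (auto intro: cmonoD(3))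
  also have "\<dots> \<le> real N" using M by simp
  finally show ?thesis using M by simp
 qed
 ultimately show ?thesis unfolding cmono_def by blast
qed

section \<open>A staircase through a large cube\<close>

definition clamp :: "real => real" where
 "clamp t = min 1 (max 0 t)"

lemma sum_clamp: "(\<Sum>i<N. clamp (t - real i)) = min (max 0 t) (real N)"
proof (induction N)
 case (Suc N)
 have "min (max 0 t) (real N) + clamp (t - real N) = min (max 0 t) (real (Suc N))"
  unfolding clamp_def min_def max_def by (cases "t \<le> real N"; cases "t \<le> real N + 1"; cases "0 \<le> t") auto
 thus ?case using Suc by simp
qed simp

text \<open>A path in the \<open>n * N\<close>-dimensional cube along which \<open>mean\<close> is the identity: in the \<open>i\<close>-th block, the coordinates
 increase one after the other.\<close>

definition stair :: "nat => nat => vec => nat => real" where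
 "stair n N q = (\<lambda>l\<in>{..<n * N}. clamp (real N * q (l div N) - real (l mod N)))"

definition mean :: "nat => nat => vec => nat => real" where
 "mean n N u = (\<lambda>i\<in>{..<n}. (\<Sum>k<N. u (i * N + k)) / real N)"

text \<open>A face that contains the staircase near \<open>q\<close>: coordinates already passed are
  1, those not yet reached are 0. One unit of slack on either side makes the same face serve all
  points within 1/N.\<close>

definition stsp :: "nat => vec => nat => nat + nat" where
 "stsp N q l = (if real (l mod N) + 2 \<le> real N * q (l div N) then Inl 1
  else if real N * q (l div N) + 1 \<le> real (l mod N) then Inl 0 else Inr l)"

lemma block: "i < n ==> k < N ==> i * N + k < n * (N::nat)"
proof -
 assume "i < n" "k < N"
 hence "i * N + k < Suc i * N" by simp
 also have "\<dots> \<le> n * N" using \<open>i < n\<close> by (intro mult_le_mono1) simp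
 finally show ?thesis .
qed

lemma block_div: "l < n * N ==> l div N < (n::nat)" "l < n * N ==> l mod N < (N::nat)"
 by (simp_all add: less_mult_imp_div_less) (metis mod_less_divisor mult_0_right neq0_conv not_less_zero)

lemma cmap_stair: "cmap n (n * N) (stair n N)"
 unfolding stair_def clamp_def
 by (intro cmap_restrictI cmono_ramp cmono_coord block_div(1)) simp_all

lemma cmap_mean:
 assumes "N > 0"
 shows "cmap (n * N) n (mean n N)"
 unfolding mean_def using assms by (intro cmap_restrictI cmono_average cmono_coord block) simp_all

lemma setter_stsp: "setter K (stsp N q)"
 by (auto simp: setter_def stsp_def)

lemma stair_fixed:
 assumes q: "q : cb n q0 (1 / real N)" and N: "N > 0"
 shows "lmap (n * N) (n * N) (stsp N q0) (stair n N q) = stair n N q"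
proof -
 let ?K = "n * N"
 have qc: "q : cube n" using q cb_cube by blast
 have s: "stair n N q : cube ?K" by (rule cmapD(1)[OF cmap_stair qc])
 show ?thesis
 proof (rule cube_eqI[OF lmap_cube[OF setter_bspec[OF setter_stsp] s] s])
  fix l assume l: "l < ?K"
  have "\<bar>q (l div N) - q0 (l div N)\<bar> < 1 / real N" using q block_div(1)[OF l] by (simp add: cb_def)
  hence "real N * \<bar>q (l div N) - q0 (l div N)\<bar> < 1" using N by (simp add: field_simps)
  hence "\<bar>real N * q (l div N) - real N * q0 (l div N)\<bar> < 1" using N by (simp add: abs_mult right_diff_distrib[symmetric])
  thus "lmap ?K ?K (stsp N q0) (stair n N q) l = stair n N q l"
   using l s by (auto simp: lmap_def stsp_def stair_def clamp_def)
 qed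
qed

text \<open>On the face the free coordinates of a block lie in a short window around
  \<open>N * q i\<close>. The face is squeezed between the staircases shifted by two units, so a
  block sum deviates from \<open>N * q i\<close> by at most 2.\<close>

lemma mean_near:
 assumes q: "q : cube n" and u: "u : cube (n * N)" and N: "N > 0" and d: "2 / real N < d"
 shows "mean n N (lmap (n * N) (n * N) (stsp N q) u) : cb n q d"
proof -
 let ?K = "n * N" and ?u = "lmap (n * N) (n * N) (stsp N q) u"
 have uc: "?u : cube ?K" by (rule lmap_cube[OF setter_bspec[OF setter_stsp] u])
 have "\<bar>mean n N ?u i - q i\<bar> < d" if i: "i < n" for i
 proof -
  let ?t = "real N * q i"
  have t: "0 \<le> ?t" "?t \<le> real N" using cube_coord[OF q i] by (simp_all add: mult_left_le)
  have k: "clamp (?t - 2 - real k) \<le> ?u (i * N + k) \<and> ?u (i * N + k) \<le> clamp (?t + 2 - real k)" if "k < N" for k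
  proof -
   have "0 \<le> u (i * N + k) \<and> u (i * N + k) \<le> 1" by (rule cube_coord[OF u block[OF i that]])
   thus ?thesis using that u block[OF i that] by (auto simp: lmap_def stsp_def clamp_def)
  qed
  have "(\<Sum>k<N. clamp (?t - 2 - real k)) \<le> (\<Sum>k<N. ?u (i * N + k))" using k by (intro sum_mono) simp
  moreover have "(\<Sum>k<N. ?u (i * N + k)) \<le> (\<Sum>k<N. clamp (?t + 2 - real k))" using k by (intro sum_mono) simp
  ultimately have "?t - 2 \<le> (\<Sum>k<N. ?u (i * N + k))" "(\<Sum>k<N. ?u (i * N + k)) \<le> ?t + 2"
   unfolding sum_clamp using t by linarith+
  hence "\<bar>(\<Sum>k<N. ?u (i * N + k)) - ?t\<bar> \<le> 2" by linarith
  moreover have "mean n N ?u i - q i = ((\<Sum>k<N. ?u (i * N + k)) - ?t) / real N" using i N by (simp add: mean_def field_simps)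
  ultimately have "\<bar>mean n N ?u i - q i\<bar> \<le> 2 / real N" using N by (simp add: divide_right_mono)
  thus ?thesis using d by simp
 qed
 thus ?thesis using cmapD(1)[OF cmap_mean[OF N] uc] by (simp add: cb_def)
qed

text \<open>The last variable of \<open>w\<close> is time and the others form the large cube.
  \<open>Qa\<close> leads from \<open>s\<close>, the variable of the cell, to its maximum with the
  reparametrized level; \<open>Qb\<close> leads to the same maximum from the reparametrized level
  alone.\<close>

definition Qa :: "nat => nat => gsys => vec => real => real => real" where
 "Qa n N G w s t = max s (min (w (n * N)) (G (mean n N (lcut (n * N) w)) t))"

definition Qb :: "nat => nat => gsys => vec => real => real => real" where
 "Qb n N G w s t = max (min (w (n * N)) s) (G (mean n N (lcut (n * N) w)) t)"

lemma qsys_Q: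
 assumes G: "gfun n G" and N: "N > 0"
 shows "qsys (Suc (n * N)) (Qa n N G)" (is ?a) and "qsys (Suc (n * N)) (Qb n N G)" (is ?b)
proof -
 let ?K = "n * N"
 have c: "cmono k (\<lambda>u. G (mean n N (lcut ?K (a u))) t)" "cmono k (\<lambda>u. a u ?K)"
  if "cmap k (Suc ?K) a" "0 \<le> t" "t \<le> 1" for k a t
  using gfun_cmono[OF G cmap_comp[OF cmap_mean[OF N] cmap_comp[OF cmap_init that(1)]] cmono_const[OF that(2,3)]] cmapD(2)[OF that(1)]
  by simp_all
 have e: "G (mean n N (lcut ?K w)) 0 = 0" "G (mean n N (lcut ?K w)) 1 = 1" "0 \<le> w ?K" "w ?K \<le> 1" if "w : cube (Suc ?K)" for w
  using G cmapD(1)[OF cmap_mean[OF N] init_cube[OF that]] cube_coord[OF that, of ?K] by (auto simp: gfun_def)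
 show ?a
  unfolding qsys_def Qa_def
 proof (intro conjI allI impI ballI)
  fix k a g and t :: real assume a: "cmap k (Suc ?K) a" "cmono k g" "0 \<le> t" "t \<le> 1"
  show "cmono k (\<lambda>u. max (g u) (min (a u ?K) (G (mean n N (lcut ?K (a u))) t)))"
   by (intro cmono_max cmono_min a(2) c(2)[OF a(1,3,4)] c(1)[OF a(1,3,4)])
 qed (use e in simp_all)
 show ?b
  unfolding qsys_def Qb_def
 proof (intro conjI allI impI ballI)
  fix k a g and t :: real assume a: "cmap k (Suc ?K) a" "cmono k g" "0 \<le> t" "t \<le> 1"
  show "cmono k (\<lambda>u. max (min (a u ?K) (g u)) (G (mean n N (lcut ?K (a u))) t))"
   by (intro cmono_max cmono_min a(2) c(2)[OF a(1,3,4)] c(1)[OF a(1,3,4)])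
 qed (use e in simp_all)
qed

text \<open>The choice of \<open>N\<close>: by \<open>mean_near\<close>, the block means over the
  face of the staircase at \<open>q\<close> stay in a ball around \<open>q\<close> on which
  \<open>th\<close> is flat.\<close>

lemma flat_scale:
 assumes C: "cubical_set C" and th: "stream_map (dcube n) (realization C) th" and G: "good C n th G"
 shows "EX N>0. EX d. 2 / real N < d \<and> (ALL q:cube n. flat C th G (cb n q d))"
proof -
 obtain d where d: "d > 0" "ALL q:cube n. flat C th G (cb n q d)"
  using cube_lebesgue[where R = "flat C th G" and n = n, OF flat_nbhd[OF C th G]] flat_subset[OF C] by metis
 obtain N :: nat where N: "2 / d < real N" using reals_Archimedean2 by blast
 have "0 < real N" using N d(1) by (smt (verit) divide_pos_pos)
 hence "2 / real N < d" using N d(1) by (simp add: field_simps)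
 thus ?thesis using \<open>0 < real N\<close> d(2) by auto
qed

context cubcat_data
begin

context
 fixes n N :: nat and th :: "vec => 'a rpt" and G :: "vec => real => real" and v :: 'a and d :: real
 assumes th: "stream_map (dcube n) (realization C) th" and G: "good C n th G" and N: "N > 0"
  and d: "2 / real N < d" "\<And>q. q : cube n ==> flat C th G (cb n q d)"
  and v: "v : cells C 0"
  and bd: "\<And>q j. q : cube n ==> j < n ==> q j = 0 \<or> q j = 1 ==> th q = pt C 0 v (zero 0)"
begin

lemma gG: "gfun n G"
 using G by (simp add: good_def)

lemma stream_Q:
 assumes Q: "Q = Qa n N G \<or> Q = Qb n N G"
 shows "stream_map (dcube (Suc n)) (realization C)
  (\<lambda>x. onp C (Lam Q G (Suc (n * N)) (lcut n x) (snoc (n * N) (stair n N (lcut n x)) (x n))) (th (lcut n x)))"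
proof (rule stream_Lam[OF th gG _ cmap_snoc[OF cmap_comp[OF cmap_stair cmap_init] cmono_coord]])
 let ?K = "n * N"
 show "qsys (Suc ?K) Q" using Q qsys_Q[OF gG N] by auto
 fix x assume x: "x : cube (Suc n)"
 let ?q = "lcut n x"
 note q = init_cube[OF x]
 let ?A = "cb n ?q d"
 \<comment> \<open>The face of the staircase at \<open>?q\<close>, with the time coordinate left
   free.\<close>
 define ph where "ph = (\<lambda>l. if l < ?K then stsp N ?q l else Inr l)"
 have S: "setter (Suc ?K) ph" using setter_stsp[of ?K N ?q] by (auto simp: setter_def ph_def)
 have Nd: "1 / real N \<le> d" using d(1) N by (simp add: field_simps)
 have near: "lcut n y : ?A \<and> lmap (Suc ?K) (Suc ?K) ph (snoc ?K (stair n N (lcut n y)) (y n)) = snoc ?K (stair n N (lcut n y)) (y n)"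
  if y: "y : cb (Suc n) x (1 / real N)" for y
 proof
  have yc: "y : cube (Suc n)" using y cb_cube by blast
  have l: "lcut n y : cb n ?q (1 / real N)" using y init_cube[OF yc] by (auto simp: cb_def lcut_def)
  thus "lcut n y : ?A" using cb_mono[OF Nd] by blast
  let ?p = "stair n N (lcut n y)"
  have p: "?p : cube ?K" by (rule cmapD(1)[OF cmap_stair init_cube[OF yc]])
  have P: "snoc ?K ?p (y n) : cube (Suc ?K)" using snoc_cube[OF p] cube_coord[OF yc, of n] by simp
  show "lmap (Suc ?K) (Suc ?K) ph (snoc ?K ?p (y n)) = snoc ?K ?p (y n)"
  proof (rule cube_eqI[OF lmap_cube[OF setter_bspec[OF S] P] P])
   fix i assume i: "i < Suc ?K"
   show "lmap (Suc ?K) (Suc ?K) ph (snoc ?K ?p (y n)) i = snoc ?K ?p (y n) i"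
   proof (cases "i < ?K")
    case True
    have "lmap ?K ?K (stsp N ?q) ?p i = ?p i" using stair_fixed[OF l N] by simp
    thus ?thesis using True i P p setterE[OF setter_stsp True, of N ?q]
     by (cases "stsp N ?q i") (auto simp: lmap_def ph_def snoc_nth stsp_def split: if_splits)
   next
    case False
    thus ?thesis using i P by (simp add: lmap_def ph_def)
   qed
  qed
 qed
 have dep: "Q (lmap (Suc ?K) (Suc ?K) ph w) s t = Q (lmap (Suc ?K) (Suc ?K) ph w) s t'"
  if w: "w : cube (Suc ?K)" and tt: "ALL q:?A. G q t = G q t'" for w s t t'
 proof -
  let ?w = "lmap (Suc ?K) (Suc ?K) ph w"
  note wc = lmap_cube[OF setter_bspec[OF S] w] and lw = init_cube[OF w]
  have "lcut ?K ?w = lmap ?K ?K (stsp N ?q) (lcut ?K w)"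
  proof (rule cube_eqI[OF init_cube[OF wc] lmap_cube[OF setter_bspec[OF setter_stsp] lw]])
   fix i assume i: "i < ?K"
   show "lcut ?K ?w i = lmap ?K ?K (stsp N ?q) (lcut ?K w) i"
    using i w lw by (auto simp: lcut_nth lmap_def ph_def stsp_def)
  qed
  hence "mean n N (lcut ?K ?w) : ?A" using mean_near[OF q lw N d(1)] by simp
  hence "G (mean n N (lcut ?K ?w)) t = G (mean n N (lcut ?K ?w)) t'" using tt by blast
  thus ?thesis using Q by (auto simp: Qa_def Qb_def)
 qed
 show "EX e>0. EX A ph. flat C th G A \<and> setter (Suc ?K) ph \<and>
   (ALL y:cb (Suc n) x e. lcut n y : A \<and> lmap (Suc ?K) (Suc ?K) ph (snoc ?K (stair n N (lcut n y)) (y n)) = snoc ?K (stair n N (lcut n y)) (y n)) \<and>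
   (ALL w:cube (Suc ?K). ALL s t t'. (ALL q:A. G q t = G q t') -->
    Q (lmap (Suc ?K) (Suc ?K) ph w) s t = Q (lmap (Suc ?K) (Suc ?K) ph w) s t')"
  using near dep S d(2)[OF q] N by (intro exI[of _ "1 / real N"] conjI exI[of _ ?A] exI[of _ ph]) auto
qed simp

text \<open>At the times 0 and 1 the point lies on a face of the cell, so the time may be
  substituted in \<open>hh\<close> beforehand.\<close>

lemma Lam_face:
 assumes Q: "qsys (Suc K) Q" and c: "c : cells C k" and x: "x : cube k" and q: "q : cube n" and p: "p : cube K" and e: "e \<le> 1"
 shows "Lam Q G (Suc K) q (snoc K p (real e)) k c x =
  pt C (k + Suc K) (rho (k + Suc K) k c (\<lambda>w. hh Q (Suc K) k x (lmap (k + Suc K) (k + Suc K) (psp {k + K} e) w)))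
   (cat k (Suc K) (gact k (G q) x) (snoc K p (real e)))"
  "cat k (Suc K) (gact k (G q) x) (snoc K p (real e)) : cube (k + Suc K)"
proof -
 let ?P = "cat k (Suc K) (gact k (G q) x) (snoc K p (real e))"
 show P: "?P : cube (k + Suc K)"
  using e by (intro cat_cube[OF gact_cube[OF gfun_unit[OF gG q] x] snoc_cube[OF p]]) auto
 have "lmap (k + Suc K) (k + Suc K) (psp {k + K} e) ?P = ?P"
  by (rule psp_lmap(3)[OF P e]) (use cat_nth(2)[of K "Suc K" k] in \<open>simp add: snoc_nth\<close>)
 thus "Lam Q G (Suc K) q (snoc K p (real e)) k c x =
  pt C (k + Suc K) (rho (k + Suc K) k c (\<lambda>w. hh Q (Suc K) k x (lmap (k + Suc K) (k + Suc K) (psp {k + K} e) w))) ?P"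
  unfolding Lam_def using pt_rho[OF c cmap_hh[OF Q x] setter_bspec[OF setter_psp[OF e]] P, of "{k + K}"] by simp
qed

lemma hh_face:
 assumes "w : cube (k + Suc K)" "e \<le> 1" "i < k"
 shows "lmap (k + Suc K) (k + Suc K) (psp {k + K} e) w i = w i"
  "rcut k (Suc K) (lmap (k + Suc K) (k + Suc K) (psp {k + K} e) w) K = real e"
  "lcut K (rcut k (Suc K) (lmap (k + Suc K) (k + Suc K) (psp {k + K} e) w)) = rcut k K w"
 using psp_lmap(2)[OF assms(1,2), of _ "{k + K}"] assms(3) by (auto simp: rcut_def lcut_def intro!: restrict_ext)

lemma mean_rcut: "w : cube (k + Suc (n * N)) ==> mean n N (rcut k (n * N) w) : cube n"
proof -
 assume "w : cube (k + Suc (n * N))"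
 hence "rcut k (n * N) w : cube (n * N)"
  unfolding rcut_def by (intro cube_restrictI cube_coord) auto
 thus ?thesis by (rule cmapD(1)[OF cmap_mean[OF N]])
qed

text \<open>At time 0 \<open>Qa\<close> returns \<open>s\<close>; the cell is then a degeneracy of
  \<open>c\<close> itself, realized at the reparametrized point.\<close>

lemma Lam_left:
 assumes c: "c : cells C k" and x: "x : cube k" and q: "q : cube n" and p: "p : cube (n * N)"
 shows "Lam (Qa n N G) G (Suc (n * N)) q (snoc (n * N) p 0) k c x = pt C k c (gact k (G q) x)"
proof -
 let ?K = "n * N" and ?M = "k + Suc (n * N)"
 let ?P = "cat k (Suc ?K) (gact k (G q) x) (snoc ?K p (real 0))"
 note L = Lam_face[OF qsys_Q(1)[OF gG N] c x q p le0]
 have b: "bspec ?M k Inr" by (auto simp: bspec_def)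
 have u: "unit_fun (G q)" by (rule gfun_unit[OF gG q])
 have "rho ?M k c (\<lambda>w. hh (Qa n N G) (Suc ?K) k x (lmap ?M ?M (psp {k + ?K} 0) w)) = rho ?M k c (lmap ?M k Inr)"
 proof (rule rho_cong)
  fix w assume w: "w : cube ?M"
  note wc = psp_lmap(1)[OF w le0, of "{k + ?K}"]
  show "hh (Qa n N G) (Suc ?K) k x (lmap ?M ?M (psp {k + ?K} 0) w) = lmap ?M k Inr w"
  proof (rule cube_eqI[OF cmapD(1)[OF cmap_hh[OF qsys_Q(1)[OF gG N] x] wc] lmap_cube[OF b w]])
   fix i assume i: "i < k"
   have "0 \<le> G (mean n N (rcut k ?K w)) (x i)" "0 \<le> w i"
    using gfun_unit[OF gG mean_rcut[OF w]] cube_coord[OF x i] cube_coord[OF w, of i] i by (auto simp: unit_fun_def)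
   moreover have "lmap ?M k Inr w i = w i" using i w by (simp add: lmap_def)
   ultimately show "hh (Qa n N G) (Suc ?K) k x (lmap ?M ?M (psp {k + ?K} 0) w) i = lmap ?M k Inr w i"
    using i w hh_face[OF w le0 i] by (simp add: hh_def Qa_def)
  qed
 qed
 also have "\<dots> = act C ?M k (bmap ?M k Inr) c" by (rule rho_lmap[OF c b])
 finally have "Lam (Qa n N G) G (Suc ?K) q (snoc ?K p (real 0)) k c x = pt C ?M (act C ?M k (bmap ?M k Inr) c) ?P" using L(1) by simp
 also have "\<dots> = pt C k c (lmap ?M k Inr ?P)" by (rule pt_lmap[OF C b c L(2)])
 also have "lmap ?M k Inr ?P = gact k (G q) x"
  by (rule cube_eqI[OF lmap_cube[OF b L(2)] gact_cube[OF u x]]) (use L(2) in \<open>simp add: lmap_def cat_nth\<close>)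
 finally show ?thesis by simp
qed

lemma Lam_mid:
 assumes c: "c : cells C k" and x: "x : cube k" and q: "q : cube n" and p: "p : cube (n * N)"
 shows "Lam (Qa n N G) G (Suc (n * N)) q (snoc (n * N) p 1) k c x = Lam (Qb n N G) G (Suc (n * N)) q (snoc (n * N) p 1) k c x"
proof -
 let ?K = "n * N" and ?M = "k + Suc (n * N)"
 have "rho ?M k c (\<lambda>w. hh (Qa n N G) (Suc ?K) k x (lmap ?M ?M (psp {k + ?K} 1) w)) =
   rho ?M k c (\<lambda>w. hh (Qb n N G) (Suc ?K) k x (lmap ?M ?M (psp {k + ?K} 1) w))"
 proof (rule rho_cong)
  fix w assume w: "w : cube ?M"
  have "Qa n N G (rcut k (Suc ?K) (lmap ?M ?M (psp {k + ?K} 1) w)) (lmap ?M ?M (psp {k + ?K} 1) w i) (x i) =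
    Qb n N G (rcut k (Suc ?K) (lmap ?M ?M (psp {k + ?K} 1) w)) (lmap ?M ?M (psp {k + ?K} 1) w i) (x i)" if i: "i < k" for i
  proof -
   have "G (mean n N (rcut k ?K w)) (x i) \<le> 1" "w i \<le> 1"
    using gfun_unit[OF gG mean_rcut[OF w]] cube_coord[OF x i] cube_coord[OF w, of i] i by (auto simp: unit_fun_def)
   thus ?thesis unfolding Qa_def Qb_def hh_face[OF w order_refl i] by simp
  qed
  thus "hh (Qa n N G) (Suc ?K) k x (lmap ?M ?M (psp {k + ?K} 1) w) = hh (Qb n N G) (Suc ?K) k x (lmap ?M ?M (psp {k + ?K} 1) w)"
   unfolding hh_def by (intro restrict_ext) simp
 qed
 thus ?thesis
  using Lam_face(1)[OF qsys_Q(1)[OF gG N] c x q p order_refl] Lam_face(1)[OF qsys_Q(2)[OF gG N] c x q p order_refl] by simp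
qed

text \<open>At time 0 \<open>Qb\<close> does not see \<open>s\<close>; the cell is then a degeneracy
  of the value of \<open>RR\<close>, realized on the staircase.\<close>

lemma Lam_right:
 assumes c: "c : cells C k" and x: "x : cube k" and q: "q : cube n" and p: "p : cube (n * N)"
 shows "Lam (Qb n N G) G (Suc (n * N)) q (snoc (n * N) p 0) k c x = pt C (n * N) (RR G (n * N) (mean n N) (pt C k c x)) p"
proof -
 let ?K = "n * N" and ?M = "k + Suc (n * N)"
 let ?P = "cat k (Suc ?K) (gact k (G q) x) (snoc ?K p (real 0))"
 define xi where "xi = (\<lambda>l. Inr (k + l) :: nat + nat)"
 have b: "bspec ?M ?K xi" by (auto simp: bspec_def xi_def)
 note L = Lam_face[OF qsys_Q(2)[OF gG N] c x q p le0]
 note g = gcmap[OF gG cmap_mean[OF N] x]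
 have "rho ?M k c (\<lambda>w. hh (Qb n N G) (Suc ?K) k x (lmap ?M ?M (psp {k + ?K} 0) w)) =
   rho ?M k c (\<lambda>w. gact k (G (mean n N (lmap ?M ?K xi w))) x)"
 proof (rule rho_cong)
  fix w assume w: "w : cube ?M"
  have r: "lmap ?M ?K xi w = rcut k ?K w" using w by (auto simp: lmap_def rcut_def xi_def)
  have "Qb n N G (rcut k (Suc ?K) (lmap ?M ?M (psp {k + ?K} 0) w)) (lmap ?M ?M (psp {k + ?K} 0) w i) (x i) =
    G (mean n N (rcut k ?K w)) (x i)" if i: "i < k" for i
  proof -
   have "0 \<le> G (mean n N (rcut k ?K w)) (x i)" "0 \<le> w i"
    using gfun_unit[OF gG mean_rcut[OF w]] cube_coord[OF x i] cube_coord[OF w, of i] i by (auto simp: unit_fun_def)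
   thus ?thesis unfolding Qb_def hh_face[OF w le0 i] by simp
  qed
  thus "hh (Qb n N G) (Suc ?K) k x (lmap ?M ?M (psp {k + ?K} 0) w) = gact k (G (mean n N (lmap ?M ?K xi w))) x"
   unfolding hh_def gact_def r by (intro restrict_ext) simp
 qed
 hence "Lam (Qb n N G) G (Suc ?K) q (snoc ?K p (real 0)) k c x =
   pt C ?M (rho ?M k c (\<lambda>w. gact k (G (mean n N (lmap ?M ?K xi w))) x)) ?P" using L(1) by simp
 also have "\<dots> = pt C ?K (rho ?K k c (\<lambda>u. gact k (G (mean n N u)) x)) (lmap ?M ?K xi ?P)"
  by (rule pt_rho[OF c g b L(2), symmetric])
 also have "lmap ?M ?K xi ?P = p"
  by (rule cube_eqI[OF lmap_cube[OF b L(2)] p]) (use L(2) cat_nth(2)[of _ "Suc ?K" k] in \<open>simp add: lmap_def xi_def snoc_nth\<close>)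
 finally show ?thesis using RR_pt[OF gG cmap_mean[OF N] c x] by simp
qed

lemma Lam_boundary:
 assumes Q: "qsys L Q" and q: "q : cube n" and z: "z : cube L"
 shows "Lam Q G L q z 0 v (zero 0) = pt C 0 v (zero 0)"
proof -
 have "rho L 0 v (hh Q L 0 (zero 0)) = cv C v L" using rho_cv[OF v] cmap_hh[OF Q zero_cube[of 0]] by simp
 moreover have "cat 0 L (gact 0 (G q) (zero 0)) z : cube L"
  using cat_cube[OF gact_cube[OF gfun_unit[OF gG q] zero_cube[of 0]] z] by simp
 ultimately show ?thesis unfolding Lam_def using pt_cv[OF C v] by simp
qed

text \<open>Both cells are restricted to the face \<open>stsp N q\<close>, which contains the
  staircase point. On it the block means stay in a flat ball around \<open>q\<close>, where
  \<open>r\<close> involves no gluing and agrees with \<open>RR\<close>.\<close>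

lemma RR_stair:
 assumes q: "q : cube n"
 shows "pt C (n * N) (RR G (n * N) (mean n N) (th q)) (stair n N q) = pt C (n * N) (r th G (n * N) (mean n N)) (stair n N q)"
proof -
 let ?K = "n * N" and ?p = "stair n N q" and ?ph = "stsp N q"
 note S = setter_bspec[OF setter_stsp[of ?K N q]] and m = cmap_mean[OF N, of n]
 have p: "?p : cube ?K" by (rule cmapD(1)[OF cmap_stair q])
 have Zp: "th q : points C" by (rule stream_points[OF C th q])
 have "q : cb n q (1 / real N)" using cb_self[OF q] N by simp
 hence fz: "lmap ?K ?K ?ph ?p = ?p" by (rule stair_fixed[OF _ N])
 have dp: "d > 0" using d(1) N by (smt (verit) divide_nonneg_nonneg of_nat_0_le_iff)
 have A: "(\<lambda>u. mean n N (lmap ?K ?K ?ph u)) ` cube ?K \<subseteq> cb n q d" using mean_near[OF q _ N d(1)] by blast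
 have "pt C ?K (RR G ?K (mean n N) (th q)) ?p = pt C ?K (act C ?K ?K (bmap ?K ?K ?ph) (RR G ?K (mean n N) (th q))) ?p"
  using pt_lmap[OF C S RR_cell[OF gG m Zp] p] fz by simp
 also have "act C ?K ?K (bmap ?K ?K ?ph) (RR G ?K (mean n N) (th q)) = RR G ?K (\<lambda>u. mean n N (lmap ?K ?K ?ph u)) (th q)"
  using RR_act[OF gG m Zp box_bmap[OF S]] linear_ext_bmap[OF S] by simp
 also have "\<dots> = r th G ?K (\<lambda>u. mean n N (lmap ?K ?K ?ph u))"
  by (rule r_small[OF th G cmap_comp[OF m cmap_lmap[OF S]] d(2)[OF q] A cb_self[OF q dp] q, symmetric])
 also have "\<dots> = act C ?K ?K (bmap ?K ?K ?ph) (r th G ?K (mean n N))" by (rule r_natural(2)[OF th G m S, symmetric])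
 also have "pt C ?K \<dots> ?p = pt C ?K (r th G ?K (mean n N)) ?p"
  using pt_lmap[OF C S r_natural(1)[OF th G m] p] fz by simp
 finally show ?thesis .
qed

lemma hts_stair:
 "EX M. hts C n (pt C 0 v (zero 0)) (\<lambda>q. push C (G q) (th q)) M \<and>
  hts C n (pt C 0 v (zero 0)) (\<lambda>q. pt C (n * N) (r th G (n * N) (mean n N)) (stair n N q)) M"
proof -
 let ?K = "n * N"
 define H where "H = (\<lambda>Q x. onp C (Lam Q G (Suc ?K) (lcut n x) (snoc ?K (stair n N (lcut n x)) (x n))) (th (lcut n x)))"
 have Hs: "stream_map (dcube (Suc n)) (realization C) (H Q)" if "Q = Qa n N G \<or> Q = Qb n N G" for Q
  unfolding H_def by (rule stream_Q[OF that])
 have HL: "H Q x = Lam Q G (Suc ?K) (lcut n x) (snoc ?K (stair n N (lcut n x)) (x n)) k c y"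
  if Q: "qsys (Suc ?K) Q" and x: "x : cube (Suc n)" and c: "c : cells C k" "y : cube k" "th (lcut n x) = pt C k c y" for Q x k c y
 proof -
  have z: "snoc ?K (stair n N (lcut n x)) (x n) : cube (Suc ?K)"
   using snoc_cube[OF cmapD(1)[OF cmap_stair init_cube[OF x]]] cube_coord[OF x, of n] by simp
  show ?thesis unfolding H_def c(3) by (rule onp_pt[OF C c(1,2) Lam_nat[OF Q gG init_cube[OF x] z]])
 qed
 note Qs = qsys_Q[OF gG N]
 have B: "H Q x = pt C 0 v (zero 0)" if Q: "qsys (Suc ?K) Q" and x: "x : cube (Suc n)" and j: "j < n" "x j = 0 \<or> x j = 1" for Q x j
 proof -
  have z: "snoc ?K (stair n N (lcut n x)) (x n) : cube (Suc ?K)"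
   using snoc_cube[OF cmapD(1)[OF cmap_stair init_cube[OF x]]] cube_coord[OF x, of n] by simp
  have "th (lcut n x) = pt C 0 v (zero 0)" by (rule bd[OF init_cube[OF x] j(1)]) (use j in \<open>simp add: lcut_nth\<close>)
  thus ?thesis using HL[OF Q x v zero_cube] Lam_boundary[OF Q init_cube[OF x] z] by simp
 qed
 have E: "H Q (snoc n q (real e)) = Lam Q G (Suc ?K) q (snoc ?K (stair n N q) (real e)) k c y"
  if "qsys (Suc ?K) Q" "q : cube n" "c : cells C k" "y : cube k" "th q = pt C k c y" "e \<le> 1" for Q q k c y e
  using HL[OF that(1) snoc_cube[OF that(2)], of "real e" c k y] that lcut_snoc[OF that(2)] by (simp add: snoc_nth)
 have "hts C n (pt C 0 v (zero 0)) (\<lambda>q. push C (G q) (th q)) (\<lambda>q. H (Qa n N G) (snoc n q 1))"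
 proof (rule htsI[OF Hs[of "Qa n N G"]])
  fix q assume q: "q : cube n"
  obtain k c y where c: "c : cells C k" "y : cube k" "th q = pt C k c y" using pointsE[OF stream_points[OF C th q]] .
  show "H (Qa n N G) (snoc n q 0) = push C (G q) (th q)"
   using E[OF Qs(1) q c le0] Lam_left[OF c(1,2) q cmapD(1)[OF cmap_stair q]] push_pt[OF C gfun_unit[OF gG q] c(1,2)] c(3) by simp
 qed (use B[OF Qs(1)] in auto)
 moreover have "hts C n (pt C 0 v (zero 0)) (\<lambda>q. pt C ?K (r th G ?K (mean n N)) (stair n N q)) (\<lambda>q. H (Qa n N G) (snoc n q 1))"
 proof (rule htsI[OF Hs[of "Qb n N G"]])
  fix q assume q: "q : cube n"
  obtain k c y where c: "c : cells C k" "y : cube k" "th q = pt C k c y" using pointsE[OF stream_points[OF C th q]] .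
  note p = cmapD(1)[OF cmap_stair q, of N]
  show "H (Qb n N G) (snoc n q 0) = pt C ?K (r th G ?K (mean n N)) (stair n N q)"
   using E[OF Qs(2) q c le0] Lam_right[OF c(1,2) q p] RR_stair[OF q] c(3) by simp
  show "H (Qb n N G) (snoc n q 1) = H (Qa n N G) (snoc n q 1)"
   using E[OF Qs(1) q c order_refl] E[OF Qs(2) q c order_refl] Lam_mid[OF c(1,2) q p] by simp
 qed (use B[OF Qs(2)] in auto)
 ultimately show ?thesis by blast
qed

end

end

section \<open>From block means to the identity\<close>

text \<open>A common extension of two maps: the block means where the first \<open>n\<close>
  coordinates vanish, and the identity where the blocks vanish.\<close>

definition join :: "nat => nat => vec => nat => real" where
 "join n N w = (\<lambda>i\<in>{..<n}. max (w i) (mean n N (rcut n (n * N) w) i))"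

lemma cmap_join:
 assumes "N > 0"
 shows "cmap (n + n * N) n (join n N)"
 unfolding join_def
 by (intro cmap_restrictI cmono_max cmono_coord cmapD(2)[OF cmap_comp[OF cmap_mean[OF assms] cmap_rcut]]) simp_all

definition minv :: "nat => vec => real => nat => real" where
 "minv k q s = (\<lambda>i\<in>{..<k}. min (q i) s)"

lemma cmap_minv: "cmap l k f ==> cmono l g ==> cmap l k (\<lambda>u. minv k (f u) (g u))"
 unfolding minv_def by (intro cmap_restrictI cmono_min) (auto dest: cmapD(2))

lemma minv_ends:
 assumes "q : cube k"
 shows "minv k q 1 = q" "minv k q 0 = zero k"
proof -
 show "minv k q 1 = q"
 proof (rule cube_eqI[OF _ assms])
  show "minv k q 1 : cube k" unfolding minv_def using cube_coord[OF assms] by (intro cube_restrictI) auto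
  show "minv k q 1 i = q i" if "i < k" for i using cube_coord[OF assms that] that by (simp add: minv_def)
 qed
 show "minv k q 0 = zero k"
  unfolding minv_def zero_def using cube_coord[OF assms] by (intro restrict_ext) auto
qed

context cubcat_data
begin

context
 fixes n N :: nat and th :: "vec => 'a rpt" and G :: "vec => real => real" and v :: 'a
 assumes th: "stream_map (dcube n) (realization C) th" and G: "good C n th G" and N: "N > 0"
  and v: "v : cells C 0"
  and bd: "\<And>q j. q : cube n ==> j < n ==> q j = 0 \<or> q j = 1 ==> th q = pt C 0 v (zero 0)"
begin

lemma r_face:
 assumes b: "cmap k n b" and S: "bspec l k ph" and e: "e \<le> (1::nat)" and j: "j < n" "\<And>w. w : cube l ==> b (lmap l k ph w) j = real e"
 shows "act C l k (bmap l k ph) (r th G k b) = cv C v l"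
proof -
 note bS = cmap_comp[OF b cmap_lmap[OF S]]
 have e01: "real e = 0 \<or> real e = 1" using e by (cases e) auto
 have "act C l k (bmap l k ph) (r th G k b) = r th G l (\<lambda>u. b (lmap l k ph u))" by (rule r_natural(2)[OF th G b S])
 also have "\<dots> = cv C v l"
 proof (rule r_const[OF v _ bS])
  show "gfun n G" using G by (simp add: good_def)
  show "th (b (lmap l k ph u)) = pt C 0 v (zero 0)" if u: "u : cube l" for u
   by (rule bd[OF cmapD(1)[OF bS u] j(1)]) (use j(2)[OF u] e01 in simp)
 qed
 finally show ?thesis .
qed

lemma pt_r_face:
 assumes b: "cmap k n b" and e: "e \<le> 1" "e' \<le> (1::nat)" and P: "P : cube k" "\<And>i. i < k ==> i : S ==> P i = real e"
  and j: "j < n" "\<And>w. w : cube k ==> b (lmap k k (psp S e) w) j = real e'"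
 shows "pt C k (r th G k b) P = pt C 0 v (zero 0)"
proof -
 note S = setter_bspec[OF setter_psp[OF e(1)], of k S]
 have "pt C k (r th G k b) P = pt C k (act C k k (bmap k k (psp S e)) (r th G k b)) P"
  using pt_lmap[OF C S r_natural(1)[OF th G b] P(1)] psp_lmap(3)[OF P(1) e(1) P(2)] by simp
 also have "\<dots> = pt C k (cv C v k) P" by (simp only: r_face[OF b S e(2) j])
 finally show ?thesis using pt_cv[OF C v P(1)] by simp
qed

lemma join_faces:
 assumes w: "w : cube (n + n * N)" and j: "j < n"
 shows "join n N (lmap (n + n * N) (n + n * N) (psp (insert j {n + l | l. l div N = j}) 0) w) j = real 0"
  "join n N (lmap (n + n * N) (n + n * N) (psp {n + l | l. l div N = j} 1) w) j = real 1"
  "join n N (lmap (n + n * N) (n + n * N) (psp {j} 1) w) j = real 1"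
proof -
 let ?M = "n + n * N"
 let ?B = "{n + l | l. l div N = j}"
 have b: "j * N + k < n * N" "n + (j * N + k) : ?B" if "k < N" for k using block[OF j that] that by auto
 have m: "mean n N (rcut n (n * N) y) j = (\<Sum>k<N. y (n + (j * N + k))) / real N" for y :: vec
  using j b(1) by (simp add: mean_def rcut_def)
 have m01: "mean n N (rcut n (n * N) y) j = e" if "\<And>k. k < N ==> y (n + (j * N + k)) = e" for y e
  using that N unfolding m by simp
 have J: "join n N y j = max (y j) (mean n N (rcut n (n * N) y) j)" for y using j by (simp add: join_def)
 note w1 = cube_coord[OF w, of j]
 have 1: "lmap ?M ?M (psp (insert j ?B) 0) w i = 0" if "i < ?M" "i : insert j ?B" for i
  using psp_lmap(2)[OF w le0 that(1), of "insert j ?B"] that(2) by simp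
 have "mean n N (rcut n (n * N) (lmap ?M ?M (psp (insert j ?B) 0) w)) j = 0"
  by (rule m01, rule 1) (use b in auto)
 thus "join n N (lmap ?M ?M (psp (insert j ?B) 0) w) j = real 0" using 1[of j] j by (simp add: J)
 have 2: "lmap ?M ?M (psp ?B 1) w i = 1" if "i < ?M" "i : ?B" for i
  using psp_lmap(2)[OF w order_refl that(1), of ?B] that(2) by simp
 have "mean n N (rcut n (n * N) (lmap ?M ?M (psp ?B 1) w)) j = 1"
  by (rule m01, rule 2) (use b in auto)
 moreover have "lmap ?M ?M (psp ?B 1) w j = w j" using psp_lmap(2)[OF w order_refl, of j ?B] j by simp
 ultimately show "join n N (lmap ?M ?M (psp ?B 1) w) j = real 1" using w1 j by (simp add: J)
 have 3: "lmap ?M ?M (psp {j} 1) w : cube ?M" "lmap ?M ?M (psp {j} 1) w j = 1"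
  using psp_lmap(1,2)[OF w order_refl] j by auto
 have "mean n N (rcut n (n * N) (lmap ?M ?M (psp {j} 1) w)) j \<le> 1"
  using cube_coord[OF cmapD(1)[OF cmap_mean[OF N] rcut_cube[OF 3(1)]] j] by simp
 thus "join n N (lmap ?M ?M (psp {j} 1) w) j = real 1" using 3(2) by (simp add: J)
qed

lemma stair_faces:
 assumes q: "q : cube n" and l: "l < n * N"
 shows "q (l div N) = 0 ==> stair n N q l = 0" "q (l div N) = 1 ==> stair n N q l = 1"
proof -
 have "real (l mod N) + 1 \<le> real N" using block_div(2)[OF l] by linarith
 thus "q (l div N) = 1 ==> stair n N q l = 1" using l by (simp add: stair_def clamp_def)
 show "q (l div N) = 0 ==> stair n N q l = 0" using l by (simp add: stair_def clamp_def)
qed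

text \<open>Everything takes place in the single cell \<open>?b\<close>. One homotopy keeps the
  staircase and raises the first coordinates from 0, the other keeps the first coordinates and
  raises the staircase from 0; both end at the pair of \<open>q\<close> and its staircase.\<close>

lemma hts_mean:
 "EX M. hts C n (pt C 0 v (zero 0)) (\<lambda>q. pt C (n * N) (r th G (n * N) (mean n N)) (stair n N q)) M \<and>
  hts C n (pt C 0 v (zero 0)) (\<lambda>q. pt C n (r th G n (\<lambda>u. u)) q) M"
proof -
 let ?K = "n * N" and ?Z = "pt C 0 v (zero 0)"
 let ?b = "r th G (n + ?K) (join n N)"
 note J = cmap_join[OF N, of n]
 have bc: "?b : cells C (n + ?K)" by (rule r_natural(1)[OF th G J])
 have ci: "cmap (Suc n) n (lcut n)" "cmap (Suc n) ?K (\<lambda>x. stair n N (lcut n x))" "cmono (Suc n) (\<lambda>x. x n)"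
  using cmap_init cmap_comp[OF cmap_stair cmap_init] cmono_coord[of n "Suc n"] by auto
 define p1 where "p1 = (\<lambda>x. cat n ?K (minv n (lcut n x) (x n)) (stair n N (lcut n x)))"
 define p2 where "p2 = (\<lambda>x. cat n ?K (lcut n x) (minv ?K (stair n N (lcut n x)) (x n)))"
 have p1: "cmap (Suc n) (n + ?K) p1" unfolding p1_def by (intro cmap_cat cmap_minv ci)
 have p2: "cmap (Suc n) (n + ?K) p2" unfolding p2_def by (intro cmap_cat cmap_minv ci)
 \<comment> \<open>For \<open>x j = 0\<close> the coordinate \<open>j\<close> and its whole block
   vanish, and so does their maximum. For \<open>x j = 1\<close> the block is constantly 1, which
   suffices although the coordinate \<open>j\<close> itself is still rising.\<close>
 have B1: "pt C (n + ?K) ?b (p1 x) = ?Z" if x: "x : cube (Suc n)" and j: "j < n" "x j = 0 \<or> x j = 1" for x j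
  using j(2)
 proof
  assume z: "x j = 0"
  have q: "lcut n x j = 0" using z j by (simp add: lcut_nth)
  show ?thesis
  proof (rule pt_r_face[where S = "insert j {n + l | l. l div N = j}" and e = 0 and e' = 0, OF J _ _ cmapD(1)[OF p1 x] _ j(1)])
   show "join n N (lmap (n + ?K) (n + ?K) (psp (insert j {n + l | l. l div N = j}) 0) w) j = real 0" if "w : cube (n + ?K)" for w
    by (rule join_faces(1)[OF that j(1)])
  next
   fix i assume i: "i < n + ?K" "i : insert j {n + l | l. l div N = j}"
   then consider "i = j" | l where "i = n + l" "l < ?K" "l div N = j" by auto
   thus "p1 x i = real 0"
   proof cases
    case 1
    thus ?thesis using j(1) q cube_coord[OF x, of n] by (simp add: p1_def cat_nth minv_def)
   next
    case 2
    thus ?thesis using stair_faces(1)[OF init_cube[OF x] 2(2)] q by (simp add: p1_def cat_nth)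
   qed
  qed simp_all
 next
  assume z: "x j = 1"
  have q: "lcut n x j = 1" using z j by (simp add: lcut_nth)
  show ?thesis
  proof (rule pt_r_face[where S = "{n + l | l. l div N = j}" and e = 1 and e' = 1, OF J _ _ cmapD(1)[OF p1 x] _ j(1)])
   show "join n N (lmap (n + ?K) (n + ?K) (psp {n + l | l. l div N = j} 1) w) j = real 1" if "w : cube (n + ?K)" for w
    by (rule join_faces(2)[OF that j(1)])
  next
   fix i assume i: "i < n + ?K" "i : {n + l | l. l div N = j}"
   then obtain l where l: "i = n + l" "l < ?K" "l div N = j" by auto
   thus "p1 x i = real 1" using stair_faces(2)[OF init_cube[OF x] l(2)] q by (simp add: p1_def cat_nth)
  qed simp_all
 qed
 have B2: "pt C (n + ?K) ?b (p2 x) = ?Z" if x: "x : cube (Suc n)" and j: "j < n" "x j = 0 \<or> x j = 1" for x j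
  using j(2)
 proof
  assume z: "x j = 0"
  have q: "lcut n x j = 0" using z j by (simp add: lcut_nth)
  show ?thesis
  proof (rule pt_r_face[where S = "insert j {n + l | l. l div N = j}" and e = 0 and e' = 0, OF J _ _ cmapD(1)[OF p2 x] _ j(1)])
   show "join n N (lmap (n + ?K) (n + ?K) (psp (insert j {n + l | l. l div N = j}) 0) w) j = real 0" if "w : cube (n + ?K)" for w
    by (rule join_faces(1)[OF that j(1)])
  next
   fix i assume i: "i < n + ?K" "i : insert j {n + l | l. l div N = j}"
   then consider "i = j" | l where "i = n + l" "l < ?K" "l div N = j" by auto
   thus "p2 x i = real 0"
   proof cases
    case 1
    thus ?thesis using j(1) q by (simp add: p2_def cat_nth)
   next
    case 2
    thus ?thesis using stair_faces(1)[OF init_cube[OF x] 2(2)] q cube_coord[OF x, of n] by (simp add: p2_def cat_nth minv_def)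
   qed
  qed simp_all
 next
  assume z: "x j = 1"
  have q: "lcut n x j = 1" using z j by (simp add: lcut_nth)
  show ?thesis
  proof (rule pt_r_face[where S = "{j}" and e = 1 and e' = 1, OF J _ _ cmapD(1)[OF p2 x] _ j(1)])
   show "join n N (lmap (n + ?K) (n + ?K) (psp {j} 1) w) j = real 1" if "w : cube (n + ?K)" for w
    by (rule join_faces(3)[OF that j(1)])
   show "p2 x i = real 1" if "i : {j}" for i using that j(1) q by (simp add: p2_def cat_nth)
  qed simp_all
 qed
 have q1: "p1 (snoc n q 1) = cat n ?K q (stair n N q)" "p2 (snoc n q 1) = cat n ?K q (stair n N q)"
  "p1 (snoc n q 0) = cat n ?K (zero n) (stair n N q)" "p2 (snoc n q 0) = cat n ?K q (zero ?K)" if q: "q : cube n" for q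
  using q cmapD(1)[OF cmap_stair q, of N] by (simp_all add: p1_def p2_def lcut_snoc snoc_nth minv_ends)
 have left: "pt C (n + ?K) ?b (cat n ?K (zero n) u) = pt C ?K (r th G ?K (mean n N)) u" if u: "u : cube ?K" for u
 proof -
  define ph where "ph = (\<lambda>j. if j < n then Inl 0 else Inr (j - n) :: nat + nat)"
  have S: "bspec ?K (n + ?K) ph" by (rule bspecI) (auto simp: ph_def split: if_splits)
  have l: "lmap ?K (n + ?K) ph w = cat n ?K (zero n) w" if "w : cube ?K" for w
   using that by (auto simp: lmap_def cat_def zero_def ph_def)
  have "pt C (n + ?K) ?b (cat n ?K (zero n) u) = pt C ?K (act C ?K (n + ?K) (bmap ?K (n + ?K) ph) ?b) u"
   using pt_lmap[OF C S bc u] l[OF u] by simp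
  also have "act C ?K (n + ?K) (bmap ?K (n + ?K) ph) ?b = r th G ?K (\<lambda>w. join n N (lmap ?K (n + ?K) ph w))"
   by (rule r_natural(2)[OF th G J S])
  also have "\<dots> = r th G ?K (mean n N)"
  proof (rule r_cong)
   fix w assume w: "w : cube ?K"
   have mc: "mean n N w : cube n" by (rule cmapD(1)[OF cmap_mean[OF N] w])
   show "join n N (lmap ?K (n + ?K) ph w) = mean n N w"
   proof (rule cube_eqI[OF cmapD(1)[OF J lmap_cube[OF S w]] mc])
    show "join n N (lmap ?K (n + ?K) ph w) i = mean n N w i" if i: "i < n" for i
     using cube_coord[OF mc i] i by (simp add: l[OF w] join_def rcut_cat[OF w] cat_nth) (simp add: zero_def)
   qed
  qed
  finally show ?thesis .
 qed
 have right: "pt C (n + ?K) ?b (cat n ?K u (zero ?K)) = pt C n (r th G n (\<lambda>u. u)) u" if u: "u : cube n" for u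
 proof -
  define ph where "ph = (\<lambda>j. if j < n then Inr j else Inl 0 :: nat + nat)"
  have S: "bspec n (n + ?K) ph" by (rule bspecI) (auto simp: ph_def split: if_splits)
  have l: "lmap n (n + ?K) ph w = cat n ?K w (zero ?K)" if "w : cube n" for w
   using that by (auto simp: lmap_def cat_def zero_def ph_def intro!: restrict_ext)
  have "pt C (n + ?K) ?b (cat n ?K u (zero ?K)) = pt C n (act C n (n + ?K) (bmap n (n + ?K) ph) ?b) u"
   using pt_lmap[OF C S bc u] l[OF u] by simp
  also have "act C n (n + ?K) (bmap n (n + ?K) ph) ?b = r th G n (\<lambda>w. join n N (lmap n (n + ?K) ph w))"
   by (rule r_natural(2)[OF th G J S])
  also have "\<dots> = r th G n (\<lambda>u. u)"
  proof (rule r_cong)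
   fix w assume w: "w : cube n"
   show "join n N (lmap n (n + ?K) ph w) = w"
   proof (rule cube_eqI[OF cmapD(1)[OF J lmap_cube[OF S w]] w])
    fix i assume i: "i < n"
    have "mean n N (zero ?K) i = 0" using i block[OF i] by (simp add: mean_def zero_def)
    thus "join n N (lmap n (n + ?K) ph w) i = w i"
     using cube_coord[OF w i] i by (simp add: l[OF w] join_def rcut_cat[OF zero_cube] cat_nth)
   qed
  qed
  finally show ?thesis .
 qed
 let ?M = "\<lambda>q. pt C (n + ?K) ?b (cat n ?K q (stair n N q))"
 have "hts C n ?Z (\<lambda>q. pt C ?K (r th G ?K (mean n N)) (stair n N q)) ?M"
  by (rule htsI[OF stream_map_comp_cmap[OF stream_chart[OF C bc] p1] B1])
   (simp_all add: q1 left cmapD(1)[OF cmap_stair])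
 moreover have "hts C n ?Z (\<lambda>q. pt C n (r th G n (\<lambda>u. u)) q) ?M"
  by (rule htsI[OF stream_map_comp_cmap[OF stream_chart[OF C bc] p2] B2]) (simp_all add: q1 right)
 ultimately show ?thesis by blast
qed

lemma r_boundary:
 assumes "j < n" "e \<le> 1"
 shows "av C n (psp {j} e) (r th G n (\<lambda>u. u)) = cv C v n"
 unfolding av_def
 by (rule r_face[OF cmap_id setter_bspec[OF setter_psp[OF assms(2)]] assms(2,1)])
  (use psp_lmap(2)[OF _ assms(2) assms(1), of _ "{j}"] in simp)

end

theorem realized_cell:
 assumes th: "stream_map (dcube n) (realization C) th" and G: "good C n th G" and v: "v : cells C 0"
  and bd: "\<And>q j. q : cube n ==> j < n ==> q j = 0 \<or> q j = 1 ==> th q = pt C 0 v (zero 0)"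
 shows "equivclp (hts C n (pt C 0 v (zero 0))) th (pt C n (r th G n (\<lambda>u. u)))"
proof -
 let ?h = "hts C n (pt C 0 v (zero 0))"
 have two: "equivclp ?h a b" if ex: "EX M. ?h a M \<and> ?h b M" for a b
 proof -
  obtain M where "?h a M" "?h b M" using ex by blast
  hence "equivclp ?h a M" "equivclp ?h M b" by (auto intro: equivclp_sym r_into_equivclp)
  thus ?thesis by (rule equivclp_trans)
 qed
 have gG: "gfun n G" using G by (simp add: good_def)
 obtain N d where N: "N > 0" "2 / real N < d" "ALL q:cube n. flat C th G (cb n q d)" using flat_scale[OF C th G] by blast
 have d: "\<And>q. q : cube n ==> flat C th G (cb n q d)" using N(3) by blast
 have "equivclp ?h th (\<lambda>q. push C (G q) (th q))" by (rule two, rule hts_reparam[OF C v th bd gG])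
 also have "equivclp ?h (\<lambda>q. push C (G q) (th q)) (\<lambda>q. pt C (n * N) (r th G (n * N) (mean n N)) (stair n N q))"
  by (rule two, rule hts_stair[OF th G N(1,2) d v bd])
 also have "equivclp ?h (\<lambda>q. pt C (n * N) (r th G (n * N) (mean n N)) (stair n N q)) (\<lambda>q. pt C n (r th G n (\<lambda>u. u)) q)"
  by (rule two, rule hts_mean[OF th G N(1) v bd])
 finally show ?thesis .
qed

end

section \<open>The cell attached to a map into the realization\<close>

definition lastsp :: "nat => nat => nat => nat + nat" where
 "lastsp n e = (\<lambda>i. if i < n then Inr i else Inl e)"

text \<open>The faces are compared through idempotents, so that all of them keep the dimension
  \<open>k\<close>. Only the first \<open>n\<close> directions are constrained; the remaining ones
  are parameters.\<close>

definition bdc :: "'a cset => 'a => nat => nat => 'a set" where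
 "bdc C v n k = {c : cells C k. ALL j<n. \<forall>e\<le>1. av C k (psp {j} e) c = cv C v k}"

definition face :: "'a cset => nat => nat => 'a => 'a" where
 "face C n e c = act C n (Suc n) (bmap n (Suc n) (lastsp n e)) c"

definition htc :: "'a cset => 'a => nat => 'a => 'a => bool" where
 "htc C v n p p' \<longleftrightarrow> (EX c:bdc C v n (Suc n). p = face C n 0 c \<and> p' = face C n 1 c)"

lemma bspec_last: "e \<le> 1 ==> bspec n (Suc n) (lastsp n e)"
 by (rule bspecI) (auto simp: lastsp_def split: if_splits)

lemma lmap_last: "q : cube n ==> lmap n (Suc n) (lastsp n e) q = snoc n q (real e)"
 by (auto simp: lmap_def snoc_def lastsp_def intro!: restrict_ext)

lemma stream_proj:
 "stream_map (dcube n) (realization C) th ==> stream_map (dcube (Suc n)) (realization C) (\<lambda>x. th (lcut n x))"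
 by (rule stream_map_comp_cmap[OF _ cmap_init])

text \<open>At an obstructed level both systems are locally constant in the level, hence so is every
  combination of them by \<open>max\<close> and \<open>min\<close> with the time.\<close>

lemma good_join:
 assumes G: "good C n th G" "good C n th G'"
 shows "good C (Suc n) (\<lambda>x. th (lcut n x)) (\<lambda>x t. max (G (lcut n x) t) (min (x n) (G' (lcut n x) t)))"
proof -
 let ?H = "\<lambda>x t. max (G (lcut n x) t) (min (x n) (G' (lcut n x) t))"
 have g: "gfun n G" "gfun n G'" using G by (simp_all add: good_def)
 have e: "G (lcut n x) 0 = 0" "G (lcut n x) 1 = 1" "G' (lcut n x) 0 = 0" "G' (lcut n x) 1 = 1" "0 \<le> x n" "x n \<le> 1"
  if "x : cube (Suc n)" for x
  using g init_cube[OF that] cube_coord[OF that, of n] by (auto simp: gfun_def)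
 have "gfun (Suc n) ?H"
  unfolding gfun_def
 proof (intro conjI allI impI ballI)
  fix k a g' assume a: "cmap k (Suc n) a" "cmono k g'"
  show "cmono k (\<lambda>u. max (G (lcut n (a u)) (g' u)) (min (a u n) (G' (lcut n (a u)) (g' u))))"
   by (intro cmono_max cmono_min cmapD(2)[OF a(1)] gfun_cmono[OF g(1) cmap_comp[OF cmap_init a(1)] a(2)]
     gfun_cmono[OF g(2) cmap_comp[OF cmap_init a(1)] a(2)]) simp
 qed (use e in simp_all)
 moreover have "(t \<le> 1/3 --> ?H x t = 0) \<and> (2/3 \<le> t --> ?H x t = 1)" if x: "x : cube (Suc n)" for x t
  using G init_cube[OF x] e[OF x] by (simp add: good_def)
 moreover have "flatat (Suc n) ?H x T" if x: "x : cube (Suc n)" and b: "bad C (\<lambda>x. th (lcut n x)) T x" for x T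
 proof -
  have "bad C th T (lcut n x)" using b by (simp add: bad_def)
  hence "flatat n G (lcut n x) T" "flatat n G' (lcut n x) T" using G init_cube[OF x] by (simp_all add: good_def)
  then obtain d d' where d: "d > 0" "ALL q':cb n (lcut n x) d. ALL a b. \<bar>a - T\<bar> < d --> \<bar>b - T\<bar> < d --> G q' a = G q' b"
   and d': "d' > 0" "ALL q':cb n (lcut n x) d'. ALL a b. \<bar>a - T\<bar> < d' --> \<bar>b - T\<bar> < d' --> G' q' a = G' q' b"
   unfolding flatat_def by blast
  show ?thesis
  proof (rule flatatI[of "min d d'"])
   fix y a b assume y: "y : cb (Suc n) x (min d d')" and ab: "\<bar>a - T\<bar> < min d d'" "\<bar>b - T\<bar> < min d d'"
   have "y : cube (Suc n)" using y cb_cube by blast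
   hence "lcut n y : cb n (lcut n x) (min d d')" using y init_cube by (auto simp: cb_def lcut_nth)
   hence "lcut n y : cb n (lcut n x) d" "lcut n y : cb n (lcut n x) d'"
    using cb_mono[of "min d d'" d n "lcut n x"] cb_mono[of "min d d'" d' n "lcut n x"] by auto
   hence "G (lcut n y) a = G (lcut n y) b" "G' (lcut n y) a = G' (lcut n y) b"
    using d(2) d'(2) ab by (meson min_less_iff_conj)+
   thus "?H y a = ?H y b" by simp
  qed (use d(1) d'(1) in simp)
 qed
 ultimately show ?thesis by (simp add: good_def)
qed

lemma good_cong:
 assumes "good C m th G" "\<And>q. q : cube m ==> th q = th' q"
 shows "good C m th' G"
 using assms unfolding good_def bad_def by simp

lemma good_max:
 assumes G: "good C n th G" "good C n th G'"
 shows "good C n th (\<lambda>q t. max (G q t) (G' q t))"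
proof -
 have g: "gfun n (\<lambda>q t. max (G q t) (G' q t))"
  unfolding gfun_def
 proof (intro conjI allI impI ballI)
  fix k a g assume a: "cmap k n a" "cmono k g"
  show "cmono k (\<lambda>u. max (G (a u) (g u)) (G' (a u) (g u)))"
   using G gfun_cmono[OF _ a] by (intro cmono_max) (auto simp: good_def)
 qed (use G in \<open>auto simp: good_def gfun_def\<close>)
 have f: "flatat n (\<lambda>q t. max (G q t) (G' q t)) q T" if q: "q : cube n" and b: "bad C th T q" for q T
 proof -
  have "flatat n G q T" "flatat n G' q T" using G q b by (simp_all add: good_def)
  then obtain d d' where d: "d > 0" "ALL q':cb n q d. ALL a b. \<bar>a - T\<bar> < d --> \<bar>b - T\<bar> < d --> G q' a = G q' b"
   and d': "d' > 0" "ALL q':cb n q d'. ALL a b. \<bar>a - T\<bar> < d' --> \<bar>b - T\<bar> < d' --> G' q' a = G' q' b"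
   unfolding flatat_def by blast
  show ?thesis
  proof (rule flatatI[of "min d d'"])
   fix y a b assume y: "y : cb n q (min d d')" and ab: "\<bar>a - T\<bar> < min d d'" "\<bar>b - T\<bar> < min d d'"
   have "y : cb n q d" "y : cb n q d'" using y cb_mono[of "min d d'" d n q] cb_mono[of "min d d'" d' n q] by auto
   hence "G y a = G y b" "G' y a = G' y b" using d(2) d'(2) ab by (meson min_less_iff_conj)+
   thus "max (G y a) (G' y a) = max (G y b) (G' y b)" by simp
  qed (use d(1) d'(1) in simp)
 qed
 show ?thesis unfolding good_def using g f G by (simp add: good_def)
qed

context cubcat_data
begin

lemma rr_cong2:
 assumes "\<And>q t. q : cube m ==> 0 \<le> t ==> t \<le> 1 ==> G q t = G' q t" "\<And>q. q : cube m ==> th q = th' q" "cmap k m a"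
 shows "rr th G j k a = rr th' G' j k a"
 using assms(3)
proof (induction j arbitrary: k a)
 case 0
 have "rho k n c (\<lambda>u. gact n (G (a u)) x) = rho k n c (\<lambda>u. gact n (G' (a u)) x)" if "x : cube n" for n c x
 proof (rule rho_cong)
  fix u assume "u : cube k"
  thus "gact n (G (a u)) x = gact n (G' (a u)) x"
   using assms(1)[OF cmapD(1)[OF 0]] cube_coord[OF that] by (auto simp: gact_def intro!: restrict_ext)
 qed
 hence "(ALL n c x. c : cells C n --> x : cube n --> Z = pt C n c x --> d = rho k n c (\<lambda>u. gact n (G (a u)) x)) \<longleftrightarrow>
   (ALL n c x. c : cells C n --> x : cube n --> Z = pt C n c x --> d = rho k n c (\<lambda>u. gact n (G' (a u)) x))" for Z d
  by simp
 thus ?case using assms(2)[OF cmapD(1)[OF 0 zero_cube]] by (simp add: RR_def)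
next
 case (Suc j)
 have "(\<lambda>l. \<lambda>s\<in>cells (sd2_cube k) l. rr th G j l (\<lambda>u. a (sd2_cell l k s u))) =
   (\<lambda>l. \<lambda>s\<in>cells (sd2_cube k) l. rr th' G' j l (\<lambda>u. a (sd2_cell l k s u)))"
  using Suc by (intro ext restrict_ext Suc.IH cmap_comp[OF _ cmap_sd2_cell])
 thus ?case by simp
qed

lemma r_cong2:
 assumes th: "stream_map (dcube m) (realization C) th" "stream_map (dcube m) (realization C) th'"
  and G: "good C m th G" "good C m th' G'"
  and eq: "\<And>q t. q : cube m ==> 0 \<le> t ==> t \<le> 1 ==> G q t = G' q t" "\<And>q. q : cube m ==> th q = th' q" and a: "cmap k m a"
 shows "r th G k a = r th' G' k a"
proof -
 obtain i where i: "sm (flat C th G) i k a" using flat_sm[OF th(1) G(1) a] by blast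
 obtain j where j: "sm (flat C th' G') j k a" using flat_sm[OF th(2) G(2) a] by blast
 have "r th G k a = rr th G (max i j) k a" by (rule r_eq[OF th(1) G(1) a sm_le[OF _ i]]) simp
 also have "\<dots> = rr th' G' (max i j) k a" by (rule rr_cong2[OF eq a])
 also have "\<dots> = r th' G' k a" by (rule r_eq[OF th(2) G(2) a sm_le[OF _ j], symmetric]) simp
 finally show ?thesis .
qed

section \<open>Homotopy invariance of the glued cell\<close>

text \<open>The gluing is carried out over the whole cylinder. By naturality its ends are the cells
  glued over the ends, and on the sides, where \<open>H\<close> is constant, it is totally
  degenerate.\<close>

lemma r_homotopy:
 assumes H: "stream_map (dcube (Suc n)) (realization C) H" and G: "good C (Suc n) H G" and v: "v : cells C 0"
  and bd: "\<And>x j. x : cube (Suc n) ==> j < n ==> x j = 0 \<or> x j = 1 ==> H x = pt C 0 v (zero 0)"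
 shows "htc C v n (r (\<lambda>q. H (snoc n q 0)) (\<lambda>q. G (snoc n q 0)) n (\<lambda>u. u)) (r (\<lambda>q. H (snoc n q 1)) (\<lambda>q. G (snoc n q 1)) n (\<lambda>u. u))"
proof -
 let ?c = "r H G (Suc n) (\<lambda>u. u)"
 have f: "face C n e ?c = r (\<lambda>q. H (snoc n q (real e))) (\<lambda>q. G (snoc n q (real e))) n (\<lambda>u. u)" if e: "e \<le> 1" for e
 proof -
  have sn: "cmap n (Suc n) (\<lambda>q. snoc n q (real e))" using e by (intro cmap_snoc cmap_id cmono_const) simp_all
  have "face C n e ?c = r H G n (lmap n (Suc n) (lastsp n e))"
   unfolding face_def using r_natural(2)[OF H G cmap_id bspec_last[OF e]] by simp
  also have "\<dots> = r H G n (\<lambda>u. snoc n u (real e))" by (rule r_cong) (rule lmap_last)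
  also have "\<dots> = r (\<lambda>q. H (snoc n q (real e))) (\<lambda>q. G (snoc n q (real e))) n (\<lambda>u. u)"
   by (rule r_comp[OF H G sn cmap_id, symmetric])
  finally show ?thesis .
 qed
 have "av C (Suc n) (psp {j} e) ?c = cv C v (Suc n)" if j: "j < n" and e: "e \<le> 1" for j e
 proof -
  note S = setter_bspec[OF setter_psp[OF e, of "Suc n" "{j}"]]
  have e01: "real e = 0 \<or> real e = 1" using e by (cases e) auto
  have "av C (Suc n) (psp {j} e) ?c = r H G (Suc n) (lmap (Suc n) (Suc n) (psp {j} e))"
   unfolding av_def using r_natural(2)[OF H G cmap_id S] by simp
  also have "\<dots> = cv C v (Suc n)"
  proof (rule r_const[OF v _ cmap_lmap[OF S]])
   show "gfun (Suc n) G" using G by (simp add: good_def)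
   show "H (lmap (Suc n) (Suc n) (psp {j} e) u) = pt C 0 v (zero 0)" if u: "u : cube (Suc n)" for u
    by (rule bd[OF psp_lmap(1)[OF u e] j]) (use psp_lmap(2)[OF u e, of j "{j}"] j e01 in simp)
  qed
  finally show ?thesis .
 qed
 hence "?c : bdc C v n (Suc n)" using r_natural(1)[OF H G cmap_id] by (simp add: bdc_def)
 thus ?thesis unfolding htc_def using f[OF le0] f[OF order_refl] by (intro bexI[of _ ?c]) simp_all
qed

lemma equivclp_two: "R a c ==> R b c ==> equivclp R a b"
 by (rule equivclp_trans[of _ _ c]) (auto intro: equivclp_sym r_into_equivclp)

text \<open>On the cylinder over \<open>th\<close> the second system is switched on by the time,
  which leads from either system to their maximum.\<close>

lemma r_independent:
 assumes th: "stream_map (dcube n) (realization C) th" and G: "good C n th G" "good C n th G'" and v: "v : cells C 0"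
  and bd: "\<And>q j. q : cube n ==> j < n ==> q j = 0 \<or> q j = 1 ==> th q = pt C 0 v (zero 0)"
 shows "equivclp (htc C v n) (r th G n (\<lambda>u. u)) (r th G' n (\<lambda>u. u))"
proof -
 have main: "htc C v n (r th F n (\<lambda>u. u)) (r th (\<lambda>q t. max (F q t) (F' q t)) n (\<lambda>u. u))"
  if F: "good C n th F" "good C n th F'" for F F'
 proof -
  let ?H = "\<lambda>x t. max (F (lcut n x) t) (min (x n) (F' (lcut n x) t))" and ?M = "\<lambda>q t. max (F q t) (F' q t)"
  note gH = good_join[OF F] and sH = stream_proj[OF th]
  have F01: "0 \<le> F q t" "0 \<le> F' q t" "F' q t \<le> 1" if "q : cube n" "0 \<le> t" "t \<le> 1" for q t
   using gfun_unit[OF _ that(1)] F that(2,3) by (auto simp: good_def unit_fun_def)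
  have h: "htc C v n (r (\<lambda>q. th (lcut n (snoc n q 0))) (\<lambda>q. ?H (snoc n q 0)) n (\<lambda>u. u))
    (r (\<lambda>q. th (lcut n (snoc n q 1))) (\<lambda>q. ?H (snoc n q 1)) n (\<lambda>u. u))"
  proof (rule r_homotopy[OF sH gH v])
   show "th (lcut n x) = pt C 0 v (zero 0)" if "x : cube (Suc n)" "j < n" "x j = 0 \<or> x j = 1" for x j
    by (rule bd[OF init_cube[OF that(1)] that(2)]) (use that in \<open>simp add: lcut_nth\<close>)
  qed
  have e: "r (\<lambda>q. th (lcut n (snoc n q s))) (\<lambda>q. ?H (snoc n q s)) n (\<lambda>u. u) = r th F'' n (\<lambda>u. u)"
   if s: "0 \<le> s" "s \<le> 1" and g: "good C n th F''"
    and eq: "\<And>q t. q : cube n ==> 0 \<le> t ==> t \<le> 1 ==> max (F q t) (min s (F' q t)) = F'' q t" for s F''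
  proof -
   have sn: "cmap n (Suc n) (\<lambda>q. snoc n q s)" using s by (intro cmap_snoc cmap_id cmono_const)
   show ?thesis
    by (rule r_cong2[OF stream_map_comp_cmap[OF sH sn] th good_comp[OF gH sn] g _ _ cmap_id])
     (simp_all add: lcut_snoc snoc_nth eq)
  qed
  have "r (\<lambda>q. th (lcut n (snoc n q 0))) (\<lambda>q. ?H (snoc n q 0)) n (\<lambda>u. u) = r th F n (\<lambda>u. u)"
   by (rule e[OF _ _ F(1)]) (use F01 in simp_all)
  moreover have "r (\<lambda>q. th (lcut n (snoc n q 1))) (\<lambda>q. ?H (snoc n q 1)) n (\<lambda>u. u) = r th ?M n (\<lambda>u. u)"
   by (rule e[OF _ _ good_max[OF F]]) (use F01 in simp_all)
  ultimately show ?thesis using h by simp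
 qed
 have m: "(\<lambda>q t. max (G' q t) (G q t)) = (\<lambda>q t. max (G q t) (G' q t))" by (intro ext) (rule max.commute)
 show ?thesis by (rule equivclp_two[of "htc C v n", OF main[OF G] main[OF G(2,1), unfolded m]])
qed

lemma rho_cv_gen:
 assumes v: "v : cells C 0" and h: "cmap k n h"
 shows "rho k n (cv C v n) h = cv C v k"
proof -
 have t: "bspec n 0 (\<lambda>_. Inl 0)" by (simp add: bspec_def)
 have "rho k n (cv C v n) h = rho k 0 v (\<lambda>u. lmap n 0 (\<lambda>_. Inl 0) (h u))" unfolding cv_def by (rule rho_nat_lmap[OF v h t])
 also have "\<dots> = cv C v k" by (rule rho_cv[OF v cmap_comp[OF cmap_lmap[OF t] h]])
 finally show ?thesis .
qed

text \<open>As \<open>h\<close> sends each lateral face of the cylinder into the corresponding face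
  of the cube, the boundary condition on \<open>p\<close> passes to its value along
  \<open>h\<close>.\<close>

lemma rho_path:
 assumes v: "v : cells C 0" and p: "p : bdc C v n n" and h: "cmap (Suc n) n h"
  and hb: "\<And>w j e. w : cube (Suc n) ==> j < n ==> e \<le> (1::nat) ==> w j = real e ==> h w j = real e"
 shows "htc C v n (rho n n p (\<lambda>q. h (snoc n q 0))) (rho n n p (\<lambda>q. h (snoc n q 1)))"
proof -
 let ?c = "rho (Suc n) n p h"
 have pc: "p : cells C n" using p by (simp add: bdc_def)
 have f: "face C n e ?c = rho n n p (\<lambda>q. h (snoc n q (real e)))" if e: "e \<le> 1" for e
 proof -
  have "face C n e ?c = rho n n p (\<lambda>q. h (lmap n (Suc n) (lastsp n e) q))"
   unfolding face_def by (rule rho_act_lmap[OF pc h bspec_last[OF e]])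
  also have "\<dots> = rho n n p (\<lambda>q. h (snoc n q (real e)))" by (rule rho_cong) (simp add: lmap_last)
  finally show ?thesis .
 qed
 have "av C (Suc n) (psp {j} e) ?c = cv C v (Suc n)" if j: "j < n" and e: "e \<le> 1" for j e
 proof -
  note S = setter_bspec[OF setter_psp[OF e, of "Suc n" "{j}"]] and S' = setter_bspec[OF setter_psp[OF e, of n "{j}"]]
  let ?h = "\<lambda>w. h (lmap (Suc n) (Suc n) (psp {j} e) w)"
  have hc: "cmap (Suc n) n ?h" by (rule cmap_comp[OF h cmap_lmap[OF S]])
  have "av C (Suc n) (psp {j} e) ?c = rho (Suc n) n p ?h" unfolding av_def by (rule rho_act_lmap[OF pc h S])
  also have "\<dots> = rho (Suc n) n p (\<lambda>w. lmap n n (psp {j} e) (?h w))"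
  proof (rule rho_cong)
   fix w assume w: "w : cube (Suc n)"
   have "?h w j = real e"
    by (rule hb[OF psp_lmap(1)[OF w e] j e]) (use psp_lmap(2)[OF w e, of j "{j}"] j in simp)
   thus "?h w = lmap n n (psp {j} e) (?h w)" using psp_lmap(3)[OF cmapD(1)[OF hc w] e, of "{j}"] by simp
  qed
  also have "\<dots> = rho (Suc n) n (av C n (psp {j} e) p) ?h" unfolding av_def by (rule rho_nat_lmap[OF pc hc S', symmetric])
  also have "av C n (psp {j} e) p = cv C v n" using p j e by (simp add: bdc_def)
  finally show ?thesis using rho_cv_gen[OF v hc] by simp
 qed
 hence "?c : bdc C v n (Suc n)" using rho_cell[OF pc h] by (simp add: bdc_def)
 thus ?thesis unfolding htc_def using f[OF le0] f[OF order_refl] by (intro bexI[of _ ?c]) simp_all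
qed

text \<open>By \<open>r_chart\<close> the glued cell is \<open>p\<close> evaluated along the map
  that sends \<open>q\<close> to \<open>gact n (G q) q\<close>. The paths \<open>h1\<close> and
  \<open>h2\<close> lead from the identity and from that map to their maximum.\<close>

lemma r_cell:
 assumes v: "v : cells C 0" and p: "p : bdc C v n n" and G: "good C n (pt C n p) G"
 shows "equivclp (htc C v n) (r (pt C n p) G n (\<lambda>u. u)) p"
proof -
 have pc: "p : cells C n" using p by (simp add: bdc_def)
 have gG: "gfun n G" using G by (simp add: good_def)
 define h1 where "h1 = (\<lambda>w. \<lambda>i\<in>{..<n}. max (w i) (min (w n) (G (lcut n w) (w i))))"
 define h2 where "h2 = (\<lambda>w. \<lambda>i\<in>{..<n}. max (min (w n) (w i)) (G (lcut n w) (w i)))"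
 have c: "cmono (Suc n) (\<lambda>w. G (lcut n w) (w i))" if "i < n" for i
  by (rule gfun_cmono[OF gG cmap_init cmono_coord]) (use that in simp)
 have h1: "cmap (Suc n) n h1" unfolding h1_def by (intro cmap_restrictI cmono_max cmono_min c cmono_coord) simp_all
 have h2: "cmap (Suc n) n h2" unfolding h2_def by (intro cmap_restrictI cmono_max cmono_min c cmono_coord) simp_all
 have b: "h1 w j = real e \<and> h2 w j = real e" if w: "w : cube (Suc n)" and j: "j < n" and e: "e \<le> 1" "w j = real e" for w j e
 proof -
  have "G (lcut n w) (real e) = real e" using gG init_cube[OF w] e(1) by (cases e) (auto simp: gfun_def)
  moreover have "0 \<le> w n" "w n \<le> 1" using cube_coord[OF w, of n] by simp_all
  moreover have "e = 0 \<or> e = 1" using e(1) by linarith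
  ultimately show ?thesis using j e(2) by (auto simp: h1_def h2_def)
 qed
 have G01: "0 \<le> G q t" "G q t \<le> 1" if "q : cube n" "0 \<le> t" "t \<le> 1" for q t
  using gfun_unit[OF gG that(1)] that(2,3) by (auto simp: unit_fun_def)
 have H1: "htc C v n (rho n n p (\<lambda>q. h1 (snoc n q 0))) (rho n n p (\<lambda>q. h1 (snoc n q 1)))" by (rule rho_path[OF v p h1]) (use b in blast)
 have H2: "htc C v n (rho n n p (\<lambda>q. h2 (snoc n q 0))) (rho n n p (\<lambda>q. h2 (snoc n q 1)))" by (rule rho_path[OF v p h2]) (use b in blast)
 have "rho n n p (\<lambda>q. h1 (snoc n q 0)) = rho n n p (\<lambda>q. q)"
 proof (rule rho_cong)
  fix q assume q: "q : cube n"
  show "h1 (snoc n q 0) = q"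
  proof (rule cube_eqI[OF _ q])
   show "h1 (snoc n q 0) : cube n" by (rule cmapD(1)[OF h1 snoc_cube[OF q]]) simp_all
   show "h1 (snoc n q 0) i = q i" if "i < n" for i
    using that G01[OF q] cube_coord[OF q that] by (simp add: h1_def snoc_nth lcut_snoc[OF q])
  qed
 qed
 hence 1: "rho n n p (\<lambda>q. h1 (snoc n q 0)) = p" using rho_id[OF pc] by simp
 have "rho n n p (\<lambda>q. h2 (snoc n q 0)) = rho n n p (\<lambda>q. gact n (G q) q)"
 proof (rule rho_cong)
  fix q assume q: "q : cube n"
  show "h2 (snoc n q 0) = gact n (G q) q"
   unfolding h2_def gact_def
   by (rule restrict_ext) (use G01[OF q] cube_coord[OF q] in \<open>simp add: snoc_nth lcut_snoc[OF q]\<close>)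
 qed
 hence 2: "rho n n p (\<lambda>q. h2 (snoc n q 0)) = r (pt C n p) G n (\<lambda>u. u)" using r_chart[OF pc G cmap_id] by simp
 have 3: "rho n n p (\<lambda>q. h1 (snoc n q 1)) = rho n n p (\<lambda>q. h2 (snoc n q 1))"
 proof (rule rho_cong)
  fix q assume q: "q : cube n"
  show "h1 (snoc n q 1) = h2 (snoc n q 1)"
   unfolding h1_def h2_def
   by (rule restrict_ext) (use G01[OF q] cube_coord[OF q] in \<open>simp add: snoc_nth lcut_snoc[OF q]\<close>)
 qed
 show ?thesis by (rule equivclp_two[of "htc C v n", OF H2[unfolded 2] H1[unfolded 1 3]])
qed

end

section \<open>Cells of the loop object\<close>

lemma box_id_bmap: "box_id n = bmap n n Inr"
 unfolding box_id_def bmap_def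
proof (rule restrict_ext)
 fix x assume "x : grid 1 n"
 hence "restrict x {..<n} = x" unfolding grid_def by (rule PiE_restrict)
 thus "x = (\<lambda>j\<in>{..<n}. case Inr j of Inl e => e | Inr i => x i)" by simp
qed

lemma bspec_Inr: "bspec n n Inr"
 by (simp add: bspec_def)

lemma box_grid: "box_hom m n f ==> x : grid 1 m ==> f x : grid 1 n"
 using box_coordinates[of m n f] by (auto dest: PiE_mem)

lemma box_compose_assoc:
 assumes "box_hom l m f"
 shows "compose (grid 1 l) (compose (grid 1 m) T h) f = compose (grid 1 l) T (compose (grid 1 l) h f)"
 using box_grid[OF assms] by (auto simp: compose_def restrict_def fun_eq_iff)

section \<open>Tensor products of box morphisms\<close>

definition tens :: "nat => nat => (nat => nat + nat) => (nat => nat + nat) => nat => nat + nat" where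
 "tens p p' ph ps = (\<lambda>j. if j < p' then ph j else (case ps (j - p') of Inl e => Inl e | Inr i => Inr (p + i)))"

lemma bspec_tens:
 assumes S: "bspec p p' ph" "bspec q q' ps"
 shows "bspec (p + q) (p' + q') (tens p p' ph ps)"
proof (rule bspecI)
 show "e \<le> 1" if "j < p' + q'" "tens p p' ph ps j = Inl e" for j e
 proof (cases "j < p'")
  case True
  thus ?thesis using bspecD(1)[OF S(1), of j e] that(2) by (simp add: tens_def)
 next
  case False
  hence "ps (j - p') = Inl e" "j - p' < q'" using that by (auto simp: tens_def split: sum.splits)
  thus ?thesis using bspecD(1)[OF S(2)] by blast
 qed
 have L: "j < p' \<and> ph j = Inr i \<and> i < p \<or> \<not> j < p' \<and> (EX l<q. ps (j - p') = Inr l \<and> i = p + l)"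
  if tj: "j < p' + q'" "tens p p' ph ps j = Inr i" for j i
 proof (cases "j < p'")
  case True
  thus ?thesis using bspecD(2)[OF S(1), of j i] tj(2) by (simp add: tens_def)
 next
  case False
  then obtain l where "ps (j - p') = Inr l" "i = p + l" "j - p' < q'" using tj by (auto simp: tens_def split: sum.splits)
  thus ?thesis using False bspecD(2)[OF S(2), of "j - p'" l] by blast
 qed
 show "i < p + q" if "j < p' + q'" "tens p p' ph ps j = Inr i" for j i
  using L[OF that] by auto
 show "j = j'" if j: "j < p' + q'" "j' < p' + q'" "tens p p' ph ps j = Inr i" "tens p p' ph ps j' = Inr i" for j j' i
  using L[OF j(1,3)] L[OF j(2,4)]
 proof (elim disjE conjE exE)
  assume "j < p'" "ph j = Inr i" "j' < p'" "ph j' = Inr i"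
  thus ?thesis using bspecD(3)[OF S(1)] by blast
 next
  fix l l' assume "\<not> j < p'" "ps (j - p') = Inr l" "i = p + l" "\<not> j' < p'" "ps (j' - p') = Inr l'" "i = p + l'"
  hence "j - p' = j' - p'" using j(1,2) bspecD(3)[OF S(2), of "j - p'" "j' - p'" l] by simp
  thus ?thesis using \<open>\<not> j < p'\<close> \<open>\<not> j' < p'\<close> by simp
 qed auto
qed

lemma box_tensor_bmap:
 assumes S: "bspec p p' ph" "bspec q q' ps"
 shows "box_tensor p p' (bmap p p' ph) q q' (bmap q q' ps) = bmap (p + q) (p' + q') (tens p p' ph ps)"
 unfolding box_tensor_def bmap_def[of "p + q"]
proof (rule restrict_ext, rule restrict_ext)
 fix x j assume x: "x : grid 1 (p + q)" and j: "j : {..<p' + q'}"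
 have g: "(\<lambda>i\<in>{..<p}. x i) : grid 1 p" "(\<lambda>i\<in>{..<q}. x (p + i)) : grid 1 q"
  using grid_bound[OF x] by (auto intro!: grid_restrictI)
 show "(if j < p' then bmap p p' ph (\<lambda>i\<in>{..<p}. x i) j else bmap q q' ps (\<lambda>i\<in>{..<q}. x (p + i)) (j - p')) =
   (case tens p p' ph ps j of Inl e => e | Inr i => x i)"
 proof (cases "j < p'")
  case True
  thus ?thesis using g(1) bspecD(2)[OF S(1) True] by (cases "ph j") (auto simp: bmap_def tens_def)
 next
  case False
  hence l: "j - p' < q'" using j by auto
  thus ?thesis using False g(2) bspecD(2)[OF S(2) l] by (cases "ps (j - p')") (auto simp: bmap_def tens_def)
 qed
qed

lemma box_hom_tensor: "box_hom p p' f ==> box_hom q q' g ==> box_hom (p + q) (p' + q') (box_tensor p p' f q q' g)"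
 using box_spec[of p p' f] box_spec[of q q' g] box_tensor_bmap box_bmap[OF bspec_tens] by metis

section \<open>Day convolution with a representable\<close>

text \<open>Covers a cube and its boundary at once, so that the computations with coends are done a
  single time.\<close>

definition subrep :: "mor cset => nat => bool" where
 "subrep A n \<longleftrightarrow> (ALL m. cells A m \<subseteq> {f. box_hom m n f}) \<and> (ALL k m f g. act A k m f g = compose (grid 1 k) g f) \<and>
  (ALL k m f g. g : cells A m --> box_hom k m f --> compose (grid 1 k) g f : cells A k)"

lemma subrep_rep: "subrep (representable n) n"
 by (auto simp: subrep_def representable_def simp del: One_nat_def intro: box_compose)

lemma subrep_boundary: "subrep (boundary n) n"
proof -
 have "act (boundary n) = act (representable n)" by (simp add: boundary_def)
 thus ?thesis using boundary_maximal(1)[of n] unfolding subpresheaf_def subrep_def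
  by (auto simp: representable_def)
qed

abbreviation dpts :: "mor cset => nat => nat => (mor, mor) day set" where
 "dpts A k m \<equiv> {(p, q, a, b, h). a : cells A p \<and> b : cells (representable k) q \<and> box_hom m (p + q) h}"

definition dgen :: "mor cset => nat => nat => (mor, mor) day rel" where
 "dgen A k m = {((p, q, act A p p' f a, act (representable k) q q' g b, h),
   (p', q', a, b, compose (grid 1 m) (box_tensor p p' f q q' g) h)) | p p' q q' f g a b h.
    box_hom p p' f \<and> box_hom q q' g \<and> a : cells A p' \<and> b : cells (representable k) q' \<and> box_hom m (p + q) h}"

lemma day_rel_gen: "day_rel A (representable k) m = gen_equiv (dpts A k m) (dgen A k m)"
 by (simp add: day_rel_def dgen_def)

lemma dgenE:
 assumes "(u, w) : dgen A k m" "subrep A n"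
 obtains p p' q q' f g a b h where "u = (p, q, compose (grid 1 p) a f, compose (grid 1 q) b g, h)"
  "w = (p', q', a, b, compose (grid 1 m) (box_tensor p p' f q q' g) h)" "box_hom p p' f" "box_hom q q' g"
  "a : cells A p'" "box_hom q' k b" "box_hom m (p + q) h"
proof -
 obtain p p' q q' f g a b h where "u = (p, q, act A p p' f a, act (representable k) q q' g b, h)"
  "w = (p', q', a, b, compose (grid 1 m) (box_tensor p p' f q q' g) h)" "box_hom p p' f" "box_hom q q' g"
  "a : cells A p'" "b : cells (representable k) q'" "box_hom m (p + q) h" using assms(1) unfolding dgen_def by blast
 moreover from this(6) have "box_hom q' k b" by (simp add: representable_def)
 moreover have "act A p p' f a = compose (grid 1 p) a f" using assms(2) by (simp add: subrep_def)
 moreover have "act (representable k) q q' g b = compose (grid 1 q) b g" by (simp add: representable_def)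
 ultimately show thesis using that by simp
qed

lemma dgenI:
 assumes "subrep A n" "box_hom p p' f" "box_hom q q' g" "a : cells A p'" "box_hom q' k b" "box_hom m (p + q) h"
 shows "((p, q, compose (grid 1 p) a f, compose (grid 1 q) b g, h),
  (p', q', a, b, compose (grid 1 m) (box_tensor p p' f q q' g) h)) : dgen A k m"
proof -
 have "((p, q, act A p p' f a, act (representable k) q q' g b, h),
  (p', q', a, b, compose (grid 1 m) (box_tensor p p' f q q' g) h)) : dgen A k m"
  unfolding dgen_def using assms(2-6) by (auto simp: representable_def)
 moreover have "act A p p' f a = compose (grid 1 p) a f" using assms(1) by (simp add: subrep_def)
 moreover have "act (representable k) q q' g b = compose (grid 1 q) b g" by (simp add: representable_def)
 ultimately show ?thesis by simp
qed

lemma dgen_subset: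
 assumes "subrep A n"
 shows "dgen A k m \<subseteq> dpts A k m \<times> dpts A k m"
proof (rule subrelI)
 fix u w assume "(u, w) : dgen A k m"
 then obtain p p' q q' f g a b h where uw: "u = (p, q, compose (grid 1 p) a f, compose (grid 1 q) b g, h)"
  "w = (p', q', a, b, compose (grid 1 m) (box_tensor p p' f q q' g) h)" "box_hom p p' f" "box_hom q q' g"
  "a : cells A p'" "box_hom q' k b" "box_hom m (p + q) h" using assms by (rule dgenE)
 have "compose (grid 1 p) a f : cells A p" using assms uw(3,5) by (simp add: subrep_def)
 moreover have "box_hom q k (compose (grid 1 q) b g)" by (rule box_compose[OF uw(4,6)])
 moreover have "box_hom m (p' + q') (compose (grid 1 m) (box_tensor p p' f q q' g) h)"
  by (rule box_compose[OF uw(7) box_hom_tensor[OF uw(3,4)]])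
 ultimately show "(u, w) : dpts A k m \<times> dpts A k m" using uw by (simp add: representable_def)
qed

text \<open>The morphism that corresponds to an element of the coend when the tensor product of two
  cubes is identified with the cube of the sum of their dimensions.\<close>

definition dval :: "nat => nat => nat => (mor, mor) day => mor" where
 "dval n k m = (\<lambda>(p, q, a, b, h). compose (grid 1 m) (box_tensor p n a q k b) h)"

lemma dval_gen:
 assumes "(u, w) : dgen A k m" and A: "subrep A n"
 shows "dval n k m u = dval n k m w"
proof -
 obtain p p' q q' f g a b h where uw: "u = (p, q, compose (grid 1 p) a f, compose (grid 1 q) b g, h)"
  "w = (p', q', a, b, compose (grid 1 m) (box_tensor p p' f q q' g) h)" "box_hom p p' f" "box_hom q q' g"
  "a : cells A p'" "box_hom q' k b" "box_hom m (p + q) h" using assms by (rule dgenE)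
 have "box_hom p' n a" using A uw(5) by (auto simp: subrep_def)
 then obtain al where a: "bspec p' n al" "a = bmap p' n al" using box_spec by blast
 obtain be where b: "bspec q' k be" "b = bmap q' k be" using box_spec[OF uw(6)] by blast
 obtain ph where f: "bspec p p' ph" "f = bmap p p' ph" using box_spec[OF uw(3)] by blast
 obtain ps where g: "bspec q q' ps" "g = bmap q q' ps" using box_spec[OF uw(4)] by blast
 obtain et where h: "bspec m (p + q) et" "h = bmap m (p + q) et" using box_spec[OF uw(7)] by blast
 have u: "dval n k m u = bmap m (n + k) (scomp (tens p n (scomp al ph) (scomp be ps)) et)"
  unfolding uw(1) dval_def a(2) b(2) f(2) g(2) h(2) prod.case bmap_comp[OF f(1) a(1)] bmap_comp[OF g(1) b(1)]
   box_tensor_bmap[OF bspec_comp[OF f(1) a(1)] bspec_comp[OF g(1) b(1)]]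
  by (rule bmap_comp[OF h(1) bspec_tens[OF bspec_comp[OF f(1) a(1)] bspec_comp[OF g(1) b(1)]]])
 have w: "dval n k m w = bmap m (n + k) (scomp (tens p' n al be) (scomp (tens p p' ph ps) et))"
  unfolding uw(2) dval_def a(2) b(2) f(2) g(2) h(2) prod.case box_tensor_bmap[OF f(1) g(1)] box_tensor_bmap[OF a(1) b(1)]
   bmap_comp[OF h(1) bspec_tens[OF f(1) g(1)]]
  by (rule bmap_comp[OF bspec_comp[OF h(1) bspec_tens[OF f(1) g(1)]] bspec_tens[OF a(1) b(1)]])
 show ?thesis unfolding u w
 proof (rule bmap_cong)
  fix j assume j: "j < n + k"
  show "scomp (tens p n (scomp al ph) (scomp be ps)) et j = scomp (tens p' n al be) (scomp (tens p p' ph ps) et) j"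
  proof (cases "j < n")
   case True
   show ?thesis using True bspecD(2)[OF a(1) True] by (cases "al j") (auto simp: tens_def)
  next
   case False
   thus ?thesis by (cases "be (j - n)") (auto simp: tens_def split: sum.splits)
  qed
 qed
qed

definition dcl :: "mor cset => nat => nat => (mor, mor) day => (mor, mor) day set" where
 "dcl A k m t = day_rel A (representable k) m `` {t}"

definition cval :: "nat => nat => nat => (mor, mor) day set => mor" where
 "cval n k m X = dval n k m (SOME t. t : X)"

lemma dcl_equiv: "subrep A n ==> equiv (dpts A k m) (day_rel A (representable k) m)"
 unfolding day_rel_gen by (rule gen_equiv(1)[OF dgen_subset])

lemma cval_dcl:
 assumes A: "subrep A n" and t: "t : dpts A k m"
 shows "cval n k m (dcl A k m t) = dval n k m t"
proof -
 have "t : dcl A k m t" unfolding dcl_def by (rule equiv_class_self[OF dcl_equiv[OF A] t])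
 hence "(SOME t'. t' : dcl A k m t) : dcl A k m t" by (rule someI)
 hence "(t, SOME t'. t' : dcl A k m t) : gen_equiv (dpts A k m) (dgen A k m)" by (simp add: dcl_def day_rel_gen)
 hence "dval n k m t = dval n k m (SOME t'. t' : dcl A k m t)"
  by (rule gen_equiv_respects[OF _ dgen_subset[OF A]]) (rule dval_gen[OF _ A])
 thus ?thesis by (simp add: cval_def)
qed

lemma day_cells: "cells (day A (representable k)) m = dcl A k m ` dpts A k m"
 by (simp only: day_def dcl_def[abs_def] quotient_def UNION_singleton_eq_range cset.simps)

lemma dcl_gen:
 assumes "subrep A n" "(u, w) : dgen A k m"
 shows "dcl A k m u = dcl A k m w"
 unfolding dcl_def
proof (rule equiv_class_eq[OF dcl_equiv[OF assms(1)]])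
 show "(u, w) : day_rel A (representable k) m"
  unfolding day_rel_gen using gen_equiv(2)[OF dgen_subset[OF assms(1)]] assms(2) by blast
qed

lemma dcl_image:
 assumes A: "subrep A n" and A': "subrep A' n'" and t: "t : dpts A k m"
  and F: "\<And>u w. (u, w) : dgen A k m ==> (F u, F w) : dgen A' k' m'"
 shows "day_rel A' (representable k') m' `` (F ` dcl A k m t) = dcl A' k' m' (F t)"
 unfolding dcl_def day_rel_gen[of A]
proof (rule class_image_gen[OF dgen_subset[OF A] dcl_equiv[OF A'] t])
 fix u w assume "(u, w) : dgen A k m"
 hence "(F u, F w) : dgen A' k' m'" by (rule F)
 thus "(F u, F w) : day_rel A' (representable k') m'"
  unfolding day_rel_gen using gen_equiv(2)[OF dgen_subset[OF A']] by blast
qed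

lemma day_act:
 assumes A: "subrep A n" and t: "(p, q, a, b, h) : dpts A k m" and f: "box_hom l m f"
 shows "act (day A (representable k)) l m f (dcl A k m (p, q, a, b, h)) = dcl A k l (p, q, a, b, compose (grid 1 l) h f)"
proof -
 let ?F = "\<lambda>(p, q, a, b, h). (p, q, a, b, compose (grid 1 l) h f) :: (mor, mor) day"
 have "act (day A (representable k)) l m f (dcl A k m (p, q, a, b, h)) = day_rel A (representable k) l `` (?F ` dcl A k m (p, q, a, b, h))"
  by (simp add: day_def)
 also have "\<dots> = dcl A k l (?F (p, q, a, b, h))"
 proof (rule dcl_image[OF A A t])
  fix u w assume "(u, w) : dgen A k m"
  then obtain p p' q q' f' g a b h where uw: "u = (p, q, compose (grid 1 p) a f', compose (grid 1 q) b g, h)"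
   "w = (p', q', a, b, compose (grid 1 m) (box_tensor p p' f' q q' g) h)" "box_hom p p' f'" "box_hom q q' g"
   "a : cells A p'" "box_hom q' k b" "box_hom m (p + q) h" using A by (rule dgenE)
  show "(?F u, ?F w) : dgen A k l"
   unfolding uw prod.case box_compose_assoc[OF f] by (rule dgenI[OF A uw(3-6) box_compose[OF f uw(7)]])
 qed
 finally show ?thesis by simp
qed

lemma day_incl:
 assumes A: "subrep A n" and t: "t : dpts A k m"
 shows "day_map (representable n) (representable k) (\<lambda>_ f. f) (\<lambda>_ g. g) m (dcl A k m t) = dcl (representable n) k m t"
proof -
 have "day_map (representable n) (representable k) (\<lambda>_ f. f) (\<lambda>_ g. g) m (dcl A k m t) =
   day_rel (representable n) (representable k) m `` ((\<lambda>(p, q, a, b, h). (p, q, a, b, h)) ` dcl A k m t)"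
  by (simp add: day_map_def)
 also have "\<dots> = dcl (representable n) k m ((\<lambda>(p, q, a, b, h). (p, q, a, b, h)) t)"
 proof (rule dcl_image[OF A subrep_rep t])
  fix u w assume "(u, w) : dgen A k m"
  then obtain p p' q q' f g a b h where uw: "u = (p, q, compose (grid 1 p) a f, compose (grid 1 q) b g, h)"
   "w = (p', q', a, b, compose (grid 1 m) (box_tensor p p' f q q' g) h)" "box_hom p p' f" "box_hom q q' g"
   "a : cells A p'" "box_hom q' k b" "box_hom m (p + q) h" using A by (rule dgenE)
  have "a : cells (representable n) p'" using A uw(5) by (auto simp: subrep_def representable_def)
  thus "((\<lambda>(p, q, a, b, h). (p, q, a, b, h)) u, (\<lambda>(p, q, a, b, h). (p, q, a, b, h)) w) : dgen (representable n) k m"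
   unfolding uw prod.case by (rule dgenI[OF subrep_rep uw(3,4) _ uw(6,7)])
 qed
 finally show ?thesis by (cases t) simp
qed

lemma day_post:
 assumes A: "subrep A n" and t: "(p, q, a, b, h) : dpts A k m" and f: "box_hom k k' f"
 shows "day_map A (representable k') (\<lambda>_ b. b) (\<lambda>k g. compose (grid 1 k) f g) m (dcl A k m (p, q, a, b, h)) =
  dcl A k' m (p, q, a, compose (grid 1 q) f b, h)"
proof -
 let ?F = "\<lambda>(p, q, a, b, h). (p, q, a, compose (grid 1 q) f b, h) :: (mor, mor) day"
 have "day_map A (representable k') (\<lambda>_ b. b) (\<lambda>k g. compose (grid 1 k) f g) m (dcl A k m (p, q, a, b, h)) =
   day_rel A (representable k') m `` (?F ` dcl A k m (p, q, a, b, h))"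
  by (simp add: day_map_def)
 also have "\<dots> = dcl A k' m (?F (p, q, a, b, h))"
 proof (rule dcl_image[OF A A t])
  fix u w assume "(u, w) : dgen A k m"
  then obtain p p' q q' f' g a b h where uw: "u = (p, q, compose (grid 1 p) a f', compose (grid 1 q) b g, h)"
   "w = (p', q', a, b, compose (grid 1 m) (box_tensor p p' f' q q' g) h)" "box_hom p p' f'" "box_hom q q' g"
   "a : cells A p'" "box_hom q' k b" "box_hom m (p + q) h" using A by (rule dgenE)
  show "(?F u, ?F w) : dgen A k' m"
   unfolding uw prod.case box_compose_assoc[OF uw(4), symmetric] by (rule dgenI[OF A uw(3-5) box_compose[OF uw(6) f] uw(7)])
 qed
 finally show ?thesis by simp
qed

lemma dval_box:
 assumes A: "subrep A n" and t: "t : dpts A k m"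
 shows "box_hom m (n + k) (dval n k m t)"
proof -
 obtain p q a b h where t': "t = (p, q, a, b, h)" by (cases t)
 have bh: "box_hom p n a" "box_hom q k b" "box_hom m (p + q) h" using A t by (auto simp: t' subrep_def representable_def)
 show ?thesis unfolding t' dval_def prod.case by (rule box_compose[OF bh(3) box_hom_tensor[OF bh(1,2)]])
qed

text \<open>The coend relation moves \<open>a\<close> and \<open>b\<close> into the last component
  and leaves identities behind.\<close>

lemma dcl_canonical:
 assumes t: "t : dpts (representable n) k m"
 shows "dcl (representable n) k m t = dcl (representable n) k m (n, k, box_id n, box_id k, dval n k m t)"
proof -
 obtain p q a b h where t': "t = (p, q, a, b, h)" by (cases t)
 have b: "box_hom p n a" "box_hom q k b" "box_hom m (p + q) h" using t by (auto simp: t' representable_def)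
 have "((p, q, compose (grid 1 p) (box_id n) a, compose (grid 1 q) (box_id k) b, h),
   (n, k, box_id n, box_id k, compose (grid 1 m) (box_tensor p n a q k b) h)) : dgen (representable n) k m"
  by (rule dgenI[OF subrep_rep b(1,2) _ _ b(3)]) (auto simp: representable_def intro: box_id)
 hence "((p, q, a, b, h), (n, k, box_id n, box_id k, dval n k m t)) : dgen (representable n) k m"
  unfolding box_id_neutral[OF b(1)] box_id_neutral[OF b(2)] by (simp add: t' dval_def)
 thus ?thesis unfolding t' by (rule dcl_gen[OF subrep_rep])
qed

section \<open>Boundaries, constant cells and the Yoneda correspondence\<close>

text \<open>A morphism without constant coordinates has the section \<open>ga\<close>, so a
  subpresheaf that contains it contains the identity and is everything. Conversely the morphisms
  with a constant coordinate form a proper subpresheaf.\<close>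

lemma boundary_cells:
 "f : cells (boundary n) m \<longleftrightarrow> (EX ph. bspec m n ph \<and> f = bmap m n ph \<and> (EX j<n. EX e. ph j = Inl e))"
proof
 assume f: "f : cells (boundary n) m"
 have "box_hom m n f" using f subrep_boundary[of n] by (auto simp: subrep_def)
 then obtain ph where S: "bspec m n ph" "f = bmap m n ph" using box_spec by blast
 have "EX j<n. EX e. ph j = Inl e"
 proof (rule ccontr)
  assume "\<not> ?thesis"
  hence r: "EX i. ph j = Inr i" if "j < n" for j using that by (cases "ph j") auto
  define ga where "ga = (\<lambda>l. if EX a<n. ph a = Inr l then Inr (THE a. a < n \<and> ph a = Inr l) else Inl 0 :: nat + nat)"
  have ga: "ga l = Inr a" if "a < n" "ph a = Inr l" for a l
  proof -
   have "(THE a. a < n \<and> ph a = Inr l) = a" using that bspecD(3)[OF S(1)] by blast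
   thus ?thesis using that by (auto simp: ga_def)
  qed
  have g: "bspec n m ga"
  proof (rule bspecI)
   fix l a assume "ga l = Inr a"
   then obtain b where "b < n" "ph b = Inr l" by (auto simp: ga_def split: if_splits)
   thus "a < n" using ga \<open>ga l = Inr a\<close> by force
  next
   fix l l' a assume la: "ga l = Inr a" "ga l' = Inr a"
   then obtain b b' where b: "b < n" "ph b = Inr l" "b' < n" "ph b' = Inr l'" by (auto simp: ga_def split: if_splits)
   hence "b = a" "b' = a" using ga la by force+
   thus "l = l'" using b by simp
  qed (auto simp: ga_def split: if_splits)
  have "compose (grid 1 n) f (bmap n m ga) = bmap n n (scomp ph ga)" unfolding S(2) by (rule bmap_comp[OF g S(1)])
  also have "\<dots> = bmap n n Inr"
  proof (rule bmap_cong)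
   fix j assume j: "j < n"
   obtain i where "ph j = Inr i" using r[OF j] by blast
   thus "scomp ph ga j = Inr j" using ga[OF j] by simp
  qed
  finally have "compose (grid 1 n) f (bmap n m ga) = box_id n" by (simp add: box_id_bmap)
  hence id: "box_id n : cells (boundary n) n"
   using subrep_boundary[of n] f box_bmap[OF g] unfolding subrep_def by metis
  have "cells (boundary n) = cells (representable n)"
  proof (intro ext equalityI subsetI)
   fix l g assume "g : cells (boundary n) l"
   thus "g : cells (representable n) l" using subrep_boundary[of n] by (auto simp: subrep_def representable_def)
  next
   fix l g assume "g : cells (representable n) l"
   hence "box_hom l n g" by (simp add: representable_def)
   thus "g : cells (boundary n) l"
    using subrep_boundary[of n] id box_id_neutral[of l n g] unfolding subrep_def by metis
  qed
  thus False using boundary_maximal(2)[of n] by blast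
 qed
 thus "EX ph. bspec m n ph \<and> f = bmap m n ph \<and> (EX j<n. EX e. ph j = Inl e)" using S by blast
next
 assume f: "EX ph. bspec m n ph \<and> f = bmap m n ph \<and> (EX j<n. EX e. ph j = Inl e)"
 define D where "D = (\<lambda>m. {f. EX ph. bspec m n ph \<and> f = bmap m n ph \<and> (EX j<n. EX e. ph j = Inl e)})"
 have D: "subpresheaf (representable n) D"
  unfolding subpresheaf_def
 proof (intro conjI allI ballI impI)
  show "D m \<subseteq> cells (representable n) m" for m by (auto simp: D_def representable_def box_bmap)
  fix l m g f assume f: "f : D m" and g: "box_hom l m g"
  obtain ph j e where S: "bspec m n ph" "f = bmap m n ph" "j < n" "ph j = Inl e" using f by (auto simp: D_def)
  obtain ps where T: "bspec l m ps" "g = bmap l m ps" using box_spec[OF g] by blast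
  have "act (representable n) l m g f = bmap l n (scomp ph ps)"
   using bmap_comp[OF T(1) S(1)] S(2) T(2) by (simp add: representable_def)
  moreover have "scomp ph ps j = Inl e" using S(4) by simp
  ultimately show "act (representable n) l m g f : D l" using bspec_comp[OF T(1) S(1)] S(3) by (auto simp: D_def)
 qed
 have "box_id n \<notin> D n"
 proof
  assume "box_id n : D n"
  then obtain ph j e where S: "bspec n n ph" "box_id n = bmap n n ph" "j < n" "ph j = Inl e" by (auto simp: D_def)
  \<comment> \<open>A point that a map with \<open>j\<close>-th coordinate constantly
    \<open>e\<close> cannot fix.\<close>
  have x: "(\<lambda>i\<in>{..<n}. 1 - e) : grid 1 n" by (rule grid_restrictI) simp
  have "box_id n (\<lambda>i\<in>{..<n}. 1 - e) j = bmap n n ph (\<lambda>i\<in>{..<n}. 1 - e) j" using S(2) by simp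
  hence "1 - e = e" using x S(3,4) by (simp add: box_id_def bmap_def)
  thus False using bspecD(1)[OF S(1,3,4)] by arith
 qed
 moreover have "box_id n : cells (representable n) n" by (simp add: representable_def box_id)
 ultimately have "D \<noteq> cells (representable n)" by metis
 hence "D m \<subseteq> cells (boundary n) m" by (rule boundary_maximal(3)[OF D])
 thus "f : cells (boundary n) m" using f by (auto simp: D_def)
qed

lemma cv_act_box:
 assumes C: "cubical_set C" and v: "v : cells C 0" and f: "box_hom l k f"
 shows "act C l k f (cv C v k) = cv C v l"
proof -
 have t: "bspec k 0 (\<lambda>_. Inl 0)" by (simp add: bspec_def)
 obtain ph where S: "bspec l k ph" "f = bmap l k ph" using box_spec[OF f] by blast
 have "act C l k f (cv C v k) = act C l 0 (bmap l 0 (scomp (\<lambda>_. Inl 0) ph)) v"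
  unfolding cv_def S(2) by (rule act_spec[OF C v S(1) t])
 thus ?thesis by (simp add: cv_def)
qed

lemma cv_cell_box: "cubical_set C ==> v : cells C 0 ==> cv C v k : cells C k"
 unfolding cv_def by (rule cubical_setD(1)[OF _ box_bmap]) (auto simp: bspec_def)

lemma cv_0: "cubical_set C ==> v : cells C 0 ==> cv C v 0 = v"
proof -
 assume C: "cubical_set C" and v: "v : cells C 0"
 have "bmap 0 0 (\<lambda>_. Inl 0) = box_id 0" unfolding box_id_bmap by (rule bmap_cong) simp
 thus ?thesis using cubical_setD(2)[OF C v] by (simp add: cv_def)
qed

lemma generated_cells:
 assumes C: "cubical_set C" and v: "v : cells C 0"
 shows "cells (generated C v) m = {cv C v m}"
proof -
 have "cells (generated C v) m = \<Inter> {D m | D. subpresheaf C D \<and> v : D 0}" by (simp add: generated_def)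
 also have "\<dots> = {cv C v m}"
 proof
  have "subpresheaf C (\<lambda>m. {cv C v m})"
   unfolding subpresheaf_def using cv_act_box[OF C v] cv_cell_box[OF C v] by simp
  thus "\<Inter> {D m | D. subpresheaf C D \<and> v : D 0} \<subseteq> {cv C v m}"
   using cv_0[OF C v] by (intro Inter_lower) (auto intro!: exI[of _ "\<lambda>m. {cv C v m}"])
  have "cv C v m : D m" if D: "subpresheaf C D" "v : D 0" for D
  proof -
   have "box_hom m 0 (bmap m 0 (\<lambda>_. Inl 0))" by (rule box_bmap) (simp add: bspec_def)
   thus ?thesis using D unfolding subpresheaf_def cv_def by blast
  qed
  thus "{cv C v m} \<subseteq> \<Inter> {D m | D. subpresheaf C D \<and> v : D 0}" by auto
 qed
 finally show ?thesis .
qed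

text \<open>The cubical function that a cell of dimension \<open>n + k\<close> determines on the
  tensor product, restricted to \<open>A\<close>.\<close>

definition yo :: "mor cset => 'a cset => nat => nat => 'a => (mor, 'a) expo" where
 "yo A C n k c = (\<lambda>m. \<lambda>X\<in>cells (day A (representable k)) m. act C m (n + k) (cval n k m X) c)"

definition mk :: "'a cset => nat => nat => 'a => 'a loops" where
 "mk C n k c = (yo (representable n) C n k c, yo (boundary n) C n k c)"

lemma dcl_cells: "t : dpts A k m ==> dcl A k m t : cells (day A (representable k)) m"
 unfolding day_cells by (rule imageI)

lemma day_cellE:
 assumes "X : cells (day A (representable k)) m"
 obtains p q a b h where "(p, q, a, b, h) : dpts A k m" "X = dcl A k m (p, q, a, b, h)"
 using assms unfolding day_cells by blast

lemma yo_dcl: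
 assumes A: "subrep A n" and t: "t : dpts A k m"
 shows "yo A C n k c m (dcl A k m t) = act C m (n + k) (dval n k m t) c"
 unfolding yo_def using dcl_cells[OF t] cval_dcl[OF A t] by simp

lemma yo_chom:
 assumes A: "subrep A n" and C: "cubical_set C" and c: "c : cells C (n + k)" and E: "act E = act C"
  and v: "\<And>m t. t : dpts A k m ==> act C m (n + k) (dval n k m t) c : cells E m"
 shows "yo A C n k c : chom (day A (representable k)) E"
 unfolding chom_def
proof (intro CollectI conjI allI ballI impI)
 show "yo A C n k c m : cells (day A (representable k)) m \<rightarrow>\<^sub>E cells E m" for m
 proof (rule PiE_I)
  show "yo A C n k c m X : cells E m" if "X : cells (day A (representable k)) m" for X
   using that by (rule day_cellE) (simp only: yo_dcl[OF A] v)
 qed (simp add: yo_def)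
 fix l m f X assume X: "X : cells (day A (representable k)) m" and f: "box_hom l m f"
 obtain p q a b h where t: "(p, q, a, b, h) : dpts A k m" "X = dcl A k m (p, q, a, b, h)" using X by (rule day_cellE)
 have t': "(p, q, a, b, compose (grid 1 l) h f) : dpts A k l" using t(1) box_compose[OF f] by auto
 have "dval n k l (p, q, a, b, compose (grid 1 l) h f) = compose (grid 1 l) (dval n k m (p, q, a, b, h)) f"
  unfolding dval_def prod.case by (rule box_compose_assoc[OF f, symmetric])
 thus "yo A C n k c l (act (day A (representable k)) l m f X) = act E l m f (yo A C n k c m X)"
  unfolding t(2) day_act[OF A t(1) f] yo_dcl[OF A t'] yo_dcl[OF A t(1)] E
  using cubical_setD(3)[OF C f dval_box[OF A t(1)] c] by simp
qed

abbreviation ucell :: "nat => nat => (mor, mor) day" where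
 "ucell n k \<equiv> (n, k, box_id n, box_id k, box_id (n + k))"

lemma ucell_pts: "ucell n k : dpts (representable n) k (n + k)"
 by (auto simp: representable_def intro: box_id)

lemma dval_bmap:
 assumes "bspec p n al" "bspec q k be" "bspec m (p + q) et"
 shows "dval n k m (p, q, bmap p n al, bmap q k be, bmap m (p + q) et) = bmap m (n + k) (scomp (tens p n al be) et)"
 unfolding dval_def prod.case box_tensor_bmap[OF assms(1,2)] by (rule bmap_comp[OF assms(3) bspec_tens[OF assms(1,2)]])

lemma dval_ucell: "dval n k (n + k) (ucell n k) = box_id (n + k)"
 unfolding box_id_bmap dval_bmap[OF bspec_Inr bspec_Inr bspec_Inr] by (rule bmap_cong) (auto simp: tens_def)

text \<open>By \<open>dcl_canonical\<close> every cell of the tensor product is a pullback of the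
  universal one.\<close>

lemma chom_dcl:
 assumes a: "a : chom (day (representable n) (representable k)) E" and t: "t : dpts (representable n) k m"
 shows "a m (dcl (representable n) k m t) = act E m (n + k) (dval n k m t) (a (n + k) (dcl (representable n) k (n + k) (ucell n k)))"
proof -
 have b: "box_hom m (n + k) (dval n k m t)" by (rule dval_box[OF subrep_rep t])
 have "act (day (representable n) (representable k)) m (n + k) (dval n k m t) (dcl (representable n) k (n + k) (ucell n k)) =
   dcl (representable n) k m (n, k, box_id n, box_id k, compose (grid 1 m) (box_id (n + k)) (dval n k m t))"
  by (rule day_act[OF subrep_rep ucell_pts b])
 also have "\<dots> = dcl (representable n) k m t" unfolding box_id_neutral[OF b] by (rule dcl_canonical[OF t, symmetric])
 finally have e: "act (day (representable n) (representable k)) m (n + k) (dval n k m t) (dcl (representable n) k (n + k) (ucell n k)) =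
   dcl (representable n) k m t" .
 have "a m (act (day (representable n) (representable k)) m (n + k) (dval n k m t) (dcl (representable n) k (n + k) (ucell n k))) =
   act E m (n + k) (dval n k m t) (a (n + k) (dcl (representable n) k (n + k) (ucell n k)))"
  using a b dcl_cells[OF ucell_pts[of n k]] unfolding chom_def by blast
 thus ?thesis unfolding e .
qed

lemma Omega_cells: "cells (Omega n C v) k = {(a, b). a : chom (day (representable n) (representable k)) C \<and>
  b : chom (day (boundary n) (representable k)) (generated C v) \<and>
  ccomp (day (boundary n) (representable k)) a (day_map (representable n) (representable k) (\<lambda>_ f. f) (\<lambda>_ g. g)) =
  ccomp (day (boundary n) (representable k)) (\<lambda>_ c. c) b}"
 by (simp add: Omega_def pullback_def exponent_def exponent_pre_def exponent_post_def)

lemma ev_mk: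
 assumes C: "cubical_set C" and c: "c : cells C (n + k)"
 shows "fst (mk C n k c) (n + k) (dcl (representable n) k (n + k) (ucell n k)) = c"
 unfolding mk_def fst_conv yo_dcl[OF subrep_rep ucell_pts] dval_ucell by (rule cubical_setD(2)[OF C c])

text \<open>A cell of the boundary has a constant coordinate \<open>e\<close> in some place
  \<open>j\<close>. The action on \<open>c\<close> thus factors through the idempotent
  \<open>psp {j} e\<close>, which sends \<open>c\<close> to a totally degenerate cell.\<close>

lemma mk_cell:
 assumes C: "cubical_set C" and v: "v : cells C 0" and c: "c : bdc C v n (n + k)"
 shows "mk C n k c : cells (Omega n C v) k"
proof -
 have cc: "c : cells C (n + k)" using c by (simp add: bdc_def)
 have 1: "yo (representable n) C n k c : chom (day (representable n) (representable k)) C"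
  by (rule yo_chom[OF subrep_rep C cc refl]) (rule cubical_setD(1)[OF C dval_box[OF subrep_rep] cc])
 have 2: "yo (boundary n) C n k c : chom (day (boundary n) (representable k)) (generated C v)"
 proof (rule yo_chom[OF subrep_boundary C cc])
  show "act (generated C v) = act C" by (simp add: generated_def)
  fix m and t :: "(mor, mor) day" assume t: "t : dpts (boundary n) k m"
  obtain p q a b h where t': "t = (p, q, a, b, h)" by (cases t)
  have ab: "a : cells (boundary n) p" "box_hom q k b" "box_hom m (p + q) h" using t by (auto simp: t' representable_def)
  obtain al j e where a: "bspec p n al" "a = bmap p n al" "j < n" "al j = Inl e" using ab(1) unfolding boundary_cells by blast
  obtain be where b: "bspec q k be" "b = bmap q k be" using box_spec[OF ab(2)] by blast
  obtain et where h: "bspec m (p + q) et" "h = bmap m (p + q) et" using box_spec[OF ab(3)] by blast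
  let ?xi = "scomp (tens p n al be) et"
  have W: "dval n k m t = bmap m (n + k) ?xi" unfolding t' a(2) b(2) h(2) by (rule dval_bmap[OF a(1) b(1) h(1)])
  have x: "bspec m (n + k) ?xi" by (rule bspec_comp[OF h(1) bspec_tens[OF a(1) b(1)]])
  have e: "e \<le> 1" by (rule bspecD(1)[OF a(1,3,4)])
  have "act C m (n + k) (dval n k m t) c = act C m (n + k) (bmap m (n + k) (scomp (psp {j} e) ?xi)) c"
   unfolding W
   by (rule arg_cong[where f = "\<lambda>f. act C m (n + k) f c"], rule bmap_cong) (use a(3,4) in \<open>auto simp: psp_def tens_def\<close>)
  also have "\<dots> = act C m (n + k) (bmap m (n + k) ?xi) (av C (n + k) (psp {j} e) c)"
   unfolding av_def by (rule act_spec[OF C cc x setter_bspec[OF setter_psp[OF e]], symmetric])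
  also have "av C (n + k) (psp {j} e) c = cv C v (n + k)" using c a(3) e by (simp add: bdc_def)
  finally show "act C m (n + k) (dval n k m t) c : cells (generated C v) m"
   using cv_act_box[OF C v box_bmap[OF x]] generated_cells[OF C v] by simp
 qed
 have "ccomp (day (boundary n) (representable k)) (yo (representable n) C n k c) (day_map (representable n) (representable k) (\<lambda>_ f. f) (\<lambda>_ g. g)) =
  ccomp (day (boundary n) (representable k)) (\<lambda>_ c. c) (yo (boundary n) C n k c)"
 proof (rule ext)
  fix m
  have "yo (representable n) C n k c m (day_map (representable n) (representable k) (\<lambda>_ f. f) (\<lambda>_ g. g) m X) = yo (boundary n) C n k c m X"
   if X: "X : cells (day (boundary n) (representable k)) m" for X
  proof -
   obtain p q a b h where t: "(p, q, a, b, h) : dpts (boundary n) k m" "X = dcl (boundary n) k m (p, q, a, b, h)" using X by (rule day_cellE)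
   have t': "(p, q, a, b, h) : dpts (representable n) k m"
    using t(1) subrep_boundary[of n] by (auto simp: subrep_def representable_def)
   show ?thesis unfolding t(2) day_incl[OF subrep_boundary t(1)] yo_dcl[OF subrep_boundary t(1)] yo_dcl[OF subrep_rep t'] by simp
  qed
  thus "ccomp (day (boundary n) (representable k)) (yo (representable n) C n k c) (day_map (representable n) (representable k) (\<lambda>_ f. f) (\<lambda>_ g. g)) m =
   ccomp (day (boundary n) (representable k)) (\<lambda>_ c. c) (yo (boundary n) C n k c) m"
   unfolding ccomp_def compose_def by (intro restrict_ext)
 qed
 thus ?thesis unfolding Omega_cells mk_def using 1 2 by simp
qed

text \<open>The first component is given by the Yoneda correspondence and determines the second
  through the pullback condition. Evaluating the second one at the idempotents
  \<open>psp {j} e\<close> yields the boundary conditions on \<open>c\<close>.\<close>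

lemma cells_mk:
 assumes C: "cubical_set C" and v: "v : cells C 0" and w: "w : cells (Omega n C v) k"
 shows "EX c:bdc C v n (n + k). w = mk C n k c"
proof -
 obtain a b where ab: "w = (a, b)" and a: "a : chom (day (representable n) (representable k)) C"
  and b: "b : chom (day (boundary n) (representable k)) (generated C v)"
  and eq: "ccomp (day (boundary n) (representable k)) a (day_map (representable n) (representable k) (\<lambda>_ f. f) (\<lambda>_ g. g)) =
   ccomp (day (boundary n) (representable k)) (\<lambda>_ c. c) b"
  using w unfolding Omega_cells by blast
 define c where "c = a (n + k) (dcl (representable n) k (n + k) (ucell n k))"
 have c: "c : cells C (n + k)" using a dcl_cells[OF ucell_pts[of n k]] unfolding chom_def c_def by blast
 have at: "a m (dcl (representable n) k m t) = act C m (n + k) (dval n k m t) c" if "t : dpts (representable n) k m" for m t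
  unfolding c_def by (rule chom_dcl[OF a that])
 have bt: "b m (dcl (boundary n) k m t) = act C m (n + k) (dval n k m t) c" if t: "t : dpts (boundary n) k m" for m t
 proof -
  have t': "t : dpts (representable n) k m"
   using t subrep_boundary[of n] by (auto simp: subrep_def representable_def)
  have "ccomp (day (boundary n) (representable k)) a (day_map (representable n) (representable k) (\<lambda>_ f. f) (\<lambda>_ g. g)) m (dcl (boundary n) k m t) =
    ccomp (day (boundary n) (representable k)) (\<lambda>_ c. c) b m (dcl (boundary n) k m t)" using eq by simp
  hence "a m (dcl (representable n) k m t) = b m (dcl (boundary n) k m t)"
   using dcl_cells[OF t] day_incl[OF subrep_boundary t] by (simp add: ccomp_def compose_def)
  thus ?thesis using at[OF t'] by simp
 qed
 have "a = yo (representable n) C n k c"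
 proof (rule ext, rule extensionalityI)
  show "a m : extensional (cells (day (representable n) (representable k)) m)" for m using a by (auto simp: chom_def PiE_def)
  show "yo (representable n) C n k c m : extensional (cells (day (representable n) (representable k)) m)" for m by (simp add: yo_def)
  show "a m X = yo (representable n) C n k c m X" if "X : cells (day (representable n) (representable k)) m" for m X
   using that by (rule day_cellE) (simp only: at yo_dcl[OF subrep_rep])
 qed
 moreover have "b = yo (boundary n) C n k c"
 proof (rule ext, rule extensionalityI)
  show "b m : extensional (cells (day (boundary n) (representable k)) m)" for m using b by (auto simp: chom_def PiE_def)
  show "yo (boundary n) C n k c m : extensional (cells (day (boundary n) (representable k)) m)" for m by (simp add: yo_def)
  show "b m X = yo (boundary n) C n k c m X" if "X : cells (day (boundary n) (representable k)) m" for m X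
   using that by (rule day_cellE) (simp only: bt yo_dcl[OF subrep_boundary])
 qed
 moreover have "av C (n + k) (psp {j} e) c = cv C v (n + k)" if j: "j < n" and e: "e \<le> 1" for j e
 proof -
  note S = setter_bspec[OF setter_psp[OF e]]
  let ?t = "(n, k, bmap n n (psp {j} e), bmap k k Inr, bmap (n + k) (n + k) Inr)"
  have "psp {j} e j = Inl e" by (simp add: psp_def)
  hence "bmap n n (psp {j} e) : cells (boundary n) n"
   unfolding boundary_cells using S[of n "{j}"] j by blast
  hence t: "?t : dpts (boundary n) k (n + k)" by (simp add: representable_def box_bmap bspec_Inr)
  have "dval n k (n + k) ?t = bmap (n + k) (n + k) (psp {j} e)"
   unfolding dval_bmap[OF S bspec_Inr bspec_Inr] by (rule bmap_cong) (use j in \<open>auto simp: tens_def psp_def\<close>)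
  hence "b (n + k) (dcl (boundary n) k (n + k) ?t) = av C (n + k) (psp {j} e) c" using bt[OF t] by (simp add: av_def)
  moreover have "b (n + k) (dcl (boundary n) k (n + k) ?t) : cells (generated C v) (n + k)"
   using b dcl_cells[OF t] unfolding chom_def by blast
  ultimately show ?thesis using generated_cells[OF C v] by simp
 qed
 ultimately show ?thesis using c ab by (intro bexI[of _ c]) (auto simp: mk_def bdc_def)
qed

lemma coface_bmap: "coface 0 0 e = bmap 0 1 (\<lambda>_. Inl e)"
 by (auto simp: coface_def bmap_def intro!: restrict_ext)

text \<open>The parameter of the exponential becomes the last coordinate of the cell, so the
  endpoints of a path of loops are the last faces of a cell.\<close>

lemma yo_face:
 assumes A: "subrep A n" and C: "cubical_set C" and c: "c : cells C (Suc n)" and e: "e \<le> 1"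
 shows "act (exponent A C) 0 1 (coface 0 0 e) (yo A C n 1 c) = yo A C n 0 (face C n e c)"
proof (rule ext)
 fix m
 let ?g = "coface 0 0 e"
 have g: "box_hom 0 1 ?g" using box_coface[of 0 0 e] e by simp
 have "yo A C n 1 c m (day_map A (representable 1) (\<lambda>_ b. b) (\<lambda>k g. compose (grid 1 k) ?g g) m X) = act C m (n + 0) (cval n 0 m X) (face C n e c)"
  if X: "X : cells (day A (representable 0)) m" for X
 proof -
  obtain p q a b h where t: "(p, q, a, b, h) : dpts A 0 m" "X = dcl A 0 m (p, q, a, b, h)" using X by (rule day_cellE)
  have ab: "box_hom p n a" "box_hom q 0 b" "box_hom m (p + q) h" using t(1) A by (auto simp: subrep_def representable_def)
  have t': "(p, q, a, compose (grid 1 q) ?g b, h) : dpts A 1 m"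
   using t(1) box_compose[OF ab(2) g] by (simp add: representable_def)
  obtain al where a: "bspec p n al" "a = bmap p n al" using box_spec[OF ab(1)] by blast
  obtain be where b: "bspec q 0 be" "b = bmap q 0 be" using box_spec[OF ab(2)] by blast
  obtain et where h: "bspec m (p + q) et" "h = bmap m (p + q) et" using box_spec[OF ab(3)] by blast
  have gs: "bspec 0 1 (\<lambda>_. Inl e)" using e by (simp add: bspec_def)
  have gb: "compose (grid 1 q) ?g b = bmap q 1 (scomp (\<lambda>_. Inl e) be)"
   unfolding coface_bmap b(2) by (rule bmap_comp[OF b(1) gs])
  note gbs = bspec_comp[OF b(1) gs]
  have W: "dval n 1 m (p, q, a, compose (grid 1 q) ?g b, h) = bmap m (n + 1) (scomp (tens p n al (scomp (\<lambda>_. Inl e) be)) et)"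
   unfolding gb a(2) h(2) by (rule dval_bmap[OF a(1) gbs h(1)])
  have W0: "dval n 0 m (p, q, a, b, h) = bmap m (n + 0) (scomp (tens p n al be) et)"
   unfolding a(2) b(2) h(2) by (rule dval_bmap[OF a(1) b(1) h(1)])
  have w0: "bspec m n (scomp (tens p n al be) et)" using bspec_comp[OF h(1) bspec_tens[OF a(1) b(1)]] by simp
  have "yo A C n 1 c m (day_map A (representable 1) (\<lambda>_ b. b) (\<lambda>k g. compose (grid 1 k) ?g g) m X) =
    act C m (n + 1) (bmap m (n + 1) (scomp (tens p n al (scomp (\<lambda>_. Inl e) be)) et)) c"
   unfolding t(2) day_post[OF A t(1) g] yo_dcl[OF A t'] W ..
  also have "bmap m (n + 1) (scomp (tens p n al (scomp (\<lambda>_. Inl e) be)) et) = bmap m (Suc n) (scomp (lastsp n e) (scomp (tens p n al be) et))"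
   unfolding Suc_eq_plus1[symmetric] by (rule bmap_cong) (auto simp: tens_def lastsp_def)
  also have "act C m (n + 1) \<dots> c = act C m n (bmap m n (scomp (tens p n al be) et)) (face C n e c)"
   unfolding face_def using act_spec[OF C c w0 bspec_last[OF e]] by simp
  also have "\<dots> = act C m (n + 0) (cval n 0 m X) (face C n e c)"
   unfolding t(2) cval_dcl[OF A t(1)] W0 by simp
  finally show ?thesis .
 qed
 thus "act (exponent A C) 0 1 ?g (yo A C n 1 c) m = yo A C n 0 (face C n e c) m"
  unfolding exponent_def yo_def[of A C n 0] ccomp_def compose_def cset.simps by (intro restrict_ext)
qed

lemma yo_map:
 assumes A: "subrep A n" and g: "\<And>m f. box_hom m (n + k) f ==> g m (act C m (n + k) f c) = act D m (n + k) f (g (n + k) c)"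
 shows "ccomp (day A (representable k)) g (yo A C n k c) = yo A D n k (g (n + k) c)"
proof (rule ext)
 fix m
 have "g m (yo A C n k c m X) = act D m (n + k) (cval n k m X) (g (n + k) c)" if X: "X : cells (day A (representable k)) m" for X
 proof -
  obtain p q a b h where t: "(p, q, a, b, h) : dpts A k m" "X = dcl A k m (p, q, a, b, h)" using X by (rule day_cellE)
  show ?thesis
   unfolding t(2) yo_dcl[OF A t(1)] cval_dcl[OF A t(1)] by (rule g[OF dval_box[OF A t(1)]])
 qed
 thus "ccomp (day A (representable k)) g (yo A C n k c) m = yo A D n k (g (n + k) c) m"
  unfolding ccomp_def compose_def yo_def[of A D] by (intro restrict_ext)
qed

lemma mk_face:
 assumes C: "cubical_set C" and c: "c : cells C (Suc n)" and e: "e \<le> 1"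
 shows "act (Omega n C v) 0 1 (coface 0 0 e) (mk C n 1 c) = mk C n 0 (face C n e c)"
proof -
 have "act (exponent (boundary n) (generated C v)) = act (exponent (boundary n) C)" by (simp add: exponent_def)
 thus ?thesis
  using yo_face[OF subrep_rep C c e] yo_face[OF subrep_boundary C c e] by (simp add: Omega_def pullback_def mk_def)
qed

lemma mk_map:
 assumes "\<And>m f. box_hom m (n + k) f ==> g m (act C m (n + k) f c) = act D m (n + k) f (g (n + k) c)"
 shows "Omega_map n g k (mk C n k c) = mk D n k (g (n + k) c)"
 using yo_map[OF subrep_rep, of n k g C c D, OF assms] yo_map[OF subrep_boundary, of n k g C c D, OF assms] by (simp add: Omega_map_def mk_def exponent_post_def)

lemma face_bdc:
 assumes C: "cubical_set C" and v: "v : cells C 0" and c: "c : bdc C v n (Suc n)" and e: "e \<le> 1"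
 shows "face C n e c : bdc C v n n"
proof -
 have cc: "c : cells C (Suc n)" using c by (simp add: bdc_def)
 note L = bspec_last[OF e, of n]
 have "av C n (psp {j} e') (face C n e c) = cv C v n" if j: "j < n" and e': "e' \<le> 1" for j e'
 proof -
  note S = setter_bspec[OF setter_psp[OF e', of n "{j}"]] and S' = setter_bspec[OF setter_psp[OF e', of "Suc n" "{j}"]]
  have "av C n (psp {j} e') (face C n e c) = act C n (Suc n) (bmap n (Suc n) (scomp (lastsp n e) (psp {j} e'))) c"
   unfolding av_def face_def by (rule act_spec[OF C cc S L])
  also have "bmap n (Suc n) (scomp (lastsp n e) (psp {j} e')) = bmap n (Suc n) (scomp (psp {j} e') (lastsp n e))"
   by (rule bmap_cong) (use j in \<open>auto simp: lastsp_def psp_def\<close>)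
  also have "act C n (Suc n) \<dots> c = act C n (Suc n) (bmap n (Suc n) (lastsp n e)) (av C (Suc n) (psp {j} e') c)"
   unfolding av_def by (rule act_spec[OF C cc L S', symmetric])
  also have "\<dots> = cv C v n" using c j e' cv_act_box[OF C v box_bmap[OF L]] by (simp add: bdc_def)
  finally show ?thesis .
 qed
 thus ?thesis using cubical_setD(1)[OF C box_bmap[OF L] cc] by (simp add: bdc_def face_def)
qed

lemma htc_bdc:
 assumes "cubical_set C" "v : cells C 0" "htc C v n x y"
 shows "x : bdc C v n n" "y : bdc C v n n"
 using assms face_bdc[OF assms(1,2)] by (auto simp: htc_def)

section \<open>Connected components of the loop object\<close>

definition pgen :: "nat => 'a cset => 'a => 'a loops rel" where
 "pgen n C v = {(act (Omega n C v) 0 1 (coface 0 0 0) e, act (Omega n C v) 0 1 (coface 0 0 1) e) | e. e : cells (Omega n C v) 1}"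

lemma pgen_htc:
 assumes C: "cubical_set C" and v: "v : cells C 0"
 shows "(u, w) : pgen n C v \<longleftrightarrow> (EX x y. htc C v n x y \<and> u = mk C n 0 x \<and> w = mk C n 0 y)"
proof
 assume "(u, w) : pgen n C v"
 then obtain e where e: "e : cells (Omega n C v) 1" and uw: "u = act (Omega n C v) 0 1 (coface 0 0 0) e" "w = act (Omega n C v) 0 1 (coface 0 0 1) e"
  unfolding pgen_def by blast
 obtain c where c: "c : bdc C v n (n + 1)" "e = mk C n 1 c" using cells_mk[OF C v e] by blast
 have cc: "c : cells C (Suc n)" using c(1) by (simp add: bdc_def)
 have "htc C v n (face C n 0 c) (face C n 1 c)" unfolding htc_def using c(1) by auto
 thus "EX x y. htc C v n x y \<and> u = mk C n 0 x \<and> w = mk C n 0 y"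
  using uw mk_face[OF C cc] c(2) by (intro exI[of _ "face C n 0 c"] exI[of _ "face C n 1 c"]) simp
next
 assume "EX x y. htc C v n x y \<and> u = mk C n 0 x \<and> w = mk C n 0 y"
 then obtain c where c: "c : bdc C v n (Suc n)" "u = mk C n 0 (face C n 0 c)" "w = mk C n 0 (face C n 1 c)" by (auto simp: htc_def)
 have cc: "c : cells C (Suc n)" using c(1) by (simp add: bdc_def)
 have "mk C n 1 c : cells (Omega n C v) 1" using mk_cell[OF C v, of c n 1] c(1) by simp
 hence "(act (Omega n C v) 0 1 (coface 0 0 0) (mk C n 1 c), act (Omega n C v) 0 1 (coface 0 0 1) (mk C n 1 c)) : pgen n C v"
  unfolding pgen_def by blast
 thus "(u, w) : pgen n C v" using mk_face[OF C cc le0, of v] mk_face[OF C cc order_refl, of v] c(2,3) by simp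
qed

lemma pi0_mk:
 assumes C: "cubical_set C" and v: "v : cells C 0" and x: "x : bdc C v n n" and y: "y : bdc C v n n"
 shows "(mk C n 0 x, mk C n 0 y) : pi0_rel (Omega n C v) \<longleftrightarrow> equivclp (htc C v n) x y"
proof -
 let ?A = "cells (Omega n C v) 0"
 have rel: "pi0_rel (Omega n C v) = gen_equiv ?A (pgen n C v)" by (simp add: pi0_rel_def pgen_def)
 have mc: "mk C n 0 z : ?A" if "z : bdc C v n n" for z using mk_cell[OF C v, of z n 0] that by simp
 have sub: "pgen n C v \<subseteq> ?A \<times> ?A" using pgen_htc[OF C v] htc_bdc[OF C v] mc by (auto simp del: One_nat_def)
 \<comment> \<open>Evaluation at the universal cell inverts \<open>mk\<close> on the left; it turns
   the homotopy class of a cell into a function on the loop object that is constant on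
   components.\<close>
 define ev where "ev = (\<lambda>w :: 'a loops. fst w n (dcl (representable n) 0 n (ucell n 0)))"
 have ev: "ev (mk C n 0 z) = z" if "z : bdc C v n n" for z using ev_mk[OF C, of z n 0] that by (simp add: ev_def bdc_def)
 show ?thesis
 proof
  assume "(mk C n 0 x, mk C n 0 y) : pi0_rel (Omega n C v)"
  hence "(\<lambda>w. Collect (equivclp (htc C v n) (ev w))) (mk C n 0 x) = (\<lambda>w. Collect (equivclp (htc C v n) (ev w))) (mk C n 0 y)"
   unfolding rel
  proof (rule gen_equiv_respects[OF _ sub])
   fix u w assume "(u, w) : pgen n C v"
   then obtain a b where ab: "htc C v n a b" "u = mk C n 0 a" "w = mk C n 0 b" using pgen_htc[OF C v] by blast
   have "ev u = a" "ev w = b" using ab htc_bdc[OF C v ab(1)] ev by auto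
   moreover have "equivclp (htc C v n) a b" by (rule r_into_equivclp[of "htc C v n", OF ab(1)])
   ultimately show "Collect (equivclp (htc C v n) (ev u)) = Collect (equivclp (htc C v n) (ev w))"
    by (auto intro: equivclp_trans equivclp_sym)
  qed
  hence "Collect (equivclp (htc C v n) x) = Collect (equivclp (htc C v n) y)" using ev x y by simp
  moreover have "equivclp (htc C v n) y y" by (simp add: equivclp_def)
  ultimately show "equivclp (htc C v n) x y" by blast
 next
  assume "equivclp (htc C v n) x y"
  hence "y : bdc C v n n \<and> (mk C n 0 x, mk C n 0 y) : gen_equiv ?A (pgen n C v)"
  proof (induction rule: equivclp_induct)
   case base
   show ?case using x gen_equiv(1)[OF sub] mc[OF x] by (auto simp: equiv_def refl_on_def)
  next
   case (step y z)
   have yz: "(mk C n 0 y, mk C n 0 z) : pgen n C v \<or> (mk C n 0 z, mk C n 0 y) : pgen n C v"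
    using step(2) pgen_htc[OF C v] by blast
   have "(mk C n 0 y, mk C n 0 z) : gen_equiv ?A (pgen n C v)"
    using yz gen_equiv(1,2)[OF sub] unfolding equiv_def by (meson subsetD symD)
   moreover have "z : bdc C v n n" using step(2) htc_bdc[OF C v] by blast
   ultimately show ?case using step(3) gen_equiv(1)[OF sub] unfolding equiv_def by (meson transD)
  qed
  thus "(mk C n 0 x, mk C n 0 y) : pi0_rel (Omega n C v)" by (simp add: rel)
 qed
qed

lemma pi0_equiv:
 assumes C: "cubical_set C" and v: "v : cells C 0"
 shows "equiv (cells (Omega n C v) 0) (pi0_rel (Omega n C v))"
proof -
 have "pgen n C v \<subseteq> cells (Omega n C v) 0 \<times> cells (Omega n C v) 0"
  using pgen_htc[OF C v] htc_bdc[OF C v] mk_cell[OF C v, of _ n 0] by (auto simp del: One_nat_def)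
 thus ?thesis using gen_equiv(1) unfolding pi0_rel_def pgen_def by blast
qed

lemma tau_mk:
 assumes C: "cubical_set C" and v: "v : cells C 0"
 shows "tau n C v = (\<lambda>x. pi0_rel (Omega n C v) `` {mk C n 0 x}) ` bdc C v n n"
proof -
 have "cells (Omega n C v) 0 = mk C n 0 ` bdc C v n n"
 proof (intro equalityI subsetI)
  fix w assume "w : cells (Omega n C v) 0"
  hence "EX c:bdc C v n (n + 0). w = mk C n 0 c" by (rule cells_mk[OF C v])
  thus "w : mk C n 0 ` bdc C v n n" by auto
 next
  fix w assume "w : mk C n 0 ` bdc C v n n"
  thus "w : cells (Omega n C v) 0" using mk_cell[OF C v, of _ n 0] by (elim imageE) simp
 qed
 thus ?thesis by (simp add: tau_def pi0_def quotient_def UNION_singleton_eq_range image_image)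
qed

section \<open>The comparison map\<close>

lemma SS_cells: "h : cells (SS C) n \<longleftrightarrow> h : extensional (cube n) \<and> stream_map (dcube n) (realization C) h"
 by (simp add: SS_def sing_def)

lemma SS_act: "act (SS C) m n f h = restrict (\<lambda>x. h (linear_ext m n f x)) (cube m)"
 by (simp add: SS_def sing_def compose_def)

lemma SS_restrict: "stream_map (dcube n) (realization C) h ==> restrict h (cube n) : cells (SS C) n"
 unfolding SS_cells using stream_map_cong[of n "realization C" h "restrict h (cube n)"] by simp

lemma SS_act_cell: "h : cells (SS C) n ==> box_hom m n f ==> act (SS C) m n f h : cells (SS C) m"
 unfolding SS_act by (rule SS_restrict, rule stream_map_comp_cmap[OF _ cmap_linear_ext]) (simp_all add: SS_cells)

lemma cubical_set_SS: "cubical_set (SS C)"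
 unfolding cubical_set_def
proof (intro conjI allI ballI impI)
 show "act (SS C) m n f h : cells (SS C) m" if "h : cells (SS C) n" "box_hom m n f" for m n f h
  using SS_act_cell that .
 show "act (SS C) n n (box_id n) h = h" if "h : cells (SS C) n" for n h
  unfolding SS_act
 proof (rule extensionalityI[of _ "cube n"])
  show "h : extensional (cube n)" using that by (simp add: SS_cells)
  show "restrict (\<lambda>x. h (linear_ext n n (box_id n) x)) (cube n) x = h x" if "x : cube n" for x
   using that by (simp add: box_id_bmap linear_ext_bmap[OF bspec_Inr] lmap_id)
 qed simp
 show "act (SS C) l n (compose (grid 1 l) g f) h = act (SS C) l m f (act (SS C) m n g h)"
  if f: "box_hom l m f" and g: "box_hom m n g" for l m n f g h
  unfolding SS_act linear_ext_compose[OF f g]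
  by (rule restrict_ext) (simp add: compose_def linear_ext_box[OF f])
qed

lemma SS_unit_pt: "SS_unit C n c = restrict (pt C n c) (cube n)"
 by (simp only: SS_unit_def pt_def[abs_def])

lemma SS_unit_cell: "cubical_set C ==> c : cells C n ==> SS_unit C n c : cells (SS C) n"
 unfolding SS_unit_pt by (rule SS_restrict[OF stream_chart])

lemma SS_unit_act:
 assumes "cubical_set C" "c : cells C n" "box_hom m n f"
 shows "SS_unit C m (act C m n f c) = act (SS C) m n f (SS_unit C n c)"
 unfolding SS_act SS_unit_pt
 by (rule restrict_ext) (simp add: pt_act[OF assms(1,3,2)] linear_ext_box[OF assms(3)])

lemma SS_cv:
 assumes C: "cubical_set C" and v: "v : cells C 0"
 shows "cv (SS C) (SS_unit C 0 v) k = restrict (\<lambda>x. pt C 0 v (zero 0)) (cube k)"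
proof -
 have "bspec k 0 (\<lambda>_. Inl 0)" by (simp add: bspec_def)
 hence "cv (SS C) (SS_unit C 0 v) k = SS_unit C k (cv C v k)"
  unfolding cv_def by (rule SS_unit_act[OF C v box_bmap, symmetric])
 thus ?thesis unfolding SS_unit_pt using pt_cv[OF C v] by (auto intro!: restrict_ext)
qed

text \<open>The idempotent retracts the cube onto the face where the \<open>j\<close>-th coordinate
  is \<open>e\<close>, so the condition speaks about the values on that face;
  \<open>n \<le> k\<close> ensures that the coordinate exists.\<close>

lemma SS_bdc:
 assumes C: "cubical_set C" and v: "v : cells C 0" and nk: "n \<le> k"
 shows "h : bdc (SS C) (SS_unit C 0 v) n k \<longleftrightarrow> h : cells (SS C) k \<and>
  (ALL x:cube k. ALL j<n. x j = 0 \<or> x j = 1 --> h x = pt C 0 v (zero 0))"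
proof -
 have "av (SS C) k (psp {j} e) h = cv (SS C) (SS_unit C 0 v) k \<longleftrightarrow> (ALL x:cube k. x j = real e --> h x = pt C 0 v (zero 0))"
  if j: "j < n" and e: "e \<le> 1" for j e
 proof -
  note S = setter_bspec[OF setter_psp[OF e, of k "{j}"]]
  have a: "av (SS C) k (psp {j} e) h = restrict (\<lambda>x. h (lmap k k (psp {j} e) x)) (cube k)"
   by (simp add: av_def SS_act linear_ext_bmap[OF S])
  show ?thesis
   unfolding a SS_cv[OF C v]
  proof
   assume eq: "restrict (\<lambda>x. h (lmap k k (psp {j} e) x)) (cube k) = restrict (\<lambda>x. pt C 0 v (zero 0)) (cube k)"
   show "ALL x:cube k. x j = real e --> h x = pt C 0 v (zero 0)"
   proof (intro ballI impI)
    fix x assume x: "x : cube k" "x j = real e"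
    have "h (lmap k k (psp {j} e) x) = pt C 0 v (zero 0)" using fun_cong[OF eq, of x] x(1) by simp
    thus "h x = pt C 0 v (zero 0)" using psp_lmap(3)[OF x(1) e, of "{j}"] x(2) by simp
   qed
  next
   assume h: "ALL x:cube k. x j = real e --> h x = pt C 0 v (zero 0)"
   show "restrict (\<lambda>x. h (lmap k k (psp {j} e) x)) (cube k) = restrict (\<lambda>x. pt C 0 v (zero 0)) (cube k)"
    by (rule restrict_ext) (use h psp_lmap(1)[OF _ e] psp_lmap(2)[OF _ e] j nk in simp)
  qed
 qed
 hence *: "(ALL j<n. \<forall>e\<le>1. av (SS C) k (psp {j} e) h = cv (SS C) (SS_unit C 0 v) k) \<longleftrightarrow>
   (ALL j<n. \<forall>e\<le>1. ALL x:cube k. x j = real e --> h x = pt C 0 v (zero 0))" by simp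
 have "(\<forall>e\<le>1. ALL x:cube k. x j = real e --> h x = pt C 0 v (zero 0)) \<longleftrightarrow>
   (ALL x:cube k. x j = 0 \<or> x j = 1 --> h x = pt C 0 v (zero 0))" for j
 proof (intro iffI ballI impI allI)
  fix x assume "\<forall>e\<le>1. ALL x:cube k. x j = real e --> h x = pt C 0 v (zero 0)" "x : cube k" "x j = 0 \<or> x j = 1"
  thus "h x = pt C 0 v (zero 0)" by (metis le0 of_nat_0 of_nat_1 order_refl)
 next
  fix e :: nat and x assume h: "ALL x:cube k. x j = 0 \<or> x j = 1 --> h x = pt C 0 v (zero 0)" and e: "e \<le> 1" and x: "x : cube k" "x j = real e"
  have "real e = 0 \<or> real e = 1" using e by (cases e) auto
  hence "x j = 0 \<or> x j = 1" using x(2) by simp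
  thus "h x = pt C 0 v (zero 0)" using h x(1) by blast
 qed
 thus ?thesis using * by (auto simp: bdc_def)
qed

lemma SS_face: "e \<le> 1 ==> face (SS C) n e h = restrict (\<lambda>q. h (snoc n q (real e))) (cube n)"
 unfolding face_def SS_act linear_ext_bmap[OF bspec_last] by (rule restrict_ext) (simp add: lmap_last)

lemma htc_hts:
 assumes C: "cubical_set C" and v: "v : cells C 0" and h: "htc (SS C) (SS_unit C 0 v) n th0 th1"
 shows "hts C n (pt C 0 v (zero 0)) th0 th1"
proof -
 obtain H where H: "H : bdc (SS C) (SS_unit C 0 v) n (Suc n)" "th0 = face (SS C) n 0 H" "th1 = face (SS C) n 1 H"
  using h by (auto simp: htc_def)
 have H': "stream_map (dcube (Suc n)) (realization C) H"
  "\<And>x j. x : cube (Suc n) ==> j < n ==> x j = 0 \<or> x j = 1 ==> H x = pt C 0 v (zero 0)"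
  using H(1) SS_bdc[OF C v, of n "Suc n" H] by (auto simp: SS_cells)
 show ?thesis by (rule htsI[OF H']) (simp_all add: H(2,3) SS_face)
qed

lemma hts_htc:
 assumes C: "cubical_set C" and v: "v : cells C 0" and h: "hts C n (pt C 0 v (zero 0)) th0 th1"
 shows "htc (SS C) (SS_unit C 0 v) n (restrict th0 (cube n)) (restrict th1 (cube n))"
proof -
 obtain H where sH: "stream_map (dcube (Suc n)) (realization C) H"
  and bH: "ALL x:cube (Suc n). ALL j<n. x j = 0 \<or> x j = 1 --> H x = pt C 0 v (zero 0)"
  and eH: "ALL q:cube n. H (snoc n q 0) = th0 q \<and> H (snoc n q 1) = th1 q"
  using h unfolding hts_def by (elim exE conjE)
 note H = sH bH[rule_format] eH[rule_format]
 let ?H = "restrict H (cube (Suc n))"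
 have "?H : bdc (SS C) (SS_unit C 0 v) n (Suc n)"
  using SS_bdc[OF C v, of n "Suc n" ?H] SS_restrict[OF H(1)] H(2) by simp
 moreover have "face (SS C) n 0 ?H = restrict th0 (cube n)"
  unfolding SS_face[OF le0] by (rule restrict_ext) (use H(3) snoc_cube in simp)
 moreover have "face (SS C) n 1 ?H = restrict th1 (cube n)"
  unfolding SS_face[OF order_refl] by (rule restrict_ext) (use H(3) snoc_cube in simp)
 ultimately show ?thesis unfolding htc_def by metis
qed

lemma unit_bdc:
 assumes C: "cubical_set C" and v: "v : cells C 0" and c: "c : bdc C v n k"
 shows "SS_unit C k c : bdc (SS C) (SS_unit C 0 v) n k"
proof -
 have cc: "c : cells C k" using c by (simp add: bdc_def)
 have t: "bspec k 0 (\<lambda>_. Inl 0)" by (simp add: bspec_def)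
 have "av (SS C) k (psp {j} e) (SS_unit C k c) = cv (SS C) (SS_unit C 0 v) k" if "j < n" "e \<le> 1" for j e
 proof -
  have "av (SS C) k (psp {j} e) (SS_unit C k c) = SS_unit C k (av C k (psp {j} e) c)"
   unfolding av_def by (rule SS_unit_act[OF C cc box_bmap[OF setter_bspec[OF setter_psp[OF that(2)]]], symmetric])
  also have "av C k (psp {j} e) c = cv C v k" using c that by (simp add: bdc_def)
  also have "SS_unit C k (cv C v k) = cv (SS C) (SS_unit C 0 v) k"
   unfolding cv_def by (rule SS_unit_act[OF C v box_bmap[OF t]])
  finally show ?thesis .
 qed
 thus ?thesis using SS_unit_cell[OF C cc] by (simp add: bdc_def)
qed

lemma unit_htc:
 assumes C: "cubical_set C" and v: "v : cells C 0" and h: "htc C v n x y"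
 shows "htc (SS C) (SS_unit C 0 v) n (SS_unit C n x) (SS_unit C n y)"
proof -
 obtain c where c: "c : bdc C v n (Suc n)" "x = face C n 0 c" "y = face C n 1 c" using h by (auto simp: htc_def)
 have cc: "c : cells C (Suc n)" using c(1) by (simp add: bdc_def)
 have "SS_unit C n (face C n e c) = face (SS C) n e (SS_unit C (Suc n) c)" if "e \<le> 1" for e
  unfolding face_def by (rule SS_unit_act[OF C cc box_bmap[OF bspec_last[OF that]]])
 thus ?thesis unfolding htc_def using unit_bdc[OF C v c(1)] c(2,3) by (intro bexI[of _ "SS_unit C (Suc n) c"]) simp_all
qed

lemma equivclp_map:
 assumes "equivclp R x y" "\<And>a b. R a b ==> S (f a) (f b)"
 shows "equivclp S (f x) (f y)"
 using assms(1)
proof (induction rule: equivclp_induct)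
 case base
 show ?case by (simp add: equivclp_def)
next
 case (step y z)
 have "S (f y) (f z) \<or> S (f z) (f y)" using step(2) assms(2) by blast
 thus ?case using step(3) equivclp_into_equivclp[of S "f x" "f y" "f z"] by blast
qed

section \<open>Injectivity and surjectivity on components\<close>

context cubcat_data
begin

text \<open>Induction along the zigzag. A homotopy receives a system on its cylinder, whose
  restrictions to the ends need not be the systems chosen there; \<open>r_independent\<close>
  bridges the difference.\<close>

lemma SS_class:
 assumes v: "v : cells C 0" and e: "equivclp (htc (SS C) (SS_unit C 0 v) n) th th'"
  and th: "th : bdc (SS C) (SS_unit C 0 v) n n"
 shows "th' : bdc (SS C) (SS_unit C 0 v) n n \<and> (ALL G G'. good C n th G --> good C n th' G' -->
  equivclp (htc C v n) (r th G n (\<lambda>u. u)) (r th' G' n (\<lambda>u. u)))"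
 using e
proof (induction rule: equivclp_induct)
 case base
 have "stream_map (dcube n) (realization C) th"
  "\<And>q j. q : cube n ==> j < n ==> q j = 0 \<or> q j = 1 ==> th q = pt C 0 v (zero 0)"
  using th SS_bdc[OF C v, of n n th] by (auto simp: SS_cells)
 thus ?case using r_independent[OF _ _ _ v] th by blast
next
 case (step y z)
 have vS: "SS_unit C 0 v : cells (SS C) 0" by (rule SS_unit_cell[OF C v])
 have b: "x : bdc (SS C) (SS_unit C 0 v) n n" if "htc (SS C) (SS_unit C 0 v) n x y' \<or> htc (SS C) (SS_unit C 0 v) n y' x" for x y'
  using htc_bdc[OF cubical_set_SS vS] that by blast
 have str: "stream_map (dcube n) (realization C) x"
  "\<And>q j. q : cube n ==> j < n ==> q j = 0 \<or> q j = 1 ==> x q = pt C 0 v (zero 0)"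
  if "x : bdc (SS C) (SS_unit C 0 v) n n" for x
  using that SS_bdc[OF C v, of n n x] by (auto simp: SS_cells)
 have one: "equivclp (htc C v n) (r x Gx n (\<lambda>u. u)) (r y' Gy n (\<lambda>u. u))"
  if h: "htc (SS C) (SS_unit C 0 v) n x y'" and G: "good C n x Gx" "good C n y' Gy" for x y' Gx Gy
 proof -
  have xb: "x : bdc (SS C) (SS_unit C 0 v) n n" and yb: "y' : bdc (SS C) (SS_unit C 0 v) n n" using b h by blast+
  obtain H where sH: "stream_map (dcube (Suc n)) (realization C) H"
   and bH: "ALL x:cube (Suc n). ALL j<n. x j = 0 \<or> x j = 1 --> H x = pt C 0 v (zero 0)"
   and eH: "ALL q:cube n. H (snoc n q 0) = x q \<and> H (snoc n q 1) = y' q"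
   using htc_hts[OF C v h] unfolding hts_def by (elim exE conjE)
  note H = sH bH[rule_format] eH[rule_format]
  obtain K where K: "good C (Suc n) H K" using good_exists[OF C H(1)] by blast
  have sn: "cmap n (Suc n) (\<lambda>q. snoc n q s)" if "0 \<le> s" "s \<le> 1" for s using that by (intro cmap_snoc cmap_id cmono_const)
  have e: "equivclp (htc C v n) (r (\<lambda>q. H (snoc n q s)) (\<lambda>q. K (snoc n q s)) n (\<lambda>u. u)) (r w Gw n (\<lambda>u. u))"
   if s: "0 \<le> s" "s \<le> 1" and w: "w : bdc (SS C) (SS_unit C 0 v) n n" "good C n w Gw" and eq: "\<And>q. q : cube n ==> H (snoc n q s) = w q" for s w Gw
  proof -
   note Ks = good_comp[OF K sn[OF s]]
   have Kw: "good C n w (\<lambda>q. K (snoc n q s))" by (rule good_cong[OF Ks eq])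
   have "r (\<lambda>q. H (snoc n q s)) (\<lambda>q. K (snoc n q s)) n (\<lambda>u. u) = r w (\<lambda>q. K (snoc n q s)) n (\<lambda>u. u)"
    by (rule r_cong2[OF stream_map_comp_cmap[OF H(1) sn[OF s]] str(1)[OF w(1)] Ks Kw refl eq cmap_id])
   thus ?thesis using r_independent[OF str(1)[OF w(1)] Kw w(2) v str(2)[OF w(1)]] by simp
  qed
  have ht: "equivclp (htc C v n) (r (\<lambda>q. H (snoc n q 0)) (\<lambda>q. K (snoc n q 0)) n (\<lambda>u. u)) (r (\<lambda>q. H (snoc n q 1)) (\<lambda>q. K (snoc n q 1)) n (\<lambda>u. u))"
   by (rule r_into_equivclp[of "htc C v n", OF r_homotopy[OF H(1) K v H(2)]])
  have e0: "equivclp (htc C v n) (r (\<lambda>q. H (snoc n q 0)) (\<lambda>q. K (snoc n q 0)) n (\<lambda>u. u)) (r x Gx n (\<lambda>u. u))"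
   by (rule e[OF _ _ xb G(1)]) (use H(3) in simp_all)
  have e1: "equivclp (htc C v n) (r (\<lambda>q. H (snoc n q 1)) (\<lambda>q. K (snoc n q 1)) n (\<lambda>u. u)) (r y' Gy n (\<lambda>u. u))"
   by (rule e[OF _ _ yb G(2)]) (use H(3) in simp_all)
  show ?thesis by (rule equivclp_trans[OF equivclp_sym[OF e0] equivclp_trans[OF ht e1]])
 qed
 have yb: "y : bdc (SS C) (SS_unit C 0 v) n n" and zb: "z : bdc (SS C) (SS_unit C 0 v) n n" using step(2) b by blast+
 obtain Gy where Gy: "good C n y Gy" using good_exists[OF C str(1)[OF yb]] by blast
 show ?case
 proof (intro conjI zb allI impI)
  fix G G' assume G: "good C n th G" "good C n z G'"
  have "equivclp (htc C v n) (r th G n (\<lambda>u. u)) (r y Gy n (\<lambda>u. u))" using step(3) G(1) Gy by blast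
  moreover have "equivclp (htc C v n) (r y Gy n (\<lambda>u. u)) (r z G' n (\<lambda>u. u))"
   using step(2) one Gy G(2) equivclp_sym[of "htc C v n"] by blast
  ultimately show "equivclp (htc C v n) (r th G n (\<lambda>u. u)) (r z G' n (\<lambda>u. u))" by (rule equivclp_trans)
 qed
qed

text \<open>The glued cell of the realization of \<open>z\<close> is homotopic to \<open>z\<close>,
  so gluing is a left inverse of the unit on homotopy classes.\<close>

lemma unit_reflects:
 assumes v: "v : cells C 0" and x: "x : bdc C v n n" and y: "y : bdc C v n n"
  and e: "equivclp (htc (SS C) (SS_unit C 0 v) n) (SS_unit C n x) (SS_unit C n y)"
 shows "equivclp (htc C v n) x y"
proof -
 have one: "EX G. good C n (SS_unit C n z) G \<and> equivclp (htc C v n) (r (SS_unit C n z) G n (\<lambda>u. u)) z" if z: "z : bdc C v n n" for z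
 proof -
  have zc: "z : cells C n" using z by (simp add: bdc_def)
  note s = stream_chart[OF C zc]
  have s': "stream_map (dcube n) (realization C) (SS_unit C n z)" using SS_unit_cell[OF C zc] by (simp add: SS_cells)
  obtain G where G: "good C n (pt C n z) G" using good_exists[OF C s] by blast
  have eq: "pt C n z q = SS_unit C n z q" if "q : cube n" for q using that by (simp add: SS_unit_pt)
  have G': "good C n (SS_unit C n z) G" by (rule good_cong[OF G eq])
  have "r (pt C n z) G n (\<lambda>u. u) = r (SS_unit C n z) G n (\<lambda>u. u)" by (rule r_cong2[OF s s' G G' refl eq cmap_id])
  thus ?thesis using r_cell[OF v z G] G' by auto
 qed
 obtain G where G: "good C n (SS_unit C n x) G" "equivclp (htc C v n) (r (SS_unit C n x) G n (\<lambda>u. u)) x" using one[OF x] by blast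
 obtain G' where G': "good C n (SS_unit C n y) G'" "equivclp (htc C v n) (r (SS_unit C n y) G' n (\<lambda>u. u)) y" using one[OF y] by blast
 have "equivclp (htc C v n) (r (SS_unit C n x) G n (\<lambda>u. u)) (r (SS_unit C n y) G' n (\<lambda>u. u))"
  using SS_class[OF v e unit_bdc[OF C v x]] G(1) G'(1) by blast
 thus ?thesis by (rule equivclp_trans[OF equivclp_sym[OF G(2)] equivclp_trans[OF _ G'(2)]])
qed

text \<open>The preimage is the cell glued from \<open>th\<close> itself; its lateral faces are
  totally degenerate because \<open>th\<close> is constant on the boundary.\<close>

lemma unit_surjective:
 assumes v: "v : cells C 0" and th: "th : bdc (SS C) (SS_unit C 0 v) n n"
 shows "EX x:bdc C v n n. equivclp (htc (SS C) (SS_unit C 0 v) n) th (SS_unit C n x)"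
proof -
 have s: "stream_map (dcube n) (realization C) th" "th : extensional (cube n)"
  and bd: "\<And>q j. q : cube n ==> j < n ==> q j = 0 \<or> q j = 1 ==> th q = pt C 0 v (zero 0)"
  using th SS_bdc[OF C v, of n n th] by (auto simp: SS_cells)
 obtain G where G: "good C n th G" using good_exists[OF C s(1)] by blast
 let ?c = "r th G n (\<lambda>u. u)"
 have "av C n (psp {j} e) ?c = cv C v n" if "j < n" "e \<le> 1" for j e
  using r_boundary[OF s(1) G zero_less_one v _ that] bd by blast
 hence c: "?c : bdc C v n n"
  unfolding bdc_def using r_natural(1)[OF s(1) G cmap_id] by simp
 have "equivclp (hts C n (pt C 0 v (zero 0))) th (pt C n ?c)"
  using realized_cell[OF s(1) G v] bd by blast
 hence "equivclp (htc (SS C) (SS_unit C 0 v) n) (restrict th (cube n)) (restrict (pt C n ?c) (cube n))"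
  by (rule equivclp_map[where f = "\<lambda>th. restrict th (cube n)"]) (rule hts_htc[OF C v])
 moreover have "restrict th (cube n) = th" using s(2) by (rule extensional_restrict)
 ultimately show ?thesis using c by (auto simp: SS_unit_pt)
qed

end

theorem corollary5p19:
 fixes C :: "'a cset" and v :: 'a and n :: nat
 assumes "cubcat C" and "v : cells C 0"
 shows "bij_betw (tau_map n (SS C) v (SS_unit C)) (tau n C v) (tau n (SS C) (SS_unit C 0 v))"
proof -
 obtain rho mu where "cubcat_data C rho mu" using cubcat_data_exists[OF assms(1)] by blast
 then interpret cubcat_data C rho mu .
 note v = assms(2) and S = cubical_set_SS[of C] and vS = SS_unit_cell[OF C assms(2)]
 let ?w = "SS_unit C 0 v" and ?u = "SS_unit C n"
 let ?P = "pi0_rel (Omega n C v)" and ?Q = "pi0_rel (Omega n (SS C) ?w)"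
 have ub: "?u x : bdc (SS C) ?w n n" if "x : bdc C v n n" for x by (rule unit_bdc[OF C v that])
 have map: "Omega_map n (SS_unit C) 0 (mk C n 0 x) = mk (SS C) n 0 (?u x)" if x: "x : bdc C v n n" for x
  using mk_map[where g = "SS_unit C" and k = 0 and C = C and D = "SS C", OF SS_unit_act[OF C]] x by (simp add: bdc_def)
 have cls: "?Q `` {mk (SS C) n 0 x} = ?Q `` {mk (SS C) n 0 y} \<longleftrightarrow> equivclp (htc (SS C) ?w n) x y"
  if "x : bdc (SS C) ?w n n" "y : bdc (SS C) ?w n n" for x y
  using eq_equiv_class_iff[OF pi0_equiv[OF S vS] mk_cell[OF S vS] mk_cell[OF S vS], of x n y] pi0_mk[OF S vS that] that by simp
 have clsC: "?P `` {mk C n 0 x} = ?P `` {mk C n 0 y} \<longleftrightarrow> equivclp (htc C v n) x y"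
  if "x : bdc C v n n" "y : bdc C v n n" for x y
  using eq_equiv_class_iff[OF pi0_equiv[OF C v] mk_cell[OF C v] mk_cell[OF C v], of x n y] pi0_mk[OF C v that] that by simp
 \<comment> \<open>The induced map takes the saturated image of a whole component, so all
   representatives must be seen to land in one component.\<close>
 have tm: "tau_map n (SS C) v (SS_unit C) (?P `` {mk C n 0 x}) = ?Q `` {mk (SS C) n 0 (?u x)}" if x: "x : bdc C v n n" for x
 proof -
  have "?Q `` {Omega_map n (SS_unit C) 0 w} = ?Q `` {mk (SS C) n 0 (?u x)}" if w: "w : ?P `` {mk C n 0 x}" for w
  proof -
   have "w : cells (Omega n C v) 0" using w pi0_equiv[OF C v] by (auto simp: equiv_def refl_on_def)
   then obtain y where y: "y : bdc C v n n" "w = mk C n 0 y" using cells_mk[OF C v, of w n 0] by auto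
   have "equivclp (htc C v n) x y" using w y pi0_mk[OF C v x y(1)] by simp
   hence "equivclp (htc (SS C) ?w n) (?u x) (?u y)" by (rule equivclp_map) (rule unit_htc[OF C v])
   thus ?thesis using cls[OF ub[OF x] ub[OF y(1)]] map[OF y(1)] y(2) by simp
  qed
  moreover have "mk C n 0 x : ?P `` {mk C n 0 x}"
   using equiv_class_self[OF pi0_equiv[OF C v]] mk_cell[OF C v, of x n 0] x by simp
  ultimately show ?thesis unfolding tau_map_def pi0_map_def by blast
 qed
 show ?thesis
  unfolding bij_betw_def tau_mk[OF C v] tau_mk[OF S vS]
 proof
  show "inj_on (tau_map n (SS C) v (SS_unit C)) ((\<lambda>x. ?P `` {mk C n 0 x}) ` bdc C v n n)"
  proof (rule inj_onI)
   fix X Y assume "X : (\<lambda>x. ?P `` {mk C n 0 x}) ` bdc C v n n" "Y : (\<lambda>x. ?P `` {mk C n 0 x}) ` bdc C v n n"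
    and eq: "tau_map n (SS C) v (SS_unit C) X = tau_map n (SS C) v (SS_unit C) Y"
   then obtain x y where x: "x : bdc C v n n" "X = ?P `` {mk C n 0 x}" and y: "y : bdc C v n n" "Y = ?P `` {mk C n 0 y}" by blast
   have "equivclp (htc (SS C) ?w n) (?u x) (?u y)" using eq tm x y cls[OF ub[OF x(1)] ub[OF y(1)]] by simp
   hence "equivclp (htc C v n) x y" by (rule unit_reflects[OF v x(1) y(1)])
   thus "X = Y" using clsC[OF x(1) y(1)] x(2) y(2) by simp
  qed
  show "tau_map n (SS C) v (SS_unit C) ` (\<lambda>x. ?P `` {mk C n 0 x}) ` bdc C v n n = (\<lambda>x. ?Q `` {mk (SS C) n 0 x}) ` bdc (SS C) ?w n n"
  proof (intro equalityI subsetI)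
   fix Z assume "Z : tau_map n (SS C) v (SS_unit C) ` (\<lambda>x. ?P `` {mk C n 0 x}) ` bdc C v n n"
   thus "Z : (\<lambda>x. ?Q `` {mk (SS C) n 0 x}) ` bdc (SS C) ?w n n" using tm ub by auto
  next
   fix Z assume "Z : (\<lambda>x. ?Q `` {mk (SS C) n 0 x}) ` bdc (SS C) ?w n n"
   then obtain t where t: "t : bdc (SS C) ?w n n" "Z = ?Q `` {mk (SS C) n 0 t}" by blast
   obtain x where x: "x : bdc C v n n" "equivclp (htc (SS C) ?w n) t (?u x)" using unit_surjective[OF v t(1)] by blast
   have "Z = tau_map n (SS C) v (SS_unit C) (?P `` {mk C n 0 x})" using tm[OF x(1)] t(2) cls[OF t(1) ub[OF x(1)]] x(2) by simp
   thus "Z : tau_map n (SS C) v (SS_unit C) ` (\<lambda>x. ?P `` {mk C n 0 x}) ` bdc C v n n" using x(1) by blast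
  qed
 qed
qed

end
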